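(* Let $R\in\mathbb N$. Let $X_1,\ldots,X_N\sim X$ be i.i.d. random surfaces on $[0,1]^2$ (random elements of $\mathcal H=\mathcal L_2([0,1]^2)=\mathcal L_2[0,1]\otimes\mathcal L_2[0,1]$) with $\mathbb E(\|X\|^4)<\infty$, where the covariance $C$ of $X$ has separable expansion $C=\sum_{i=1}^\infty\sigma_iA_i\,\tilde\otimes\,B_i$ with $\sigma_1>\cdots>\sigma_R>\sigma_{R+1}\ge\cdots\ge0$. Assume that the kernel $c(t,s,t',s')$ of $C$ is $L$-Lipschitz continuous on $[0,1]^4$. For $K_1,K_2\in\mathbb N$, let the $n$-th surface be measured on a $K_1\times K_2$ grid of pixels $I^K_{i,j}$ as $$Y_n^K[i,j]=X_n^K[i,j]+E_n^K[i,j],\qquad n=1,\ldots,N,\ i=1,\ldots,K_1,\ j=1,\ldots,K_2,$$ where the measurement errors $E_n^K[i,j]$ are i.i.d., independent of $X_1^K,\ldots,X_N^K$, with $\mathbb E(E_n^K[i,j])=0$, $\mathrm{Var}(E_n^K[i,j])=\sigma^2$ and $\mathbb E(|E_n^K[i,j]|^4)<\infty$. Suppose that one of the following holds: 1. $X$ has almost surely continuous sample paths, and $X_n^K[i,j]=X_n(t_i^{K_1},s_j^{K_2})$ for all $n,i,j$, where $(t_i^{K_1},s_j^{K_2})\in I^K_{i,j}$ are given locations (scheme S1); 2. $X_n^K[i,j]=\frac{1}{|I^K_{i,j}|}\iint_{I^K_{i,j}}X_n(t,s)\,dt\,ds$ for all $n,i,j$ (scheme S2). Let $\widehat C_N^K$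 be the empirical covariance of the pixelated surfaces $Y_1^K,\ldots,Y_N^K$, and let $\widehat C^K_{R,N}$ be its best $R$-separable approximation. Let $\alpha_i=\min\{\sigma_{i-1}^2-\sigma_i^2,\sigma_i^2-\sigma_{i+1}^2\}$ for $i=1,\ldots,R$ (with $\sigma_0=+\infty$) and $a_R=\|C\|_2\sum_{i=1}^R(\sigma_i/\alpha_i)$. Then $$\begin{aligned}\|\widehat C^K_{R,N}-C\|_2\ \le\ &\Big(\sum_{i=R+1}^\infty\sigma_i^2\Big)^{1/2}+\mathcal O_{\mathbb P}\Big(\frac{a_R}{\sqrt N}\Big)+(16a_R+\sqrt2)L\Big(\frac1{K_1^2}+\frac1{K_2^2}\Big)^{1/2}+\frac{8\sqrt2L^2}{\|C\|_2}\Big(\frac1{K_1^2}+\frac1{K_2^2}\Big)a_R\\&+\frac{(8\sqrt2a_R+1)\sigma^2}{\sqrt{K_1K_2}}+\frac{4\sqrt2\sigma^4a_R}{\|C\|_2K_1K_2}+\frac{16L\sigma^2a_R}{\|C\|_2\sqrt{K_1K_2}}\Big(\frac1{K_1^2}+\frac1{K_2^2}\Big)^{1/2},\end{aligned}$$ where the $\mathcal O_{\mathbb P}$ term (as $N\to\infty$) is uniform in $K_1,K_2$.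
   Context: Pixels: $\{T_1^{K_1},\ldots,T_{K_1}^{K_1}\}$ and $\{S_1^{K_2},\ldots,S_{K_2}^{K_2}\}$ are regular partitions of $[0,1]$ into intervals of lengths $1/K_1$ and $1/K_2$, and $I^K_{i,j}=T_i^{K_1}\times S_j^{K_2}$, so $|I^K_{i,j}|=1/(K_1K_2)$. The pixelated surface is $Y_n^K(t,s)=\sum_{i=1}^{K_1}\sum_{j=1}^{K_2}Y_n^K[i,j]\mathbf 1\{(t,s)\in I^K_{i,j}\}$. Lipschitz continuity on $[0,1]^4$ is with respect to the Euclidean norm. Here $\sigma_i$ (with index) are scores and $\sigma^2$ is the noise variance. $\mathcal S_2(\mathcal K)$ is the Hilbert space of Hilbert–Schmidt operators on a Hilbert space $\mathcal K$ with norm $\|\cdot\|_2$. With $\mathcal H_1=\mathcal H_2=\mathcal L_2[0,1]$: for $A\in\mathcal S_2(\mathcal H_1)$, $B\in\mathcal S_2(\mathcal H_2)$, $A\,\tilde\otimes\,B$ is the unique operator in $\mathcal S_2(\mathcal H)$ with $(A\,\tilde\otimes\,B)(x\otimes y)=Ax\otimes By$. A separable expansion of $C\in\mathcal S_2(\mathcal H)$ is $C=\sum_{j\ge1}\sigma_jA_j\,\tilde\otimes\,B_j$ with $\sigma_1\ge\sigma_2\ge\cdots\ge0$ and $\{A_j\},\{B_j\}$ orthonormal bases of $\mathcal S_2(\mathcal H_1),\mathcal S_2(\mathcal H_2)$ (the singular value decomposition of $C$ viewed as a Hilbert–Schmidt operator $\mathcal H_2\otimes\mathcal H_2\to\mathcal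 H_1\otimes\mathcal H_1$). $\mathrm{DoS}(G)\le R$ means that at most $R$ scores of $G$ are nonzero, equivalently $G$ is a sum of $R$ operators of the form $A\,\tilde\otimes\,B$. The best $R$-separable approximation of $F\in\mathcal S_2(\mathcal H)$ is $\arg\min_G\|F-G\|_2^2$ subject to $\mathrm{DoS}(G)\le R$, i.e. the truncation of the separable expansion of $F$ to its first $R$ terms. The covariance of $X$ is $C=\mathbb E[(X-m)\otimes(X-m)]$ with $m=\mathbb EX$, an integral operator $(Cf)(t,s)=\int_0^1\int_0^1c(t,s,t',s')f(t',s')\,dt'ds'$. The empirical covariance of $Z_1,\dots,Z_N$ is $N^{-1}\sum_n(Z_n-\bar Z)\otimes(Z_n-\bar Z)$.
   Formalization: The fourth moments of the measurement errors are assumed bounded by a constant common to all grids K1, K2 (automatic if the error law does not depend on the grid); with only finiteness on each grid the claimed uniformity in K1, K2 fails. *)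

theory Defs
  imports "HOL-Probability.Probability"
begin

section \<open>The space of square-integrable functions on the unit cube\<close>

abbreviation cube_measure :: "'a::euclidean_space measure"
  where "cube_measure \<equiv> restrict_space lborel (cbox 0 One)"

lemma finite_measure_cube: "finite_measure (cube_measure :: 'a::euclidean_space measure)"
  by (rule finite_measureI) (simp add: space_restrict_space emeasure_restrict_space emeasure_lborel_cbox_eq)

text \<open>
  Square-integrable functions on the unit cube: \<open>real L2\<close> is $L_2[0,1]$ and
  \<open>(real \<times> real) L2\<close> is $L_2([0,1]^2)$, since \<open>cbox 0 One\<close> is the unit interval,
  respectively the unit square.
\<close>

definition square_integrable :: "('a::euclidean_space \<Rightarrow> real) set"
  where "square_integrable =
    {f. f \<in> borel_measurable cube_measure \<and> integrable cube_measure (\<lambda>x. (f x)\<^sup>2)}"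

lemma square_integrableI:
  assumes "f \<in> borel_measurable cube_measure" "integrable cube_measure (\<lambda>x. (f x)\<^sup>2)"
  shows "f \<in> square_integrable"
  using assms by (simp add: square_integrable_def)

lemma square_integrable_measurable [measurable_dest]:
  "f \<in> square_integrable \<Longrightarrow> f \<in> borel_measurable cube_measure"
  by (simp add: square_integrable_def)

lemma square_integrable_integrable:
  "f \<in> square_integrable \<Longrightarrow> integrable cube_measure (\<lambda>x. (f x)\<^sup>2)"
  by (simp add: square_integrable_def)

lemma square_integrable_mult:
  assumes f: "f \<in> square_integrable" and g: "g \<in> square_integrable"
  shows "integrable cube_measure (\<lambda>x. f x * g x)"
proof (rule Bochner_Integration.integrable_bound)
  show "integrable cube_measure (\<lambda>x. (f x)\<^sup>2 + (g x)\<^sup>2)"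
    using f g by (intro Bochner_Integration.integrable_add square_integrable_integrable)
  show "(\<lambda>x. f x * g x) \<in> borel_measurable cube_measure"
    using f g by measurable
  have "\<bar>a * b\<bar> \<le> a\<^sup>2 + b\<^sup>2" for a b :: real
    using sum_squares_bound[of a b] sum_squares_bound[of a "- b"]
      zero_le_power2[of a] zero_le_power2[of b]
    by (simp add: abs_le_iff)
  then show "AE x in cube_measure. norm (f x * g x) \<le> norm ((f x)\<^sup>2 + (g x)\<^sup>2)"
    by (intro AE_I2) simp
qed

lemma square_integrable_zero: "(\<lambda>_. 0) \<in> square_integrable"
  by (simp add: square_integrable_def)

lemma square_integrable_add:
  assumes f: "f \<in> square_integrable" and g: "g \<in> square_integrable"
  shows "(\<lambda>x. f x + g x) \<in> square_integrable"
proof (rule square_integrableI)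
  show "(\<lambda>x. f x + g x) \<in> borel_measurable cube_measure"
    using f g by measurable
  have "integrable cube_measure (\<lambda>x. (f x)\<^sup>2 + (g x)\<^sup>2 + 2 * (f x * g x))"
    using f g
    by (intro Bochner_Integration.integrable_add integrable_mult_right square_integrable_mult
        square_integrable_integrable) auto
  then show "integrable cube_measure (\<lambda>x. (f x + g x)\<^sup>2)"
    by (simp add: power2_sum mult.assoc)
qed

lemma square_integrable_scale:
  "f \<in> square_integrable \<Longrightarrow> (\<lambda>x. c * f x) \<in> square_integrable"
  unfolding square_integrable_def by (auto simp: power_mult_distrib)

lemma square_integrable_bounded:
  assumes [measurable]: "f \<in> borel_measurable cube_measure" and b: "\<And>x. \<bar>f x\<bar> \<le> b"
  shows "f \<in> square_integrable"
proof (rule square_integrableI)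
  interpret finite_measure "cube_measure :: 'a measure" by (rule finite_measure_cube)
  have "(f x)\<^sup>2 \<le> b\<^sup>2" for x
    using power_mono[OF b[of x] abs_ge_zero, of 2] by simp
  then show "integrable cube_measure (\<lambda>x. (f x)\<^sup>2)"
    by (intro integrable_const_bound[where B="b\<^sup>2"]) auto
qed (use assms in auto)

definition L2_rel :: "('a::euclidean_space \<Rightarrow> real) \<Rightarrow> ('a \<Rightarrow> real) \<Rightarrow> bool"
  where "L2_rel f g \<longleftrightarrow> f \<in> square_integrable \<and> g \<in> square_integrable \<and>
    (AE x in cube_measure. f x = g x)"

quotient_type (overloaded) 'a L2 = "'a::euclidean_space \<Rightarrow> real" / partial: L2_rel
proof (rule part_equivpI)
  show "\<exists>f. L2_rel f f"
    by (rule exI[of _ "\<lambda>_. 0"]) (simp add: L2_rel_def square_integrable_zero)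
  show "symp L2_rel"
    by (auto simp: symp_def L2_rel_def)
  show "transp L2_rel"
    unfolding transp_def L2_rel_def by (auto elim: eventually_elim2)
qed

instantiation L2 :: (euclidean_space) real_vector
begin

lift_definition zero_L2 :: "'a L2" is "\<lambda>_. 0"
  by (simp add: L2_rel_def square_integrable_zero)

lift_definition plus_L2 :: "'a L2 \<Rightarrow> 'a L2 \<Rightarrow> 'a L2" is "\<lambda>f g x. f x + g x"
  unfolding L2_rel_def by (auto intro: square_integrable_add elim: eventually_elim2)

lift_definition scaleR_L2 :: "real \<Rightarrow> 'a L2 \<Rightarrow> 'a L2" is "\<lambda>c f x. c * f x"
  unfolding L2_rel_def by (auto intro: square_integrable_scale elim: eventually_mono)

definition uminus_L2 :: "'a L2 \<Rightarrow> 'a L2"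
  where "uminus_L2 f = (-1) *\<^sub>R f"

definition minus_L2 :: "'a L2 \<Rightarrow> 'a L2 \<Rightarrow> 'a L2"
  where "minus_L2 f g = f + (-1) *\<^sub>R g"

instance
proof
  fix f g h :: "'a L2" and a b :: real
  show "f + g + h = f + (g + h)"
    by transfer (auto simp: L2_rel_def square_integrable_add add.assoc)
  show "f + g = g + f"
    by transfer (auto simp: L2_rel_def square_integrable_add add.commute)
  show "0 + f = f"
    by transfer (auto simp: L2_rel_def)
  show "- f + f = 0"
    unfolding uminus_L2_def
    by transfer (auto simp: L2_rel_def square_integrable_zero)
  show "f - g = f + - g"
    by (simp add: minus_L2_def uminus_L2_def)
  show "a *\<^sub>R (f + g) = a *\<^sub>R f + a *\<^sub>R g"
    by transfer (auto simp: L2_rel_def square_integrable_add square_integrable_scale distrib_left)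
  show "(a + b) *\<^sub>R f = a *\<^sub>R f + b *\<^sub>R f"
    by transfer (auto simp: L2_rel_def square_integrable_add square_integrable_scale distrib_right)
  show "a *\<^sub>R b *\<^sub>R f = (a * b) *\<^sub>R f"
    by transfer (auto simp: L2_rel_def square_integrable_scale mult.assoc)
  show "1 *\<^sub>R f = f"
    by transfer (auto simp: L2_rel_def)
qed

end

instantiation L2 :: (euclidean_space) real_inner
begin

lift_definition inner_L2 :: "'a L2 \<Rightarrow> 'a L2 \<Rightarrow> real"
  is "\<lambda>f g. integral\<^sup>L cube_measure (\<lambda>x. f x * g x)"
  unfolding L2_rel_def
  by (intro integral_cong_AE)
    (auto elim: eventually_elim2 dest!: square_integrable_measurable intro!: borel_measurable_times)

definition norm_L2 :: "'a L2 \<Rightarrow> real"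
  where "norm_L2 f = sqrt (inner f f)"

definition dist_L2 :: "'a L2 \<Rightarrow> 'a L2 \<Rightarrow> real"
  where "dist_L2 f g = norm (f - g)"

definition sgn_L2 :: "'a L2 \<Rightarrow> 'a L2"
  where "sgn_L2 f = f /\<^sub>R norm f"

definition uniformity_L2 :: "('a L2 \<times> 'a L2) filter"
  where "uniformity_L2 = (INF e\<in>{0<..}. principal {(f, g). dist f g < e})"

definition open_L2 :: "'a L2 set \<Rightarrow> bool"
  where "open_L2 U \<longleftrightarrow> (\<forall>x\<in>U. \<forall>\<^sub>F (x', y) in uniformity. x' = x \<longrightarrow> y \<in> U)"

instance
proof
  fix f g h :: "'a L2" and r :: real and U :: "'a L2 set"
  show "dist f g = norm (f - g)" by (rule dist_L2_def)
  show "sgn f = f /\<^sub>R norm f" by (rule sgn_L2_def)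
  show "uniformity = (INF e\<in>{0<..}. principal {(f, g :: 'a L2). dist f g < e})"
    by (rule uniformity_L2_def)
  show "open U = (\<forall>x\<in>U. \<forall>\<^sub>F (x', y) in uniformity. x' = x \<longrightarrow> y \<in> U)"
    by (rule open_L2_def)
  show "inner f g = inner g f"
    by transfer (simp add: mult.commute)
  show "inner (f + g) h = inner f h + inner g h"
    by transfer (simp add: L2_rel_def distrib_right square_integrable_mult)
  show "inner (r *\<^sub>R f) g = r * inner f g"
    by transfer (simp add: mult.assoc)
  show "0 \<le> inner f f"
    by transfer simp
  show "inner f f = 0 \<longleftrightarrow> f = 0"
  proof transfer
    fix f :: "'a \<Rightarrow> real" assume "L2_rel f f"
    then have f: "f \<in> square_integrable" by (simp add: L2_rel_def)
    have "integral\<^sup>L cube_measure (\<lambda>x. f x * f x) = 0 \<longleftrightarrow> (AE x in cube_measure. f x * f x = 0)"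
      by (rule integral_nonneg_eq_0_iff_AE[OF square_integrable_mult[OF f f]]) simp
    then show "integral\<^sup>L cube_measure (\<lambda>x. f x * f x) = 0 \<longleftrightarrow> L2_rel f (\<lambda>_. 0)"
      using f by (simp add: L2_rel_def square_integrable_zero)
  qed
  show "norm f = sqrt (inner f f)" by (rule norm_L2_def)
qed

end

lemma L2_rel_refl_iff: "L2_rel f f \<longleftrightarrow> f \<in> square_integrable"
  by (simp add: L2_rel_def)

lemma rep_L2_square_integrable: "rep_L2 x \<in> square_integrable"
  using Quotient_rep_reflp[OF Quotient_L2] by (auto simp: L2_rel_def)

lemma abs_rep_L2: "abs_L2 (rep_L2 x) = x"
  by (rule Quotient_abs_rep[OF Quotient_L2])

lemma rep_abs_L2: "f \<in> square_integrable \<Longrightarrow> AE p in cube_measure. rep_L2 (abs_L2 f) p = f p"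
  using Quotient_rep_abs[OF Quotient_L2, of f] by (auto simp: L2_rel_def)

lemma norm_abs_L2:
  assumes "f \<in> square_integrable"
  shows "(norm (abs_L2 f))\<^sup>2 = integral\<^sup>L cube_measure (\<lambda>p. (f p)\<^sup>2)"
proof -
  have "inner (abs_L2 f) (abs_L2 f) = integral\<^sup>L cube_measure (\<lambda>p. f p * f p)"
    by (rule inner_L2.abs_eq) (use assms in \<open>simp_all add: L2_rel_refl_iff\<close>)
  then show ?thesis
    by (simp only: power2_norm_eq_inner) (simp add: power2_eq_square)
qed

lemma abs_L2_diff:
  assumes f: "f \<in> square_integrable" and g: "g \<in> square_integrable"
  shows "abs_L2 f - abs_L2 g = abs_L2 (\<lambda>p. f p - g p)"
proof -
  have "abs_L2 f - abs_L2 g = abs_L2 f + (-1) *\<^sub>R abs_L2 g"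
    by simp
  also have "(-1) *\<^sub>R abs_L2 g = abs_L2 (\<lambda>p. - 1 * g p)"
    by (rule scaleR_L2.abs_eq) (use g in \<open>simp add: L2_rel_refl_iff\<close>)
  also have "abs_L2 f + \<dots> = abs_L2 (\<lambda>p. f p + - 1 * g p)"
    by (rule plus_L2.abs_eq)
      (use f square_integrable_scale[OF g, of "-1"] in \<open>simp_all add: L2_rel_refl_iff\<close>)
  finally show ?thesis by simp
qed

lemma square_integrable_diff:
  assumes f: "f \<in> square_integrable" and g: "g \<in> square_integrable"
  shows "(\<lambda>p. f p - g p) \<in> square_integrable"
  using square_integrable_add[OF f square_integrable_scale[OF g, of "-1"]] by simp

lemma norm_L2_diff:
  assumes f: "f \<in> square_integrable" and g: "g \<in> square_integrable"
  shows "(norm (abs_L2 f - abs_L2 g))\<^sup>2 = integral\<^sup>L cube_measure (\<lambda>p. (f p - g p)\<^sup>2)"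
  by (simp add: abs_L2_diff f g norm_abs_L2 square_integrable_diff)

lemma square_integrable_nn_integral:
  assumes [measurable]: "f \<in> borel_measurable cube_measure"
    and le: "(\<integral>\<^sup>+p. ennreal ((f p)\<^sup>2) \<partial>cube_measure) \<le> ennreal c" and c: "0 \<le> c"
  shows "f \<in> square_integrable" and "norm (abs_L2 f) \<le> sqrt c"
proof -
  show f: "f \<in> square_integrable"
  proof (rule square_integrableI)
    show "integrable cube_measure (\<lambda>p. (f p)\<^sup>2)"
      using le by (intro integrableI_bounded) (auto intro: le_less_trans)
  qed fact
  have "ennreal (integral\<^sup>L cube_measure (\<lambda>p. (f p)\<^sup>2)) \<le> ennreal c"
    using le by (subst nn_integral_eq_integral[symmetric]) (auto intro: square_integrable_integrable f)
  then have "(norm (abs_L2 f))\<^sup>2 \<le> c"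
    using c by (simp add: norm_abs_L2 f)
  then show "norm (abs_L2 f) \<le> sqrt c"
    by (rule real_le_rsqrt)
qed

instance L2 :: (euclidean_space) banach
proof
  fix X :: "nat \<Rightarrow> 'a L2" assume X: "Cauchy X"
  have "\<exists>n. \<forall>i\<ge>n. \<forall>j\<ge>n. norm (X i - X j) < (1/2) ^ k" for k
    using X by (auto simp: Cauchy_def dist_norm intro!: zero_less_power)
  then obtain n where n: "\<And>k i j. n k \<le> i \<Longrightarrow> n k \<le> j \<Longrightarrow> norm (X i - X j) < (1/2) ^ k"
    by metis
  define r where "r k = Max (n ` {..k})" for k
  have nr: "n k \<le> r i" if "k \<le> i" for k i
    using that by (auto simp: r_def intro!: Max_ge)
  define F where "F k = rep_L2 (X (r k))" for k
  have F: "F k \<in> square_integrable" and absF: "abs_L2 (F k) = X (r k)" for k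
    by (simp_all add: F_def rep_L2_square_integrable abs_rep_L2)
  have Fm [measurable]: "F k \<in> borel_measurable cube_measure" for k
    using F by (rule square_integrable_measurable)
  have FF: "(\<integral>\<^sup>+p. ennreal ((F i p - F j p)\<^sup>2) \<partial>cube_measure) \<le> ennreal (((1/2) ^ k)\<^sup>2)"
    if "k \<le> i" "k \<le> j" for i j k
  proof -
    have "(\<integral>\<^sup>+p. ennreal ((F i p - F j p)\<^sup>2) \<partial>cube_measure)
        = ennreal (integral\<^sup>L cube_measure (\<lambda>p. (F i p - F j p)\<^sup>2))"
      by (intro nn_integral_eq_integral square_integrable_integrable square_integrable_diff F) simp
    also have "\<dots> = ennreal ((norm (X (r i) - X (r j)))\<^sup>2)"
      by (simp add: norm_L2_diff[OF F F, symmetric] absF)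
    also have "\<dots> \<le> ennreal (((1/2) ^ k)\<^sup>2)"
      using n[OF nr nr, of k i j] that by (intro ennreal_leI power_mono) auto
    finally show ?thesis .
  qed
  define D where "D k p = \<bar>F (Suc k) p - F k p\<bar>" for k p
  have [measurable]: "D k \<in> borel_measurable cube_measure" for k
    unfolding D_def by measurable
  have D: "(\<integral>\<^sup>+p. ennreal (D k p) \<partial>cube_measure) \<le> ennreal (2 * (1/2) ^ k)" for k
  proof -
    have le: "D k p \<le> 2 ^ k * (F (Suc k) p - F k p)\<^sup>2 + (1/2) ^ k" for p
    proof -
      have "0 \<le> (2 ^ k * D k p - 1)\<^sup>2 + 2 ^ k * D k p"
        by (simp add: D_def)
      then have "0 \<le> (1/2) ^ k * ((2 ^ k * D k p)\<^sup>2 - 2 ^ k * D k p + 1)"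
        by (intro mult_nonneg_nonneg) (simp_all add: power2_eq_square algebra_simps)
      also have "\<dots> = 2 ^ k * (D k p)\<^sup>2 - D k p + (1/2) ^ k"
        by (simp add: power2_eq_square field_simps power_one_over)
      finally show ?thesis by (simp add: D_def)
    qed
    have "(\<integral>\<^sup>+p. ennreal (D k p) \<partial>cube_measure)
        \<le> (\<integral>\<^sup>+p. ennreal (2 ^ k) * ennreal ((F (Suc k) p - F k p)\<^sup>2) + ennreal ((1/2) ^ k) \<partial>cube_measure)"
      using le by (intro nn_integral_mono)
        (simp add: ennreal_mult[symmetric] ennreal_plus[symmetric] del: ennreal_plus)
    also have "\<dots> = ennreal (2 ^ k) * (\<integral>\<^sup>+p. ennreal ((F (Suc k) p - F k p)\<^sup>2) \<partial>cube_measure)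
        + ennreal ((1/2) ^ k) * emeasure cube_measure (space cube_measure :: 'a set)"
      by (subst nn_integral_add) (auto simp: nn_integral_cmult)
    also have "emeasure cube_measure (space cube_measure :: 'a set) = 1"
      by (simp add: space_restrict_space emeasure_restrict_space emeasure_lborel_cbox_eq)
    also have "ennreal (2 ^ k) * (\<integral>\<^sup>+p. ennreal ((F (Suc k) p - F k p)\<^sup>2) \<partial>cube_measure)
        \<le> ennreal (2 ^ k) * ennreal (((1/2) ^ k)\<^sup>2)"
      by (intro mult_left_mono FF) auto
    also have "ennreal (2 ^ k) * ennreal (((1/2) ^ k)\<^sup>2) + ennreal ((1/2) ^ k) * 1
        = ennreal (2 * (1/2) ^ k)"
      by (simp add: ennreal_mult[symmetric] ennreal_plus[symmetric] power2_eq_square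
          power_one_over field_simps del: ennreal_plus)
    finally show ?thesis by (auto simp: add_right_mono)
  qed
  have "(\<integral>\<^sup>+p. (\<Sum>k. ennreal (D k p)) \<partial>cube_measure) = (\<Sum>k. \<integral>\<^sup>+p. ennreal (D k p) \<partial>cube_measure)"
    by (rule nn_integral_suminf) simp
  also have "\<dots> \<le> (\<Sum>k. ennreal (2 * (1/2) ^ k))"
    by (intro suminf_le D) auto
  also have "\<dots> = ennreal (\<Sum>k. 2 * (1/2) ^ k)"
    by (intro suminf_ennreal2 summable_mult summable_geometric) auto
  finally have "(\<integral>\<^sup>+p. (\<Sum>k. ennreal (D k p)) \<partial>cube_measure) \<noteq> \<infinity>"
    by (auto simp: top_unique)
  then have "AE p in cube_measure. (\<Sum>k. ennreal (D k p)) \<noteq> \<infinity>"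
    by (intro nn_integral_PInf_AE) auto
  then have conv: "AE p in cube_measure. convergent (\<lambda>k. F k p)"
  proof eventually_elim
    case (elim p)
    then have "summable (\<lambda>k. D k p)"
      by (intro summable_suminf_not_top) (auto simp: D_def)
    then have "summable (\<lambda>k. F (Suc k) p - F k p)"
      unfolding D_def by (rule summable_rabs_cancel)
    then have "convergent (\<lambda>m. \<Sum>k<m. F (Suc k) p - F k p)"
      by (simp add: summable_iff_convergent)
    then have "convergent (\<lambda>m. F m p - F 0 p)"
      by (simp only: sum_lessThan_telescope[of "\<lambda>k. F k p"])
    from convergent_add[OF this convergent_const[of "F 0 p"]] show ?case
      by simp
  qed
  define f where "f p = lim (\<lambda>k. F k p)" for p
  have fm [measurable]: "f \<in> borel_measurable cube_measure"
    unfolding f_def by measurable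
  have fF: "(\<integral>\<^sup>+p. ennreal ((f p - F k p)\<^sup>2) \<partial>cube_measure) \<le> ennreal (((1/2) ^ k)\<^sup>2)" for k
  proof -
    have "(\<integral>\<^sup>+p. ennreal ((f p - F k p)\<^sup>2) \<partial>cube_measure)
        = (\<integral>\<^sup>+p. liminf (\<lambda>j. ennreal ((F j p - F k p)\<^sup>2)) \<partial>cube_measure)"
    proof (rule nn_integral_cong_AE)
      show "AE p in cube_measure. ennreal ((f p - F k p)\<^sup>2) = liminf (\<lambda>j. ennreal ((F j p - F k p)\<^sup>2))"
        using conv
      proof eventually_elim
        case (elim p)
        then have "(\<lambda>j. F j p) \<longlonglongrightarrow> f p"
          by (simp add: f_def convergent_LIMSEQ_iff)
        then have "(\<lambda>j. ennreal ((F j p - F k p)\<^sup>2)) \<longlonglongrightarrow> ennreal ((f p - F k p)\<^sup>2)"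
          by (intro tendsto_intros)
        from lim_imp_Liminf[OF _ this] show ?case by simp
      qed
    qed
    also have "\<dots> \<le> liminf (\<lambda>j. \<integral>\<^sup>+p. ennreal ((F j p - F k p)\<^sup>2) \<partial>cube_measure)"
      by (intro nn_integral_liminf) simp
    also have "\<dots> \<le> ennreal (((1/2) ^ k)\<^sup>2)"
      by (intro Liminf_le eventually_mono[OF eventually_ge_at_top[of k]] FF) auto
    finally show ?thesis .
  qed
  have "(\<lambda>p. f p - F 0 p) \<in> square_integrable"
    by (rule square_integrable_nn_integral(1)[OF _ fF]) auto
  from square_integrable_add[OF this F[of 0]] have f: "f \<in> square_integrable"
    by simp
  have fn: "norm (abs_L2 f - X (r k)) \<le> (1/2) ^ k" for k
  proof -
    have "norm (abs_L2 (\<lambda>p. f p - F k p)) \<le> sqrt (((1/2) ^ k)\<^sup>2)"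
      by (rule square_integrable_nn_integral(2)[OF _ fF]) auto
    then show ?thesis
      by (simp add: abs_L2_diff[OF f F, symmetric] absF)
  qed
  have "X \<longlonglongrightarrow> abs_L2 f"
  proof (rule LIMSEQ_I)
    fix e :: real assume "0 < e"
    then obtain k where k: "(1/2) ^ k < e / 2"
      using real_arch_pow_inv[of "e / 2" "1/2"] by auto
    have "norm (X i - abs_L2 f) < e" if "n k \<le> i" for i
    proof -
      have "norm (X i - abs_L2 f) \<le> norm (X i - X (r k)) + norm (abs_L2 f - X (r k))"
        using norm_triangle_ineq4[of "X i - X (r k)" "abs_L2 f - X (r k)"] by simp
      also have "\<dots> < e"
        using n[OF that nr[of k k]] fn[of k] k by simp
      finally show ?thesis .
    qed
    then show "\<exists>no. \<forall>i\<ge>no. norm (X i - abs_L2 f) < e" by blast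
  qed
  then show "convergent X" by (rule convergentI)
qed

lemma square_integrable_dominated:
  assumes [measurable]: "f \<in> borel_measurable cube_measure" and w: "w \<in> square_integrable"
    and le: "AE p in cube_measure. \<bar>f p\<bar> \<le> \<bar>w p\<bar>"
  shows "f \<in> square_integrable"
proof (rule square_integrableI)
  show "integrable cube_measure (\<lambda>p. (f p)\<^sup>2)"
  proof (rule Bochner_Integration.integrable_bound[OF square_integrable_integrable[OF w]])
    show "AE p in cube_measure. norm ((f p)\<^sup>2) \<le> norm ((w p)\<^sup>2)"
      using le by eventually_elim (simp add: abs_le_square_iff)
  qed simp
qed fact

lemma abs_L2_dominated_convergence:
  fixes f :: "'a::euclidean_space \<Rightarrow> real"
  assumes f: "f \<in> square_integrable" and w: "w \<in> square_integrable"
    and s [measurable]: "\<And>n. s n \<in> borel_measurable cube_measure"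
    and lim: "AE p in cube_measure. (\<lambda>n. s n p) \<longlonglongrightarrow> f p"
    and le: "\<And>n. AE p in cube_measure. \<bar>s n p\<bar> \<le> \<bar>w p\<bar>"
  shows "(\<lambda>n. abs_L2 (s n)) \<longlonglongrightarrow> abs_L2 f"
proof -
  have sq: "s n \<in> square_integrable" for n
    by (rule square_integrable_dominated[OF s w le])
  note [measurable] = square_integrable_measurable[OF f] square_integrable_measurable[OF w]
  have ae: "AE p in cube_measure. \<forall>n. \<bar>s n p\<bar> \<le> \<bar>w p\<bar>"
    using le by (simp add: AE_all_countable)
  have "(\<lambda>n. integral\<^sup>L cube_measure (\<lambda>p. (s n p - f p)\<^sup>2)) \<longlonglongrightarrow> integral\<^sup>L cube_measure (\<lambda>p::'a. 0)"
  proof (rule integral_dominated_convergence[where w = "\<lambda>p. 4 * (w p)\<^sup>2"])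
    show "integrable cube_measure (\<lambda>p. 4 * (w p)\<^sup>2)"
      by (intro integrable_mult_right square_integrable_integrable w)
    show "AE p in cube_measure. (\<lambda>n. (s n p - f p)\<^sup>2) \<longlonglongrightarrow> 0"
      using lim
    proof eventually_elim
      case (elim p)
      then have "(\<lambda>n. (s n p - f p)\<^sup>2) \<longlonglongrightarrow> (f p - f p)\<^sup>2"
        by (intro tendsto_intros)
      then show ?case by simp
    qed
    show "AE p in cube_measure. norm ((s n p - f p)\<^sup>2) \<le> 4 * (w p)\<^sup>2" for n
      using lim ae
    proof eventually_elim
      case (elim p)
      then have "\<bar>f p\<bar> \<le> \<bar>w p\<bar>"
        by (intro LIMSEQ_le_const2[OF tendsto_rabs[OF elim(1)]]) auto
      with spec[OF elim(2), of n] have "\<bar>s n p - f p\<bar> \<le> \<bar>2 * w p\<bar>"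
        by linarith
      then have "(s n p - f p)\<^sup>2 \<le> (2 * w p)\<^sup>2"
        by (simp only: abs_le_square_iff)
      then show ?case by (simp add: power_mult_distrib)
    qed
  qed (auto intro: borel_measurable_const)
  then have "(\<lambda>n. (norm (abs_L2 (s n) - abs_L2 f))\<^sup>2) \<longlonglongrightarrow> 0"
    by (simp add: norm_L2_diff[OF sq f])
  from tendsto_real_sqrt[OF this] have "(\<lambda>n. norm (abs_L2 (s n) - abs_L2 f)) \<longlonglongrightarrow> 0"
    by simp
  then show ?thesis
    by (rule Lim_null[THEN iffD2, OF tendsto_norm_zero_cancel])
qed

lemma abs_L2_add:
  "f \<in> square_integrable \<Longrightarrow> g \<in> square_integrable \<Longrightarrow>
    abs_L2 (\<lambda>p. f p + g p) = abs_L2 f + abs_L2 g"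
  by (rule plus_L2.abs_eq[symmetric]) (simp_all add: L2_rel_refl_iff)

lemma abs_L2_scale: "f \<in> square_integrable \<Longrightarrow> abs_L2 (\<lambda>p. c * f p) = c *\<^sub>R abs_L2 f"
  by (rule scaleR_L2.abs_eq[symmetric]) (simp add: L2_rel_refl_iff)

lemma abs_L2_zero: "abs_L2 (\<lambda>_. 0) = 0"
  by (rule zero_L2.abs_eq[symmetric])

lemma abs_L2_cong_AE:
  "f \<in> square_integrable \<Longrightarrow> g \<in> square_integrable \<Longrightarrow> AE p in cube_measure. f p = g p \<Longrightarrow>
    abs_L2 f = abs_L2 g"
  using Quotient_rel[OF Quotient_L2, of f g] by (simp add: L2_rel_def)

lemma abs_L2_sum:
  assumes "\<And>k. k \<in> I \<Longrightarrow> f k \<in> square_integrable"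
  shows "(\<lambda>p. \<Sum>k\<in>I. f k p) \<in> square_integrable \<and>
    abs_L2 (\<lambda>p. \<Sum>k\<in>I. f k p) = (\<Sum>k\<in>I. abs_L2 (f k))"
  using assms
  by (induction I rule: infinite_finite_induct)
    (simp_all add: square_integrable_zero abs_L2_zero square_integrable_add abs_L2_add)

lemma square_integrable_indicator: "A \<in> sets borel \<Longrightarrow> indicator A \<in> square_integrable"
  by (rule square_integrable_bounded[where b=1], rule measurable_restrict_space1)
    (simp_all add: indicator_def)

lemma L2_dense_subspace:
  fixes V :: "'a::euclidean_space L2 set"
  assumes V: "subspace V" "closed V"
    and G: "Int_stable G" "sigma UNIV G = borel" "UNIV \<in> G"
    and GV: "\<And>A. A \<in> G \<Longrightarrow> abs_L2 (indicator A) \<in> V"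
  shows "V = UNIV"
proof -
  have lim: "abs_L2 f \<in> V"
    if "f \<in> square_integrable" "w \<in> square_integrable"
      "\<And>n. s n \<in> borel_measurable cube_measure"
      "AE p in cube_measure. (\<lambda>n. s n p) \<longlonglongrightarrow> f p"
      "\<And>n. AE p in cube_measure. \<bar>s n p\<bar> \<le> \<bar>w p\<bar>" "\<And>n. abs_L2 (s n) \<in> V" for f w s
    using closed_sequentially[OF V(2) that(6) abs_L2_dominated_convergence[OF that(1-5)]] .
  have sets_G: "sigma_sets UNIV G = sets borel"
    using arg_cong[OF G(2), of sets] by (simp add: sets_measure_of_conv)
  have ind: "abs_L2 (indicator A) \<in> V" if "A \<in> sets borel" for A
  proof -
    have "G \<subseteq> Pow UNIV" and "A \<in> sigma_sets UNIV G"
      using that by (simp_all add: sets_G)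
    with G(1) show ?thesis
    proof (induction rule: sigma_sets_induct_disjoint)
      case (basic A)
      then show ?case by (rule GV)
    next
      case empty
      show ?case
        using subspace_0[OF V(1)] by (simp add: indicator_def abs_L2_zero)
    next
      case (compl A)
      then have A: "indicator A \<in> square_integrable"
        by (intro square_integrable_indicator) (simp add: sets_G)
      have "(indicator (UNIV - A) :: 'a \<Rightarrow> real) = (\<lambda>p. indicator UNIV p - indicator A p)"
        by (auto simp: indicator_def)
      then have "abs_L2 (indicator (UNIV - A)) = abs_L2 (indicator UNIV) - abs_L2 (indicator A)"
        using abs_L2_diff[OF square_integrable_indicator A, of UNIV] by simp
      then show ?case
        using subspace_diff[OF V(1) GV[OF G(3)] compl(2)] by simp
    next
      case (union A)
      then have A: "A n \<in> sets borel" for n by (auto simp: sets_G)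
      then have ind: "indicator (A n) \<in> square_integrable" for n
        by (rule square_integrable_indicator)
      define s where "s n = (indicator (\<Union>k<n. A k) :: 'a \<Rightarrow> real)" for n :: nat
      have s_sum: "s n = (\<lambda>p. \<Sum>k<n. indicator (A k) p)" for n
      proof
        show "s n p = (\<Sum>k<n. indicator (A k) p)" for p
          unfolding s_def
          by (rule indicator_UN_disjoint)
            (use union(1) in \<open>auto simp: disjoint_family_on_def\<close>)
      qed
      have sm: "s n \<in> borel_measurable cube_measure" for n
        unfolding s_def using A
        by (intro square_integrable_measurable square_integrable_indicator) auto
      have slim: "AE p in cube_measure. (\<lambda>n. s n p) \<longlonglongrightarrow> indicator (\<Union> (range A)) p"
        unfolding s_def by (rule AE_I2, rule LIMSEQ_indicator_UN)
      have sle: "AE p in cube_measure. \<bar>s n p\<bar> \<le> \<bar>1 :: real\<bar>" for n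
        unfolding s_def by (rule AE_I2) (simp add: indicator_def)
      have sV: "abs_L2 (s n) \<in> V" for n
        using abs_L2_sum[of "{..<n}" "\<lambda>k. indicator (A k)"] ind union(3)
        by (auto simp: s_sum intro!: subspace_sum[OF V(1)])
      have U: "indicator (\<Union> (range A)) \<in> square_integrable"
        using A by (intro square_integrable_indicator) auto
      have one: "(\<lambda>_. 1) \<in> square_integrable"
        by (rule square_integrable_bounded[where b=1]) auto
      show ?case
        by (rule lim[OF U one sm slim sle sV])
    qed
  qed
  have nonneg: "u \<in> square_integrable \<longrightarrow> abs_L2 u \<in> V"
    if "u \<in> borel_measurable cube_measure" "\<And>x. 0 \<le> u x" for u
    using that
  proof (induction rule: borel_measurable_induct_real)
    case (set A)
    then obtain B where B: "B \<in> sets borel" "A = B \<inter> cbox 0 One"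
      by (auto simp: sets_restrict_space)
    have "A \<in> sets borel" using B by auto
    from ind[OF this] show ?case ..
  next
    case (mult u c)
    show ?case
    proof (cases "c = 0")
      case True
      then show ?thesis using subspace_0[OF V(1)] by (simp add: abs_L2_zero)
    next
      case False
      show ?thesis
      proof
        assume "(\<lambda>x. c * u x) \<in> square_integrable"
        from square_integrable_scale[OF this, of "inverse c"] False
        have u: "u \<in> square_integrable" by (simp add: field_simps)
        then show "abs_L2 (\<lambda>x. c * u x) \<in> V"
          using mult(4) by (auto simp: abs_L2_scale intro: subspace_scale[OF V(1)])
      qed
    qed
  next
    case (add u v)
    show ?case
    proof
      assume w: "(\<lambda>x. v x + u x) \<in> square_integrable"
      have "u \<in> square_integrable" "v \<in> square_integrable"
        using add(1-5) by (auto intro!: square_integrable_dominated[OF _ w])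
      then show "abs_L2 (\<lambda>x. v x + u x) \<in> V"
        using add by (auto simp: abs_L2_add intro!: subspace_add[OF V(1)])
    qed
  next
    case (seq U)
    show ?case
    proof
      assume u: "u \<in> square_integrable"
      have le: "U i x \<le> u x" if "x \<in> space cube_measure" for i x
        using \<open>incseq U\<close> \<open>\<And>x. x \<in> space cube_measure \<Longrightarrow> (\<lambda>i. U i x) \<longlonglongrightarrow> u x\<close>[OF that]
        by (intro incseq_le[of "\<lambda>i. U i x"]) (auto simp: incseq_def le_fun_def)
      have le': "AE p in cube_measure. \<bar>U i p\<bar> \<le> \<bar>u p\<bar>" for i
      proof (rule AE_I2)
        fix p :: 'a assume "p \<in> space cube_measure"
        from le[OF this, of i] \<open>\<And>i x. 0 \<le> U i x\<close>[of i p] show "\<bar>U i p\<bar> \<le> \<bar>u p\<bar>"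
          by linarith
      qed
      have Um: "U i \<in> borel_measurable cube_measure" for i
        by fact
      have "U i \<in> square_integrable" for i
        by (rule square_integrable_dominated[OF Um u le'])
      then have UV: "abs_L2 (U i) \<in> V" for i
        using \<open>\<And>i. U i \<in> square_integrable \<longrightarrow> abs_L2 (U i) \<in> V\<close> by blast
      have "AE p in cube_measure. (\<lambda>i. U i p) \<longlonglongrightarrow> u p"
        by (rule AE_I2) fact
      from lim[OF u u Um this le' UV] show "abs_L2 u \<in> V" .
    qed
  qed
  have "abs_L2 f \<in> V" if f: "f \<in> square_integrable" for f
  proof -
    note [measurable] = square_integrable_measurable[OF f]
    have pn: "(\<lambda>x. max 0 (f x)) \<in> square_integrable" "(\<lambda>x. max 0 (- f x)) \<in> square_integrable"
      by (auto intro!: square_integrable_dominated[OF _ f])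
    have "f = (\<lambda>x. max 0 (f x) - max 0 (- f x))" by auto
    then have "abs_L2 f = abs_L2 (\<lambda>x. max 0 (f x)) - abs_L2 (\<lambda>x. max 0 (- f x))"
      using abs_L2_diff[OF pn] by simp
    then show ?thesis
      using nonneg[of "\<lambda>x. max 0 (f x)"] nonneg[of "\<lambda>x. max 0 (- f x)"] pn
      by (auto intro!: subspace_diff[OF V(1)])
  qed
  from this[OF rep_L2_square_integrable] show ?thesis
    by (auto simp: abs_rep_L2)
qed

lemma countable_dense_span:
  fixes B :: "'a::real_normed_vector set"
  assumes "countable B"
  shows "\<exists>D. countable D \<and> closure (span B) \<subseteq> closure D"
proof -
  define D where "D = range (\<lambda>xs :: (rat \<times> nat) list. \<Sum>(q, k)\<leftarrow>xs. of_rat q *\<^sub>R from_nat_into (insert 0 B) k)"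
  have D: "x + y \<in> D" if xy: "x \<in> D" "y \<in> D" for x y
  proof -
    from xy obtain xs ys :: "(rat \<times> nat) list"
      where "x = (\<Sum>(q, k)\<leftarrow>xs. of_rat q *\<^sub>R from_nat_into (insert 0 B) k)"
        "y = (\<Sum>(q, k)\<leftarrow>ys. of_rat q *\<^sub>R from_nat_into (insert 0 B) k)"
      by (auto simp: D_def)
    then show ?thesis
      unfolding D_def by (intro range_eqI[of _ _ "xs @ ys"]) simp
  qed
  have scale: "c *\<^sub>R b \<in> closure D" if "b \<in> B" for c b
  proof -
    obtain k where k: "from_nat_into (insert 0 B) k = b"
      using from_nat_into_surj[of "insert 0 B" b] assms \<open>b \<in> B\<close> by auto
    have "c \<in> closure \<rat>" by (simp add: Rats_closure_real)
    then obtain s where s: "\<And>n. s n \<in> \<rat>" "s \<longlonglongrightarrow> c"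
      by (auto simp: closure_sequential)
    have "s n *\<^sub>R b \<in> D" for n
    proof -
      obtain q where "s n = of_rat q" using s(1)[of n] by (auto elim: Rats_cases)
      then show ?thesis
        unfolding D_def by (intro range_eqI[of _ _ "[(q, k)]"]) (simp add: k)
    qed
    moreover have "(\<lambda>n. s n *\<^sub>R b) \<longlonglongrightarrow> c *\<^sub>R b"
      by (intro tendsto_intros s)
    ultimately show ?thesis
      unfolding closure_sequential by (intro exI[of _ "\<lambda>n. s n *\<^sub>R b"] conjI allI)
  qed
  have add: "x + y \<in> closure D" if xy: "x \<in> closure D" "y \<in> closure D" for x y
  proof -
    from xy obtain s t where "\<And>n. s n \<in> D" "s \<longlonglongrightarrow> x" "\<And>n. t n \<in> D" "t \<longlonglongrightarrow> y"
      unfolding closure_sequential by blast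
    then have "(\<forall>n. s n + t n \<in> D) \<and> (\<lambda>n. s n + t n) \<longlonglongrightarrow> x + y"
      by (auto intro: D tendsto_add)
    then show ?thesis
      unfolding closure_sequential by (intro exI[of _ "\<lambda>n. s n + t n"])
  qed
  have "0 \<in> closure D"
    by (intro closure_subset[THEN subsetD]) (auto simp: D_def intro!: range_eqI[of _ _ "[]"])
  then have "x \<in> closure D" if "x \<in> span B" for x
    using span_induct_alt[OF that, of "\<lambda>y. y \<in> closure D"] by (auto intro: add scale)
  then have "closure (span B) \<subseteq> closure D"
    by (intro closure_minimal) auto
  moreover have "countable D" by (simp add: D_def)
  ultimately show ?thesis by blast
qed

lemma subspace_closure_normed:
  fixes V :: "'a::real_normed_vector set"
  assumes V: "subspace V"
  shows "subspace (closure V)"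
proof (rule subspaceI)
  show "0 \<in> closure V"
    using closure_subset subspace_0[OF V] by blast
next
  fix x y assume "x \<in> closure V" "y \<in> closure V"
  then obtain s t where "\<And>n. s n \<in> V" "s \<longlonglongrightarrow> x" "\<And>n. t n \<in> V" "t \<longlonglongrightarrow> y"
    unfolding closure_sequential by blast
  then have "(\<forall>n. s n + t n \<in> V) \<and> (\<lambda>n. s n + t n) \<longlonglongrightarrow> x + y"
    by (auto intro: subspace_add[OF V] tendsto_add)
  then show "x + y \<in> closure V"
    unfolding closure_sequential by (intro exI[of _ "\<lambda>n. s n + t n"])
next
  fix c x assume "x \<in> closure V"
  then obtain s where "\<And>n. s n \<in> V" "s \<longlonglongrightarrow> x"
    unfolding closure_sequential by blast
  then have "(\<forall>n. c *\<^sub>R s n \<in> V) \<and> (\<lambda>n. c *\<^sub>R s n) \<longlonglongrightarrow> c *\<^sub>R x"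
    by (auto intro: subspace_scale[OF V] tendsto_intros)
  then show "c *\<^sub>R x \<in> closure V"
    unfolding closure_sequential by (intro exI[of _ "\<lambda>n. c *\<^sub>R s n"])
qed

instance L2 :: (euclidean_space) second_countable_topology
proof
  obtain T :: "'a set set" where T: "countable T" "topological_basis T"
    using ex_countable_basis by blast
  define G where "G = Inter ` {b. finite b \<and> b \<subseteq> T}"
  have G_countable: "countable G"
    unfolding G_def by (intro countable_image countable_Collect_finite_subset T)
  have UN: "UNIV \<in> G" unfolding G_def by (intro image_eqI[of _ _ "{}"]) auto
  have stable: "Int_stable G"
  proof (rule Int_stableI)
    fix a b assume "a \<in> G" "b \<in> G"
    then obtain x y where "a = \<Inter>x" "b = \<Inter>y" "finite x" "x \<subseteq> T" "finite y" "y \<subseteq> T"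
      by (auto simp: G_def)
    then show "a \<inter> b \<in> G"
      unfolding G_def by (intro image_eqI[of _ _ "x \<union> y"]) auto
  qed
  have T_open: "open x" if "x \<in> T" for x
    using T(2) that by (rule topological_basis_open)
  have "topological_basis G"
    unfolding topological_basis_def
  proof (intro conjI ballI allI impI)
    fix S :: "'a set" assume "open S"
    then obtain T' where "T' \<subseteq> T" "\<Union>T' = S"
      using T(2) unfolding topological_basis_def by blast
    moreover have "T \<subseteq> G"
    proof
      fix x assume "x \<in> T"
      then show "x \<in> G" unfolding G_def by (intro image_eqI[of _ _ "{x}"]) auto
    qed
    ultimately show "\<exists>B'\<subseteq>G. \<Union>B' = S" by blast
  next
    fix x assume "x \<in> G"
    then show "open x"
      using T_open by (auto simp: G_def intro!: open_Inter)
  qed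
  from borel_eq_countable_basis[OF G_countable this] have sig: "sigma UNIV G = borel" ..
  define B where "B = (\<lambda>A. abs_L2 (indicator A)) ` G"
  have "closure (span B) = UNIV"
  proof (rule L2_dense_subspace[OF _ _ stable sig UN])
    show "subspace (closure (span B))" by (intro subspace_closure_normed subspace_span)
    show "abs_L2 (indicator A) \<in> closure (span B)" if "A \<in> G" for A
      using that by (intro closure_subset[THEN subsetD] span_base) (auto simp: B_def)
  qed simp
  moreover have "countable B" unfolding B_def using G_countable by simp
  ultimately obtain D :: "'a L2 set" where D: "countable D" "UNIV \<subseteq> closure D"
    using countable_dense_span[of B] by metis
  define U where "U = (\<lambda>(d, n). ball d (inverse (real (Suc n)))) ` (D \<times> UNIV)"
  have "topological_basis U"
  proof (rule topological_basisI)
    show "open x" if "x \<in> U" for x using that by (auto simp: U_def)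
    fix S :: "'a L2 set" and x assume "open S" "x \<in> S"
    then obtain e where e: "0 < e" "ball x e \<subseteq> S" by (auto simp: open_contains_ball)
    obtain n where n: "inverse (real (Suc n)) < e / 2"
      using reals_Archimedean[of "e / 2"] e by auto
    have "x \<in> closure D" using D by blast
    then obtain d where d: "d \<in> D" "dist d x < inverse (real (Suc n))"
      unfolding closure_approachable by (metis inverse_positive_iff_positive of_nat_0_less_iff zero_less_Suc)
    have "ball d (inverse (real (Suc n))) \<subseteq> ball x e"
    proof
      fix y assume "y \<in> ball d (inverse (real (Suc n)))"
      then show "y \<in> ball x e"
        using d(2) n dist_triangle[of x y d] by (simp add: dist_commute)
    qed
    then show "\<exists>B'\<in>U. x \<in> B' \<and> B' \<subseteq> S"
      using d e by (auto simp: U_def intro!: bexI[of _ d] exI[of _ n])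
  qed
  from topological_basis_imp_subbasis[OF this] have "open = generate_topology U" .
  moreover have "countable U" unfolding U_def using D by auto
  ultimately show "\<exists>B :: 'a L2 set set. countable B \<and> open = generate_topology B"
    by (intro exI[of _ U] conjI)
qed


section \<open>Hilbert--Schmidt operators\<close>

definition orthonormal_basis :: "'a::real_inner set \<Rightarrow> bool"
  where "orthonormal_basis B \<longleftrightarrow>
    (\<forall>e\<in>B. norm e = 1) \<and> pairwise orthogonal B \<and> closure (span B) = UNIV"

definition hilbert_schmidt :: "('a::real_inner \<Rightarrow>\<^sub>L 'b::real_inner) \<Rightarrow> bool"
  where "hilbert_schmidt T \<longleftrightarrow>
    (\<exists>B. orthonormal_basis B \<and> (\<lambda>e. (norm (blinfun_apply T e))\<^sup>2) summable_on B)"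

text \<open>For Hilbert--Schmidt operators on \<open>'a L2\<close> the value does not depend on the chosen basis.\<close>

definition hs_inner :: "('a::real_inner \<Rightarrow>\<^sub>L 'b::real_inner) \<Rightarrow> ('a \<Rightarrow>\<^sub>L 'b) \<Rightarrow> real"
  where "hs_inner S T =
    (\<Sum>\<^sub>\<infinity>e\<in>(SOME B. orthonormal_basis B). inner (blinfun_apply S e) (blinfun_apply T e))"

definition hs_norm :: "('a::real_inner \<Rightarrow>\<^sub>L 'b::real_inner) \<Rightarrow> real"
  where "hs_norm T = sqrt (hs_inner T T)"

definition rank_one :: "'a::real_inner \<Rightarrow> 'a \<Rightarrow> ('a \<Rightarrow>\<^sub>L 'a)"
  where "rank_one u v = Blinfun (\<lambda>f. inner v f *\<^sub>R u)"

definition has_kernel ::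
    "('a::euclidean_space L2 \<Rightarrow>\<^sub>L 'a L2) \<Rightarrow> ('a \<times> 'a \<Rightarrow> real) \<Rightarrow> bool"
  where "has_kernel C c \<longleftrightarrow>
    (\<forall>f. AE p in cube_measure.
      rep_L2 (blinfun_apply C f) p = (LINT q|cube_measure. c (p, q) * rep_L2 f q))"


section \<open>Separable expansions\<close>

definition tensor :: "real L2 \<Rightarrow> real L2 \<Rightarrow> (real \<times> real) L2"
  where "tensor x y = abs_L2 (\<lambda>(t, s). rep_L2 x t * rep_L2 y s)"

definition op_tensor ::
    "(real L2 \<Rightarrow>\<^sub>L real L2) \<Rightarrow> (real L2 \<Rightarrow>\<^sub>L real L2) \<Rightarrow> ((real \<times> real) L2 \<Rightarrow>\<^sub>L (real \<times> real) L2)"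
  where "op_tensor A B = (THE T. hilbert_schmidt T \<and>
    (\<forall>x y. blinfun_apply T (tensor x y) = tensor (blinfun_apply A x) (blinfun_apply B y)))"

text \<open>All sequences of this section are indexed from 1; the entry at 0 is ignored.\<close>

definition hs_orthonormal :: "(nat \<Rightarrow> ('a::real_inner \<Rightarrow>\<^sub>L 'b::real_inner)) \<Rightarrow> bool"
  where "hs_orthonormal A \<longleftrightarrow> (\<forall>j\<ge>1. hilbert_schmidt (A j)) \<and>
    (\<forall>i\<ge>1. \<forall>j\<ge>1. hs_inner (A i) (A j) = (if i = j then 1 else 0))"

text \<open>
  The singular value decomposition of \<open>C\<close>. Completeness of the orthonormal systems is not
  required: with a decreasing sequence of scores indexed by the positive integers, an operator with
  infinitely many nonzero scores may have singular vectors that do not span (for a kernel invariant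
  under exchanging \<open>t\<close> and \<open>t'\<close>, they are all self-adjoint), and would then have no expansion in
  complete bases. Expansions in complete bases are included, and the scores are the same.
\<close>

definition separable_expansion ::
    "((real \<times> real) L2 \<Rightarrow>\<^sub>L (real \<times> real) L2) \<Rightarrow> (nat \<Rightarrow> real) \<Rightarrow>
     (nat \<Rightarrow> (real L2 \<Rightarrow>\<^sub>L real L2)) \<Rightarrow> (nat \<Rightarrow> (real L2 \<Rightarrow>\<^sub>L real L2)) \<Rightarrow> bool"
  where "separable_expansion C \<sigma> A B \<longleftrightarrow>
    hilbert_schmidt C \<and> hs_orthonormal A \<and> hs_orthonormal B \<and>
    (\<forall>j\<ge>1. 0 \<le> \<sigma> j) \<and> (\<forall>j\<ge>1. \<sigma> (Suc j) \<le> \<sigma> j) \<and>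
    (\<lambda>n. hs_norm (C - (\<Sum>j=1..n. \<sigma> j *\<^sub>R op_tensor (A j) (B j)))) \<longlonglongrightarrow> 0"

definition dos_le :: "nat \<Rightarrow> ((real \<times> real) L2 \<Rightarrow>\<^sub>L (real \<times> real) L2) \<Rightarrow> bool"
  where "dos_le R G \<longleftrightarrow> (\<exists>\<sigma> A B. separable_expansion G \<sigma> A B \<and>
    finite {j. 1 \<le> j \<and> \<sigma> j \<noteq> 0} \<and> card {j. 1 \<le> j \<and> \<sigma> j \<noteq> 0} \<le> R)"

text \<open>A minimiser need not be unique, so this is a predicate.\<close>

definition best_separable_approx ::
    "nat \<Rightarrow> ((real \<times> real) L2 \<Rightarrow>\<^sub>L (real \<times> real) L2) \<Rightarrow> ((real \<times> real) L2 \<Rightarrow>\<^sub>L (real \<times> real) L2) \<Rightarrow> bool"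
  where "best_separable_approx R F G \<longleftrightarrow> hilbert_schmidt G \<and> dos_le R G \<and>
    (\<forall>G'. hilbert_schmidt G' \<and> dos_le R G' \<longrightarrow> (hs_norm (F - G))\<^sup>2 \<le> (hs_norm (F - G'))\<^sup>2)"

text \<open>The first gap uses the convention that the score of index 0 is infinite.\<close>

definition score_gap :: "(nat \<Rightarrow> real) \<Rightarrow> nat \<Rightarrow> real"
  where "score_gap \<sigma> i =
    (if i = 1 then (\<sigma> 1)\<^sup>2 - (\<sigma> 2)\<^sup>2
     else min ((\<sigma> (i - 1))\<^sup>2 - (\<sigma> i)\<^sup>2) ((\<sigma> i)\<^sup>2 - (\<sigma> (i + 1))\<^sup>2))"


section \<open>Covariance operators\<close>

definition covariance ::
    "'w measure \<Rightarrow> ('w \<Rightarrow> 'a::euclidean_space L2) \<Rightarrow> ('a L2 \<Rightarrow>\<^sub>L 'a L2)"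
  where "covariance M X = (let m = integral\<^sup>L M X in
    Blinfun (\<lambda>f. LINT \<omega>|M. blinfun_apply (rank_one (X \<omega> - m) (X \<omega> - m)) f))"

definition empirical_mean :: "nat \<Rightarrow> (nat \<Rightarrow> 'a::euclidean_space L2) \<Rightarrow> 'a L2"
  where "empirical_mean N Z = (1 / real N) *\<^sub>R (\<Sum>n=1..N. Z n)"

definition empirical_covariance ::
    "nat \<Rightarrow> (nat \<Rightarrow> 'a::euclidean_space L2) \<Rightarrow> ('a L2 \<Rightarrow>\<^sub>L 'a L2)"
  where "empirical_covariance N Z = (1 / real N) *\<^sub>R
    (\<Sum>n=1..N. rank_one (Z n - empirical_mean N Z) (Z n - empirical_mean N Z))"


section \<open>Pixels and measurement schemes\<close>

text \<open>The assignment of the common endpoint of two neighbouring cells is left open.\<close>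

definition regular_partition :: "nat \<Rightarrow> (nat \<Rightarrow> real set) \<Rightarrow> bool"
  where "regular_partition K T \<longleftrightarrow>
    (\<forall>i\<in>{1..K}. {(real i - 1) / real K <..< real i / real K} \<subseteq> T i \<and>
       T i \<subseteq> {(real i - 1) / real K .. real i / real K}) \<and>
    disjoint_family_on T {1..K} \<and> (\<Union>i\<in>{1..K}. T i) = {0..1}"

definition pixel_surface ::
    "nat \<Rightarrow> nat \<Rightarrow> (nat \<Rightarrow> real set) \<Rightarrow> (nat \<Rightarrow> real set) \<Rightarrow> (nat \<Rightarrow> nat \<Rightarrow> real) \<Rightarrow> (real \<times> real) L2"
  where "pixel_surface K1 K2 T S y =
    abs_L2 (\<lambda>p. \<Sum>i=1..K1. \<Sum>j=1..K2. y i j * indicator (T i \<times> S j) p)"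

text \<open>
  In the following schemes \<open>T K1\<close> and \<open>S K2\<close> are the partitions of the two axes, and
  \<open>XK K1 K2 n i j \<omega>\<close> is the value of the \<open>n\<close>-th surface at pixel \<open>(i, j)\<close>. In the pointwise
  scheme \<open>x n\<close> is the version of \<open>X n\<close> with almost surely continuous sample paths.
\<close>

definition pointwise_scheme ::
    "'w measure \<Rightarrow> (nat \<Rightarrow> 'w \<Rightarrow> (real \<times> real) L2) \<Rightarrow>
     (nat \<Rightarrow> nat \<Rightarrow> real set) \<Rightarrow> (nat \<Rightarrow> nat \<Rightarrow> real set) \<Rightarrow>
     (nat \<Rightarrow> nat \<Rightarrow> nat \<Rightarrow> nat \<Rightarrow> nat \<Rightarrow> 'w \<Rightarrow> real) \<Rightarrow> bool"
  where "pointwise_scheme M X T S XK \<longleftrightarrow>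
    (\<exists>(x :: nat \<Rightarrow> 'w \<Rightarrow> real \<times> real \<Rightarrow> real) (t :: nat \<Rightarrow> nat \<Rightarrow> real) (s :: nat \<Rightarrow> nat \<Rightarrow> real).
      (\<forall>n\<ge>1. \<forall>p\<in>cbox 0 One. (\<lambda>\<omega>. x n \<omega> p) \<in> borel_measurable M) \<and>
      (\<forall>n\<ge>1. AE \<omega> in M. continuous_on (cbox 0 One) (x n \<omega>) \<and> X n \<omega> = abs_L2 (x n \<omega>)) \<and>
      (\<forall>K\<ge>1. \<forall>i\<in>{1..K}. t K i \<in> T K i \<and> s K i \<in> S K i) \<and>
      (\<forall>K1\<ge>1. \<forall>K2\<ge>1. \<forall>n\<ge>1. \<forall>i\<in>{1..K1}. \<forall>j\<in>{1..K2}. \<forall>\<omega>\<in>space M.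
        XK K1 K2 n i j \<omega> = x n \<omega> (t K1 i, s K2 j)))"

definition averaged_scheme ::
    "'w measure \<Rightarrow> (nat \<Rightarrow> 'w \<Rightarrow> (real \<times> real) L2) \<Rightarrow>
     (nat \<Rightarrow> nat \<Rightarrow> real set) \<Rightarrow> (nat \<Rightarrow> nat \<Rightarrow> real set) \<Rightarrow>
     (nat \<Rightarrow> nat \<Rightarrow> nat \<Rightarrow> nat \<Rightarrow> nat \<Rightarrow> 'w \<Rightarrow> real) \<Rightarrow> bool"
  where "averaged_scheme M X T S XK \<longleftrightarrow>
    (\<forall>K1\<ge>1. \<forall>K2\<ge>1. \<forall>n\<ge>1. \<forall>i\<in>{1..K1}. \<forall>j\<in>{1..K2}. \<forall>\<omega>\<in>space M.
      XK K1 K2 n i j \<omega> =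
        (LINT p:T K1 i \<times> S K2 j|cube_measure. rep_L2 (X n \<omega>) p) / measure lborel (T K1 i \<times> S K2 j))"


section \<open>Probabilistic notions\<close>

definition iid_vars :: "'w measure \<Rightarrow> 'b measure \<Rightarrow> ('i \<Rightarrow> 'w \<Rightarrow> 'b) \<Rightarrow> 'i set \<Rightarrow> bool"
  where "iid_vars M N X I \<longleftrightarrow> prob_space.indep_vars M (\<lambda>_. N) X I \<and>
    (\<forall>i\<in>I. \<forall>j\<in>I. distr M N (X i) = distr M N (X j))"

text \<open>
  \<open>Z N k\<close> is $O_P(r_N)$ as \<open>N\<close> tends to infinity, uniformly in \<open>k \<in> I\<close>: the bound \<open>b\<close> and the
  threshold for \<open>N\<close> depend only on the probability level.
\<close>

definition uniform_bigO_prob ::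
    "'w measure \<Rightarrow> 'k set \<Rightarrow> (nat \<Rightarrow> 'k \<Rightarrow> 'w \<Rightarrow> real) \<Rightarrow> (nat \<Rightarrow> real) \<Rightarrow> bool"
  where "uniform_bigO_prob M I Z r \<longleftrightarrow>
    (\<forall>N. \<forall>k\<in>I. Z N k \<in> borel_measurable M) \<and>
    (\<forall>\<epsilon>>0. \<exists>b. \<forall>\<^sub>F N in sequentially. \<forall>k\<in>I.
      measure M {\<omega>\<in>space M. \<bar>Z N k \<omega>\<bar> > b * r N} \<le> \<epsilon>)"

end

theory Submission
  imports Defs
begin

text \<open>
  No perturbation theory of singular values is needed. Since the truncation of the expansion of $C$ is
  a competitor for the best approximation of the empirical covariance, the error is at most the tail
  plus twice the distance $d$ of the empirical covariance from $C$; and $a_R \ge 1$, so the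
  coefficients of the bias terms exceed what this requires. The distance $d$ splits into the kernel
  discretisation error, at most $\sqrt2 L h$ with $h = (K_1^{-2} + K_2^{-2})^{1/2}$, the noise
  covariance of norm $\sigma^2 / \sqrt{K_1 K_2}$, and a random fluctuation.

  In the pointwise scheme the fluctuation need not be of order $N^{-1/2}$ uniformly in the grid,
  because fourth moments of point values are not assumed. A pixel value is compared with the average
  of the surface over the pixel shrunk by a factor $\delta$ towards the sampling location: these
  averages have fourth moments controlled by those of $\|X\|$, and the differences have second
  moments of order $\delta L h$. After truncating the surfaces whose pixel values are not dominated
  by $\|X\|$, the fluctuation is $O_P(N^{-1/2})$ up to a term of mean $O(\delta L h)$. As $\delta$ is
  arbitrary, this term is absorbed by the surplus in the coefficient of $L h$.
\<close>

section \<open>Orthonormal bases\<close>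

text \<open>The obstacle is uniformity in the grid. The Hilbert-Schmidt norm of a pixel matrix is
  the pixel area times its Frobenius norm, so variances of entries are averaged over pairs of pixels
  and a grid-free bound per surface suffices. Bessel's inequality supplies it for averages over
  disjoint sets. For point values it is available only through averages over boxes smaller by a
  factor \<open>4 ^ k\<close>, which costs a factor \<open>16 ^ k\<close> in area. The replacement
  error is small in mean square because the kernel enters the variance of an increment with
  coefficients 1 - 2 + 1, so its common value cancels. Discarded products form rank-one matrices,
  whose Frobenius norm is a sum of squares, so second moments control them in mean. The probability
  level determines \<open>k\<close>, and \<open>k\<close> determines the constant in front of
  \<open>1 / sqrt N\<close>; the grid enters neither choice. In the final accounting, twice the
  distance costs \<open>(2 + 2 * sqrt 2) * L * h\<close> and twice the noise norm, while
  \<open>a_R \<ge> 1\<close> holds because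
  \<open>score_gap \<sigma> 1 \<le> (\<sigma> 1)\<^sup>2\<close> and
  \<open>\<sigma> 1 \<le> hs_norm C\<close>.\<close>

lemma orthonormal_basis_inner:
  assumes "orthonormal_basis B" "e \<in> B" "f \<in> B"
  shows "inner e f = (if e = f then 1 else 0)"
proof (cases "e = f")
  case True
  then show ?thesis
    using assms by (simp add: orthonormal_basis_def flip: power2_norm_eq_inner)
next
  case False
  then show ?thesis
    using assms by (auto simp: orthonormal_basis_def pairwise_def orthogonal_def)
qed

lemma inner_sum_orthonormal_basis:
  assumes "orthonormal_basis B" "finite F" "F \<subseteq> B"
  shows "inner (\<Sum>e\<in>F. a e *\<^sub>R e) (\<Sum>e\<in>F. b e *\<^sub>R e) = (\<Sum>e\<in>F. a e * b e)"
proof -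
  have "inner (\<Sum>e\<in>F. a e *\<^sub>R e) (\<Sum>e\<in>F. b e *\<^sub>R e) = (\<Sum>e\<in>F. \<Sum>f\<in>F. a e * (b f * inner e f))"
    by (simp only: inner_sum_left inner_scaleR_left)
      (simp only: inner_sum_right inner_scaleR_right sum_distrib_left)
  also have "\<dots> = (\<Sum>e\<in>F. \<Sum>f\<in>F. if e = f then a e * b f else 0)"
    using assms(3) orthonormal_basis_inner[OF assms(1)]
    by (intro sum.cong refl) (auto simp: subset_iff)
  also have "\<dots> = (\<Sum>e\<in>F. a e * b e)"
    using assms(2) by simp
  finally show ?thesis .
qed

lemma norm_sum_orthonormal_basis:
  assumes "orthonormal_basis B" "finite F" "F \<subseteq> B"
  shows "norm (\<Sum>e\<in>F. a e *\<^sub>R e) = L2_set a F"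
  using inner_sum_orthonormal_basis[OF assms, of a a]
  by (simp add: norm_eq_sqrt_inner L2_set_def power2_eq_square)

lemma span_finite_sum:
  assumes "x \<in> span B"
  obtains F a where "finite F" "F \<subseteq> B" "x = (\<Sum>e\<in>F. a e *\<^sub>R e)"
  using assms unfolding span_explicit by blast

text \<open>An induction principle: a condition that cuts out a closed subspace holds everywhere
  once it holds on a basis.\<close>

lemma orthonormal_basis_closed_subspace_UNIV:
  assumes B: "orthonormal_basis B" and V: "subspace V" "closed V" "B \<subseteq> V"
  shows "V = UNIV"
proof -
  have "span B \<subseteq> V"
    using V by (intro span_minimal)
  then have "closure (span B) \<subseteq> V"
    using V by (intro closure_minimal)
  then show ?thesis
    using B by (auto simp: orthonormal_basis_def)
qed

lemma orthonormal_basis_bounded_linear_eqI: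
  assumes B: "orthonormal_basis B" and fg: "bounded_linear f" "bounded_linear g"
    and eq: "\<And>e. e \<in> B \<Longrightarrow> f e = g e"
  shows "f = g"
proof -
  interpret f: bounded_linear f by fact
  interpret g: bounded_linear g by fact
  have "{x. f x = g x} = UNIV"
  proof (rule orthonormal_basis_closed_subspace_UNIV[OF B])
    show "subspace {x. f x = g x}"
      by (rule subspaceI) (auto simp: f.add g.add f.scaleR g.scaleR f.zero g.zero)
    show "closed {x. f x = g x}"
      by (intro closed_Collect_eq f.continuous_on g.continuous_on continuous_on_id)
    show "B \<subseteq> {x. f x = g x}" using eq by auto
  qed
  then show ?thesis by auto
qed

text \<open>
  Stating Parseval's identity for functionals makes the adjoint of an operator dispensable
  below, and with it the Riesz representation theorem.
\<close>

lemma orthonormal_basis_has_sum_functional: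
  fixes \<phi> :: "'a::real_inner \<Rightarrow> real"
  assumes B: "orthonormal_basis B" and \<phi>: "bounded_linear \<phi>"
  shows "((\<lambda>e. (\<phi> e)\<^sup>2) has_sum (onorm \<phi>)\<^sup>2) B"
proof -
  interpret bounded_linear \<phi> by fact
  have o: "0 \<le> onorm \<phi>" by (rule onorm_pos_le[OF \<phi>])
  \<comment> \<open>\<open>\<phi>\<close> is tested on the vector with coefficients
    \<open>\<phi> e\<close>, where its value is the square of that vector's norm.\<close>
  have bessel: "L2_set \<phi> F \<le> onorm \<phi>" if F: "finite F" "F \<subseteq> B" for F
  proof (cases "L2_set \<phi> F = 0")
    case False
    then have pos: "0 < L2_set \<phi> F"
      using L2_set_nonneg[of \<phi> F] by linarith
    have "(L2_set \<phi> F)\<^sup>2 = \<phi> (\<Sum>e\<in>F. \<phi> e *\<^sub>R e)"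
      by (simp add: sum scaleR L2_set_def sum_nonneg power2_eq_square)
    also have "\<dots> \<le> onorm \<phi> * norm (\<Sum>e\<in>F. \<phi> e *\<^sub>R e)"
      using onorm[OF \<phi>, of "\<Sum>e\<in>F. \<phi> e *\<^sub>R e"] by (simp add: abs_le_iff)
    also have "norm (\<Sum>e\<in>F. \<phi> e *\<^sub>R e) = L2_set \<phi> F"
      by (rule norm_sum_orthonormal_basis[OF B F])
    finally show ?thesis
      using pos by (simp add: power2_eq_square)
  qed (use o in simp)
  have le: "(\<Sum>e\<in>F. (\<phi> e)\<^sup>2) \<le> (onorm \<phi>)\<^sup>2" if F: "finite F" "F \<subseteq> B" for F
    using power_mono[OF bessel[OF F] L2_set_nonneg, of 2] by (simp add: L2_set_def sum_nonneg)
  have summable: "(\<lambda>e. (\<phi> e)\<^sup>2) summable_on B"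
    by (intro nonneg_bdd_above_summable_on bdd_aboveI[of _ "(onorm \<phi>)\<^sup>2"]) (auto intro: le)
  define S where "S = (\<Sum>\<^sub>\<infinity>e\<in>B. (\<phi> e)\<^sup>2)"
  have S: "S \<le> (onorm \<phi>)\<^sup>2"
    unfolding S_def by (intro infsum_le_finite_sums summable le)
  \<comment> \<open>Conversely, Cauchy-Schwarz on the coefficients bounds \<open>\<phi>\<close> by
    \<open>sqrt S\<close> on the span, and density carries the bound to the whole space.\<close>
  have "\<bar>\<phi> x\<bar> \<le> sqrt S * norm x" if x: "x \<in> span B" for x
  proof -
    obtain F a where F: "finite F" "F \<subseteq> B" and xF: "x = (\<Sum>e\<in>F. a e *\<^sub>R e)"
      using x by (rule span_finite_sum)
    have "\<bar>\<phi> x\<bar> \<le> (\<Sum>e\<in>F. \<bar>a e\<bar> * \<bar>\<phi> e\<bar>)"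
      unfolding xF by (simp add: sum scaleR flip: abs_mult)
    also have "\<dots> \<le> L2_set a F * L2_set \<phi> F"
      by (rule L2_set_mult_ineq)
    also have "L2_set \<phi> F \<le> sqrt S"
      unfolding L2_set_def S_def
      by (intro real_sqrt_le_mono finite_sum_le_infsum summable F) simp
    finally show ?thesis
      using norm_sum_orthonormal_basis[OF B F, of a]
      by (simp add: xF mult_left_mono mult.commute[of "sqrt S"])
  qed
  then have "span B \<subseteq> {x. \<bar>\<phi> x\<bar> \<le> sqrt S * norm x}" by auto
  then have "closure (span B) \<subseteq> {x. \<bar>\<phi> x\<bar> \<le> sqrt S * norm x}"
    by (intro closure_minimal closed_Collect_le continuous_intros continuous_on continuous_on_id)
  then have "\<bar>\<phi> x\<bar> \<le> sqrt S * norm x" for x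
    using B by (auto simp: orthonormal_basis_def)
  moreover have S0: "0 \<le> S" unfolding S_def by (rule infsum_nonneg) simp
  ultimately have "onorm \<phi> \<le> sqrt S"
    by (intro onorm_bound) auto
  then have "(onorm \<phi>)\<^sup>2 \<le> S"
    using o S0 by (metis power_mono real_sqrt_pow2)
  with S have "S = (onorm \<phi>)\<^sup>2" by simp
  then show ?thesis
    using has_sum_infsum[OF summable] by (simp add: S_def)
qed

lemma onorm_inner: "onorm (\<lambda>y. inner x y) = norm x"
proof (rule antisym)
  show "onorm (\<lambda>y. inner x y) \<le> norm x"
    by (intro onorm_bound) (simp_all add: Cauchy_Schwarz_ineq2)
  have "norm x * norm x \<le> onorm (\<lambda>y. inner x y) * norm x"
    using onorm[OF bounded_linear_inner_right[of x], of x]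
    by (simp add: power2_norm_eq_inner flip: power2_eq_square)
  then show "norm x \<le> onorm (\<lambda>y. inner x y)"
    using onorm_pos_le[OF bounded_linear_inner_right[of x]] by (cases "norm x = 0") auto
qed

lemma parseval:
  "orthonormal_basis B \<Longrightarrow> ((\<lambda>e. (inner x e)\<^sup>2) has_sum (norm x)\<^sup>2) B"
  using orthonormal_basis_has_sum_functional[OF _ bounded_linear_inner_right[of x]]
  by (simp add: onorm_inner)

text \<open>Polarization of \<open>parseval\<close>, which accounts for the factor 1/4.\<close>

lemma parseval_inner:
  assumes "orthonormal_basis B"
  shows "((\<lambda>e. inner x e * inner y e) has_sum inner x y) B"
proof -
  have "((\<lambda>e. ((inner (x + y) e)\<^sup>2 - (inner (x - y) e)\<^sup>2) * (1 / 4)) has_sum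
      ((norm (x + y))\<^sup>2 - (norm (x - y))\<^sup>2) * (1 / 4)) B"
    unfolding diff_conv_add_uminus[of "(_::real)\<^sup>2"]
    by (intro has_sum_cmult_left has_sum_add has_sum_uminusI parseval assms)
  moreover have "((inner (x + y) e)\<^sup>2 - (inner (x - y) e)\<^sup>2) * (1 / 4) = inner x e * inner y e" for e
    by (simp add: inner_add_left inner_diff_left power2_eq_square algebra_simps)
  moreover have "((norm (x + y))\<^sup>2 - (norm (x - y))\<^sup>2) * (1 / 4) = inner x y"
    by (simp add: power2_norm_eq_inner inner_add_left inner_add_right inner_diff_left
        inner_diff_right inner_commute)
  ultimately show ?thesis by simp
qed

lemma bessel_inequality:
  assumes "orthonormal_basis B" "finite F" "F \<subseteq> B"
  shows "(\<Sum>e\<in>F. (inner x e)\<^sup>2) \<le> (norm x)\<^sup>2"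
  by (rule finite_sum_le_has_sum[OF parseval[OF assms(1)] assms(2,3)]) simp

text \<open>The operator sends \<open>x\<close> to the sum of
  \<open>inner x e *\<^sub>R v e\<close>. Bessel and Cauchy-Schwarz bound finite sums of norms by
  \<open>norm x * sqrt S\<close>, which gives absolute convergence and boundedness at once;
  completeness of the codomain turns absolute convergence into convergence. Tensor products of
  operators are built from their values on a basis in this way.\<close>

lemma orthonormal_basis_extension:
  fixes v :: "'a::real_inner \<Rightarrow> 'b::banach"
  assumes B: "orthonormal_basis B" and v: "(\<lambda>e. (norm (v e))\<^sup>2) summable_on B"
  shows "\<exists>T :: 'a \<Rightarrow>\<^sub>L 'b. \<forall>e\<in>B. blinfun_apply T e = v e"
proof -
  define S where "S = (\<Sum>\<^sub>\<infinity>e\<in>B. (norm (v e))\<^sup>2)"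
  define t where "t x = (\<Sum>\<^sub>\<infinity>e\<in>B. inner x e *\<^sub>R v e)" for x
  have fin: "(\<Sum>e\<in>F. norm (inner x e *\<^sub>R v e)) \<le> norm x * sqrt S" if F: "finite F" "F \<subseteq> B" for F x
  proof -
    have "(\<Sum>e\<in>F. norm (inner x e *\<^sub>R v e)) \<le> L2_set (inner x) F * L2_set (\<lambda>e. norm (v e)) F"
      using L2_set_mult_ineq[of "inner x" "\<lambda>e. norm (v e)" F] by simp
    also have "\<dots> \<le> norm x * sqrt S"
    proof (intro mult_mono)
      show "L2_set (inner x) F \<le> norm x"
        using bessel_inequality[OF B F, of x] by (simp add: L2_set_def real_le_lsqrt sum_nonneg)
      show "L2_set (\<lambda>e. norm (v e)) F \<le> sqrt S"
        unfolding L2_set_def S_def by (intro real_sqrt_le_mono finite_sum_le_infsum v F) simp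
    qed auto
    finally show ?thesis .
  qed
  have abs: "(\<lambda>e. inner x e *\<^sub>R v e) abs_summable_on B" for x
    unfolding abs_summable_iff_bdd_above
    by (intro bdd_aboveI[of _ "norm x * sqrt S"]) (use fin in auto)
  then have sm: "(\<lambda>e. inner x e *\<^sub>R v e) summable_on B" for x
    by (rule abs_summable_summable)
  have "bounded_linear t"
  proof (rule bounded_linear_intro[where K = "sqrt S"])
    show "t (x + y) = t x + t y" for x y
      unfolding t_def by (simp add: inner_add_left scaleR_add_left infsum_add sm)
    show "t (r *\<^sub>R x) = r *\<^sub>R t x" for r x
      unfolding t_def by (simp add: infsum_scaleR_right flip: scaleR_scaleR)
    show "norm (t x) \<le> norm x * sqrt S" for x
    proof -
      have "norm (t x) \<le> (\<Sum>\<^sub>\<infinity>e\<in>B. norm (inner x e *\<^sub>R v e))"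
        unfolding t_def by (rule norm_infsum_bound[OF abs])
      also have "\<dots> \<le> norm x * sqrt S"
        by (intro infsum_le_finite_sums abs fin)
      finally show ?thesis .
    qed
  qed
  then have "blinfun_apply (Blinfun t) = t"
    by (rule bounded_linear_Blinfun_apply)
  moreover have "t e = v e" if e: "e \<in> B" for e
  proof -
    have "t e = (\<Sum>\<^sub>\<infinity>f\<in>{e}. inner e f *\<^sub>R v f)"
      unfolding t_def
      by (rule infsum_cong_neutral) (use e in \<open>auto simp: orthonormal_basis_inner[OF B]\<close>)
    then show ?thesis
      using e by (simp add: orthonormal_basis_inner[OF B])
  qed
  ultimately show ?thesis by (intro exI[of _ "Blinfun t"]) simp
qed


section \<open>Hilbert--Schmidt operators\<close>

text \<open>Tonelli for unordered sums: non-negativity makes the double family summable, so the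
  order of summation may be exchanged.\<close>

lemma has_sum_swap_nonneg:
  fixes f :: "'a \<Rightarrow> 'b \<Rightarrow> real"
  assumes f: "\<And>x y. 0 \<le> f x y"
    and g: "\<And>x. x \<in> A \<Longrightarrow> ((\<lambda>y. f x y) has_sum g x) B" "(g has_sum S) A"
    and h: "\<And>y. y \<in> B \<Longrightarrow> ((\<lambda>x. f x y) has_sum h y) A"
  shows "(h has_sum S) B"
proof -
  have s: "(\<lambda>(x, y). f x y) summable_on A \<times> B"
    using g f by (intro summable_on_SigmaI[where g = g]) (auto intro: has_sum_imp_summable)
  have "((\<lambda>(x, y). f x y) has_sum S) (A \<times> B)"
    using g s by (intro has_sum_SigmaI[where g = g]) auto
  then have "((\<lambda>(y, x). f x y) has_sum S) (B \<times> A)"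
    unfolding has_sum_swap[of _ _ A] by (simp add: case_prod_unfold)
  then show ?thesis
    by (rule has_sum_SigmaD) (use h in auto)
qed

text \<open>Both sides add up the squares of all matrix entries \<open>inner (T e) f\<close>, by
  rows and by columns. The functional \<open>inner (T x) f\<close> of \<open>x\<close> stands for
  the adjoint applied to \<open>f\<close>. The left sum involves only \<open>B\<close> and the right
  one only \<open>F\<close>, which is the source of independence of the basis.\<close>

lemma has_sum_norm_operator:
  fixes T :: "'a::real_inner \<Rightarrow>\<^sub>L 'a"
  assumes B: "orthonormal_basis B" and F: "orthonormal_basis F"
  shows "((\<lambda>e. (norm (blinfun_apply T e))\<^sup>2) has_sum s) B \<longleftrightarrow>
    ((\<lambda>f. (onorm (\<lambda>x. inner (blinfun_apply T x) f))\<^sup>2) has_sum s) F"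
proof -
  have 1: "((\<lambda>f. (inner (blinfun_apply T e) f)\<^sup>2) has_sum (norm (blinfun_apply T e))\<^sup>2) F" for e
    by (rule parseval[OF F])
  have bl: "bounded_linear (\<lambda>x. inner (blinfun_apply T x) f)" for f
    by (intro bounded_linear_intros blinfun.bounded_linear_right)
  have 2: "((\<lambda>e. (inner (blinfun_apply T e) f)\<^sup>2) has_sum
      (onorm (\<lambda>x. inner (blinfun_apply T x) f))\<^sup>2) B" for f
    by (rule orthonormal_basis_has_sum_functional[OF B bl])
  show ?thesis
    using has_sum_swap_nonneg[where f = "\<lambda>e f. (inner (blinfun_apply T e) f)\<^sup>2", OF _ 1 _ 2]
      has_sum_swap_nonneg[where f = "\<lambda>f e. (inner (blinfun_apply T e) f)\<^sup>2", OF _ 2 _ 1]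
    by (intro iffI) (simp_all add: zero_le_power2)
qed

lemma hilbert_schmidt_has_sum:
  fixes T :: "'a::real_inner \<Rightarrow>\<^sub>L 'a"
  assumes T: "hilbert_schmidt T" and B: "orthonormal_basis B"
  shows "((\<lambda>e. (norm (blinfun_apply T e))\<^sup>2) has_sum (hs_norm T)\<^sup>2) B"
proof -
  obtain B' s where B': "orthonormal_basis B'"
    and s: "((\<lambda>e. (norm (blinfun_apply T e))\<^sup>2) has_sum s) B'"
    using T by (auto simp: hilbert_schmidt_def summable_on_def)
  \<comment> \<open>From vectors of \<open>B'\<close> to functionals indexed by \<open>F\<close>,
    and from there back to vectors of the same \<open>F\<close>.\<close>
  have *: "((\<lambda>e. (norm (blinfun_apply T e))\<^sup>2) has_sum s) F" if F: "orthonormal_basis F" for F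
    using s has_sum_norm_operator[OF B' F] has_sum_norm_operator[OF F F] by blast
  have some: "orthonormal_basis (SOME F :: 'a set. orthonormal_basis F)"
    using B by (rule someI)
  have "0 \<le> s"
    by (rule has_sum_nonneg[OF s]) simp
  then have "(hs_norm T)\<^sup>2 = s"
    using infsumI[OF *[OF some]] by (simp add: hs_norm_def hs_inner_def power2_norm_eq_inner)
  with *[OF B] show ?thesis by simp
qed

lemma hilbert_schmidt_basis:
  fixes T :: "'a::real_inner \<Rightarrow>\<^sub>L 'b::real_inner"
  assumes "hilbert_schmidt T"
  obtains B :: "'a set" where "orthonormal_basis B"
  using assms by (auto simp: hilbert_schmidt_def)

lemma hs_inner_self_nonneg: "0 \<le> hs_inner T T"
  unfolding hs_inner_def by (rule infsum_nonneg) simp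

lemma hs_norm_nonneg: "0 \<le> hs_norm T"
  by (simp add: hs_norm_def hs_inner_self_nonneg)

lemma hs_norm_boundI:
  fixes T :: "'a::real_inner \<Rightarrow>\<^sub>L 'a"
  assumes B: "orthonormal_basis B" and c: "0 \<le> c"
    and le: "\<And>F. finite F \<Longrightarrow> F \<subseteq> B \<Longrightarrow> (\<Sum>e\<in>F. (norm (blinfun_apply T e))\<^sup>2) \<le> c\<^sup>2"
  shows "hilbert_schmidt T" "hs_norm T \<le> c"
proof -
  have "(\<lambda>e. (norm (blinfun_apply T e))\<^sup>2) summable_on B"
    by (intro nonneg_bdd_above_summable_on bdd_aboveI[of _ "c\<^sup>2"]) (auto intro: le)
  with B show T: "hilbert_schmidt T"
    by (auto simp: hilbert_schmidt_def)
  have "(hs_norm T)\<^sup>2 \<le> c\<^sup>2"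
    by (rule has_sum_le_finite_sums[OF hilbert_schmidt_has_sum[OF T B] le])
  then show "hs_norm T \<le> c"
    using c by (rule power2_le_imp_le)
qed

text \<open>Minkowski's inequality on finite subsets of one basis.\<close>

lemma hs_add:
  fixes S T :: "'a::real_inner \<Rightarrow>\<^sub>L 'a"
  assumes S: "hilbert_schmidt S" and T: "hilbert_schmidt T"
  shows "hilbert_schmidt (S + T)" "hs_norm (S + T) \<le> hs_norm S + hs_norm T"
proof -
  obtain B :: "'a set" where B: "orthonormal_basis B"
    using S by (rule hilbert_schmidt_basis)
  have L2: "L2_set (\<lambda>e. norm (blinfun_apply U e)) F \<le> hs_norm U"
    if "hilbert_schmidt U" "finite F" "F \<subseteq> B" for U :: "'a \<Rightarrow>\<^sub>L 'a" and F
  proof -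
    have "(\<Sum>e\<in>F. (norm (blinfun_apply U e))\<^sup>2) \<le> (hs_norm U)\<^sup>2"
      by (rule finite_sum_le_has_sum[OF hilbert_schmidt_has_sum[OF that(1) B] that(2,3)]) simp
    then show ?thesis
      by (simp add: L2_set_def real_le_lsqrt hs_norm_nonneg)
  qed
  have le: "(\<Sum>e\<in>F. (norm (blinfun_apply (S + T) e))\<^sup>2) \<le> (hs_norm S + hs_norm T)\<^sup>2"
    if F: "finite F" "F \<subseteq> B" for F
  proof -
    have "L2_set (\<lambda>e. norm (blinfun_apply (S + T) e)) F
        \<le> L2_set (\<lambda>e. norm (blinfun_apply S e) + norm (blinfun_apply T e)) F"
      by (intro L2_set_mono) (simp_all add: blinfun.add_left norm_triangle_ineq)
    also have "\<dots> \<le> hs_norm S + hs_norm T"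
      using L2[OF S F] L2[OF T F] L2_set_triangle_ineq[of _ _ F]
      by (meson add_mono order_trans)
    finally have "(L2_set (\<lambda>e. norm (blinfun_apply (S + T) e)) F)\<^sup>2 \<le> (hs_norm S + hs_norm T)\<^sup>2"
      by (intro power_mono L2_set_nonneg)
    then show ?thesis by (simp add: L2_set_def sum_nonneg)
  qed
  show "hilbert_schmidt (S + T)" "hs_norm (S + T) \<le> hs_norm S + hs_norm T"
    using hs_norm_boundI[OF B _ le] by (simp_all add: hs_norm_nonneg)
qed

lemma hs_scaleR:
  assumes "hilbert_schmidt T"
  shows "hilbert_schmidt (c *\<^sub>R T)" and "hs_norm (c *\<^sub>R T) = \<bar>c\<bar> * hs_norm T"
proof -
  show "hilbert_schmidt (c *\<^sub>R T)"
    using assms by (auto simp: hilbert_schmidt_def blinfun.scaleR_left power_mult_distrib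
        intro: summable_on_cmult_right)
  have "hs_inner (c *\<^sub>R T) (c *\<^sub>R T) = c\<^sup>2 * hs_inner T T"
    by (simp add: hs_inner_def blinfun.scaleR_left power2_eq_square mult.assoc infsum_cmult_right')
  then show "hs_norm (c *\<^sub>R T) = \<bar>c\<bar> * hs_norm T"
    by (simp add: hs_norm_def real_sqrt_mult)
qed

lemma hs_diff:
  fixes S T :: "'a::real_inner \<Rightarrow>\<^sub>L 'a"
  assumes "hilbert_schmidt S" "hilbert_schmidt T"
  shows "hilbert_schmidt (S - T)" "hs_norm (S - T) \<le> hs_norm S + hs_norm T"
  using hs_add[OF assms(1) hs_scaleR(1)[OF assms(2), of "-1"]] hs_scaleR(2)[OF assms(2), of "-1"]
  by simp_all

lemma hs_norm_minus_commute:
  fixes S T :: "'a::real_inner \<Rightarrow>\<^sub>L 'a"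
  shows "hs_norm (S - T) = hs_norm (T - S)"
  by (simp add: hs_norm_def hs_inner_def blinfun.diff_left inner_diff_left inner_diff_right
      inner_commute algebra_simps)

lemma hs_norm_triangle:
  fixes S T U :: "'a::real_inner \<Rightarrow>\<^sub>L 'a"
  assumes "hilbert_schmidt S" "hilbert_schmidt T" "hilbert_schmidt U"
  shows "hs_norm (S - U) \<le> hs_norm (S - T) + hs_norm (T - U)"
  using hs_add(2)[OF hs_diff(1)[OF assms(1,2)] hs_diff(1)[OF assms(2,3)]] by simp

lemma hilbert_schmidt_zero:
  "orthonormal_basis (B :: 'a::real_inner set) \<Longrightarrow> hilbert_schmidt (0 :: 'a \<Rightarrow>\<^sub>L 'a)"
  by (rule hs_norm_boundI[of B 0]) simp_all

lemma hilbert_schmidt_sum: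
  fixes T :: "'i \<Rightarrow> ('a::real_inner \<Rightarrow>\<^sub>L 'a)"
  assumes "orthonormal_basis (B :: 'a set)" and "\<And>i. i \<in> I \<Longrightarrow> hilbert_schmidt (T i)"
  shows "hilbert_schmidt (\<Sum>i\<in>I. T i)"
  using assms(2)
  by (induction I rule: infinite_finite_induct)
    (auto intro: hs_add(1) hilbert_schmidt_zero[OF assms(1)])

text \<open>Polarization again: the cross terms are summable because \<open>S + T\<close> and
  \<open>S - T\<close> are Hilbert-Schmidt, and the sum is expressed through their norms, which do
  not depend on the basis.\<close>

lemma hs_inner_has_sum:
  fixes S T :: "'a::real_inner \<Rightarrow>\<^sub>L 'a"
  assumes S: "hilbert_schmidt S" and T: "hilbert_schmidt T" and B: "orthonormal_basis B"
  shows "((\<lambda>e. inner (blinfun_apply S e) (blinfun_apply T e)) has_sum hs_inner S T) B"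
proof -
  have *: "((\<lambda>e. inner (blinfun_apply S e) (blinfun_apply T e)) has_sum
      ((hs_norm (S + T))\<^sup>2 - (hs_norm (S - T))\<^sup>2) * (1 / 4)) F" if F: "orthonormal_basis F" for F
  proof -
    have "((\<lambda>e. ((norm (blinfun_apply (S + T) e))\<^sup>2 - (norm (blinfun_apply (S - T) e))\<^sup>2) * (1 / 4))
        has_sum ((hs_norm (S + T))\<^sup>2 - (hs_norm (S - T))\<^sup>2) * (1 / 4)) F"
      unfolding diff_conv_add_uminus[of "(_::real)\<^sup>2"]
      by (intro has_sum_cmult_left has_sum_add has_sum_uminusI hilbert_schmidt_has_sum F
          hs_add hs_diff S T)
    moreover have "((norm (blinfun_apply (S + T) e))\<^sup>2 - (norm (blinfun_apply (S - T) e))\<^sup>2) * (1 / 4)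
        = inner (blinfun_apply S e) (blinfun_apply T e)" for e
      by (simp add: blinfun.add_left blinfun.diff_left power2_norm_eq_inner inner_add_left
          inner_add_right inner_diff_left inner_diff_right inner_commute)
    ultimately show ?thesis by simp
  qed
  have "orthonormal_basis (SOME F :: 'a set. orthonormal_basis F)"
    using B by (rule someI)
  then have "hs_inner S T = ((hs_norm (S + T))\<^sup>2 - (hs_norm (S - T))\<^sup>2) * (1 / 4)"
    unfolding hs_inner_def by (rule infsumI[OF *])
  then show ?thesis
    using *[OF B] by (simp only:)
qed

lemma hs_inner_commute: "hs_inner S T = hs_inner T S"
  by (simp add: hs_inner_def inner_commute)

lemma hs_inner_scaleR_left: "hs_inner (c *\<^sub>R S) T = c * hs_inner S T"
  by (simp add: hs_inner_def blinfun.scaleR_left infsum_cmult_right')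

lemma hs_inner_add_left:
  fixes S T U :: "'a::real_inner \<Rightarrow>\<^sub>L 'a"
  assumes "hilbert_schmidt S" "hilbert_schmidt T" "hilbert_schmidt U"
  shows "hs_inner (S + T) U = hs_inner S U + hs_inner T U"
proof -
  obtain B :: "'a set" where B: "orthonormal_basis B"
    using assms(1) by (rule hilbert_schmidt_basis)
  show ?thesis
    by (rule has_sum_unique[OF hs_inner_has_sum[OF hs_add(1)[OF assms(1,2)] assms(3) B]])
      (simp add: blinfun.add_left inner_add_left has_sum_add hs_inner_has_sum assms B)
qed

lemma hs_inner_sum_left:
  fixes T :: "'i \<Rightarrow> ('a::real_inner \<Rightarrow>\<^sub>L 'a)"
  assumes "\<And>i. i \<in> I \<Longrightarrow> hilbert_schmidt (T i)" and U: "hilbert_schmidt U"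
  shows "hs_inner (\<Sum>i\<in>I. a i *\<^sub>R T i) U = (\<Sum>i\<in>I. a i * hs_inner (T i) U)"
proof -
  obtain B :: "'a set" where B: "orthonormal_basis B"
    using U by (rule hilbert_schmidt_basis)
  show ?thesis
    using assms(1)
  proof (induction I rule: infinite_finite_induct)
    case (insert i I)
    then have "hs_inner (a i *\<^sub>R T i + (\<Sum>i\<in>I. a i *\<^sub>R T i)) U
        = hs_inner (a i *\<^sub>R T i) U + hs_inner (\<Sum>i\<in>I. a i *\<^sub>R T i) U"
      by (intro hs_inner_add_left hs_scaleR hilbert_schmidt_sum[OF B] U) auto
    with insert show ?case by (simp add: hs_inner_scaleR_left)
  qed (simp_all add: hs_inner_def)
qed

text \<open>The common squared norm \<open>s\<close> will be 1 for the terms of a separable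
  expansion, and the squared pixel area for rank-one operators between pixel indicators.\<close>

lemma hs_norm_sum_orthogonal:
  fixes T :: "'i \<Rightarrow> ('a::real_inner \<Rightarrow>\<^sub>L 'a)"
  assumes I: "finite I" and T: "\<And>i. i \<in> I \<Longrightarrow> hilbert_schmidt (T i)"
    and orth: "\<And>i j. i \<in> I \<Longrightarrow> j \<in> I \<Longrightarrow> hs_inner (T i) (T j) = (if i = j then s else 0)"
    and B: "orthonormal_basis (B :: 'a set)"
  shows "hs_norm (\<Sum>i\<in>I. a i *\<^sub>R T i) = sqrt s * L2_set a I"
proof -
  have hs: "hilbert_schmidt (\<Sum>i\<in>I. a i *\<^sub>R T i)"
    by (intro hilbert_schmidt_sum[OF B] hs_scaleR T)
  have "hs_inner (T i) (\<Sum>j\<in>I. a j *\<^sub>R T j) = s * a i" if i: "i \<in> I" for i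
  proof -
    have "hs_inner (T i) (\<Sum>j\<in>I. a j *\<^sub>R T j) = (\<Sum>j\<in>I. a j * hs_inner (T j) (T i))"
      by (subst hs_inner_commute) (intro hs_inner_sum_left T i)
    also have "\<dots> = (\<Sum>j\<in>I. if j = i then s * a j else 0)"
      by (intro sum.cong) (auto simp: orth i)
    finally show ?thesis using I i by simp
  qed
  then have "hs_inner (\<Sum>i\<in>I. a i *\<^sub>R T i) (\<Sum>i\<in>I. a i *\<^sub>R T i) = (\<Sum>i\<in>I. a i * (s * a i))"
    using T by (subst hs_inner_sum_left[OF _ hs]) auto
  also have "\<dots> = s * (\<Sum>i\<in>I. (a i)\<^sup>2)"
    by (simp add: sum_distrib_left power2_eq_square ac_simps)
  finally show ?thesis
    by (simp add: hs_norm_def L2_set_def real_sqrt_mult)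
qed

lemma rank_one_apply: "blinfun_apply (rank_one u v) f = inner v f *\<^sub>R u"
proof -
  have "bounded_linear (\<lambda>f. inner v f *\<^sub>R u)"
    by (intro bounded_linear_intros)
  then show ?thesis
    unfolding rank_one_def by (simp add: bounded_linear_Blinfun_apply)
qed

lemma rank_one_hilbert_schmidt:
  fixes u v :: "'a::real_inner"
  assumes B: "orthonormal_basis (B :: 'a set)"
  shows "hilbert_schmidt (rank_one u v)"
proof (rule hs_norm_boundI[OF B])
  fix F assume "finite F" "F \<subseteq> B"
  have "(\<Sum>e\<in>F. (norm (blinfun_apply (rank_one u v) e))\<^sup>2) = (\<Sum>e\<in>F. (inner v e)\<^sup>2) * (norm u)\<^sup>2"
    by (simp add: rank_one_apply power_mult_distrib sum_distrib_right)
  also have "\<dots> \<le> (norm v)\<^sup>2 * (norm u)\<^sup>2"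
    by (intro mult_right_mono bessel_inequality[OF B] zero_le_power2) fact+
  finally show "(\<Sum>e\<in>F. (norm (blinfun_apply (rank_one u v) e))\<^sup>2) \<le> (norm v * norm u)\<^sup>2"
    by (simp add: power_mult_distrib)
qed simp

text \<open>The factor \<open>inner u u'\<close> is constant along the basis; what remains is
  Parseval for \<open>v\<close> and \<open>v'\<close>.\<close>

lemma hs_inner_rank_one:
  fixes u v u' v' :: "'a::real_inner"
  assumes B: "orthonormal_basis (B :: 'a set)"
  shows "hs_inner (rank_one u v) (rank_one u' v') = inner u u' * inner v v'"
proof -
  have "((\<lambda>e. inner u u' * (inner v e * inner v' e)) has_sum inner u u' * inner v v') B"
    by (intro has_sum_cmult_right parseval_inner B)
  moreover have "((\<lambda>e. inner u u' * (inner v e * inner v' e)) has_sum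
      hs_inner (rank_one u v) (rank_one u' v')) B"
    using hs_inner_has_sum[OF rank_one_hilbert_schmidt[OF B] rank_one_hilbert_schmidt[OF B] B,
        of u v u' v'] by (simp add: rank_one_apply ac_simps)
  ultimately show ?thesis
    by (rule has_sum_unique[symmetric])
qed

section \<open>Tensor products\<close>

lemma cbox_unit_prod:
  "cbox (0 :: 'a::euclidean_space \<times> 'b::euclidean_space) One = cbox 0 One \<times> cbox 0 One"
proof -
  have "(One :: 'a \<times> 'b) = (One, One)"
    by (simp add: sum_Basis_prod_eq prod_eq_iff fst_sum snd_sum)
  then show ?thesis by (simp add: zero_prod_def cbox_Pair_eq)
qed

text \<open>Makes Fubini available on the unit square. Both sigma-algebras are traces on cubes and
  are compared by two inclusions; on rectangles the measures agree because \<open>lborel\<close> is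
  a product measure.\<close>

lemma cube_measure_prod:
  "cube_measure \<Otimes>\<^sub>M cube_measure = (cube_measure :: ('a::euclidean_space \<times> 'b::euclidean_space) measure)"
proof (rule pair_measure_eqI)
  show "sigma_finite_measure (cube_measure :: 'a measure)" "sigma_finite_measure (cube_measure :: 'b measure)"
    by (intro sigma_finite_measure_restrict_space sigma_finite_lborel; simp)+
  have c: "cbox (0 :: 'a \<times> 'b) One = cbox 0 One \<times> cbox 0 One"
    by (rule cbox_unit_prod)
  \<comment> \<open>Measurability of the identity says that Borel sets of the product space, cut
    down to the cube, lie in the product sigma-algebra.\<close>
  have id: "(\<lambda>p. p) \<in> (cube_measure :: 'a measure) \<Otimes>\<^sub>M (cube_measure :: 'b measure) \<rightarrow>\<^sub>M borel"
  proof -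
    have "(\<lambda>x. x) \<in> cube_measure \<rightarrow>\<^sub>M (borel :: 'a measure)" "(\<lambda>x. x) \<in> cube_measure \<rightarrow>\<^sub>M (borel :: 'b measure)"
      by (auto intro: measurable_restrict_space1)
    then have "(\<lambda>p. (fst p, snd p)) \<in> (cube_measure :: 'a measure) \<Otimes>\<^sub>M (cube_measure :: 'b measure) \<rightarrow>\<^sub>M borel \<Otimes>\<^sub>M borel"
      by (intro measurable_Pair measurable_compose[OF measurable_fst] measurable_compose[OF measurable_snd])
    then show ?thesis by (simp add: borel_prod)
  qed
  show "sets ((cube_measure :: 'a measure) \<Otimes>\<^sub>M (cube_measure :: 'b measure)) = sets cube_measure"
  proof (intro subset_antisym subsetI)
    fix A assume "A \<in> sets (cube_measure :: ('a \<times> 'b) measure)"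
    then obtain D where D: "D \<in> sets borel" "A = cbox 0 One \<inter> D"
      by (auto simp: sets_restrict_space)
    from measurable_sets[OF id D(1)] show "A \<in> sets ((cube_measure :: 'a measure) \<Otimes>\<^sub>M (cube_measure :: 'b measure))"
      by (simp add: D(2) c space_pair_measure space_restrict_space Int_commute)
  next
    fix A assume "A \<in> sets ((cube_measure :: 'a measure) \<Otimes>\<^sub>M (cube_measure :: 'b measure))"
    then show "A \<in> sets (cube_measure :: ('a \<times> 'b) measure)"
      unfolding sets_pair_measure
    proof (induction rule: sigma_sets.induct)
      case (Basic A)
      then obtain D E where "D \<in> sets borel" "E \<in> sets borel"
        and A: "A = (cbox 0 One \<inter> D) \<times> (cbox 0 One \<inter> E)"
        by (auto simp: sets_restrict_space)
      then have "D \<times> E \<in> sets borel" by (intro borel_Times)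
      moreover have "A = cbox 0 One \<inter> (D \<times> E)" unfolding A c by auto
      ultimately show ?case by (auto simp: sets_restrict_space)
    next
      case (Compl A)
      have "space (cube_measure :: 'a measure) \<times> space (cube_measure :: 'b measure)
          = space (cube_measure :: ('a \<times> 'b) measure)"
        by (simp add: space_restrict_space c)
      then show ?case
        using sets.compl_sets[OF Compl(2)] by metis
    qed auto
  qed
  fix A B assume "A \<in> sets (cube_measure :: 'a measure)" "B \<in> sets (cube_measure :: 'b measure)"
  then have AB: "A \<subseteq> cbox 0 One" "B \<subseteq> cbox 0 One" "A \<in> sets lborel" "B \<in> sets lborel"
    by (auto simp: sets_restrict_space)
  have "emeasure (cube_measure :: ('a \<times> 'b) measure) (A \<times> B) = emeasure (lborel \<Otimes>\<^sub>M lborel) (A \<times> B)"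
    unfolding lborel_prod using AB(1,2) by (intro emeasure_restrict_space) (simp, unfold c, blast)
  also have "\<dots> = emeasure lborel A * emeasure lborel B"
    using AB by (intro lborel.emeasure_pair_measure_Times) auto
  finally show "emeasure cube_measure A * emeasure cube_measure B
      = emeasure (cube_measure :: ('a \<times> 'b) measure) (A \<times> B)"
    using AB by (simp add: emeasure_restrict_space)
qed

interpretation cube: finite_measure "cube_measure :: 'a::euclidean_space measure"
  by (rule finite_measure_cube)

interpretation cube_pair: pair_sigma_finite
  "cube_measure :: 'a::euclidean_space measure" "cube_measure :: 'b::euclidean_space measure" ..

lemma integrable_product_mult:
  fixes f :: "'a::euclidean_space \<Rightarrow> real" and g :: "'b::euclidean_space \<Rightarrow> real"
  assumes f: "integrable cube_measure f" and g: "integrable cube_measure g"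
  shows "integrable cube_measure (\<lambda>(t, s). f t * g s)"
    and "integral\<^sup>L cube_measure (\<lambda>(t, s). f t * g s) = integral\<^sup>L cube_measure f * integral\<^sup>L cube_measure g"
proof -
  note [measurable] = borel_measurable_integrable[OF f] borel_measurable_integrable[OF g]
  have *: "integrable (cube_measure \<Otimes>\<^sub>M cube_measure) (\<lambda>(t, s). f t * g s)"
    by (rule cube_pair.Fubini_integrable) (use f g in \<open>auto simp: abs_mult\<close>)
  then show "integrable cube_measure (\<lambda>(t, s). f t * g s)"
    by (simp only: cube_measure_prod)
  show "integral\<^sup>L cube_measure (\<lambda>(t, s). f t * g s) = integral\<^sup>L cube_measure f * integral\<^sup>L cube_measure g"
    using cube_pair.integral_fst[OF *] by (simp add: cube_measure_prod)
qed

lemma square_integrable_tensor: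
  fixes f :: "'a::euclidean_space \<Rightarrow> real" and g :: "'b::euclidean_space \<Rightarrow> real"
  assumes f: "f \<in> square_integrable" and g: "g \<in> square_integrable"
  shows "(\<lambda>(t, s). f t * g s) \<in> square_integrable"
proof (rule square_integrableI)
  note [measurable] = square_integrable_measurable[OF f] square_integrable_measurable[OF g]
  show "(\<lambda>(t, s). f t * g s) \<in> borel_measurable cube_measure"
    unfolding cube_measure_prod[symmetric] by measurable
  show "integrable cube_measure (\<lambda>p. (case p of (t, s) \<Rightarrow> f t * g s)\<^sup>2)"
    using integrable_product_mult(1)[OF square_integrable_integrable[OF f] square_integrable_integrable[OF g]]
    by (simp add: case_prod_unfold power_mult_distrib)
qed

lemma inner_abs_L2:
  assumes "f \<in> square_integrable" "g \<in> square_integrable"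
  shows "inner (abs_L2 f) (abs_L2 g) = integral\<^sup>L cube_measure (\<lambda>p. f p * g p)"
  using assms by (intro inner_L2.abs_eq) (simp_all add: L2_rel_refl_iff)

lemma inner_abs_L2_right:
  "f \<in> square_integrable \<Longrightarrow> inner x (abs_L2 f) = integral\<^sup>L cube_measure (\<lambda>p. rep_L2 x p * f p)"
  using inner_abs_L2[OF rep_L2_square_integrable, of f x] by (simp add: abs_rep_L2)

lemma inner_tensor_abs_L2:
  assumes f: "f \<in> square_integrable" and g: "g \<in> square_integrable"
  shows "inner (tensor x y) (abs_L2 (\<lambda>(t, s). f t * g s)) = inner x (abs_L2 f) * inner y (abs_L2 g)"
proof -
  have "inner (tensor x y) (abs_L2 (\<lambda>(t, s). f t * g s))
      = integral\<^sup>L cube_measure (\<lambda>(t, s). (rep_L2 x t * f t) * (rep_L2 y s * g s))"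
    unfolding tensor_def
    using inner_abs_L2[OF square_integrable_tensor square_integrable_tensor,
        OF rep_L2_square_integrable rep_L2_square_integrable f g, of x y]
    by (simp add: case_prod_unfold ac_simps)
  also have "\<dots> = inner x (abs_L2 f) * inner y (abs_L2 g)"
    unfolding inner_abs_L2_right[OF f] inner_abs_L2_right[OF g]
    by (intro integrable_product_mult(2) square_integrable_mult rep_L2_square_integrable f g)
  finally show ?thesis .
qed

lemma inner_tensor: "inner (tensor x y) (tensor x' y') = inner x x' * inner y y'"
  using inner_tensor_abs_L2[OF rep_L2_square_integrable rep_L2_square_integrable, of x y x' y']
  by (simp add: abs_rep_L2 flip: tensor_def)

lemma norm_tensor: "norm (tensor x y) = norm x * norm y"
  by (simp add: norm_eq_sqrt_inner inner_tensor real_sqrt_mult)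

text \<open>Follows by expanding the squared norm of \<open>z - tensor x y\<close>. Identities
  between tensors thereby become inner-product computations in which null sets of representatives do
  not appear.\<close>

lemma tensor_eqI:
  assumes "inner z z = inner (tensor x y) z" "inner (tensor x y) z = inner x x * inner y y"
  shows "z = tensor x y"
proof -
  have "inner (z - tensor x y) (z - tensor x y) = 0"
    using assms by (simp add: inner_diff_left inner_diff_right inner_commute inner_tensor)
  then show ?thesis by simp
qed

lemma bounded_bilinear_tensor: "bounded_bilinear tensor"
proof
  fix x x' y y' :: "real L2" and r :: real
  show "tensor (x + x') y = tensor x y + tensor x' y"
    by (rule tensor_eqI[symmetric])
      (simp_all add: inner_add_left inner_add_right inner_tensor algebra_simps)
  show "tensor x (y + y') = tensor x y + tensor x y'"
    by (rule tensor_eqI[symmetric])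
      (simp_all add: inner_add_left inner_add_right inner_tensor algebra_simps)
  show "tensor (r *\<^sub>R x) y = r *\<^sub>R tensor x y"
    by (rule tensor_eqI[symmetric]) (simp_all add: inner_tensor algebra_simps)
  show "tensor x (r *\<^sub>R y) = r *\<^sub>R tensor x y"
    by (rule tensor_eqI[symmetric]) (simp_all add: inner_tensor algebra_simps)
  show "\<exists>K. \<forall>x y. norm (tensor x y) \<le> norm x * norm y * K"
    by (rule exI[of _ 1]) (simp add: norm_tensor)
qed

interpretation tensor: bounded_bilinear tensor
  by (rule bounded_bilinear_tensor)

text \<open>Allows arbitrary representatives, whereas \<open>tensor\<close> is defined with the
  chosen ones.\<close>

lemma tensor_abs_L2:
  assumes f: "f \<in> square_integrable" and g: "g \<in> square_integrable"
  shows "tensor (abs_L2 f) (abs_L2 g) = abs_L2 (\<lambda>(t, s). f t * g s)"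
proof (rule tensor_eqI[symmetric])
  have "inner (abs_L2 (\<lambda>(t, s). f t * g s)) (abs_L2 (\<lambda>(t, s). f t * g s))
      = integral\<^sup>L cube_measure (\<lambda>(t, s). (f t * f t) * (g s * g s))"
    using inner_abs_L2[OF square_integrable_tensor square_integrable_tensor, OF f g f g]
    by (simp add: case_prod_unfold ac_simps)
  also have "\<dots> = inner (abs_L2 f) (abs_L2 f) * inner (abs_L2 g) (abs_L2 g)"
    unfolding inner_abs_L2[OF f f] inner_abs_L2[OF g g]
    by (intro integrable_product_mult(2) square_integrable_mult f g)
  finally show "inner (abs_L2 (\<lambda>(t, s). f t * g s)) (abs_L2 (\<lambda>(t, s). f t * g s))
      = inner (tensor (abs_L2 f) (abs_L2 g)) (abs_L2 (\<lambda>(t, s). f t * g s))"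
    by (simp add: inner_tensor_abs_L2 f g)
  show "inner (tensor (abs_L2 f) (abs_L2 g)) (abs_L2 (\<lambda>(t, s). f t * g s))
      = inner (abs_L2 f) (abs_L2 f) * inner (abs_L2 g) (abs_L2 g)"
    by (rule inner_tensor_abs_L2[OF f g])
qed

lemma tensor_indicator:
  assumes "A \<in> sets borel" "B \<in> sets borel"
  shows "tensor (abs_L2 (indicator A)) (abs_L2 (indicator B)) = abs_L2 (indicator (A \<times> B))"
proof -
  have "(indicator (A \<times> B) :: real \<times> real \<Rightarrow> real) = (\<lambda>(t, s). indicator A t * indicator B s)"
    by (auto simp: indicator_def)
  then show ?thesis
    using assms by (simp add: tensor_abs_L2 square_integrable_indicator)
qed

text \<open>Density comes in two passes. The closed span \<open>V\<close> contains every
  \<open>tensor e y\<close>, because this condition on \<open>y\<close> is linear and closed and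
  holds on \<open>F\<close>; the same argument in the first factor gives every
  \<open>tensor x y\<close>. Among these are the indicators of measurable rectangles, which generate
  the Borel sets of the plane.\<close>

lemma orthonormal_basis_tensor:
  assumes E: "orthonormal_basis E" and F: "orthonormal_basis F"
  shows "orthonormal_basis ((\<lambda>(e, f). tensor e f) ` (E \<times> F))"
proof -
  let ?B = "(\<lambda>(e, f). tensor e f) ` (E \<times> F)"
  define V where "V = closure (span ?B)"
  have V: "subspace V" "closed V"
    unfolding V_def by (auto intro: subspace_closure_normed)
  have EF: "tensor e f \<in> V" if "e \<in> E" "f \<in> F" for e f
    unfolding V_def using that by (intro closure_subset[THEN subsetD] span_base) auto
  have pre: "subspace {y. h y \<in> V}" "closed {y. h y \<in> V}"
    if h: "bounded_linear h" for h :: "real L2 \<Rightarrow> (real \<times> real) L2"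
  proof -
    interpret h: bounded_linear h by fact
    show "subspace {y. h y \<in> V}"
      using V(1) by (intro subspaceI) (auto simp: h.add h.scaleR h.zero subspace_0 subspace_add subspace_scale)
    show "closed {y. h y \<in> V}"
      using closed_vimage[OF V(2), of h] h.continuous_on[OF continuous_on_id]
      by (auto simp: vimage_def)
  qed
  have 1: "tensor e y \<in> V" if "e \<in> E" for e y
  proof -
    have "{y. tensor e y \<in> V} = UNIV"
      using pre[OF tensor.bounded_linear_right] EF[OF that]
      by (intro orthonormal_basis_closed_subspace_UNIV[OF F]) auto
    then show ?thesis by auto
  qed
  have 2: "tensor x y \<in> V" for x y
  proof -
    have "{x. tensor x y \<in> V} = UNIV"
      using pre[OF tensor.bounded_linear_left] 1
      by (intro orthonormal_basis_closed_subspace_UNIV[OF E]) auto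
    then show ?thesis by auto
  qed
  define G :: "(real \<times> real) set set" where "G = {A \<times> B |A B. A \<in> sets borel \<and> B \<in> sets borel}"
  have "V = UNIV"
  proof (rule L2_dense_subspace[OF V, where G = G])
    show "Int_stable G"
      unfolding G_def by (rule Int_stable_pair_measure_generator)
    have "sets (sigma UNIV G) = sets (borel \<Otimes>\<^sub>M (borel :: real measure))"
      unfolding sets_pair_measure G_def by simp
    then show "sigma UNIV G = (borel :: (real \<times> real) measure)"
      unfolding borel_prod
      by (rule measure_eqI) (simp only: borel_def emeasure_sigma)
    have "UNIV \<times> UNIV \<in> G"
      unfolding G_def by (rule CollectI, intro exI conjI, rule refl) simp_all
    then show "UNIV \<in> G" by (simp only: UNIV_Times_UNIV)
    show "abs_L2 (indicator D) \<in> V" if D: "D \<in> G" for D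
    proof -
      obtain A B where "D = A \<times> B" "A \<in> sets borel" "B \<in> sets borel"
        using D unfolding G_def by blast
      with 2[of "abs_L2 (indicator A)" "abs_L2 (indicator B)"] show ?thesis
        by (simp only: tensor_indicator)
    qed
  qed
  moreover have "pairwise orthogonal ?B"
    by (auto simp: pairwise_def orthogonal_def inner_tensor orthonormal_basis_inner[OF E]
        orthonormal_basis_inner[OF F])
  moreover have "\<forall>b\<in>?B. norm b = 1"
    using E F by (auto simp: norm_tensor orthonormal_basis_def)
  ultimately show ?thesis
    by (simp add: orthonormal_basis_def V_def)
qed

text \<open>The tensor basis is a set, the image of a product, while values and sums are indexed by
  pairs; injectivity translates between the two.\<close>

lemma inj_on_tensor:
  assumes E: "orthonormal_basis E" and F: "orthonormal_basis F"
  shows "inj_on (\<lambda>(e, f). tensor e f) (E \<times> F)"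
proof (rule inj_onI, clarsimp)
  fix e f e' f' assume *: "e \<in> E" "f \<in> F" "e' \<in> E" "f' \<in> F" "tensor e f = tensor e' f'"
  have "inner (tensor e f) (tensor e' f') = 1"
    using *(1,2) unfolding *(5)[symmetric] inner_tensor by (simp add: orthonormal_basis_inner[OF E] orthonormal_basis_inner[OF F])
  then have "(if e = e' then 1 else 0) * (if f = f' then 1 else 0) = (1 :: real)"
    using *(1-4) unfolding inner_tensor by (simp add: orthonormal_basis_inner[OF E] orthonormal_basis_inner[OF F])
  then show "e = e' \<and> f = f'"
    by (auto split: if_splits)
qed

lemma has_sum_mult_nonneg:
  fixes f :: "'a \<Rightarrow> real" and g :: "'b \<Rightarrow> real"
  assumes f: "(f has_sum a) A" "\<And>x. x \<in> A \<Longrightarrow> 0 \<le> f x" and g: "(g has_sum b) B" "\<And>y. y \<in> B \<Longrightarrow> 0 \<le> g y"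
  shows "((\<lambda>(x, y). f x * g y) has_sum a * b) (A \<times> B)"
proof (rule has_sum_SigmaI)
  show *: "((\<lambda>y. case (x, y) of (x, y) \<Rightarrow> f x * g y) has_sum f x * b) B" for x
    using has_sum_cmult_right[OF g(1)] by simp
  show **: "((\<lambda>x. f x * b) has_sum a * b) A"
    by (rule has_sum_cmult_left[OF f(1)])
  show "(\<lambda>(x, y). f x * g y) summable_on A \<times> B"
    using f(2) g(2) by (intro summable_on_SigmaI[where g = "\<lambda>x. f x * b", OF *] has_sum_imp_summable[OF **]) auto
qed

text \<open>Justifies the description in \<open>op_tensor\<close>. For existence the values are
  prescribed on a tensor basis, where their squared norms factor and sum to the product of the
  squared Hilbert-Schmidt norms. For uniqueness, two such operators agree on that basis.\<close>

lemma op_tensor_ex1: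
  fixes A B :: "real L2 \<Rightarrow>\<^sub>L real L2"
  assumes A: "hilbert_schmidt A" and B: "hilbert_schmidt B"
  shows "\<exists>!T. hilbert_schmidt T \<and>
    (\<forall>x y. blinfun_apply T (tensor x y) = tensor (blinfun_apply A x) (blinfun_apply B y))"
proof -
  obtain E :: "real L2 set" where E: "orthonormal_basis E"
    using A by (rule hilbert_schmidt_basis)
  let ?t = "\<lambda>(e, f). tensor e f :: (real \<times> real) L2" and ?B = "(\<lambda>(e, f). tensor e f) ` (E \<times> E)"
  define v where "v z = (case inv_into (E \<times> E) ?t z of (e, f) \<Rightarrow> tensor (blinfun_apply A e) (blinfun_apply B f))" for z
  have v: "v (tensor e f) = tensor (blinfun_apply A e) (blinfun_apply B f)" if "e \<in> E" "f \<in> E" for e f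
    using inv_into_f_f[OF inj_on_tensor[OF E E], of "(e, f)"] that by (simp add: v_def)
  have "((\<lambda>(e, f). (norm (blinfun_apply A e))\<^sup>2 * (norm (blinfun_apply B f))\<^sup>2) has_sum
      (hs_norm A)\<^sup>2 * (hs_norm B)\<^sup>2) (E \<times> E)"
    by (intro has_sum_mult_nonneg hilbert_schmidt_has_sum A B E) auto
  also have "?this \<longleftrightarrow> ((\<lambda>z. (norm (v z))\<^sup>2) has_sum (hs_norm A)\<^sup>2 * (hs_norm B)\<^sup>2) ?B"
    by (subst has_sum_reindex[OF inj_on_tensor[OF E E]])
      (auto simp: v norm_tensor power_mult_distrib intro!: has_sum_cong)
  finally have sum: "(\<lambda>z. (norm (v z))\<^sup>2) summable_on ?B"
    by (rule has_sum_imp_summable)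
  obtain T :: "(real \<times> real) L2 \<Rightarrow>\<^sub>L (real \<times> real) L2" where T: "\<And>z. z \<in> ?B \<Longrightarrow> blinfun_apply T z = v z"
    using orthonormal_basis_extension[OF orthonormal_basis_tensor[OF E E] sum] by blast
  have hs: "hilbert_schmidt T"
    using orthonormal_basis_tensor[OF E E] sum T
    by (auto simp: hilbert_schmidt_def cong: summable_on_cong intro!: exI[of _ ?B])
  have bl: "bounded_linear (\<lambda>x. blinfun_apply T (tensor x y))" "bounded_linear (\<lambda>y. blinfun_apply T (tensor x y))"
    "bounded_linear (\<lambda>x. tensor (blinfun_apply A x) z)" "bounded_linear (\<lambda>y. tensor z (blinfun_apply B y))" for x y z
    by (rule bounded_linear_compose[OF blinfun.bounded_linear_right tensor.bounded_linear_left],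
        rule bounded_linear_compose[OF blinfun.bounded_linear_right tensor.bounded_linear_right],
        rule bounded_linear_compose[OF tensor.bounded_linear_left blinfun.bounded_linear_right],
        rule bounded_linear_compose[OF tensor.bounded_linear_right blinfun.bounded_linear_right])
  have T_basis: "blinfun_apply T (tensor e f) = tensor (blinfun_apply A e) (blinfun_apply B f)"
    if ef: "e \<in> E" "f \<in> E" for e f
    using T[of "tensor e f"] v[OF ef] ef by force
  \<comment> \<open>The identity spreads from pairs of basis vectors to all tensors one argument at
    a time, both sides being bounded linear in each argument.\<close>
  have 1: "blinfun_apply T (tensor e y) = tensor (blinfun_apply A e) (blinfun_apply B y)" if e: "e \<in> E" for e y
  proof -
    have "(\<lambda>y. blinfun_apply T (tensor e y)) = (\<lambda>y. tensor (blinfun_apply A e) (blinfun_apply B y))"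
      by (rule orthonormal_basis_bounded_linear_eqI[OF E bl(2) bl(4)]) (rule T_basis[OF e])
    then show ?thesis by (rule fun_cong)
  qed
  have 2: "blinfun_apply T (tensor x y) = tensor (blinfun_apply A x) (blinfun_apply B y)" for x y
  proof -
    have "(\<lambda>x. blinfun_apply T (tensor x y)) = (\<lambda>x. tensor (blinfun_apply A x) (blinfun_apply B y))"
      by (rule orthonormal_basis_bounded_linear_eqI[OF E bl(1) bl(3)]) (use 1 in auto)
    then show ?thesis by (rule fun_cong)
  qed
  show ?thesis
  proof (rule ex1I[of _ T])
    fix T' assume "hilbert_schmidt T' \<and> (\<forall>x y. blinfun_apply T' (tensor x y) = tensor (blinfun_apply A x) (blinfun_apply B y))"
    then have "blinfun_apply T' = blinfun_apply T"
      by (intro orthonormal_basis_bounded_linear_eqI[OF orthonormal_basis_tensor[OF E E]]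
          blinfun.bounded_linear_right) (auto simp: 2)
    then show "T' = T" by (simp add: blinfun_apply_inject)
  qed (use hs 2 in auto)
qed

lemma
  assumes "hilbert_schmidt A" "hilbert_schmidt B"
  shows hilbert_schmidt_op_tensor: "hilbert_schmidt (op_tensor A B)"
    and op_tensor_tensor: "blinfun_apply (op_tensor A B) (tensor x y) = tensor (blinfun_apply A x) (blinfun_apply B y)"
  using theI'[OF op_tensor_ex1[OF assms]] unfolding op_tensor_def[symmetric] by blast+

text \<open>Over a tensor basis the terms factor. The sum over pairs is known to converge, so it may
  be evaluated over \<open>f\<close> for fixed \<open>e\<close> and then over
  \<open>e\<close>.\<close>

lemma hs_inner_op_tensor:
  assumes hs: "hilbert_schmidt A" "hilbert_schmidt B" "hilbert_schmidt A'" "hilbert_schmidt B'"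
  shows "hs_inner (op_tensor A B) (op_tensor A' B') = hs_inner A A' * hs_inner B B'"
proof -
  obtain E :: "real L2 set" where E: "orthonormal_basis E"
    using hs(1) by (rule hilbert_schmidt_basis)
  let ?t = "\<lambda>(e, f). tensor e f :: (real \<times> real) L2" and ?B = "(\<lambda>(e, f). tensor e f) ` (E \<times> E)"
  have "((\<lambda>z. inner (blinfun_apply (op_tensor A B) z) (blinfun_apply (op_tensor A' B') z)) has_sum
      hs_inner (op_tensor A B) (op_tensor A' B')) ?B"
    by (intro hs_inner_has_sum hilbert_schmidt_op_tensor hs orthonormal_basis_tensor E)
  then have "((\<lambda>(e, f). inner (blinfun_apply A e) (blinfun_apply A' e) * inner (blinfun_apply B f) (blinfun_apply B' f)) has_sum
      hs_inner (op_tensor A B) (op_tensor A' B')) (E \<times> E)"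
    unfolding has_sum_reindex[OF inj_on_tensor[OF E E]]
    by (simp add: o_def case_prod_unfold op_tensor_tensor hs inner_tensor)
  then have "((\<lambda>e. inner (blinfun_apply A e) (blinfun_apply A' e) * hs_inner B B') has_sum
      hs_inner (op_tensor A B) (op_tensor A' B')) E"
    by (rule has_sum_SigmaD) (auto intro!: has_sum_cmult_right hs_inner_has_sum hs E)
  moreover have "((\<lambda>e. inner (blinfun_apply A e) (blinfun_apply A' e) * hs_inner B B') has_sum
      hs_inner A A' * hs_inner B B') E"
    by (intro has_sum_cmult_left hs_inner_has_sum hs E)
  ultimately show ?thesis by (rule has_sum_unique)
qed

section \<open>Best separable approximations\<close>

context
  fixes C :: "(real \<times> real) L2 \<Rightarrow>\<^sub>L (real \<times> real) L2"
    and \<sigma> :: "nat \<Rightarrow> real" and A B :: "nat \<Rightarrow> (real L2 \<Rightarrow>\<^sub>L real L2)"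
  assumes expansion: "separable_expansion C \<sigma> A B"
begin

definition truncation :: "nat \<Rightarrow> ((real \<times> real) L2 \<Rightarrow>\<^sub>L (real \<times> real) L2)"
  where "truncation n = (\<Sum>j=1..n. \<sigma> j *\<^sub>R op_tensor (A j) (B j))"

lemma expansion_hilbert_schmidt: "hilbert_schmidt C"
  using expansion by (simp add: separable_expansion_def)

lemma scores_nonneg: "1 \<le> j \<Longrightarrow> 0 \<le> \<sigma> j"
  using expansion by (simp add: separable_expansion_def)

lemma expansion_basis: obtains E :: "(real \<times> real) L2 set" where "orthonormal_basis E"
  using expansion_hilbert_schmidt by (rule hilbert_schmidt_basis)

lemma hilbert_schmidt_factors: "1 \<le> j \<Longrightarrow> hilbert_schmidt (A j)" "1 \<le> j \<Longrightarrow> hilbert_schmidt (B j)"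
  using expansion by (auto simp: separable_expansion_def hs_orthonormal_def)

text \<open>The operators \<open>op_tensor (A j) (B j)\<close> are orthonormal, since their inner
  products are products of those of the factors.\<close>

lemma hs_norm_expansion_sum:
  assumes "finite J" "J \<subseteq> {1..}"
  shows "hilbert_schmidt (\<Sum>j\<in>J. a j *\<^sub>R op_tensor (A j) (B j))"
    and "hs_norm (\<Sum>j\<in>J. a j *\<^sub>R op_tensor (A j) (B j)) = L2_set a J"
proof -
  obtain E :: "(real \<times> real) L2 set" where E: "orthonormal_basis E" by (rule expansion_basis)
  have hs: "hilbert_schmidt (op_tensor (A j) (B j))" if "j \<in> J" for j
    using assms that by (intro hilbert_schmidt_op_tensor hilbert_schmidt_factors) auto
  then show "hilbert_schmidt (\<Sum>j\<in>J. a j *\<^sub>R op_tensor (A j) (B j))"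
    by (intro hilbert_schmidt_sum[OF E] hs_scaleR)
  have "hs_inner (op_tensor (A i) (B i)) (op_tensor (A j) (B j)) = (if i = j then 1 else 0)"
    if "i \<in> J" "j \<in> J" for i j
  proof -
    have "1 \<le> i" "1 \<le> j" using assms that by auto
    then show ?thesis
      using expansion
      by (auto simp: hs_inner_op_tensor hilbert_schmidt_factors separable_expansion_def hs_orthonormal_def)
  qed
  from hs_norm_sum_orthogonal[OF assms(1) hs this E, of a]
  show "hs_norm (\<Sum>j\<in>J. a j *\<^sub>R op_tensor (A j) (B j)) = L2_set a J"
    by simp
qed

lemma hilbert_schmidt_truncation: "hilbert_schmidt (truncation n)"
  and hs_norm_truncation: "hs_norm (truncation n) = L2_set \<sigma> {1..n}"
  using hs_norm_expansion_sum[of "{1..n}" \<sigma>] by (auto simp: truncation_def)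

lemma truncation_tendsto: "(\<lambda>n. hs_norm (C - truncation n)) \<longlonglongrightarrow> 0"
  using expansion by (simp add: separable_expansion_def truncation_def)

text \<open>A truncation at \<open>m \<ge> n\<close> has at least this norm, and its norm exceeds
  \<open>hs_norm C\<close> by at most an error that vanishes as \<open>m\<close> grows.\<close>

lemma L2_set_scores_le: "L2_set \<sigma> {1..n} \<le> hs_norm C"
proof (rule LIMSEQ_le_const)
  show "(\<lambda>m. hs_norm C + hs_norm (C - truncation m)) \<longlonglongrightarrow> hs_norm C"
    using tendsto_add[OF tendsto_const truncation_tendsto] by simp
  show "\<exists>m0. \<forall>m\<ge>m0. L2_set \<sigma> {1..n} \<le> hs_norm C + hs_norm (C - truncation m)"
  proof (intro exI[of _ n] allI impI)
    fix m assume "n \<le> m"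
    then have "L2_set \<sigma> {1..n} \<le> L2_set \<sigma> {1..m}"
      unfolding L2_set_def by (intro real_sqrt_le_mono sum_mono2) auto
    also have "\<dots> = hs_norm (C - (C - truncation m))"
      by (simp add: hs_norm_truncation)
    also have "\<dots> \<le> hs_norm C + hs_norm (C - truncation m)"
      by (intro hs_diff expansion_hilbert_schmidt hilbert_schmidt_truncation)
    finally show "L2_set \<sigma> {1..n} \<le> hs_norm C + hs_norm (C - truncation m)" .
  qed
qed

lemma first_score_le: "\<sigma> 1 \<le> hs_norm C"
  using L2_set_scores_le[of 1] scores_nonneg[of 1] by (simp add: L2_set_def)

lemma summable_scores: "(\<lambda>i. (\<sigma> i)\<^sup>2) summable_on {1..}"
proof (intro nonneg_bdd_above_summable_on bdd_aboveI[of _ "(hs_norm C)\<^sup>2"])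
  fix s assume "s \<in> sum (\<lambda>i. (\<sigma> i)\<^sup>2) ` {F. F \<subseteq> {1..} \<and> finite F}"
  then obtain F where F: "F \<subseteq> {1..}" "finite F" "s = (\<Sum>i\<in>F. (\<sigma> i)\<^sup>2)" by auto
  then have "s \<le> (\<Sum>i=1..Max (insert 0 F). (\<sigma> i)\<^sup>2)"
    unfolding F(3) by (intro sum_mono2) (auto intro: Max_ge)
  also have "\<dots> = (L2_set \<sigma> {1..Max (insert 0 F)})\<^sup>2"
    by (simp add: L2_set_def sum_nonneg)
  also have "\<dots> \<le> (hs_norm C)\<^sup>2"
    by (intro power_mono L2_set_scores_le L2_set_nonneg)
  finally show "s \<le> (hs_norm C)\<^sup>2" .
qed simp

text \<open>A later truncation at \<open>m\<close> is interposed: the step from \<open>R\<close> to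
  \<open>m\<close> is a finite orthogonal sum bounded by the tail, and the error at \<open>m\<close>
  tends to 0.\<close>

lemma truncation_error: "hs_norm (C - truncation R) \<le> sqrt (\<Sum>\<^sub>\<infinity>i\<in>{R + 1..}. (\<sigma> i)\<^sup>2)"
proof (rule LIMSEQ_le_const)
  let ?s = "sqrt (\<Sum>\<^sub>\<infinity>i\<in>{R + 1..}. (\<sigma> i)\<^sup>2)"
  show "(\<lambda>m. hs_norm (C - truncation m) + ?s) \<longlonglongrightarrow> ?s"
    using tendsto_add[OF truncation_tendsto tendsto_const] by simp
  show "\<exists>m0. \<forall>m\<ge>m0. hs_norm (C - truncation R) \<le> hs_norm (C - truncation m) + ?s"
  proof (intro exI[of _ R] allI impI)
    fix m assume m: "R \<le> m"
    have "{1..m} = {1..R} \<union> {R+1..m}" using m by auto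
    then have "truncation m = truncation R + (\<Sum>j=R+1..m. \<sigma> j *\<^sub>R op_tensor (A j) (B j))"
      unfolding truncation_def by (simp only:) (rule sum.union_disjoint, auto)
    then have "truncation m - truncation R = (\<Sum>j=R+1..m. \<sigma> j *\<^sub>R op_tensor (A j) (B j))"
      by simp
    then have "hs_norm (truncation m - truncation R) = L2_set \<sigma> {R+1..m}"
      using hs_norm_expansion_sum(2)[of "{R+1..m}" \<sigma>] by simp
    also have "\<dots> \<le> ?s"
      unfolding L2_set_def
      by (intro real_sqrt_le_mono finite_sum_le_infsum summable_on_subset_banach[OF summable_scores]) auto
    finally have "hs_norm (truncation m - truncation R) \<le> ?s" .
    moreover have "hs_norm (C - truncation R) \<le> hs_norm (C - truncation m) + hs_norm (truncation m - truncation R)"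
      by (intro hs_norm_triangle expansion_hilbert_schmidt hilbert_schmidt_truncation)
    ultimately show "hs_norm (C - truncation R) \<le> hs_norm (C - truncation m) + ?s" by simp
  qed
qed

text \<open>Makes the truncation an admissible competitor. Its own expansion keeps the factors
  \<open>A\<close> and \<open>B\<close> and sets the scores beyond \<open>R\<close> to 0.\<close>

lemma dos_le_truncation: "dos_le R (truncation R)"
  unfolding dos_le_def
proof (intro exI conjI)
  let ?\<sigma> = "\<lambda>j. if j \<le> R then \<sigma> j else 0"
  have trunc: "(\<Sum>j=1..n. ?\<sigma> j *\<^sub>R op_tensor (A j) (B j)) = truncation R" if "R \<le> n" for n
    unfolding truncation_def using that by (intro sum.mono_neutral_cong_right) auto
  have "(\<lambda>n. hs_norm (truncation R - (\<Sum>j=1..n. ?\<sigma> j *\<^sub>R op_tensor (A j) (B j)))) \<longlonglongrightarrow> 0"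
  proof (rule tendsto_eventually)
    show "\<forall>\<^sub>F n in sequentially. hs_norm (truncation R - (\<Sum>j=1..n. ?\<sigma> j *\<^sub>R op_tensor (A j) (B j))) = 0"
      using eventually_ge_at_top[of R] by eventually_elim (simp only: trunc, simp add: hs_norm_def hs_inner_def)
  qed
  then show "separable_expansion (truncation R) ?\<sigma> A B"
    using expansion hilbert_schmidt_truncation by (auto simp: separable_expansion_def)
  have sub: "{j. 1 \<le> j \<and> ?\<sigma> j \<noteq> 0} \<subseteq> {1..R}" by auto
  show "finite {j. 1 \<le> j \<and> ?\<sigma> j \<noteq> 0}"
    by (rule finite_subset[OF sub]) simp
  show "card {j. 1 \<le> j \<and> ?\<sigma> j \<noteq> 0} \<le> R"
    using card_mono[OF _ sub] by simp
qed

text \<open>\<open>F - C\<close> enters twice: when \<open>G\<close> is compared with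
  \<open>C\<close> through \<open>F\<close>, and when \<open>F\<close> is compared with the
  truncation of \<open>C\<close>, against which \<open>G\<close> is optimal.\<close>

lemma best_separable_approx_error:
  assumes F: "hilbert_schmidt F" and G: "best_separable_approx R F G"
  shows "hs_norm (G - C) \<le> sqrt (\<Sum>\<^sub>\<infinity>i\<in>{R + 1..}. (\<sigma> i)\<^sup>2) + 2 * hs_norm (F - C)"
proof -
  note hs = F expansion_hilbert_schmidt hilbert_schmidt_truncation
  have G': "hilbert_schmidt G" using G by (simp add: best_separable_approx_def)
  have "(hs_norm (F - G))\<^sup>2 \<le> (hs_norm (F - truncation R))\<^sup>2"
    using G dos_le_truncation hilbert_schmidt_truncation by (simp add: best_separable_approx_def)
  then have "hs_norm (F - G) \<le> hs_norm (F - truncation R)"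
    using hs_norm_nonneg by (rule power2_le_imp_le)
  moreover have "hs_norm (F - truncation R) \<le> hs_norm (F - C) + hs_norm (C - truncation R)"
    by (intro hs_norm_triangle hs)
  moreover have "hs_norm (G - C) \<le> hs_norm (G - F) + hs_norm (F - C)"
    by (intro hs_norm_triangle hs G')
  ultimately show ?thesis
    using truncation_error[of R] hs_norm_minus_commute[of G F] by linarith
qed

end


section \<open>Operators with a kernel\<close>

lemma space_cube: "space (cube_measure :: 'a::euclidean_space measure) = cbox 0 One"
  by (simp add: space_restrict_space)

lemma prob_space_cube: "prob_space (cube_measure :: 'a::euclidean_space measure)"
  by (rule prob_spaceI) (simp add: space_restrict_space emeasure_restrict_space emeasure_lborel_cbox_eq)

interpretation cube: prob_space "cube_measure :: 'a::euclidean_space measure"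
  by (rule prob_space_cube)

lemma integral_cube_const: "integral\<^sup>L cube_measure (\<lambda>p :: 'a::euclidean_space. b :: real) = b"
  using cube.prob_space[where 'a = 'a] by (simp add: space_cube)

lemma square_integrable_const: "(\<lambda>_. b) \<in> square_integrable"
  by (rule square_integrable_bounded[where b = "\<bar>b\<bar>"]) auto

lemma square_integrable_boundedI:
  fixes f :: "'a::euclidean_space \<Rightarrow> real"
  assumes "f \<in> borel_measurable cube_measure" and "\<And>x. x \<in> cbox 0 One \<Longrightarrow> \<bar>f x\<bar> \<le> b"
  shows "f \<in> square_integrable"
proof (rule square_integrable_dominated[OF assms(1) square_integrable_const[of b]], rule AE_I2)
  fix x :: 'a assume "x \<in> space cube_measure"
  with assms(2)[of x] show "\<bar>f x\<bar> \<le> \<bar>b\<bar>"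
    by (simp add: space_cube)
qed

lemma continuous_on_square_integrable:
  fixes f :: "'a::euclidean_space \<Rightarrow> real"
  assumes f: "continuous_on (cbox 0 One) f"
  shows "f \<in> square_integrable"
proof -
  obtain b where "\<And>x. x \<in> cbox 0 One \<Longrightarrow> norm (f x) \<le> b"
    using compact_imp_bounded[OF compact_continuous_image[OF f compact_cbox]]
    by (auto simp: bounded_iff)
  moreover have "f \<in> borel_measurable (restrict_space borel (cbox 0 One))"
    using f by (rule borel_measurable_continuous_on_restrict)
  then have "f \<in> borel_measurable cube_measure"
    using measurable_cong_sets[OF sets_restrict_space_cong[OF sets_lborel] refl] by blast
  ultimately show ?thesis by (intro square_integrable_boundedI) auto
qed

lemma square_integrable_imp_integrable:
  "f \<in> square_integrable \<Longrightarrow> integrable cube_measure f"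
  using square_integrable_mult[of f "\<lambda>_. 1"] square_integrable_const[of 1] by simp

lemma norm_abs_L2_le:
  assumes f: "f \<in> square_integrable" and b: "\<And>p. p \<in> cbox 0 One \<Longrightarrow> \<bar>f p\<bar> \<le> b" and "0 \<le> b"
  shows "norm (abs_L2 f) \<le> b"
proof -
  have "(norm (abs_L2 f))\<^sup>2 \<le> integral\<^sup>L cube_measure (\<lambda>p :: 'a. b\<^sup>2)"
    unfolding norm_abs_L2[OF f]
  proof (intro integral_mono square_integrable_integrable square_integrable_const f)
    show "(f p)\<^sup>2 \<le> b\<^sup>2" if "p \<in> space cube_measure" for p
      using power_mono[OF b[of p] abs_ge_zero, of 2] that by (simp add: space_cube)
  qed
  also have "\<dots> = b\<^sup>2" by (rule integral_cube_const)
  finally show ?thesis using \<open>0 \<le> b\<close> by (rule power2_le_imp_le)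
qed

lemma norm_rep_L2: "(norm x)\<^sup>2 = integral\<^sup>L cube_measure (\<lambda>p. (rep_L2 x p)\<^sup>2)"
  using norm_abs_L2[OF rep_L2_square_integrable, of x] by (simp add: abs_rep_L2)

text \<open>For fixed \<open>p\<close> the values of \<open>D e\<close> at \<open>p\<close> are the
  Fourier coefficients of the row \<open>k (p, _)\<close>, so Bessel bounds their sum of squares by
  \<open>b\<^sup>2\<close>. Integrating over the cube, which has measure 1, preserves the
  bound.\<close>

lemma hs_norm_kernel_le:
  fixes D :: "'a::euclidean_space L2 \<Rightarrow>\<^sub>L 'a L2"
  assumes D: "has_kernel D k" and k: "\<And>p. p \<in> cbox 0 One \<Longrightarrow> (\<lambda>q. k (p, q)) \<in> square_integrable"
    and b: "\<And>p q. p \<in> cbox 0 One \<Longrightarrow> q \<in> cbox 0 One \<Longrightarrow> \<bar>k (p, q)\<bar> \<le> b" "0 \<le> b"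
    and B: "orthonormal_basis (B :: 'a L2 set)"
  shows "hilbert_schmidt D" "hs_norm D \<le> b"
proof -
  have "(\<Sum>e\<in>F. (norm (blinfun_apply D e))\<^sup>2) \<le> b\<^sup>2" if F: "finite F" "F \<subseteq> B" for F
  proof -
    \<comment> \<open>The kernel formula holds off a null set that depends on \<open>e\<close>;
      since \<open>F\<close> is finite, one null set serves all its elements.\<close>
    have ae: "AE p in cube_measure. \<forall>e\<in>F. rep_L2 (blinfun_apply D e) p = inner e (abs_L2 (\<lambda>q. k (p, q)))"
    proof (rule AE_finite_allI[OF F(1)])
      fix e assume "e \<in> F"
      have "AE p in cube_measure. rep_L2 (blinfun_apply D e) p = (LINT q|cube_measure. k (p, q) * rep_L2 e q)"
        using D by (simp add: has_kernel_def)
      then show "AE p in cube_measure. rep_L2 (blinfun_apply D e) p = inner e (abs_L2 (\<lambda>q. k (p, q)))"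
        by (rule AE_mp, intro AE_I2) (simp add: inner_abs_L2_right k space_cube mult.commute)
    qed
    have le: "AE p in cube_measure. (\<Sum>e\<in>F. (rep_L2 (blinfun_apply D e) p)\<^sup>2) \<le> b\<^sup>2"
    proof (rule AE_mp[OF ae], intro AE_I2 impI)
      fix p :: 'a assume p: "p \<in> space cube_measure"
        and *: "\<forall>e\<in>F. rep_L2 (blinfun_apply D e) p = inner e (abs_L2 (\<lambda>q. k (p, q)))"
      then have "(\<Sum>e\<in>F. (rep_L2 (blinfun_apply D e) p)\<^sup>2) = (\<Sum>e\<in>F. (inner (abs_L2 (\<lambda>q. k (p, q))) e)\<^sup>2)"
        by (simp add: inner_commute)
      also have "\<dots> \<le> (norm (abs_L2 (\<lambda>q. k (p, q))))\<^sup>2"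
        by (rule bessel_inequality[OF B F])
      also have "\<dots> \<le> b\<^sup>2"
        using p b by (intro power_mono norm_abs_L2_le k) (auto simp: space_cube)
      finally show "(\<Sum>e\<in>F. (rep_L2 (blinfun_apply D e) p)\<^sup>2) \<le> b\<^sup>2" .
    qed
    have int: "integrable cube_measure (\<lambda>p. (rep_L2 (blinfun_apply D e) p)\<^sup>2)" for e
      by (intro square_integrable_integrable rep_L2_square_integrable)
    have "(\<Sum>e\<in>F. (norm (blinfun_apply D e))\<^sup>2)
        = integral\<^sup>L cube_measure (\<lambda>p. \<Sum>e\<in>F. (rep_L2 (blinfun_apply D e) p)\<^sup>2)"
      by (simp add: norm_rep_L2 Bochner_Integration.integral_sum int)
    also have "\<dots> \<le> integral\<^sup>L cube_measure (\<lambda>p :: 'a. b\<^sup>2)"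
      by (intro integral_mono_AE Bochner_Integration.integrable_sum int le) auto
    finally show ?thesis by (simp only: integral_cube_const)
  qed
  from hs_norm_boundI[OF B b(2) this] show "hilbert_schmidt D" "hs_norm D \<le> b" by auto
qed

lemma measure_cube:
  fixes A :: "'a::euclidean_space set"
  assumes "A \<in> sets borel" "A \<subseteq> cbox 0 One"
  shows "measure cube_measure (A \<inter> cbox 0 One) = measure lborel A"
  using assms by (simp add: measure_restrict_space Int_absorb2)

lemma integral_cube_indicator:
  fixes A :: "'a::euclidean_space set"
  assumes "A \<in> sets borel" "A \<subseteq> cbox 0 One"
  shows "integral\<^sup>L cube_measure (indicator A) = measure lborel A"
  by (simp add: measure_cube assms)

text \<open>The bilinear form of \<open>C\<close> on two indicators is the integral of
  \<open>c\<close> over \<open>A \<times> B\<close>, taken row by row, and \<open>c\<close> stays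
  within \<open>r\<close> of \<open>c0\<close> there. Divided by the two volumes, this compares the
  covariance of two local averages with one value of the kernel.\<close>

lemma kernel_indicator_bound:
  fixes C :: "'a::euclidean_space L2 \<Rightarrow>\<^sub>L 'a L2"
  assumes C: "has_kernel C c" and c: "\<And>p. p \<in> cbox 0 One \<Longrightarrow> (\<lambda>q. c (p, q)) \<in> square_integrable"
    and A: "A \<in> sets borel" "A \<subseteq> cbox 0 One" and B: "B \<in> sets borel" "B \<subseteq> cbox 0 One"
    and r: "\<And>p q. p \<in> A \<Longrightarrow> q \<in> B \<Longrightarrow> \<bar>c (p, q) - c0\<bar> \<le> r"
  shows "\<bar>inner (abs_L2 (indicator A)) (blinfun_apply C (abs_L2 (indicator B)))
      - c0 * (measure lborel A * measure lborel B)\<bar> \<le> r * (measure lborel A * measure lborel B)"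
proof -
  let ?f = "rep_L2 (blinfun_apply C (abs_L2 (indicator B)))"
  have sA: "indicator A \<in> square_integrable" and sB: "indicator B \<in> square_integrable"
    using A B by (auto intro: square_integrable_indicator)
  have "AE p in cube_measure. ?f p = (LINT q|cube_measure. c (p, q) * rep_L2 (abs_L2 (indicator B)) q)"
    using C by (simp add: has_kernel_def)
  then have ae: "AE p in cube_measure. ?f p = (LINT q|cube_measure. c (p, q) * indicator B q)"
  proof (rule AE_mp, intro AE_I2 impI)
    fix p :: 'a assume p: "p \<in> space cube_measure"
      and *: "?f p = (LINT q|cube_measure. c (p, q) * rep_L2 (abs_L2 (indicator B)) q)"
    note [measurable] = square_integrable_measurable[OF c[of p]] square_integrable_measurable[OF sB]
      square_integrable_measurable[OF rep_L2_square_integrable]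
    show "?f p = (LINT q|cube_measure. c (p, q) * indicator B q)"
    proof -
      have "AE q in cube_measure. c (p, q) * rep_L2 (abs_L2 (indicator B)) q = c (p, q) * indicator B q"
        using rep_abs_L2[OF sB] by eventually_elim simp
      then show ?thesis
        unfolding * using p by (intro integral_cong_AE) (auto simp: space_cube)
    qed
  qed
  have bound: "\<bar>(?f p - c0 * measure lborel B) * indicator A p\<bar> \<le> (r * measure lborel B) * indicator A p"
    if f: "?f p = (LINT q|cube_measure. c (p, q) * indicator B q)" for p
  proof (cases "p \<in> A")
    case True
    then have p: "p \<in> cbox 0 One" using A by auto
    have int: "integrable cube_measure (\<lambda>q. c (p, q) * indicator B q)" "integrable cube_measure (\<lambda>q. c0 * indicator B q)"
      "integrable cube_measure (\<lambda>q. r * indicator B q)"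
      using square_integrable_mult[OF c[OF p] sB] square_integrable_imp_integrable[OF sB] by auto
    have "?f p - c0 * measure lborel B = (LINT q|cube_measure. c (p, q) * indicator B q - c0 * indicator B q)"
      using int by (simp add: f Bochner_Integration.integral_diff measure_cube B)
    also have "\<bar>\<dots>\<bar> \<le> (LINT q|cube_measure. \<bar>c (p, q) * indicator B q - c0 * indicator B q\<bar>)"
      by (rule integral_abs_bound)
    also have "\<dots> \<le> (LINT q|cube_measure. r * indicator B q)"
      using int r[OF True] by (intro integral_mono integrable_abs Bochner_Integration.integrable_diff) (auto simp: indicator_def)
    also have "\<dots> = r * measure lborel B"
      by (simp add: measure_cube B)
    finally show ?thesis using True by simp
  qed simp
  have int: "integrable cube_measure (\<lambda>p. ?f p * indicator A p)" "integrable cube_measure (indicator A :: 'a \<Rightarrow> real)"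
    using square_integrable_mult[OF rep_L2_square_integrable sA] square_integrable_imp_integrable[OF sA] by auto
  have "inner (abs_L2 (indicator A)) (blinfun_apply C (abs_L2 (indicator B)))
      - c0 * (measure lborel A * measure lborel B)
      = (LINT p|cube_measure. (?f p - c0 * measure lborel B) * indicator A p)"
    unfolding inner_commute[of "abs_L2 (indicator A)"] inner_abs_L2_right[OF sA] left_diff_distrib
    using int by (simp add: measure_cube A mult.commute[of "measure lborel A"])
  also have "\<bar>\<dots>\<bar> \<le> (LINT p|cube_measure. \<bar>(?f p - c0 * measure lborel B) * indicator A p\<bar>)"
    by (rule integral_abs_bound)
  also have "\<dots> \<le> (LINT p|cube_measure. (r * measure lborel B) * indicator A p)"
  proof (rule integral_mono_AE)
    show "AE p in cube_measure. \<bar>(?f p - c0 * measure lborel B) * indicator A p\<bar>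
        \<le> (r * measure lborel B) * indicator A p"
      using ae by eventually_elim (rule bound)
    show "integrable cube_measure (\<lambda>p. \<bar>(?f p - c0 * measure lborel B) * indicator A p\<bar>)"
      unfolding left_diff_distrib using int by (intro integrable_abs) auto
  qed (use int in auto)
  also have "\<dots> = r * (measure lborel A * measure lborel B)"
    by (simp add: measure_cube A ac_simps)
  finally show ?thesis .
qed

section \<open>Square-integrable random variables\<close>

lemma L2_set_sum:
  "L2_set (\<lambda>q. \<Sum>n\<in>I. f n q) J \<le> (\<Sum>n\<in>I. L2_set (f n) J)"
proof (induction I rule: infinite_finite_induct)
  case (insert n I)
  have "L2_set (\<lambda>q. f n q + (\<Sum>n\<in>I. f n q)) J \<le> L2_set (f n) J + L2_set (\<lambda>q. \<Sum>n\<in>I. f n q) J"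
    by (rule L2_set_triangle_ineq)
  with insert show ?case by simp
qed (simp_all add: L2_set_def)

lemma L2_set_mult_product: "L2_set (\<lambda>(p, q). a p * b q) (P \<times> Q) = L2_set a P * L2_set b Q"
  by (simp add: L2_set_def power_mult_distrib real_sqrt_mult[symmetric] sum_product sum.cartesian_product
      case_prod_unfold)

lemma L2_set_cmult: "L2_set (\<lambda>q. c * f q) J = \<bar>c\<bar> * L2_set f J"
  by (simp add: L2_set_def power_mult_distrib real_sqrt_mult flip: sum_distrib_left)

context prob_space
begin

definition square_integrable_var :: "('a \<Rightarrow> real) \<Rightarrow> bool"
  where "square_integrable_var f \<longleftrightarrow> f \<in> borel_measurable M \<and> integrable M (\<lambda>\<omega>. (f \<omega>)\<^sup>2)"

lemma square_integrable_var_measurable [measurable_dest]: "square_integrable_var f \<Longrightarrow> f \<in> borel_measurable M"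
  by (simp add: square_integrable_var_def)

lemma square_integrable_var_mult:
  assumes f: "square_integrable_var f" and g: "square_integrable_var g"
  shows "integrable M (\<lambda>\<omega>. f \<omega> * g \<omega>)"
proof (rule Bochner_Integration.integrable_bound)
  show "integrable M (\<lambda>\<omega>. (f \<omega>)\<^sup>2 + (g \<omega>)\<^sup>2)"
    using f g by (auto simp: square_integrable_var_def)
  show "(\<lambda>\<omega>. f \<omega> * g \<omega>) \<in> borel_measurable M"
    using f g by measurable
  have "\<bar>a * b\<bar> \<le> a\<^sup>2 + b\<^sup>2" for a b :: real
    using sum_squares_bound[of a b] sum_squares_bound[of a "- b"]
      zero_le_power2[of a] zero_le_power2[of b]
    by (simp add: abs_le_iff)
  then show "AE \<omega> in M. norm (f \<omega> * g \<omega>) \<le> norm ((f \<omega>)\<^sup>2 + (g \<omega>)\<^sup>2)"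
    by (intro AE_I2) simp
qed

lemma square_integrable_var_const: "square_integrable_var (\<lambda>_. c)"
  by (simp add: square_integrable_var_def)

lemma square_integrable_var_integrable: "square_integrable_var f \<Longrightarrow> integrable M f"
  using square_integrable_var_mult[OF _ square_integrable_var_const[of 1], of f] by simp

lemma square_integrable_var_square: "square_integrable_var f \<Longrightarrow> integrable M (\<lambda>\<omega>. (f \<omega>)\<^sup>2)"
  by (simp add: square_integrable_var_def)

lemma square_integrable_var_cmult: "square_integrable_var f \<Longrightarrow> square_integrable_var (\<lambda>\<omega>. c * f \<omega>)"
  by (auto simp: square_integrable_var_def power_mult_distrib)

lemma square_integrable_var_add:
  assumes f: "square_integrable_var f" and g: "square_integrable_var g"
  shows "square_integrable_var (\<lambda>\<omega>. f \<omega> + g \<omega>)"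
  using f g square_integrable_var_mult[OF f g]
  by (auto simp: square_integrable_var_def power2_sum mult.assoc)

lemma square_integrable_var_diff:
  assumes f: "square_integrable_var f" and g: "square_integrable_var g"
  shows "square_integrable_var (\<lambda>\<omega>. f \<omega> - g \<omega>)"
  using square_integrable_var_add[OF f square_integrable_var_cmult[OF g, of "-1"]] by simp

lemma square_integrable_var_sum:
  "(\<And>n. n \<in> I \<Longrightarrow> square_integrable_var (f n)) \<Longrightarrow> square_integrable_var (\<lambda>\<omega>. \<Sum>n\<in>I. f n \<omega>)"
  by (induction I rule: infinite_finite_induct)
    (auto intro: square_integrable_var_const square_integrable_var_add)

lemma square_integrable_var_bound:
  assumes f: "f \<in> borel_measurable M" and g: "square_integrable_var g"
    and le: "\<And>\<omega>. \<omega> \<in> space M \<Longrightarrow> \<bar>f \<omega>\<bar> \<le> \<bar>g \<omega>\<bar>"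
  shows "square_integrable_var f"
  unfolding square_integrable_var_def
proof (intro conjI f Bochner_Integration.integrable_bound[OF square_integrable_var_square[OF g]])
  show "AE \<omega> in M. norm ((f \<omega>)\<^sup>2) \<le> norm ((g \<omega>)\<^sup>2)"
    using le by (intro AE_I2) (simp add: abs_le_square_iff)
qed (use f in simp)

lemma expectation_square_le:
  assumes f: "square_integrable_var f"
  shows "(expectation f)\<^sup>2 \<le> expectation (\<lambda>\<omega>. (f \<omega>)\<^sup>2)"
  using variance_positive[of f] variance_eq[OF square_integrable_var_integrable[OF f] square_integrable_var_square[OF f]]
  by simp

lemma expectation_le_sqrt:
  assumes f: "square_integrable_var f" and v: "expectation (\<lambda>\<omega>. (f \<omega>)\<^sup>2) \<le> v"
  shows "expectation f \<le> sqrt v"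
  using expectation_square_le[OF f] v by (intro real_le_rsqrt) simp

text \<open>Jensen for the Euclidean norm, by duality: the vector of expectations is paired with
  itself under the expectation, Cauchy-Schwarz is applied pointwise, and one factor of its norm
  cancels.\<close>

lemma L2_set_expectation_le:
  assumes J: "finite J" and h: "\<And>q. q \<in> J \<Longrightarrow> integrable M (h q)"
  shows "integrable M (\<lambda>\<omega>. L2_set (\<lambda>q. h q \<omega>) J)"
    and "L2_set (\<lambda>q. expectation (h q)) J \<le> expectation (\<lambda>\<omega>. L2_set (\<lambda>q. h q \<omega>) J)"
proof -
  have [measurable]: "h q \<in> borel_measurable M" if "q \<in> J" for q
    using h[OF that] by simp
  have m: "(\<lambda>\<omega>. L2_set (\<lambda>q. h q \<omega>) J) \<in> borel_measurable M"
    unfolding L2_set_def by measurable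
  show int: "integrable M (\<lambda>\<omega>. L2_set (\<lambda>q. h q \<omega>) J)"
  proof (rule Bochner_Integration.integrable_bound[OF _ m])
    show "integrable M (\<lambda>\<omega>. \<Sum>q\<in>J. \<bar>h q \<omega>\<bar>)"
      by (intro Bochner_Integration.integrable_sum integrable_abs h)
    show "AE \<omega> in M. norm (L2_set (\<lambda>q. h q \<omega>) J) \<le> norm (\<Sum>q\<in>J. \<bar>h q \<omega>\<bar>)"
      by (intro AE_I2) (simp add: L2_set_le_sum_abs sum_nonneg)
  qed
  let ?a = "\<lambda>q. expectation (h q)" and ?E = "expectation (\<lambda>\<omega>. L2_set (\<lambda>q. h q \<omega>) J)"
  have "(L2_set ?a J)\<^sup>2 = expectation (\<lambda>\<omega>. \<Sum>q\<in>J. ?a q * h q \<omega>)"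
    using h by (simp add: L2_set_def sum_nonneg power2_eq_square Bochner_Integration.integral_sum)
  also have "\<dots> \<le> expectation (\<lambda>\<omega>. L2_set ?a J * L2_set (\<lambda>q. h q \<omega>) J)"
  proof (rule integral_mono)
    fix \<omega>
    have "(\<Sum>q\<in>J. ?a q * h q \<omega>) \<le> (\<Sum>q\<in>J. \<bar>?a q\<bar> * \<bar>h q \<omega>\<bar>)"
      by (intro sum_mono) (metis abs_ge_self abs_mult)
    also have "\<dots> \<le> L2_set ?a J * L2_set (\<lambda>q. h q \<omega>) J"
      by (rule L2_set_mult_ineq)
    finally show "(\<Sum>q\<in>J. ?a q * h q \<omega>) \<le> L2_set ?a J * L2_set (\<lambda>q. h q \<omega>) J" .
  qed (use h int in auto)
  finally have *: "L2_set ?a J * L2_set ?a J \<le> L2_set ?a J * ?E"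
    by (simp add: power2_eq_square)
  have "0 \<le> ?E" by (intro Bochner_Integration.integral_nonneg) simp
  with * show "L2_set ?a J \<le> ?E"
    using L2_set_nonneg[of ?a J] by (cases "L2_set ?a J = 0") (auto simp: mult_le_cancel_left)
qed

lemma expectation_average_square:
  assumes f: "\<And>n. n \<in> {1..N} \<Longrightarrow> square_integrable_var (f n)"
    and uncorrelated: "\<And>n m. n \<in> {1..N} \<Longrightarrow> m \<in> {1..N} \<Longrightarrow> n \<noteq> m \<Longrightarrow> expectation (\<lambda>\<omega>. f n \<omega> * f m \<omega>) = 0"
  shows "expectation (\<lambda>\<omega>. ((1 / real N) * (\<Sum>n=1..N. f n \<omega>))\<^sup>2)
    = (1 / (real N)\<^sup>2) * (\<Sum>n=1..N. expectation (\<lambda>\<omega>. (f n \<omega>)\<^sup>2))"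
proof -
  have "expectation (\<lambda>\<omega>. ((1 / real N) * (\<Sum>n=1..N. f n \<omega>))\<^sup>2)
      = expectation (\<lambda>\<omega>. (1 / (real N)\<^sup>2) * (\<Sum>n=1..N. \<Sum>m=1..N. f n \<omega> * f m \<omega>))"
    by (simp add: power_mult_distrib power_divide power2_eq_square sum_product)
  also have "\<dots> = (1 / (real N)\<^sup>2) * (\<Sum>n=1..N. \<Sum>m=1..N. expectation (\<lambda>\<omega>. f n \<omega> * f m \<omega>))"
  proof -
    have int: "integrable M (\<lambda>\<omega>. f n \<omega> * f m \<omega>)" if "n \<in> {1..N}" "m \<in> {1..N}" for n m
      using that by (intro square_integrable_var_mult f)
    have "expectation (\<lambda>\<omega>. \<Sum>n=1..N. \<Sum>m=1..N. f n \<omega> * f m \<omega>)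
        = (\<Sum>n=1..N. expectation (\<lambda>\<omega>. \<Sum>m=1..N. f n \<omega> * f m \<omega>))"
      by (intro Bochner_Integration.integral_sum Bochner_Integration.integrable_sum int)
    also have "\<dots> = (\<Sum>n=1..N. \<Sum>m=1..N. expectation (\<lambda>\<omega>. f n \<omega> * f m \<omega>))"
      by (intro sum.cong refl Bochner_Integration.integral_sum int)
    finally show ?thesis by simp
  qed
  also have "(\<Sum>n=1..N. \<Sum>m=1..N. expectation (\<lambda>\<omega>. f n \<omega> * f m \<omega>))
      = (\<Sum>n=1..N. \<Sum>m=1..N. if n = m then expectation (\<lambda>\<omega>. (f n \<omega>)\<^sup>2) else 0)"
    by (intro sum.cong refl) (auto simp: uncorrelated power2_eq_square)
  finally show ?thesis by simp
qed

lemma expectation_average_square_le: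
  assumes N: "1 \<le> N" and f: "\<And>n. n \<in> {1..N} \<Longrightarrow> square_integrable_var (f n)"
    and uncorrelated: "\<And>n m. n \<in> {1..N} \<Longrightarrow> m \<in> {1..N} \<Longrightarrow> n \<noteq> m \<Longrightarrow> expectation (\<lambda>\<omega>. f n \<omega> * f m \<omega>) = 0"
    and v: "\<And>n. n \<in> {1..N} \<Longrightarrow> expectation (\<lambda>\<omega>. (f n \<omega>)\<^sup>2) \<le> v"
  shows "expectation (\<lambda>\<omega>. ((1 / real N) * (\<Sum>n=1..N. f n \<omega>))\<^sup>2) \<le> v / real N"
proof -
  have "(\<Sum>n=1..N. expectation (\<lambda>\<omega>. (f n \<omega>)\<^sup>2)) \<le> real N * v"
    using sum_bounded_above[of "{1..N}" _ v] v by simp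
  then have "(1 / (real N)\<^sup>2) * (\<Sum>n=1..N. expectation (\<lambda>\<omega>. (f n \<omega>)\<^sup>2)) \<le> (1 / (real N)\<^sup>2) * (real N * v)"
    by (intro mult_left_mono) auto
  also have "\<dots> = v / real N" using N by (simp add: power2_eq_square)
  finally show ?thesis
    using expectation_average_square[OF f uncorrelated] by simp
qed

text \<open>The source of the rate \<open>1 / sqrt N\<close>: second moments of uncorrelated
  averages add up coordinate by coordinate, and the root of the second moment bounds the mean.
  \<open>V\<close> bounds the sum over \<open>J\<close>, so the size of \<open>J\<close> does not
  enter.\<close>

lemma expectation_L2_set_average_le:
  assumes N: "1 \<le> N" and J: "finite J"
    and f: "\<And>n q. n \<in> {1..N} \<Longrightarrow> q \<in> J \<Longrightarrow> square_integrable_var (f n q)"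
    and uncorrelated: "\<And>n m q. n \<in> {1..N} \<Longrightarrow> m \<in> {1..N} \<Longrightarrow> n \<noteq> m \<Longrightarrow> q \<in> J \<Longrightarrow>
      expectation (\<lambda>\<omega>. f n q \<omega> * f m q \<omega>) = 0"
    and V: "\<And>n. n \<in> {1..N} \<Longrightarrow> (\<Sum>q\<in>J. expectation (\<lambda>\<omega>. (f n q \<omega>)\<^sup>2)) \<le> V"
  shows "integrable M (\<lambda>\<omega>. L2_set (\<lambda>q. (1 / real N) * (\<Sum>n=1..N. f n q \<omega>)) J)"
    and "expectation (\<lambda>\<omega>. L2_set (\<lambda>q. (1 / real N) * (\<Sum>n=1..N. f n q \<omega>)) J) \<le> sqrt (V / real N)"
proof -
  let ?g = "\<lambda>q \<omega>. (1 / real N) * (\<Sum>n=1..N. f n q \<omega>)"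
  have g: "square_integrable_var (?g q)" if "q \<in> J" for q
    using f that by (intro square_integrable_var_cmult square_integrable_var_sum)
  show int: "integrable M (\<lambda>\<omega>. L2_set (\<lambda>q. ?g q \<omega>) J)"
    by (intro L2_set_expectation_le J square_integrable_var_integrable g)
  have sq: "(L2_set (\<lambda>q. ?g q \<omega>) J)\<^sup>2 = (\<Sum>q\<in>J. (?g q \<omega>)\<^sup>2)" for \<omega>
    by (simp add: L2_set_def sum_nonneg)
  have "square_integrable_var (\<lambda>\<omega>. L2_set (\<lambda>q. ?g q \<omega>) J)"
    using int unfolding square_integrable_var_def sq
    by (intro conjI Bochner_Integration.integrable_sum square_integrable_var_square g
        borel_measurable_integrable)
  moreover have "expectation (\<lambda>\<omega>. (L2_set (\<lambda>q. ?g q \<omega>) J)\<^sup>2) \<le> V / real N"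
  proof -
    have "expectation (\<lambda>\<omega>. (L2_set (\<lambda>q. ?g q \<omega>) J)\<^sup>2) = (\<Sum>q\<in>J. expectation (\<lambda>\<omega>. (?g q \<omega>)\<^sup>2))"
      unfolding sq by (intro Bochner_Integration.integral_sum square_integrable_var_square g)
    also have "\<dots> = (\<Sum>q\<in>J. (1 / (real N)\<^sup>2) * (\<Sum>n=1..N. expectation (\<lambda>\<omega>. (f n q \<omega>)\<^sup>2)))"
      by (intro sum.cong refl expectation_average_square f uncorrelated)
    also have "\<dots> = (1 / (real N)\<^sup>2) * (\<Sum>n=1..N. \<Sum>q\<in>J. expectation (\<lambda>\<omega>. (f n q \<omega>)\<^sup>2))"
      by (subst sum.swap) (simp add: sum_distrib_left)
    also have "\<dots> \<le> (1 / (real N)\<^sup>2) * (real N * V)"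
      using sum_bounded_above[of "{1..N}" _ V] V by (intro mult_left_mono) auto
    also have "\<dots> = V / real N" using N by (simp add: power2_eq_square)
    finally show ?thesis .
  qed
  ultimately show "expectation (\<lambda>\<omega>. L2_set (\<lambda>q. ?g q \<omega>) J) \<le> sqrt (V / real N)"
    by (rule expectation_le_sqrt)
qed

end


section \<open>Fluctuations of the empirical covariance\<close>

definition sample_covariance :: "nat \<Rightarrow> (nat \<Rightarrow> 'p \<Rightarrow> real) \<Rightarrow> 'p \<Rightarrow> 'p \<Rightarrow> real"
  where "sample_covariance N y p q = (1 / real N) *
    (\<Sum>n=1..N. (y n p - (1 / real N) * (\<Sum>m=1..N. y m p)) * (y n q - (1 / real N) * (\<Sum>m=1..N. y m q)))"

lemma sample_covariance_cong:
  assumes "\<And>n. n \<in> {1..N} \<Longrightarrow> y n p = z n p" "\<And>n. n \<in> {1..N} \<Longrightarrow> y n q = z n q"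
  shows "sample_covariance N y p q = sample_covariance N z p q"
proof -
  have "(\<Sum>n=1..N. y n p) = (\<Sum>n=1..N. z n p)" "(\<Sum>n=1..N. y n q) = (\<Sum>n=1..N. z n q)"
    using assms by (auto intro: sum.cong)
  then show ?thesis
    unfolding sample_covariance_def using assms by (intro arg_cong2[where f = "(*)"] sum.cong) auto
qed

text \<open>Subtracting sample means removes the shift \<open>\<mu>\<close>, so centred values may
  be used. What remains is a matrix of second moments minus the rank-one matrix of the
  means.\<close>

lemma sample_covariance_shift:
  assumes N: "1 \<le> N"
  shows "sample_covariance N (\<lambda>n p. z n p + \<mu> p) p q
    = (1 / real N) * (\<Sum>n=1..N. z n p * z n q)
      - ((1 / real N) * (\<Sum>n=1..N. z n p)) * ((1 / real N) * (\<Sum>n=1..N. z n q))"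
proof -
  define a where "a p = (1 / real N) * (\<Sum>n=1..N. z n p)" for p
  have avg: "(1 / real N) * (\<Sum>m=1..N. z m p + \<mu> p) = a p + \<mu> p" for p
    using N by (simp add: a_def sum.distrib distrib_left)
  have S: "(\<Sum>n=1..N. z n p) = real N * a p" for p
    using N by (simp add: a_def)
  have "sample_covariance N (\<lambda>n p. z n p + \<mu> p) p q = (1 / real N) * (\<Sum>n=1..N. (z n p - a p) * (z n q - a q))"
    unfolding sample_covariance_def avg by simp
  also have "(\<Sum>n=1..N. (z n p - a p) * (z n q - a q))
      = (\<Sum>n=1..N. z n p * z n q) - a q * (\<Sum>n=1..N. z n p) - a p * (\<Sum>n=1..N. z n q) + real N * (a p * a q)"
    by (simp add: algebra_simps sum.distrib sum_subtractf sum_distrib_left)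
  also have "\<dots> = (\<Sum>n=1..N. z n p * z n q) - real N * (a p * a q)"
    by (simp only: S) (simp add: algebra_simps)
  also have "(1 / real N) * \<dots> = (1 / real N) * (\<Sum>n=1..N. z n p * z n q) - a p * a q"
    using N by (simp add: right_diff_distrib)
  finally show ?thesis by (simp only: a_def)
qed

text \<open>
  The events \<open>G n\<close> truncate the sample: only the truncated products are assumed to have second
  moments, and the mass outside \<open>G n\<close> is controlled in mean only.
\<close>

locale noisy_sample = prob_space M for M :: "'a measure" +
  fixes N :: nat and P :: "'p set" and x e :: "nat \<Rightarrow> 'p \<Rightarrow> 'a \<Rightarrow> real" and G :: "nat \<Rightarrow> 'a \<Rightarrow> bool"
    and \<gamma> :: "'p \<Rightarrow> 'p \<Rightarrow> real" and \<tau>2 \<Gamma> \<kappa> V \<rho> :: real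
  assumes N: "1 \<le> N" and P: "finite P" "P \<noteq> {}"
    and x: "\<And>n p. n \<in> {1..N} \<Longrightarrow> p \<in> P \<Longrightarrow> square_integrable_var (x n p)"
    and xx: "\<And>n p q. n \<in> {1..N} \<Longrightarrow> p \<in> P \<Longrightarrow> q \<in> P \<Longrightarrow> expectation (\<lambda>\<omega>. x n p \<omega> * x n q \<omega>) = \<gamma> p q"
    and xx_uncorrelated: "\<And>n m p. n \<in> {1..N} \<Longrightarrow> m \<in> {1..N} \<Longrightarrow> n \<noteq> m \<Longrightarrow> p \<in> P \<Longrightarrow>
      expectation (\<lambda>\<omega>. x n p \<omega> * x m p \<omega>) = 0"
    and \<gamma>: "\<And>p. p \<in> P \<Longrightarrow> \<gamma> p p \<le> \<Gamma>"
    and e: "\<And>n p. n \<in> {1..N} \<Longrightarrow> p \<in> P \<Longrightarrow> square_integrable_var (e n p)"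
    and e4: "\<And>n p q. n \<in> {1..N} \<Longrightarrow> p \<in> P \<Longrightarrow> q \<in> P \<Longrightarrow> square_integrable_var (\<lambda>\<omega>. e n p \<omega> * e n q \<omega>)"
    and ee: "\<And>n p q. n \<in> {1..N} \<Longrightarrow> p \<in> P \<Longrightarrow> q \<in> P \<Longrightarrow>
      expectation (\<lambda>\<omega>. e n p \<omega> * e n q \<omega>) = (if p = q then \<tau>2 else 0)"
    and ee_uncorrelated: "\<And>n m p. n \<in> {1..N} \<Longrightarrow> m \<in> {1..N} \<Longrightarrow> n \<noteq> m \<Longrightarrow> p \<in> P \<Longrightarrow>
      expectation (\<lambda>\<omega>. e n p \<omega> * e m p \<omega>) = 0"
    and e4_le: "\<And>n p q. n \<in> {1..N} \<Longrightarrow> p \<in> P \<Longrightarrow> q \<in> P \<Longrightarrow> expectation (\<lambda>\<omega>. (e n p \<omega> * e n q \<omega>)\<^sup>2) \<le> \<kappa>"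
    and e4_uncorrelated: "\<And>n m p q. n \<in> {1..N} \<Longrightarrow> m \<in> {1..N} \<Longrightarrow> n \<noteq> m \<Longrightarrow> p \<in> P \<Longrightarrow> q \<in> P \<Longrightarrow>
      expectation (\<lambda>\<omega>. (e n p \<omega> * e n q \<omega> - (if p = q then \<tau>2 else 0)) * (e m p \<omega> * e m q \<omega> - (if p = q then \<tau>2 else 0))) = 0"
    and xe: "\<And>n p q. n \<in> {1..N} \<Longrightarrow> p \<in> P \<Longrightarrow> q \<in> P \<Longrightarrow> square_integrable_var (\<lambda>\<omega>. x n p \<omega> * e n q \<omega>)"
    and xe_le: "\<And>n p q. n \<in> {1..N} \<Longrightarrow> p \<in> P \<Longrightarrow> q \<in> P \<Longrightarrow> expectation (\<lambda>\<omega>. (x n p \<omega> * e n q \<omega>)\<^sup>2) \<le> \<Gamma> * \<tau>2"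
    and xe_uncorrelated: "\<And>n m p q. n \<in> {1..N} \<Longrightarrow> m \<in> {1..N} \<Longrightarrow> n \<noteq> m \<Longrightarrow> p \<in> P \<Longrightarrow> q \<in> P \<Longrightarrow>
      expectation (\<lambda>\<omega>. (x n p \<omega> * e n q \<omega>) * (x m p \<omega> * e m q \<omega>)) = 0"
    and G: "\<And>n. n \<in> {1..N} \<Longrightarrow> Measurable.pred M (G n)"
    and w: "\<And>n p q. n \<in> {1..N} \<Longrightarrow> p \<in> P \<Longrightarrow> q \<in> P \<Longrightarrow> square_integrable_var (\<lambda>\<omega>. if G n \<omega> then x n p \<omega> * x n q \<omega> else 0)"
    and w_uncorrelated: "\<And>n m p q. n \<in> {1..N} \<Longrightarrow> m \<in> {1..N} \<Longrightarrow> n \<noteq> m \<Longrightarrow> p \<in> P \<Longrightarrow> q \<in> P \<Longrightarrow>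
      expectation (\<lambda>\<omega>.
        ((if G n \<omega> then x n p \<omega> * x n q \<omega> else 0) - expectation (\<lambda>\<omega>. if G n \<omega> then x n p \<omega> * x n q \<omega> else 0)) *
        ((if G m \<omega> then x m p \<omega> * x m q \<omega> else 0) - expectation (\<lambda>\<omega>. if G m \<omega> then x m p \<omega> * x m q \<omega> else 0))) = 0"
    and w_le: "\<And>n. n \<in> {1..N} \<Longrightarrow>
      (\<Sum>(p, q)\<in>P \<times> P. expectation (\<lambda>\<omega>. (if G n \<omega> then x n p \<omega> * x n q \<omega> else 0)\<^sup>2)) / (real (card P))\<^sup>2 \<le> V"
    and rest_le: "\<And>n. n \<in> {1..N} \<Longrightarrow> expectation (\<lambda>\<omega>. if G n \<omega> then 0 else (\<Sum>p\<in>P. (x n p \<omega>)\<^sup>2) / card P) \<le> \<rho>"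
begin

text \<open>In the application this is the pixel area; multiplied by the Frobenius norm of a pixel
  matrix it gives the Hilbert-Schmidt norm of the operator with that matrix.\<close>

definition weight :: real
  where "weight = 1 / real (card P)"

definition target :: "'p \<Rightarrow> 'p \<Rightarrow> real"
  where "target p q = \<gamma> p q + (if p = q then \<tau>2 else 0)"

definition deviation :: "('p \<Rightarrow> real) \<Rightarrow> 'a \<Rightarrow> real"
  where "deviation \<mu> \<omega> = weight *
    L2_set (\<lambda>(p, q). sample_covariance N (\<lambda>n p. x n p \<omega> + e n p \<omega> + \<mu> p) p q - target p q) (P \<times> P)"

definition kept :: "nat \<Rightarrow> 'p \<Rightarrow> 'p \<Rightarrow> 'a \<Rightarrow> real"
  where "kept n p q \<omega> = (if G n \<omega> then x n p \<omega> * x n q \<omega> else 0)"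

definition dropped :: "nat \<Rightarrow> 'p \<Rightarrow> 'p \<Rightarrow> 'a \<Rightarrow> real"
  where "dropped n p q \<omega> = (if G n \<omega> then 0 else x n p \<omega> * x n q \<omega>)"

definition mean :: "(nat \<Rightarrow> 'p \<Rightarrow> 'a \<Rightarrow> real) \<Rightarrow> 'p \<Rightarrow> 'a \<Rightarrow> real"
  where "mean z p \<omega> = (1 / real N) * (\<Sum>n=1..N. z n p \<omega>)"

text \<open>This part and those below are the norms, or bounds for the norms, of the terms into
  which the deviation is split. In the averages of products, \<open>weight\<close> sits inside the
  sum over \<open>n\<close>, so that second moments are averaged over pairs of indices.\<close>

definition kept_part where
  "kept_part \<omega> = L2_set (\<lambda>r. (1 / real N) * (\<Sum>n=1..N. weight * (kept n (fst r) (snd r) \<omega> - expectation (kept n (fst r) (snd r))))) (P \<times> P)"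
definition cross_part where
  "cross_part \<omega> = L2_set (\<lambda>r. (1 / real N) * (\<Sum>n=1..N. weight * (x n (fst r) \<omega> * e n (snd r) \<omega>))) (P \<times> P)"
definition cross_part' where
  "cross_part' \<omega> = L2_set (\<lambda>r. (1 / real N) * (\<Sum>n=1..N. weight * (x n (snd r) \<omega> * e n (fst r) \<omega>))) (P \<times> P)"
definition noise_part where
  "noise_part \<omega> = L2_set (\<lambda>r. (1 / real N) * (\<Sum>n=1..N. weight * (e n (fst r) \<omega> * e n (snd r) \<omega> - (if fst r = snd r then \<tau>2 else 0)))) (P \<times> P)"
definition mean_part where
  "mean_part \<omega> = weight * (\<Sum>p\<in>P. (mean x p \<omega> + mean e p \<omega>)\<^sup>2)"
definition dropped_part where
  "dropped_part \<omega> = (1 / real N) * (\<Sum>n=1..N. if G n \<omega> then 0 else (\<Sum>p\<in>P. (x n p \<omega>)\<^sup>2) / card P)"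

lemma weight_pos: "0 < weight" and weight_card: "weight * real (card P) = 1"
  using P by (auto simp: weight_def card_gt_0_iff)

text \<open>The squared weight is the reciprocal of the number of pairs. Thus a bound that is
  uniform over the entries survives summation, whatever the size of \<open>P\<close>.\<close>

lemma weight_sum_const: "(\<Sum>r\<in>P \<times> P. weight\<^sup>2 * c) = c"
proof -
  have "(\<Sum>r\<in>P \<times> P. weight\<^sup>2 * c) = (weight * real (card P))\<^sup>2 * c"
    by (simp add: card_cartesian_product power2_eq_square ac_simps)
  then show ?thesis by (simp add: weight_card)
qed

lemma kept_integrable: "n \<in> {1..N} \<Longrightarrow> p \<in> P \<Longrightarrow> q \<in> P \<Longrightarrow> square_integrable_var (kept n p q)"
  using w unfolding kept_def by simp

lemma dropped_integrable:
  assumes "n \<in> {1..N}" "p \<in> P" "q \<in> P"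
  shows "integrable M (dropped n p q)"
proof -
  have "dropped n p q = (\<lambda>\<omega>. x n p \<omega> * x n q \<omega> - kept n p q \<omega>)"
    by (auto simp: dropped_def kept_def)
  then show ?thesis
    using square_integrable_var_mult[OF x x] square_integrable_var_integrable[OF kept_integrable] assms
    by simp
qed

lemma kept_dropped:
  assumes "n \<in> {1..N}" "p \<in> P" "q \<in> P"
  shows "expectation (kept n p q) + expectation (dropped n p q) = \<gamma> p q"
proof -
  have "expectation (kept n p q) + expectation (dropped n p q) = expectation (\<lambda>\<omega>. kept n p q \<omega> + dropped n p q \<omega>)"
    using square_integrable_var_integrable[OF kept_integrable] dropped_integrable assms
    by (subst Bochner_Integration.integral_add) auto
  also have "(\<lambda>\<omega>. kept n p q \<omega> + dropped n p q \<omega>) = (\<lambda>\<omega>. x n p \<omega> * x n q \<omega>)"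
    by (auto simp: kept_def dropped_def)
  finally show ?thesis using xx assms by simp
qed

text \<open>The Frobenius norm of the outer product of a vector with itself is its squared Euclidean
  norm. Only second moments of \<open>x\<close> are therefore involved.\<close>

lemma dropped_norm:
  "L2_set (\<lambda>r. weight * dropped n (fst r) (snd r) \<omega>) (P \<times> P) = (if G n \<omega> then 0 else (\<Sum>p\<in>P. (x n p \<omega>)\<^sup>2) / card P)"
proof (cases "G n \<omega>")
  case False
  have "L2_set (\<lambda>r. weight * dropped n (fst r) (snd r) \<omega>) (P \<times> P) = weight * L2_set (\<lambda>(p, q). x n p \<omega> * x n q \<omega>) (P \<times> P)"
    using weight_pos False by (simp add: L2_set_cmult dropped_def case_prod_unfold)
  also have "\<dots> = weight * (\<Sum>p\<in>P. (x n p \<omega>)\<^sup>2)"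
    unfolding L2_set_mult_product by (simp add: L2_set_def sum_nonneg)
  finally show ?thesis using False by (simp add: weight_def)
qed (simp add: dropped_def L2_set_def)

lemma dropped_norm_integrable:
  "n \<in> {1..N} \<Longrightarrow> integrable M (\<lambda>\<omega>. if G n \<omega> then 0 else (\<Sum>p\<in>P. (x n p \<omega>)\<^sup>2) / card P)"
  unfolding dropped_norm[symmetric]
  using P by (intro L2_set_expectation_le(1)) (auto intro!: dropped_integrable)

text \<open>Truncation shifts the mean of the kept products away from \<open>\<gamma>\<close>; by
  Jensen the norm of this shift is at most the mean norm of the dropped matrix.\<close>

lemma dropped_expectation_norm:
  assumes n: "n \<in> {1..N}"
  shows "L2_set (\<lambda>r. weight * expectation (dropped n (fst r) (snd r))) (P \<times> P) \<le> \<rho>"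
proof -
  have "L2_set (\<lambda>r. expectation (\<lambda>\<omega>. weight * dropped n (fst r) (snd r) \<omega>)) (P \<times> P)
      \<le> expectation (\<lambda>\<omega>. L2_set (\<lambda>r. weight * dropped n (fst r) (snd r) \<omega>) (P \<times> P))"
    using P n by (intro L2_set_expectation_le(2)) (auto intro!: dropped_integrable)
  also have "\<dots> \<le> \<rho>"
    unfolding dropped_norm by (rule rest_le[OF n])
  finally show ?thesis by simp
qed

text \<open>Dropped products occur twice: as a random average, which gives
  \<open>dropped_part\<close>, and through their expectations, which account for
  \<open>\<rho>\<close>.\<close>

lemma deviation_le:
  "deviation \<mu> \<omega> \<le> (kept_part \<omega> + cross_part \<omega> + cross_part' \<omega> + noise_part \<omega> + mean_part \<omega>) + dropped_part \<omega> + \<rho>"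
proof -
  let ?J = "P \<times> P" and ?z = "\<lambda>n p. x n p \<omega> + e n p \<omega>"
  define k where "k = (\<lambda>r. (1 / real N) * (\<Sum>n=1..N. weight * (kept n (fst r) (snd r) \<omega> - expectation (kept n (fst r) (snd r)))))"
  define c where "c = (\<lambda>r. (1 / real N) * (\<Sum>n=1..N. weight * (x n (fst r) \<omega> * e n (snd r) \<omega>)))"
  define c' where "c' = (\<lambda>r. (1 / real N) * (\<Sum>n=1..N. weight * (x n (snd r) \<omega> * e n (fst r) \<omega>)))"
  define s where "s = (\<lambda>r. (1 / real N) * (\<Sum>n=1..N. weight * (e n (fst r) \<omega> * e n (snd r) \<omega> - (if fst r = snd r then \<tau>2 else 0))))"
  define d where "d = (\<lambda>r. (1 / real N) * (\<Sum>n=1..N. weight * dropped n (fst r) (snd r) \<omega>))"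
  define d' where "d' = (\<lambda>r. (- 1 / real N) * (\<Sum>n=1..N. weight * expectation (dropped n (fst r) (snd r))))"
  define m where "m p = mean x p \<omega> + mean e p \<omega>" for p
  define mm where "mm = (\<lambda>r. (- weight) * (m (fst r) * m (snd r)))"
  have entry: "weight * (sample_covariance N (\<lambda>n p. x n p \<omega> + e n p \<omega> + \<mu> p) p q - target p q)
      = k (p, q) + (c (p, q) + (c' (p, q) + (s (p, q) + (mm (p, q) + (d (p, q) + d' (p, q))))))"
    if pq: "p \<in> P" "q \<in> P" for p q
  proof -
    have m: "m p = (1 / real N) * (\<Sum>n=1..N. ?z n p)" for p
      by (simp add: m_def mean_def sum.distrib distrib_left)
    have "weight * (sample_covariance N (\<lambda>n p. x n p \<omega> + e n p \<omega> + \<mu> p) p q - target p q)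
        = mm (p, q) + weight * ((1 / real N) * (\<Sum>n=1..N. ?z n p * ?z n q) - target p q)"
      unfolding sample_covariance_shift[OF N] mm_def m by (simp add: algebra_simps)
    also have "(1 / real N) * (\<Sum>n=1..N. ?z n p * ?z n q) - target p q
        = (1 / real N) * (\<Sum>n=1..N. ?z n p * ?z n q - target p q)"
      using N by (simp add: sum_subtractf right_diff_distrib)
    \<comment> \<open>\<open>\<gamma>\<close> is written as the sum of the kept and dropped
      expectations, so that kept and dropped products are each paired with their own mean.\<close>
    also have "(\<Sum>n=1..N. ?z n p * ?z n q - target p q)
        = (\<Sum>n=1..N. (kept n p q \<omega> - expectation (kept n p q)) + x n p \<omega> * e n q \<omega> + x n q \<omega> * e n p \<omega>
            + (e n p \<omega> * e n q \<omega> - (if p = q then \<tau>2 else 0)) + dropped n p q \<omega> - expectation (dropped n p q))"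
    proof (rule sum.cong[OF refl])
      fix n assume n: "n \<in> {1..N}"
      have "x n p \<omega> * x n q \<omega> = kept n p q \<omega> + dropped n p q \<omega>"
        by (simp add: kept_def dropped_def)
      then show "?z n p * ?z n q - target p q = (kept n p q \<omega> - expectation (kept n p q)) + x n p \<omega> * e n q \<omega> + x n q \<omega> * e n p \<omega>
            + (e n p \<omega> * e n q \<omega> - (if p = q then \<tau>2 else 0)) + dropped n p q \<omega> - expectation (dropped n p q)"
        unfolding target_def kept_dropped[OF n pq, symmetric] by (simp add: algebra_simps)
    qed
    also have "weight * ((1 / real N) * \<dots>) = k (p, q) + c (p, q) + c' (p, q) + s (p, q) + d (p, q) + d' (p, q)"
      by (simp only: k_def c_def c'_def s_def d_def d'_def fst_conv snd_conv sum.distrib sum_subtractf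
          sum_distrib_left[symmetric] distrib_left right_diff_distrib minus_divide_left)
        (simp add: algebra_simps add_divide_distrib diff_divide_distrib)
    finally show ?thesis by simp
  qed
  have "deviation \<mu> \<omega> = L2_set (\<lambda>r. weight * (case r of (p, q) \<Rightarrow> sample_covariance N (\<lambda>n p. x n p \<omega> + e n p \<omega> + \<mu> p) p q - target p q)) ?J"
    using weight_pos by (simp only: deviation_def L2_set_cmult abs_of_pos)
  also have "\<dots> = L2_set (\<lambda>r. k r + (c r + (c' r + (s r + (mm r + (d r + d' r)))))) ?J"
    by (intro L2_set_cong refl) (clarsimp simp only: mem_Times_iff fst_conv snd_conv prod.case entry)
  also have "\<dots> \<le> L2_set k ?J + (L2_set c ?J + (L2_set c' ?J + (L2_set s ?J + (L2_set mm ?J + (L2_set d ?J + L2_set d' ?J)))))"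
    by (intro order_trans[OF L2_set_triangle_ineq] add_left_mono L2_set_triangle_ineq)
  also have "L2_set k ?J = kept_part \<omega>" unfolding k_def kept_part_def ..
  also have "L2_set c ?J = cross_part \<omega>" unfolding c_def cross_part_def ..
  also have "L2_set c' ?J = cross_part' \<omega>" unfolding c'_def cross_part'_def ..
  also have "L2_set s ?J = noise_part \<omega>" unfolding s_def noise_part_def ..
  also have "L2_set mm ?J = mean_part \<omega>"
  proof -
    have "L2_set mm ?J = weight * L2_set (\<lambda>(p, q). m p * m q) ?J"
      unfolding mm_def L2_set_cmult using weight_pos by (simp add: case_prod_unfold)
    then show ?thesis
      unfolding L2_set_mult_product mean_part_def by (simp add: L2_set_def sum_nonneg m_def)
  qed
  finally have "deviation \<mu> \<omega> \<le> kept_part \<omega> + (cross_part \<omega> + (cross_part' \<omega> + (noise_part \<omega> + (mean_part \<omega> + (L2_set d ?J + L2_set d' ?J)))))" .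
  moreover have "L2_set d ?J \<le> dropped_part \<omega>"
  proof -
    have "L2_set d ?J \<le> (1 / real N) * (\<Sum>n=1..N. L2_set (\<lambda>r. weight * dropped n (fst r) (snd r) \<omega>) ?J)"
      unfolding d_def L2_set_cmult[of "1 / real N"] by (simp only: abs_divide abs_of_nat abs_one)
        (intro mult_left_mono L2_set_sum, simp)
    then show ?thesis unfolding dropped_norm dropped_part_def .
  qed
  moreover have "L2_set d' ?J \<le> \<rho>"
  proof -
    have "L2_set d' ?J \<le> (1 / real N) * (\<Sum>n=1..N. L2_set (\<lambda>r. weight * expectation (dropped n (fst r) (snd r))) ?J)"
      unfolding d'_def L2_set_cmult[of "- 1 / real N"]
      by (simp only: abs_divide abs_of_nat abs_neg_one) (intro mult_left_mono L2_set_sum, simp)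
    also have "\<dots> \<le> (1 / real N) * (\<Sum>n=1..N. \<rho>)"
      using dropped_expectation_norm by (intro mult_left_mono sum_mono) auto
    finally show ?thesis using N by simp
  qed
  ultimately show ?thesis by linarith
qed

lemma kept_part: "integrable M kept_part" "expectation kept_part \<le> sqrt (V / real N)"
proof -
  let ?f = "\<lambda>n r \<omega>. weight * (kept n (fst r) (snd r) \<omega> - expectation (kept n (fst r) (snd r)))"
  have f: "square_integrable_var (?f n r)" if "n \<in> {1..N}" "r \<in> P \<times> P" for n r
    using that by (intro square_integrable_var_cmult square_integrable_var_diff square_integrable_var_const kept_integrable) auto
  have u: "expectation (\<lambda>\<omega>. ?f n r \<omega> * ?f m r \<omega>) = 0"
    if "n \<in> {1..N}" "m \<in> {1..N}" "n \<noteq> m" "r \<in> P \<times> P" for n m r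
  proof -
    have "expectation (\<lambda>\<omega>. ?f n r \<omega> * ?f m r \<omega>) = expectation (\<lambda>\<omega>. weight\<^sup>2 *
        ((kept n (fst r) (snd r) \<omega> - expectation (kept n (fst r) (snd r)))
        * (kept m (fst r) (snd r) \<omega> - expectation (kept m (fst r) (snd r)))))"
      by (simp add: power2_eq_square ac_simps)
    also have "\<dots> = 0"
      using w_uncorrelated[of n m "fst r" "snd r"] that by (auto simp: kept_def[abs_def])
    finally show ?thesis .
  qed
  have v: "(\<Sum>r\<in>P \<times> P. expectation (\<lambda>\<omega>. (?f n r \<omega>)\<^sup>2)) \<le> V" if n: "n \<in> {1..N}" for n
  proof -
    \<comment> \<open>A variance is at most the second moment, which is the quantity that
      \<open>w_le\<close> bounds.\<close>
    have "(\<Sum>r\<in>P \<times> P. expectation (\<lambda>\<omega>. (?f n r \<omega>)\<^sup>2)) \<le> (\<Sum>r\<in>P \<times> P. weight\<^sup>2 * expectation (\<lambda>\<omega>. (kept n (fst r) (snd r) \<omega>)\<^sup>2))"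
    proof (rule sum_mono)
      fix r assume r: "r \<in> P \<times> P"
      then have k: "square_integrable_var (kept n (fst r) (snd r))" using n by (intro kept_integrable) auto
      have "expectation (\<lambda>\<omega>. (?f n r \<omega>)\<^sup>2) = weight\<^sup>2 * variance (kept n (fst r) (snd r))"
        by (simp add: power_mult_distrib)
      also have "\<dots> \<le> weight\<^sup>2 * expectation (\<lambda>\<omega>. (kept n (fst r) (snd r) \<omega>)\<^sup>2)"
        using variance_eq[OF square_integrable_var_integrable[OF k] square_integrable_var_square[OF k]]
        by (intro mult_left_mono) auto
      finally show "expectation (\<lambda>\<omega>. (?f n r \<omega>)\<^sup>2) \<le> weight\<^sup>2 * expectation (\<lambda>\<omega>. (kept n (fst r) (snd r) \<omega>)\<^sup>2)" .
    qed
    also have "\<dots> = (\<Sum>(p, q)\<in>P \<times> P. expectation (\<lambda>\<omega>. (kept n p q \<omega>)\<^sup>2)) / (real (card P))\<^sup>2"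
      by (simp add: weight_def power_divide sum_divide_distrib case_prod_unfold)
    also have "\<dots> \<le> V"
      using w_le[OF n] by (simp add: kept_def)
    finally show ?thesis .
  qed
  show "integrable M kept_part" "expectation kept_part \<le> sqrt (V / real N)"
    unfolding kept_part_def[abs_def]
    using expectation_L2_set_average_le[OF N finite_cartesian_product[OF P(1) P(1)], of ?f V] f u v by auto
qed

lemma cross_parts:
  "integrable M cross_part" "expectation cross_part \<le> sqrt (\<Gamma> * \<tau>2 / real N)"
  "integrable M cross_part'" "expectation cross_part' \<le> sqrt (\<Gamma> * \<tau>2 / real N)"
proof -
  have f: "square_integrable_var (\<lambda>\<omega>. weight * (x n p \<omega> * e n q \<omega>))" if "n \<in> {1..N}" "p \<in> P" "q \<in> P" for n p q
    using that by (intro square_integrable_var_cmult xe)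
  have u: "expectation (\<lambda>\<omega>. (weight * (x n p \<omega> * e n q \<omega>)) * (weight * (x m p \<omega> * e m q \<omega>))) = 0"
    if "n \<in> {1..N}" "m \<in> {1..N}" "n \<noteq> m" "p \<in> P" "q \<in> P" for n m p q
  proof -
    have "expectation (\<lambda>\<omega>. (weight * (x n p \<omega> * e n q \<omega>)) * (weight * (x m p \<omega> * e m q \<omega>)))
        = expectation (\<lambda>\<omega>. weight\<^sup>2 * ((x n p \<omega> * e n q \<omega>) * (x m p \<omega> * e m q \<omega>)))"
      by (simp add: power2_eq_square ac_simps)
    also have "\<dots> = 0" using xe_uncorrelated[OF that] by simp
    finally show ?thesis .
  qed
  have v: "expectation (\<lambda>\<omega>. (weight * (x n p \<omega> * e n q \<omega>))\<^sup>2) \<le> weight\<^sup>2 * (\<Gamma> * \<tau>2)"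
    if "n \<in> {1..N}" "p \<in> P" "q \<in> P" for n p q
    using xe_le[OF that] by (simp add: power_mult_distrib[of weight] mult_left_mono)
  have v': "(\<Sum>r\<in>P \<times> P. expectation (\<lambda>\<omega>. (weight * (x n (fst r) \<omega> * e n (snd r) \<omega>))\<^sup>2)) \<le> \<Gamma> * \<tau>2"
    "(\<Sum>r\<in>P \<times> P. expectation (\<lambda>\<omega>. (weight * (x n (snd r) \<omega> * e n (fst r) \<omega>))\<^sup>2)) \<le> \<Gamma> * \<tau>2"
    if "n \<in> {1..N}" for n
    by (rule order_trans[OF sum_mono eq_refl[OF weight_sum_const]], use v that in auto)+
  note avg = expectation_L2_set_average_le[OF N finite_cartesian_product[OF P(1) P(1)]]
  show "integrable M cross_part" "expectation cross_part \<le> sqrt (\<Gamma> * \<tau>2 / real N)"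
    unfolding cross_part_def[abs_def]
    using avg[of "\<lambda>n r \<omega>. weight * (x n (fst r) \<omega> * e n (snd r) \<omega>)" "\<Gamma> * \<tau>2"] f u v' by auto
  show "integrable M cross_part'" "expectation cross_part' \<le> sqrt (\<Gamma> * \<tau>2 / real N)"
    unfolding cross_part'_def[abs_def]
    using avg[of "\<lambda>n r \<omega>. weight * (x n (snd r) \<omega> * e n (fst r) \<omega>)" "\<Gamma> * \<tau>2"] f u v' by auto
qed

lemma noise_part: "integrable M noise_part" "expectation noise_part \<le> sqrt (\<kappa> / real N)"
proof -
  let ?d = "\<lambda>r. if fst r = snd r then \<tau>2 else 0"
  let ?f = "\<lambda>n r \<omega>. weight * (e n (fst r) \<omega> * e n (snd r) \<omega> - ?d r)"
  have f: "square_integrable_var (?f n r)" if "n \<in> {1..N}" "r \<in> P \<times> P" for n r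
    using that by (intro square_integrable_var_cmult square_integrable_var_diff square_integrable_var_const e4) auto
  have u: "expectation (\<lambda>\<omega>. ?f n r \<omega> * ?f m r \<omega>) = 0"
    if "n \<in> {1..N}" "m \<in> {1..N}" "n \<noteq> m" "r \<in> P \<times> P" for n m r
  proof -
    have "expectation (\<lambda>\<omega>. ?f n r \<omega> * ?f m r \<omega>) = expectation (\<lambda>\<omega>. weight\<^sup>2 *
        ((e n (fst r) \<omega> * e n (snd r) \<omega> - ?d r) * (e m (fst r) \<omega> * e m (snd r) \<omega> - ?d r)))"
      by (simp add: power2_eq_square ac_simps)
    also have "\<dots> = weight\<^sup>2 * expectation (\<lambda>\<omega>. (e n (fst r) \<omega> * e n (snd r) \<omega> - ?d r) * (e m (fst r) \<omega> * e m (snd r) \<omega> - ?d r))"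
      by (rule integral_mult_right_zero)
    also have "\<dots> = 0"
      using e4_uncorrelated[of n m "fst r" "snd r"] that by auto
    finally show ?thesis .
  qed
  have v: "(\<Sum>r\<in>P \<times> P. expectation (\<lambda>\<omega>. (?f n r \<omega>)\<^sup>2)) \<le> \<kappa>" if n: "n \<in> {1..N}" for n
  proof (rule order_trans[OF sum_mono eq_refl[OF weight_sum_const]])
    fix r assume r: "r \<in> P \<times> P"
    let ?e = "\<lambda>\<omega>. e n (fst r) \<omega> * e n (snd r) \<omega>"
    have k: "square_integrable_var ?e" using n r by (intro e4) auto
    have "expectation (\<lambda>\<omega>. (?f n r \<omega>)\<^sup>2) = weight\<^sup>2 * variance ?e"
      using ee[OF n, of "fst r" "snd r"] r by (auto simp: power_mult_distrib[of weight])
    also have "\<dots> \<le> weight\<^sup>2 * expectation (\<lambda>\<omega>. (?e \<omega>)\<^sup>2)"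
      using variance_eq[OF square_integrable_var_integrable[OF k] square_integrable_var_square[OF k]]
      by (intro mult_left_mono) auto
    also have "\<dots> \<le> weight\<^sup>2 * \<kappa>"
      using r n by (intro mult_left_mono e4_le) auto
    finally show "expectation (\<lambda>\<omega>. (?f n r \<omega>)\<^sup>2) \<le> weight\<^sup>2 * \<kappa>" .
  qed
  show "integrable M noise_part" "expectation noise_part \<le> sqrt (\<kappa> / real N)"
    unfolding noise_part_def[abs_def]
    using expectation_L2_set_average_le[OF N finite_cartesian_product[OF P(1) P(1)], of ?f \<kappa>] f u v by auto
qed

text \<open>The means enter as a rank-one matrix, hence as a sum of squares; its mean is of order
  \<open>1 / N\<close>, while the other centred parts are of order
  \<open>1 / sqrt N\<close>.\<close>

lemma mean_part: "integrable M mean_part" "expectation mean_part \<le> 2 * (\<Gamma> + \<tau>2) / real N"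
proof -
  have sx: "square_integrable_var (mean x p)" and se: "square_integrable_var (mean e p)" if "p \<in> P" for p
    unfolding mean_def[abs_def] using that x e
    by (intro square_integrable_var_cmult square_integrable_var_sum; simp)+
  have ex: "expectation (\<lambda>\<omega>. (mean x p \<omega>)\<^sup>2) \<le> \<Gamma> / real N" if p: "p \<in> P" for p
    unfolding mean_def
  proof (rule expectation_average_square_le[OF N])
    show "expectation (\<lambda>\<omega>. (x n p \<omega>)\<^sup>2) \<le> \<Gamma>" if "n \<in> {1..N}" for n
      using xx[OF that p p] \<gamma>[OF p] by (simp add: power2_eq_square)
  qed (use x xx_uncorrelated p in auto)
  have ee: "expectation (\<lambda>\<omega>. (mean e p \<omega>)\<^sup>2) \<le> \<tau>2 / real N" if p: "p \<in> P" for p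
    unfolding mean_def
  proof (rule expectation_average_square_le[OF N])
    show "expectation (\<lambda>\<omega>. (e n p \<omega>)\<^sup>2) \<le> \<tau>2" if "n \<in> {1..N}" for n
      using ee[OF that p p] by (simp add: power2_eq_square)
  qed (use e ee_uncorrelated p in auto)
  have s: "square_integrable_var (\<lambda>\<omega>. mean x p \<omega> + mean e p \<omega>)" if "p \<in> P" for p
    using that by (intro square_integrable_var_add sx se)
  show int: "integrable M mean_part"
    unfolding mean_part_def[abs_def]
    by (intro integrable_mult_right Bochner_Integration.integrable_sum square_integrable_var_square s)
  have "expectation mean_part \<le> expectation (\<lambda>\<omega>. weight * (\<Sum>p\<in>P. 2 * (mean x p \<omega>)\<^sup>2 + 2 * (mean e p \<omega>)\<^sup>2))"
  proof (rule integral_mono[OF int])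
    show "integrable M (\<lambda>\<omega>. weight * (\<Sum>p\<in>P. 2 * (mean x p \<omega>)\<^sup>2 + 2 * (mean e p \<omega>)\<^sup>2))"
      by (intro integrable_mult_right Bochner_Integration.integrable_sum Bochner_Integration.integrable_add
          square_integrable_var_square sx se)
    have "(a + b)\<^sup>2 \<le> 2 * a\<^sup>2 + 2 * b\<^sup>2" for a b :: real
      using sum_squares_bound[of a b] by (simp add: power2_sum)
    then show "mean_part \<omega> \<le> weight * (\<Sum>p\<in>P. 2 * (mean x p \<omega>)\<^sup>2 + 2 * (mean e p \<omega>)\<^sup>2)" for \<omega>
      unfolding mean_part_def using weight_pos by (intro mult_left_mono sum_mono) auto
  qed
  also have "\<dots> = weight * (\<Sum>p\<in>P. 2 * expectation (\<lambda>\<omega>. (mean x p \<omega>)\<^sup>2) + 2 * expectation (\<lambda>\<omega>. (mean e p \<omega>)\<^sup>2))"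
  proof -
    have i: "integrable M (\<lambda>\<omega>. 2 * (mean x p \<omega>)\<^sup>2)" "integrable M (\<lambda>\<omega>. 2 * (mean e p \<omega>)\<^sup>2)" if "p \<in> P" for p
      using that by (auto intro!: square_integrable_var_square sx se)
    have "expectation (\<lambda>\<omega>. \<Sum>p\<in>P. 2 * (mean x p \<omega>)\<^sup>2 + 2 * (mean e p \<omega>)\<^sup>2)
        = (\<Sum>p\<in>P. expectation (\<lambda>\<omega>. 2 * (mean x p \<omega>)\<^sup>2 + 2 * (mean e p \<omega>)\<^sup>2))"
      by (intro Bochner_Integration.integral_sum Bochner_Integration.integrable_add i)
    also have "\<dots> = (\<Sum>p\<in>P. 2 * expectation (\<lambda>\<omega>. (mean x p \<omega>)\<^sup>2) + 2 * expectation (\<lambda>\<omega>. (mean e p \<omega>)\<^sup>2))"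
      using i by (intro sum.cong refl) (simp add: Bochner_Integration.integral_add)
    finally show ?thesis by simp
  qed
  also have "\<dots> \<le> weight * (\<Sum>p\<in>P. 2 * (\<Gamma> / real N) + 2 * (\<tau>2 / real N))"
    using weight_pos ex ee by (intro mult_left_mono sum_mono add_mono) auto
  also have "\<dots> = (weight * real (card P)) * (2 * (\<Gamma> / real N) + 2 * (\<tau>2 / real N))"
    by simp
  also have "\<dots> = 2 * (\<Gamma> + \<tau>2) / real N"
    unfolding weight_card by (simp add: add_divide_distrib)
  finally show "expectation mean_part \<le> 2 * (\<Gamma> + \<tau>2) / real N" .
qed

lemma dropped_part: "integrable M dropped_part" "expectation dropped_part \<le> \<rho>"
proof -
  let ?r = "\<lambda>n \<omega>. if G n \<omega> then 0 else (\<Sum>p\<in>P. (x n p \<omega>)\<^sup>2) / card P"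
  show "integrable M dropped_part"
    unfolding dropped_part_def[abs_def]
    by (intro integrable_mult_right Bochner_Integration.integrable_sum dropped_norm_integrable)
  have "expectation dropped_part = (1 / real N) * expectation (\<lambda>\<omega>. \<Sum>n=1..N. ?r n \<omega>)"
    unfolding dropped_part_def[abs_def] by (rule integral_mult_right_zero)
  also have "expectation (\<lambda>\<omega>. \<Sum>n=1..N. ?r n \<omega>) = (\<Sum>n=1..N. expectation (?r n))"
    by (intro Bochner_Integration.integral_sum dropped_norm_integrable)
  also have "(1 / real N) * \<dots> \<le> (1 / real N) * (\<Sum>n=1..N. \<rho>)"
    using rest_le by (intro mult_left_mono sum_mono) auto
  finally show "expectation dropped_part \<le> \<rho>" using N by simp
qed

definition rate :: real
  where "rate = sqrt V + 2 * sqrt (\<Gamma> * \<tau>2) + sqrt \<kappa> + 2 * (\<Gamma> + \<tau>2)"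

lemma nonneg_parts:
  "0 \<le> kept_part \<omega>" "0 \<le> cross_part \<omega>" "0 \<le> cross_part' \<omega>" "0 \<le> noise_part \<omega>" "0 \<le> mean_part \<omega>"
  "0 \<le> dropped_part \<omega>"
  using weight_pos
  by (simp_all add: kept_part_def cross_part_def cross_part'_def noise_part_def mean_part_def
      dropped_part_def sum_nonneg)

text \<open>Markov is applied twice: to the sum \<open>D\<close> of the vanishing parts at level
  \<open>t\<close>, and to \<open>dropped_part\<close> at level \<open>h / 2\<close>. The other half
  of \<open>h\<close> absorbs the deterministic \<open>\<rho>\<close>, by means of
  \<open>\<eta> \<le> 1 / 2\<close>. In the application \<open>h\<close> is \<open>L * mesh\<close>,
  to which \<open>\<rho>\<close> is proportional.\<close>

lemma deviation_tail:
  assumes t: "0 < t" and h: "0 \<le> h" and \<eta>: "\<rho> \<le> \<eta> * h" "0 \<le> \<eta>" "\<eta> \<le> 1 / 2"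
  shows "prob {\<omega> \<in> space M. h + t < deviation \<mu> \<omega>} \<le> rate / (t * sqrt (real N)) + 2 * \<eta>"
proof -
  define D where "D \<omega> = kept_part \<omega> + cross_part \<omega> + cross_part' \<omega> + noise_part \<omega> + mean_part \<omega>" for \<omega>
  note ints = kept_part(1) cross_parts(1,3) noise_part(1) mean_part(1)
  have D: "integrable M D"
    unfolding D_def[abs_def] using ints by simp
  have "expectation D = expectation kept_part + expectation cross_part + expectation cross_part'
      + expectation noise_part + expectation mean_part"
    unfolding D_def[abs_def] using ints by simp
  also have "\<dots> \<le> sqrt (V / real N) + sqrt (\<Gamma> * \<tau>2 / real N) + sqrt (\<Gamma> * \<tau>2 / real N) + sqrt (\<kappa> / real N)
      + 2 * (\<Gamma> + \<tau>2) / real N"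
    by (intro add_mono kept_part cross_parts noise_part mean_part)
  \<comment> \<open>The order \<open>1 / N\<close> of the means is weakened to
    \<open>1 / sqrt N\<close>; this needs \<open>\<Gamma>\<close> and \<open>\<tau>2\<close> to be
    non-negative, which is read off from second moments at one index.\<close>
  also have "2 * (\<Gamma> + \<tau>2) / real N \<le> 2 * (\<Gamma> + \<tau>2) / sqrt (real N)"
  proof -
    obtain p where p: "p \<in> P" using P by auto
    have "0 \<le> \<Gamma>" "0 \<le> \<tau>2"
      using xx[of 1 p p] \<gamma>[OF p] ee[of 1 p p] p N
        Bochner_Integration.integral_nonneg[of M "\<lambda>\<omega>. x 1 p \<omega> * x 1 p \<omega>"]
        Bochner_Integration.integral_nonneg[of M "\<lambda>\<omega>. e 1 p \<omega> * e 1 p \<omega>"] by auto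
    moreover have "sqrt (real N) \<le> real N"
      using N by (intro real_le_lsqrt) (auto simp: power2_eq_square)
    ultimately show ?thesis using N by (intro divide_left_mono) auto
  qed
  finally have ED: "expectation D \<le> rate / sqrt (real N)"
    by (simp add: rate_def real_sqrt_divide add_divide_distrib)
  have "prob {\<omega> \<in> space M. t \<le> D \<omega>} \<le> expectation D / t"
    by (rule integral_Markov_inequality_measure[OF D, where A = "{}", simplified])
      (use t nonneg_parts in \<open>auto simp: D_def\<close>)
  also have "\<dots> \<le> (rate / sqrt (real N)) / t"
    using t ED by (intro divide_right_mono) auto
  finally have 1: "prob {\<omega> \<in> space M. t \<le> D \<omega>} \<le> rate / (t * sqrt (real N))"
    by (simp add: mult.commute)
  have 2: "prob {\<omega> \<in> space M. h / 2 < dropped_part \<omega>} \<le> 2 * \<eta>"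
  \<comment> \<open>Markov at level \<open>h / 2\<close> requires \<open>h > 0\<close>. For
    \<open>h = 0\<close> the mean of \<open>dropped_part\<close> is 0, so it vanishes almost
    surely.\<close>
  proof (cases "h = 0")
    case True
    moreover have "0 \<le> expectation dropped_part"
      using nonneg_parts(6) by (intro Bochner_Integration.integral_nonneg)
    ultimately have "expectation dropped_part = 0"
      using dropped_part(2) \<eta>(1) by simp
    then have "AE \<omega> in M. dropped_part \<omega> = 0"
      using integral_nonneg_eq_0_iff_AE[OF dropped_part(1)] nonneg_parts(6) by auto
    then have "prob {\<omega> \<in> space M. h / 2 < dropped_part \<omega>} = 0"
      using True dropped_part(1) by (subst prob_eq_0) (auto elim: eventually_mono)
    then show ?thesis using \<eta> by simp
  next
    case False
    have "prob {\<omega> \<in> space M. h / 2 < dropped_part \<omega>} \<le> prob {\<omega> \<in> space M. h / 2 \<le> dropped_part \<omega>}"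
      using dropped_part(1) by (intro finite_measure_mono) auto
    also have "\<dots> \<le> expectation dropped_part / (h / 2)"
      by (rule integral_Markov_inequality_measure[OF dropped_part(1), where A = "{}", simplified])
        (use h False nonneg_parts in auto)
    also have "\<dots> \<le> (\<eta> * h) / (h / 2)"
      using dropped_part(2) \<eta>(1) h False by (intro divide_right_mono) auto
    finally show ?thesis using False by simp
  qed
  have "\<rho> \<le> h / 2" using \<eta> h mult_right_mono[of \<eta> "1/2" h] by simp
  have "h / 2 < dropped_part \<omega>" if "h + t < deviation \<mu> \<omega>" "\<not> t \<le> D \<omega>" for \<omega>
    using that deviation_le[of \<mu> \<omega>] \<open>\<rho> \<le> h / 2\<close> unfolding D_def by linarith
  then have "{\<omega> \<in> space M. h + t < deviation \<mu> \<omega>} \<subseteq> {\<omega> \<in> space M. t \<le> D \<omega>} \<union> {\<omega> \<in> space M. h / 2 < dropped_part \<omega>}"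
    by blast
  then have "prob {\<omega> \<in> space M. h + t < deviation \<mu> \<omega>} \<le> prob ({\<omega> \<in> space M. t \<le> D \<omega>} \<union> {\<omega> \<in> space M. h / 2 < dropped_part \<omega>})"
    using D dropped_part(1) by (intro finite_measure_mono) auto
  also have "\<dots> \<le> prob {\<omega> \<in> space M. t \<le> D \<omega>} + prob {\<omega> \<in> space M. h / 2 < dropped_part \<omega>}"
    using D dropped_part(1) by (intro measure_Un_le) auto
  finally show ?thesis using 1 2 by linarith
qed

end

section \<open>Covariance operators and local averages\<close>

text \<open>Meant for normalized indicators of disjoint sets, which are orthonormal but not given as
  part of a basis.\<close>

lemma bessel_finite:
  fixes v :: "'i \<Rightarrow> 'a::real_inner"
  assumes J: "finite J" and v: "\<And>r s. r \<in> J \<Longrightarrow> s \<in> J \<Longrightarrow> inner (v r) (v s) = (if r = s then 1 else 0)"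
  shows "(\<Sum>r\<in>J. (inner x (v r))\<^sup>2) \<le> (norm x)\<^sup>2"
proof -
  define s where "s = (\<Sum>r\<in>J. inner x (v r) *\<^sub>R v r)"
  have xs: "inner x s = (\<Sum>r\<in>J. (inner x (v r))\<^sup>2)"
    by (simp add: s_def inner_sum_right power2_eq_square)
  have vs: "inner (v r) s = inner x (v r)" if r: "r \<in> J" for r
  proof -
    have "inner (v r) s = (\<Sum>q\<in>J. if r = q then inner x (v q) else 0)"
      unfolding s_def inner_sum_right by (intro sum.cong) (auto simp: v r)
    then show ?thesis using J r by simp
  qed
  have "inner s s = (\<Sum>r\<in>J. (inner x (v r))\<^sup>2)"
    by (subst s_def) (simp add: inner_sum_left vs power2_eq_square)
  then have "inner (x - s) (x - s) = (norm x)\<^sup>2 - (\<Sum>r\<in>J. (inner x (v r))\<^sup>2)"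
    using xs by (simp add: inner_diff_left inner_diff_right inner_commute power2_norm_eq_inner)
  then show ?thesis
    using inner_ge_zero[of "x - s"] by simp
qed

context prob_space
begin

text \<open>Cauchy-Schwarz, from the non-negativity of the mean of
  \<open>(t * f + g)\<^sup>2\<close> as a quadratic polynomial in \<open>t\<close>.\<close>

lemma expectation_mult_square_le:
  assumes f: "square_integrable_var f" and g: "square_integrable_var g"
  shows "(expectation (\<lambda>\<omega>. f \<omega> * g \<omega>))\<^sup>2 \<le> expectation (\<lambda>\<omega>. (f \<omega>)\<^sup>2) * expectation (\<lambda>\<omega>. (g \<omega>)\<^sup>2)"
proof -
  let ?a = "expectation (\<lambda>\<omega>. (f \<omega>)\<^sup>2)" and ?b = "expectation (\<lambda>\<omega>. f \<omega> * g \<omega>)"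
    and ?c = "expectation (\<lambda>\<omega>. (g \<omega>)\<^sup>2)"
  have q: "0 \<le> t\<^sup>2 * ?a + 2 * t * ?b + ?c" for t
  proof -
    have "0 \<le> expectation (\<lambda>\<omega>. (t * f \<omega> + g \<omega>)\<^sup>2)" by simp
    also have "(\<lambda>\<omega>. (t * f \<omega> + g \<omega>)\<^sup>2) = (\<lambda>\<omega>. t\<^sup>2 * (f \<omega>)\<^sup>2 + (2 * t) * (f \<omega> * g \<omega>) + (g \<omega>)\<^sup>2)"
      by (auto simp: power2_eq_square algebra_simps)
    also have "expectation \<dots> = t\<^sup>2 * ?a + (2 * t) * ?b + ?c"
      using square_integrable_var_mult[OF f g] square_integrable_var_square[OF f] square_integrable_var_square[OF g]
      by simp
    finally show ?thesis .
  qed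
  have a: "0 \<le> ?a" and c: "0 \<le> ?c" by simp_all
  show ?thesis
  proof (cases "?a = 0")
    case True
    have "?b = 0"
    proof (rule ccontr)
      assume b: "?b \<noteq> 0"
      \<comment> \<open>Without quadratic term the polynomial is linear; if its slope were nonzero,
        it would take the value -1 at this \<open>t\<close>.\<close>
      have "2 * (- (?c + 1) / (2 * ?b)) * ?b = - (?c + 1)" using b by simp
      with q[of "- (?c + 1) / (2 * ?b)"] True show False by simp
    qed
    then show ?thesis using True by simp
  next
    case False
    with a have a: "0 < ?a" by (metis order_le_less)
    \<comment> \<open>\<open>t = - ?b / ?a\<close> minimizes the polynomial.\<close>
    have "(- ?b / ?a)\<^sup>2 * ?a + 2 * (- ?b / ?a) * ?b + ?c = ?c - ?b\<^sup>2 / ?a"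
      using a by (simp add: field_simps power2_eq_square)
    with q[of "- ?b / ?a"] have "?b\<^sup>2 / ?a \<le> ?c" by simp
    then show ?thesis using a by (simp add: field_simps)
  qed
qed

text \<open>Continuity of the inner product in mean square, from
  \<open>f g - F G = p q - p G - F q\<close> with \<open>p = F - f\<close> and
  \<open>q = G - g\<close>.\<close>

lemma expectation_mult_tendsto:
  assumes f: "\<And>k. square_integrable_var (f k)" "square_integrable_var F"
    and g: "\<And>k. square_integrable_var (g k)" "square_integrable_var G"
    and lim: "(\<lambda>k. expectation (\<lambda>\<omega>. (F \<omega> - f k \<omega>)\<^sup>2)) \<longlonglongrightarrow> 0"
      "(\<lambda>k. expectation (\<lambda>\<omega>. (G \<omega> - g k \<omega>)\<^sup>2)) \<longlonglongrightarrow> 0"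
  shows "(\<lambda>k. expectation (\<lambda>\<omega>. f k \<omega> * g k \<omega>)) \<longlonglongrightarrow> expectation (\<lambda>\<omega>. F \<omega> * G \<omega>)"
proof -
  let ?n = "\<lambda>h. sqrt (expectation (\<lambda>\<omega>. (h \<omega>)\<^sup>2))"
  let ?p = "\<lambda>k \<omega>. F \<omega> - f k \<omega>" and ?q = "\<lambda>k \<omega>. G \<omega> - g k \<omega>"
  have cs: "\<bar>expectation (\<lambda>\<omega>. h \<omega> * h' \<omega>)\<bar> \<le> ?n h * ?n h'"
    if "square_integrable_var h" "square_integrable_var h'" for h h'
    using real_sqrt_le_mono[OF expectation_mult_square_le[OF that]] by (simp add: real_sqrt_mult)
  note d = square_integrable_var_diff[OF f(2) f(1)] square_integrable_var_diff[OF g(2) g(1)]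
  have "(\<lambda>k. expectation (\<lambda>\<omega>. f k \<omega> * g k \<omega>) - expectation (\<lambda>\<omega>. F \<omega> * G \<omega>)) \<longlonglongrightarrow> 0"
  proof (rule Lim_null_comparison)
    show "\<forall>\<^sub>F k in sequentially. norm (expectation (\<lambda>\<omega>. f k \<omega> * g k \<omega>) - expectation (\<lambda>\<omega>. F \<omega> * G \<omega>))
        \<le> ?n (?p k) * ?n (?q k) + ?n (?p k) * ?n G + ?n F * ?n (?q k)"
    proof (rule always_eventually, rule allI)
      fix k
      have "expectation (\<lambda>\<omega>. f k \<omega> * g k \<omega>) - expectation (\<lambda>\<omega>. F \<omega> * G \<omega>)
          = expectation (\<lambda>\<omega>. ?p k \<omega> * ?q k \<omega> - ?p k \<omega> * G \<omega> - F \<omega> * ?q k \<omega>)"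
        by (subst Bochner_Integration.integral_diff[symmetric])
          (auto intro!: square_integrable_var_mult f g Bochner_Integration.integral_cong simp: algebra_simps)
      also have "\<dots> = expectation (\<lambda>\<omega>. ?p k \<omega> * ?q k \<omega>) - expectation (\<lambda>\<omega>. ?p k \<omega> * G \<omega>) - expectation (\<lambda>\<omega>. F \<omega> * ?q k \<omega>)"
        using square_integrable_var_mult[OF d] square_integrable_var_mult[OF d(1) g(2)] square_integrable_var_mult[OF f(2) d(2)]
        by simp
      finally show "norm (expectation (\<lambda>\<omega>. f k \<omega> * g k \<omega>) - expectation (\<lambda>\<omega>. F \<omega> * G \<omega>))
        \<le> ?n (?p k) * ?n (?q k) + ?n (?p k) * ?n G + ?n F * ?n (?q k)"
        using cs[OF d(1)[of k] d(2)[of k]] cs[OF d(1)[of k] g(2)] cs[OF f(2) d(2)[of k]] by simp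
    qed
    have "(\<lambda>k. ?n (?p k) * ?n (?q k) + ?n (?p k) * ?n G + ?n F * ?n (?q k)) \<longlonglongrightarrow>
        sqrt 0 * sqrt 0 + sqrt 0 * ?n G + ?n F * sqrt 0"
      by (intro tendsto_intros lim)
    then show "(\<lambda>k. ?n (?p k) * ?n (?q k) + ?n (?p k) * ?n G + ?n F * ?n (?q k)) \<longlonglongrightarrow> 0"
      by simp
  qed
  then show ?thesis by (simp add: LIM_zero_iff)
qed

text \<open>
  No moments of the almost sure limit \<open>\<xi>\<close> are assumed. The centred sequence converges almost surely
  because its increments are summable in mean, so the means converge, and Fatou's lemma applies.
\<close>

lemma limit_square_integrable:
  assumes V: "\<And>k. square_integrable_var (V k)" and \<xi>: "\<xi> \<in> borel_measurable M"
    and lim: "AE \<omega> in M. (\<lambda>k. V k \<omega>) \<longlonglongrightarrow> \<xi> \<omega>"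
    and le: "\<And>k l. k \<le> l \<Longrightarrow>
      expectation (\<lambda>\<omega>. ((V l \<omega> - expectation (V l)) - (V k \<omega> - expectation (V k)))\<^sup>2) \<le> \<epsilon> k"
    and summable: "summable (\<lambda>k. sqrt (\<epsilon> k))"
  shows "square_integrable_var \<xi>"
    and "\<And>k. expectation (\<lambda>\<omega>. ((\<xi> \<omega> - expectation \<xi>) - (V k \<omega> - expectation (V k)))\<^sup>2) \<le> \<epsilon> k"
proof -
  define U where "U k \<omega> = V k \<omega> - expectation (V k)" for k \<omega>
  have U: "square_integrable_var (U k)" for k
    unfolding U_def by (intro square_integrable_var_diff square_integrable_var_const V)
  have Ud: "square_integrable_var (\<lambda>\<omega>. U l \<omega> - U k \<omega>)" for k l
    by (intro square_integrable_var_diff U)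
  have [measurable]: "U k \<in> borel_measurable M" "V k \<in> borel_measurable M" for k
    using U V by auto
  note [measurable] = \<xi>
  have \<epsilon>: "0 \<le> \<epsilon> k" for k
    using le[of k k] by simp
  have EU: "expectation (U k) = 0" for k
    unfolding U_def using square_integrable_var_integrable[OF V] by (simp add: prob_space)
  have incr: "expectation (\<lambda>\<omega>. \<bar>U (Suc k) \<omega> - U k \<omega>\<bar>) \<le> sqrt (\<epsilon> k)" for k
  proof (rule expectation_le_sqrt)
    show "square_integrable_var (\<lambda>\<omega>. \<bar>U (Suc k) \<omega> - U k \<omega>\<bar>)"
      by (rule square_integrable_var_bound[OF _ Ud]) auto
    show "expectation (\<lambda>\<omega>. \<bar>U (Suc k) \<omega> - U k \<omega>\<bar>\<^sup>2) \<le> \<epsilon> k"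
      using le[of k "Suc k"] by (simp add: U_def)
  qed
  have "(\<integral>\<^sup>+\<omega>. (\<Sum>k. ennreal \<bar>U (Suc k) \<omega> - U k \<omega>\<bar>) \<partial>M) = (\<Sum>k. \<integral>\<^sup>+\<omega>. ennreal \<bar>U (Suc k) \<omega> - U k \<omega>\<bar> \<partial>M)"
    by (rule nn_integral_suminf) simp
  also have "\<dots> \<le> (\<Sum>k. ennreal (sqrt (\<epsilon> k)))"
  proof (intro suminf_le)
    fix k
    have "(\<integral>\<^sup>+\<omega>. ennreal \<bar>U (Suc k) \<omega> - U k \<omega>\<bar> \<partial>M) = ennreal (expectation (\<lambda>\<omega>. \<bar>U (Suc k) \<omega> - U k \<omega>\<bar>))"
      by (intro nn_integral_eq_integral integrable_abs square_integrable_var_integrable Ud) simp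
    then show "(\<integral>\<^sup>+\<omega>. ennreal \<bar>U (Suc k) \<omega> - U k \<omega>\<bar> \<partial>M) \<le> ennreal (sqrt (\<epsilon> k))"
      using incr[of k] by (simp add: ennreal_leI)
  qed auto
  also have "\<dots> = ennreal (\<Sum>k. sqrt (\<epsilon> k))"
    by (intro suminf_ennreal2 summable) (simp add: \<epsilon>)
  finally have "(\<integral>\<^sup>+\<omega>. (\<Sum>k. ennreal \<bar>U (Suc k) \<omega> - U k \<omega>\<bar>) \<partial>M) \<noteq> \<infinity>"
    by (auto simp: top_unique)
  then have "AE \<omega> in M. (\<Sum>k. ennreal \<bar>U (Suc k) \<omega> - U k \<omega>\<bar>) \<noteq> \<infinity>"
    by (intro nn_integral_PInf_AE) auto
  then have conv: "AE \<omega> in M. convergent (\<lambda>k. U k \<omega>)"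
  proof eventually_elim
    case (elim \<omega>)
    then have "summable (\<lambda>k. \<bar>U (Suc k) \<omega> - U k \<omega>\<bar>)"
      by (intro summable_suminf_not_top) auto
    then have "summable (\<lambda>k. U (Suc k) \<omega> - U k \<omega>)"
      by (rule summable_rabs_cancel)
    then have "convergent (\<lambda>m. \<Sum>k<m. U (Suc k) \<omega> - U k \<omega>)"
      by (simp add: summable_iff_convergent)
    then have "convergent (\<lambda>m. U m \<omega> - U 0 \<omega>)"
      by (simp only: sum_lessThan_telescope[of "\<lambda>k. U k \<omega>"])
    from convergent_add[OF this convergent_const[of "U 0 \<omega>"]] show ?case by simp
  qed
  \<comment> \<open>One outcome at which both sequences converge is enough: their difference is the
    deterministic sequence of means.\<close>
  have "\<exists>\<omega>\<in>space M. (\<lambda>k. V k \<omega>) \<longlonglongrightarrow> \<xi> \<omega> \<and> convergent (\<lambda>k. U k \<omega>)"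
  proof (rule ccontr)
    assume *: "\<not> ?thesis"
    have "AE \<omega> in M. False"
      using lim conv AE_space
    proof eventually_elim
      case (elim \<omega>)
      with * show False by blast
    qed
    then show False using AE_False prob_space by (simp add: AE_iff_null)
  qed
  then obtain \<omega>0 where "(\<lambda>k. V k \<omega>0) \<longlonglongrightarrow> \<xi> \<omega>0" "convergent (\<lambda>k. U k \<omega>0)" by auto
  then have "convergent (\<lambda>k. V k \<omega>0 - U k \<omega>0)"
    by (intro convergent_diff) (auto intro: convergentI)
  then obtain a where a: "(\<lambda>k. expectation (V k)) \<longlonglongrightarrow> a"
    by (auto simp: U_def convergent_def)
  have fatou: "(\<integral>\<^sup>+\<omega>. ennreal (((\<xi> \<omega> - a) - U k \<omega>)\<^sup>2) \<partial>M) \<le> ennreal (\<epsilon> k)" for k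
  proof -
    have "(\<integral>\<^sup>+\<omega>. ennreal (((\<xi> \<omega> - a) - U k \<omega>)\<^sup>2) \<partial>M) = (\<integral>\<^sup>+\<omega>. liminf (\<lambda>l. ennreal ((U l \<omega> - U k \<omega>)\<^sup>2)) \<partial>M)"
    proof (rule nn_integral_cong_AE)
      show "AE \<omega> in M. ennreal (((\<xi> \<omega> - a) - U k \<omega>)\<^sup>2) = liminf (\<lambda>l. ennreal ((U l \<omega> - U k \<omega>)\<^sup>2))"
        using lim
      proof eventually_elim
        case (elim \<omega>)
        have "(\<lambda>l. U l \<omega>) \<longlonglongrightarrow> \<xi> \<omega> - a"
          unfolding U_def by (intro tendsto_diff elim a)
        then have "(\<lambda>l. ennreal ((U l \<omega> - U k \<omega>)\<^sup>2)) \<longlonglongrightarrow> ennreal (((\<xi> \<omega> - a) - U k \<omega>)\<^sup>2)"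
          by (intro tendsto_intros)
        from lim_imp_Liminf[OF _ this] show ?case by simp
      qed
    qed
    also have "\<dots> \<le> liminf (\<lambda>l. \<integral>\<^sup>+\<omega>. ennreal ((U l \<omega> - U k \<omega>)\<^sup>2) \<partial>M)"
      by (intro nn_integral_liminf) simp
    also have "\<dots> \<le> ennreal (\<epsilon> k)"
    proof (intro Liminf_le eventually_mono[OF eventually_ge_at_top[of k]])
      fix l assume "k \<le> l"
      then show "(\<integral>\<^sup>+\<omega>. ennreal ((U l \<omega> - U k \<omega>)\<^sup>2) \<partial>M) \<le> ennreal (\<epsilon> k)"
        using le[of k l] square_integrable_var_square[OF Ud[of l k]]
        by (subst nn_integral_eq_integral) (auto simp: U_def intro: ennreal_leI)
    qed auto
    finally show ?thesis .
  qed
  have D: "square_integrable_var (\<lambda>\<omega>. (\<xi> \<omega> - a) - U k \<omega>)" for k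
    unfolding square_integrable_var_def using fatou[of k]
    by (auto intro!: integrableI_bounded intro: le_less_trans)
  have DE: "expectation (\<lambda>\<omega>. ((\<xi> \<omega> - a) - U k \<omega>)\<^sup>2) \<le> \<epsilon> k" for k
    using fatou[of k] \<epsilon>[of k] square_integrable_var_square[OF D[of k]]
    by (subst (asm) nn_integral_eq_integral) auto
  have "square_integrable_var (\<lambda>\<omega>. ((\<xi> \<omega> - a) - U 0 \<omega>) + (U 0 \<omega> + a))"
    by (intro square_integrable_var_add D U square_integrable_var_const)
  then show sq: "square_integrable_var \<xi>" by simp
  have "(\<lambda>k. sqrt (\<epsilon> k)) \<longlonglongrightarrow> 0"
    using summable by (rule summable_LIMSEQ_zero)
  \<comment> \<open>\<open>U k\<close> has mean 0, so the mean of \<open>(\<xi> - a) - U k\<close>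
    is \<open>expectation \<xi> - a\<close>. Its square is at most \<open>\<epsilon> k\<close>,
    which tends to 0 and identifies \<open>a\<close> as the mean of \<open>\<xi>\<close>.\<close>
  moreover have "\<bar>expectation \<xi> - a\<bar> \<le> sqrt (\<epsilon> k)" for k
  proof -
    have "expectation (\<lambda>\<omega>. (\<xi> \<omega> - a) - U k \<omega>) = expectation \<xi> - a"
      using square_integrable_var_integrable[OF sq] square_integrable_var_integrable[OF U] EU
      by (simp add: prob_space)
    then have "(expectation \<xi> - a)\<^sup>2 \<le> \<epsilon> k"
      using expectation_square_le[OF D[of k]] DE[of k] by simp
    then show ?thesis using real_sqrt_le_mono by fastforce
  qed
  ultimately have "\<bar>expectation \<xi> - a\<bar> \<le> 0"
    by (intro LIMSEQ_le_const) auto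
  then have "a = expectation \<xi>" by simp
  then show "expectation (\<lambda>\<omega>. ((\<xi> \<omega> - expectation \<xi>) - (V k \<omega> - expectation (V k)))\<^sup>2) \<le> \<epsilon> k" for k
    using DE[of k] by (simp add: U_def)
qed

section \<open>The covariance operator in weak form\<close>

context
  fixes X :: "'a \<Rightarrow> 'b::euclidean_space L2"
  assumes X: "X \<in> borel_measurable M" and X2: "integrable M (\<lambda>\<omega>. (norm (X \<omega>))\<^sup>2)"
begin

lemma random_element_integrable: "integrable M X"
proof (rule Bochner_Integration.integrable_bound[OF _ X])
  show "integrable M (\<lambda>\<omega>. 1 + (norm (X \<omega>))\<^sup>2)" using X2 by simp
  have "t \<le> 1 + t\<^sup>2" for t :: real
  proof -
    have "2 * t \<le> t\<^sup>2 + 1" using sum_squares_bound[of t 1] by simp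
    then show ?thesis using zero_le_power2[of t] by linarith
  qed
  then show "AE \<omega> in M. norm (X \<omega>) \<le> norm (1 + (norm (X \<omega>))\<^sup>2)"
    by (intro AE_I2) simp
qed

lemma centred_norm_square_integrable: "integrable M (\<lambda>\<omega>. (norm (X \<omega> - u))\<^sup>2)"
proof (rule Bochner_Integration.integrable_bound)
  show "integrable M (\<lambda>\<omega>. 2 * (norm (X \<omega>))\<^sup>2 + 2 * (norm u)\<^sup>2)"
    using X2 by simp
  show "(\<lambda>\<omega>. (norm (X \<omega> - u))\<^sup>2) \<in> borel_measurable M" using X by measurable
  have "(norm (x - u))\<^sup>2 \<le> 2 * (norm x)\<^sup>2 + 2 * (norm u)\<^sup>2" for x
  proof -
    have "(norm (x - u))\<^sup>2 \<le> (norm x + norm u)\<^sup>2"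
      by (intro power_mono norm_triangle_ineq4) simp
    also have "\<dots> \<le> 2 * (norm x)\<^sup>2 + 2 * (norm u)\<^sup>2"
      using sum_squares_bound[of "norm x" "norm u"] by (simp add: power2_sum)
    finally show ?thesis .
  qed
  then show "AE \<omega> in M. norm ((norm (X \<omega> - u))\<^sup>2) \<le> norm (2 * (norm (X \<omega>))\<^sup>2 + 2 * (norm u)\<^sup>2)"
    by (intro AE_I2) simp
qed

lemma inner_square_integrable: "square_integrable_var (\<lambda>\<omega>. inner (X \<omega> - u) g)"
  unfolding square_integrable_var_def
proof
  show m: "(\<lambda>\<omega>. inner (X \<omega> - u) g) \<in> borel_measurable M" using X by measurable
  show "integrable M (\<lambda>\<omega>. (inner (X \<omega> - u) g)\<^sup>2)"
  proof (rule Bochner_Integration.integrable_bound)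
    show "integrable M (\<lambda>\<omega>. (norm (X \<omega> - u))\<^sup>2 * (norm g)\<^sup>2)"
      using centred_norm_square_integrable by simp
    show "AE \<omega> in M. norm ((inner (X \<omega> - u) g)\<^sup>2) \<le> norm ((norm (X \<omega> - u))\<^sup>2 * (norm g)\<^sup>2)"
      using Cauchy_Schwarz_ineq by (intro AE_I2) (simp add: power2_norm_eq_inner)
  qed (use m in simp)
qed

lemma expectation_inner: "expectation (\<lambda>\<omega>. inner (X \<omega>) g) = inner (expectation X) g"
  using random_element_integrable by (rule integral_inner_left)

text \<open>The operator is defined through \<open>Blinfun\<close>, so it acts as the Bochner
  integral only once that integral is shown to be bounded linear in \<open>f\<close>, with the mean
  of the squared norm as bound. Testing with \<open>g\<close> then moves the inner product under the
  integral.\<close>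

lemma inner_covariance:
  "inner g (blinfun_apply (covariance M X) f)
    = expectation (\<lambda>\<omega>. inner (X \<omega> - expectation X) g * inner (X \<omega> - expectation X) f)"
proof -
  define Y where "Y \<omega> = X \<omega> - expectation X" for \<omega>
  have [measurable]: "Y \<in> borel_measurable M" unfolding Y_def using X by measurable
  have Y2: "integrable M (\<lambda>\<omega>. (norm (Y \<omega>))\<^sup>2)"
    unfolding Y_def by (rule centred_norm_square_integrable)
  have le: "norm (inner (Y \<omega>) f *\<^sub>R Y \<omega>) \<le> norm f * (norm (Y \<omega>))\<^sup>2" for \<omega> f
    using mult_right_mono[OF Cauchy_Schwarz_ineq2[of "Y \<omega>" f] norm_ge_zero[of "Y \<omega>"]]
    by (simp add: power2_eq_square ac_simps)
  have int: "integrable M (\<lambda>\<omega>. inner (Y \<omega>) f *\<^sub>R Y \<omega>)" for f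
    by (rule Bochner_Integration.integrable_bound[OF integrable_mult_right[OF Y2, of "norm f"]])
      (use le in \<open>auto simp: abs_mult intro: AE_I2\<close>)
  have "bounded_linear (\<lambda>f. LINT \<omega>|M. inner (Y \<omega>) f *\<^sub>R Y \<omega>)"
  proof (rule bounded_linear_intro[where K = "expectation (\<lambda>\<omega>. (norm (Y \<omega>))\<^sup>2)"])
    show "(LINT \<omega>|M. inner (Y \<omega>) (f + f') *\<^sub>R Y \<omega>)
        = (LINT \<omega>|M. inner (Y \<omega>) f *\<^sub>R Y \<omega>) + (LINT \<omega>|M. inner (Y \<omega>) f' *\<^sub>R Y \<omega>)" for f f'
      using int by (simp add: inner_add_right scaleR_add_left)
    show "(LINT \<omega>|M. inner (Y \<omega>) (r *\<^sub>R f) *\<^sub>R Y \<omega>) = r *\<^sub>R (LINT \<omega>|M. inner (Y \<omega>) f *\<^sub>R Y \<omega>)" for r f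
      by (simp flip: scaleR_scaleR)
    show "norm (LINT \<omega>|M. inner (Y \<omega>) f *\<^sub>R Y \<omega>) \<le> norm f * expectation (\<lambda>\<omega>. (norm (Y \<omega>))\<^sup>2)" for f
    proof -
      have "norm (LINT \<omega>|M. inner (Y \<omega>) f *\<^sub>R Y \<omega>) \<le> (LINT \<omega>|M. norm (inner (Y \<omega>) f *\<^sub>R Y \<omega>))"
        by (rule integral_norm_bound)
      also have "\<dots> \<le> (LINT \<omega>|M. norm f * (norm (Y \<omega>))\<^sup>2)"
        by (intro integral_mono integrable_norm int integrable_mult_right Y2 le)
      finally show ?thesis by simp
    qed
  qed
  then have "blinfun_apply (covariance M X) f = (LINT \<omega>|M. inner (Y \<omega>) f *\<^sub>R Y \<omega>)"
    unfolding covariance_def Let_def rank_one_apply Y_def by (simp add: bounded_linear_Blinfun_apply)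
  then have "inner g (blinfun_apply (covariance M X) f) = (LINT \<omega>|M. inner g (inner (Y \<omega>) f *\<^sub>R Y \<omega>))"
    using integral_inner_right[OF int, of g f] by simp
  also have "\<dots> = expectation (\<lambda>\<omega>. inner (Y \<omega>) g * inner (Y \<omega>) f)"
    by (simp add: inner_commute mult.commute)
  finally show ?thesis by (simp add: Y_def)
qed

end

end

section \<open>Averages over shrinking boxes\<close>

definition local_average :: "'a::euclidean_space set \<Rightarrow> 'a L2 \<Rightarrow> real"
  where "local_average Q f = inner f (abs_L2 (indicator Q)) / measure lborel Q"

lemma local_average_measurable [measurable]: "local_average Q \<in> borel_measurable borel"
  unfolding local_average_def by measurable

lemma local_average_tendsto:
  fixes x :: "'a::euclidean_space \<Rightarrow> real"
  assumes x: "continuous_on (cbox 0 One) x" and p: "p \<in> cbox 0 One"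
    and Q: "\<And>k. Q k \<in> sets borel" "\<And>k. Q k \<subseteq> cbox 0 One" "\<And>k. 0 < measure lborel (Q k)"
    and r: "\<And>k q. q \<in> Q k \<Longrightarrow> dist q p \<le> r k" "r \<longlonglongrightarrow> 0"
  shows "(\<lambda>k. local_average (Q k) (abs_L2 x)) \<longlonglongrightarrow> x p"
proof (rule LIMSEQ_I)
  fix \<epsilon> :: real assume \<epsilon>: "0 < \<epsilon>"
  then obtain d where d: "0 < d" "\<And>q. q \<in> cbox 0 One \<Longrightarrow> dist q p < d \<Longrightarrow> dist (x q) (x p) < \<epsilon> / 2"
    using x p unfolding continuous_on_iff by (meson half_gt_zero)
  obtain k0 where k0: "\<And>k. k0 \<le> k \<Longrightarrow> \<bar>r k\<bar> < d"
    using LIMSEQ_D[OF r(2) d(1)] by auto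
  have "norm (local_average (Q k) (abs_L2 x) - x p) < \<epsilon>" if k: "k0 \<le> k" for k
  proof -
    let ?m = "measure lborel (Q k)"
    have sx: "x \<in> square_integrable" by (rule continuous_on_square_integrable[OF x])
    have sQ: "indicator (Q k) \<in> square_integrable" by (rule square_integrable_indicator[OF Q(1)])
    have int: "integrable cube_measure (\<lambda>q. x q * indicator (Q k) q)" "integrable cube_measure (indicator (Q k) :: 'a \<Rightarrow> real)"
      using square_integrable_mult[OF sx sQ] square_integrable_imp_integrable[OF sQ] by auto
    have m: "measure cube_measure (Q k \<inter> cbox 0 One) = ?m"
      by (rule measure_cube[OF Q(1,2)])
    have "inner (abs_L2 x) (abs_L2 (indicator (Q k))) - x p * ?m = (LINT q|cube_measure. x q * indicator (Q k) q - x p * indicator (Q k) q)"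
      using int by (simp add: inner_abs_L2[OF sx sQ] m)
    also have "\<bar>\<dots>\<bar> \<le> (LINT q|cube_measure. \<bar>x q * indicator (Q k) q - x p * indicator (Q k) q\<bar>)"
      by (rule integral_abs_bound)
    also have "\<dots> \<le> (LINT q|cube_measure. (\<epsilon> / 2) * indicator (Q k) q)"
    proof (rule integral_mono)
      fix q :: 'a
      show "\<bar>x q * indicator (Q k) q - x p * indicator (Q k) q\<bar> \<le> (\<epsilon> / 2) * indicator (Q k) q"
      proof (cases "q \<in> Q k")
        case True
        then have "dist q p < d" using r(1)[of q k] k0[OF k] by simp
        then have "dist (x q) (x p) < \<epsilon> / 2" using True Q(2) by (intro d) auto
        then show ?thesis using True by (simp add: dist_real_def)
      qed simp
    qed (use int in auto)
    also have "\<dots> = (\<epsilon> / 2) * ?m" by (simp add: m)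
    finally have "\<bar>inner (abs_L2 x) (abs_L2 (indicator (Q k))) - x p * ?m\<bar> / ?m \<le> \<epsilon> / 2"
      using Q(3)[of k] by (simp add: pos_divide_le_eq)
    moreover have "local_average (Q k) (abs_L2 x) - x p = (inner (abs_L2 x) (abs_L2 (indicator (Q k))) - x p * ?m) / ?m"
      using Q(3)[of k] by (simp add: local_average_def diff_divide_distrib)
    ultimately have "\<bar>local_average (Q k) (abs_L2 x) - x p\<bar> \<le> \<epsilon> / 2"
      using Q(3)[of k] by (simp only: abs_divide abs_of_pos)
    then show ?thesis
      using \<epsilon> by simp
  qed
  then show "\<exists>k0. \<forall>k\<ge>k0. norm (local_average (Q k) (abs_L2 x) - x p) < \<epsilon>" by blast
qed

text \<open>The image of the open box \<open>box a b\<close> under the homothety with centre \<open>p\<close> and ratio \<open>1 / 4 ^ k\<close>.\<close>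

definition shrunk :: "'a::euclidean_space \<Rightarrow> 'a \<Rightarrow> 'a \<Rightarrow> nat \<Rightarrow> 'a set"
  where "shrunk p a b k = box (p + (1 / 4 ^ k) *\<^sub>R (a - p)) (p + (1 / 4 ^ k) *\<^sub>R (b - p))"

text \<open>As a \<open>lim\<close> of continuous functionals this is measurable on all of
  \<open>L2\<close>, including those elements where the limit does not exist and the value has no
  meaning.\<close>

definition point_value :: "'a::euclidean_space \<Rightarrow> 'a \<Rightarrow> 'a \<Rightarrow> 'a L2 \<Rightarrow> real"
  where "point_value p a b f = lim (\<lambda>k. local_average (shrunk p a b k) f)"

lemma point_value_measurable [measurable]: "point_value p a b \<in> borel_measurable borel"
  unfolding point_value_def by measurable

lemma shrunk_borel: "shrunk p a b k \<in> sets borel"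
  by (simp add: shrunk_def)

context
  fixes p a b :: "'a::euclidean_space"
  assumes p: "p \<in> cbox a b" and ab: "\<And>i. i \<in> Basis \<Longrightarrow> a \<bullet> i < b \<bullet> i"
begin

lemma shrunk_component:
  assumes q: "q \<in> shrunk p a b k" and i: "i \<in> Basis"
  shows "(1 / 4 ^ k) * ((a - p) \<bullet> i) < (q - p) \<bullet> i" "(q - p) \<bullet> i < (1 / 4 ^ k) * ((b - p) \<bullet> i)"
proof -
  have "(p + (1 / 4 ^ k) *\<^sub>R (a - p)) \<bullet> i < q \<bullet> i" "q \<bullet> i < (p + (1 / 4 ^ k) *\<^sub>R (b - p)) \<bullet> i"
    using q i unfolding shrunk_def mem_box by auto
  then show "(1 / 4 ^ k) * ((a - p) \<bullet> i) < (q - p) \<bullet> i" "(q - p) \<bullet> i < (1 / 4 ^ k) * ((b - p) \<bullet> i)"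
    unfolding inner_add_left inner_scaleR_left inner_diff_left[of q] by linarith+
qed

lemma point_component: "i \<in> Basis \<Longrightarrow> (a - p) \<bullet> i \<le> 0" "i \<in> Basis \<Longrightarrow> 0 \<le> (b - p) \<bullet> i"
  using p by (auto simp: mem_box inner_diff_left)

text \<open>A contracting homothety centred in the closed box maps the open box into itself, even
  when \<open>p\<close> lies on a face. Pixels contain their open box, so the images stay in the
  pixel whichever endpoints belong to it.\<close>

lemma shrunk_subset: "shrunk p a b k \<subseteq> box a b"
proof
  fix q assume q: "q \<in> shrunk p a b k"
  have \<delta>: "0 \<le> (1 / 4 ^ k :: real)" "(1 / 4 ^ k :: real) \<le> 1" by simp_all
  show "q \<in> box a b"
    unfolding mem_box
  proof (intro ballI conjI)
    fix i :: 'a assume i: "i \<in> Basis"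
    have "(a - p) \<bullet> i \<le> (1 / 4 ^ k) * ((a - p) \<bullet> i)"
      using mult_right_mono_neg[OF \<delta>(2) point_component(1)[OF i]] by simp
    then show "a \<bullet> i < q \<bullet> i"
      using shrunk_component(1)[OF q i] by (simp add: inner_diff_left)
    have "(1 / 4 ^ k) * ((b - p) \<bullet> i) \<le> (b - p) \<bullet> i"
      using mult_right_mono[OF \<delta>(2) point_component(2)[OF i]] by simp
    then show "q \<bullet> i < b \<bullet> i"
      using shrunk_component(2)[OF q i] by (simp add: inner_diff_left)
  qed
qed

lemma shrunk_dist:
  assumes q: "q \<in> shrunk p a b k"
  shows "dist q p \<le> dist a b / 4 ^ k"
proof -
  have "norm (q - p) \<le> norm ((1 / 4 ^ k) *\<^sub>R (b - a))"
  proof (rule norm_le_componentwise)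
    fix i :: 'a assume i: "i \<in> Basis"
    have 0: "0 \<le> (1 / 4 ^ k :: real)" by simp
    have "(1 / 4 ^ k) * ((b - a) \<bullet> i) = (1 / 4 ^ k) * ((b - p) \<bullet> i) - (1 / 4 ^ k) * ((a - p) \<bullet> i)"
      by (simp only: right_diff_distrib[symmetric]) (simp add: inner_diff_left)
    moreover have "(1 / 4 ^ k) * ((a - p) \<bullet> i) \<le> 0" "0 \<le> (1 / 4 ^ k) * ((b - p) \<bullet> i)"
      using point_component[OF i] by (auto simp: mult_nonneg_nonpos intro!: divide_nonpos_pos)
    ultimately have "\<bar>(q - p) \<bullet> i\<bar> \<le> (1 / 4 ^ k) * ((b - a) \<bullet> i)"
      using shrunk_component[OF q i] by linarith
    then show "\<bar>(q - p) \<bullet> i\<bar> \<le> \<bar>(1 / 4 ^ k) *\<^sub>R (b - a) \<bullet> i\<bar>"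
      by (simp only: inner_scaleR_left)
  qed
  then show ?thesis by (simp add: dist_norm norm_minus_commute)
qed

text \<open>In the plane the ratio of areas is \<open>16 ^ k\<close>, the factor that reappears in
  Bessel's inequality for the shrunk boxes.\<close>

lemma measure_shrunk: "measure lborel (shrunk p a b k) = measure lborel (box a b) / (4 ^ k) ^ DIM('a)"
proof -
  have le: "(p + (1 / 4 ^ k) *\<^sub>R (a - p)) \<bullet> i \<le> (p + (1 / 4 ^ k) *\<^sub>R (b - p)) \<bullet> i" if "i \<in> Basis" for i
    using ab[OF that] by (simp add: inner_add_left inner_diff_left divide_right_mono)
  have "measure lborel (shrunk p a b k) = (\<Prod>i\<in>Basis. (1 / 4 ^ k) * ((b - a) \<bullet> i))"
    unfolding shrunk_def using le
    by (simp add: measure_lborel_box_eq inner_add_left inner_diff_left diff_divide_distrib[symmetric])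
  also have "\<dots> = (1 / 4 ^ k) ^ DIM('a) * measure lborel (box a b)"
    using ab by (subst prod.distrib) (simp add: less_imp_le)
  finally show ?thesis by (simp add: power_one_over power_divide)
qed

lemma measure_box_pos: "0 < measure lborel (box a b)"
  using ab by (simp add: less_imp_le inner_diff_left prod_pos)

lemma measure_shrunk_pos: "0 < measure lborel (shrunk p a b k)"
  unfolding measure_shrunk using measure_box_pos by simp

end

text \<open>The covariance identity is assumed in weak form, with \<open>C\<close> as a parameter,
  so that one operator and one kernel are shared by all copies of the surface.\<close>

locale lipschitz_covariance = prob_space M for M :: "'w measure" +
  fixes X :: "'w \<Rightarrow> 'b::euclidean_space L2" and C :: "'b L2 \<Rightarrow>\<^sub>L 'b L2" and c :: "'b \<times> 'b \<Rightarrow> real" and L :: real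
  assumes X: "X \<in> borel_measurable M" and X2: "integrable M (\<lambda>\<omega>. (norm (X \<omega>))\<^sup>2)"
    and cov: "\<And>f g. inner g (blinfun_apply C f)
      = expectation (\<lambda>\<omega>. inner (X \<omega> - expectation X) g * inner (X \<omega> - expectation X) f)"
    and C: "has_kernel C c" and c: "L-lipschitz_on (cbox 0 One) c"
begin

definition centred :: "('w \<Rightarrow> real) \<Rightarrow> 'w \<Rightarrow> real"
  where "centred f \<omega> = f \<omega> - expectation f"

lemma centred_square_integrable: "square_integrable_var f \<Longrightarrow> square_integrable_var (centred f)"
  unfolding centred_def[abs_def] by (intro square_integrable_var_diff square_integrable_var_const)

lemma kernel_square_integrable:
  assumes "p \<in> cbox 0 One"
  shows "(\<lambda>q. c (p, q)) \<in> square_integrable"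
proof (rule continuous_on_square_integrable)
  have "continuous_on (cbox 0 One) (c \<circ> (\<lambda>q. (p, q)))"
    using assms
    by (intro continuous_on_compose continuous_intros
        continuous_on_subset[OF lipschitz_on_continuous_on[OF c]]) (auto simp: cbox_unit_prod)
  then show "continuous_on (cbox 0 One) (\<lambda>q. c (p, q))" by (simp add: o_def)
qed

text \<open>\<open>sqrt 2 * s\<close> bounds the Euclidean norm of a pair of displacements of length
  at most \<open>s\<close>.\<close>

lemma kernel_dist:
  assumes "p \<in> cbox 0 One" "q \<in> cbox 0 One" "u \<in> cbox 0 One" "v \<in> cbox 0 One"
    and "dist u p \<le> s" "dist v q \<le> s"
  shows "\<bar>c (u, v) - c (p, q)\<bar> \<le> sqrt 2 * L * s"
proof -
  have s: "0 \<le> s" using assms(5) zero_le_dist[of u p] by linarith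
  have "dist (c (u, v)) (c (p, q)) \<le> L * dist (u, v) (p, q)"
    using assms by (intro lipschitz_onD[OF c]) (auto simp: cbox_unit_prod)
  also have "dist (u, v) (p, q) \<le> sqrt (s\<^sup>2 + s\<^sup>2)"
    unfolding dist_Pair_Pair using assms by (intro real_sqrt_le_mono add_mono power_mono) auto
  also have "sqrt (s\<^sup>2 + s\<^sup>2) = sqrt 2 * s"
    using s by (simp add: real_sqrt_mult flip: mult_2)
  finally have "dist (c (u, v)) (c (p, q)) \<le> L * (sqrt 2 * s)"
    using lipschitz_on_nonneg[OF c] by (simp add: mult_left_mono)
  then show ?thesis
    by (simp add: dist_real_def ac_simps)
qed

lemma local_average_square_integrable: "square_integrable_var (\<lambda>\<omega>. local_average Q (X \<omega>))"
  unfolding local_average_def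
  using square_integrable_var_cmult[OF inner_square_integrable[OF X X2, of 0 "abs_L2 (indicator Q)"], of "1 / measure lborel Q"]
  by simp

lemma centred_local_average:
  "centred (\<lambda>\<omega>. local_average Q (X \<omega>)) \<omega> = inner (X \<omega> - expectation X) (abs_L2 (indicator Q)) / measure lborel Q"
  using expectation_inner[OF X X2, of "abs_L2 (indicator Q)"]
  by (simp add: centred_def local_average_def inner_diff_left diff_divide_distrib)

text \<open>The covariance of two averages is the mean of the kernel over the product of the two
  sets, hence as close to \<open>c0\<close> as the kernel is there.\<close>

lemma covariance_local_averages:
  assumes Q: "Q \<in> sets borel" "Q \<subseteq> cbox 0 One" "0 < measure lborel Q"
    and Q': "Q' \<in> sets borel" "Q' \<subseteq> cbox 0 One" "0 < measure lborel Q'"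
    and r: "\<And>p q. p \<in> Q \<Longrightarrow> q \<in> Q' \<Longrightarrow> \<bar>c (p, q) - c0\<bar> \<le> r"
  shows "\<bar>expectation (\<lambda>\<omega>. centred (\<lambda>\<omega>. local_average Q (X \<omega>)) \<omega> * centred (\<lambda>\<omega>. local_average Q' (X \<omega>)) \<omega>) - c0\<bar> \<le> r"
proof -
  let ?m = "measure lborel Q * measure lborel Q'"
  let ?i = "inner (abs_L2 (indicator Q)) (blinfun_apply C (abs_L2 (indicator Q')))"
  have "expectation (\<lambda>\<omega>. centred (\<lambda>\<omega>. local_average Q (X \<omega>)) \<omega> * centred (\<lambda>\<omega>. local_average Q' (X \<omega>)) \<omega>) = ?i / ?m"
    unfolding cov centred_local_average by simp
  moreover have "\<bar>?i - c0 * ?m\<bar> \<le> r * ?m"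
    by (rule kernel_indicator_bound[OF C kernel_square_integrable Q(1,2) Q'(1,2) r])
  moreover have m: "0 < ?m" using Q Q' by simp
  moreover have "\<bar>?i / ?m - c0\<bar> = \<bar>?i - c0 * ?m\<bar> / ?m"
  proof -
    have "?i / ?m - c0 = (?i - c0 * ?m) / ?m"
      using Q(3) Q'(3) by (simp add: diff_divide_distrib)
    then show ?thesis using m by simp
  qed
  ultimately show ?thesis by (simp add: pos_divide_le_eq)
qed

end

text \<open>
  Point evaluation is not defined on \<open>L2\<close>. For the class of a continuous function it is recovered as
  the limit of averages over shrinking boxes, which makes the pixel values of the pointwise scheme
  measurable functions of the random surface.
\<close>

locale continuous_surface = lipschitz_covariance M X C c L
  for M :: "'w measure" and X :: "'w \<Rightarrow> 'b::euclidean_space L2" and C c L +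
  fixes x :: "'w \<Rightarrow> 'b \<Rightarrow> real"
  assumes x: "AE \<omega> in M. continuous_on (cbox 0 One) (x \<omega>) \<and> X \<omega> = abs_L2 (x \<omega>)"
begin

context
  fixes p a b :: 'b
  assumes p: "p \<in> cbox a b" and ab: "\<And>i. i \<in> Basis \<Longrightarrow> a \<bullet> i < b \<bullet> i" and sub: "cbox a b \<subseteq> cbox 0 One"
begin

lemma shrunk_facts:
  "shrunk p a b k \<in> sets borel" "shrunk p a b k \<subseteq> cbox 0 One" "0 < measure lborel (shrunk p a b k)"
  using shrunk_borel measure_shrunk_pos[OF p ab] shrunk_subset[OF p ab, of k] sub box_subset_cbox[of a b] by auto

lemma local_average_AE_tendsto: "AE \<omega> in M. (\<lambda>k. local_average (shrunk p a b k) (X \<omega>)) \<longlonglongrightarrow> x \<omega> p"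
  using x
proof eventually_elim
  case (elim \<omega>)
  have "(\<lambda>k. dist a b * (1 / 4) ^ k) \<longlonglongrightarrow> dist a b * 0"
    by (intro tendsto_mult tendsto_const LIMSEQ_realpow_zero) auto
  then have "(\<lambda>k. dist a b / 4 ^ k) \<longlonglongrightarrow> 0"
    by (simp add: power_one_over)
  then have "(\<lambda>k. local_average (shrunk p a b k) (abs_L2 (x \<omega>))) \<longlonglongrightarrow> x \<omega> p"
    using elim p sub shrunk_facts shrunk_dist[OF p ab]
    by (intro local_average_tendsto[where r = "\<lambda>k. dist a b / 4 ^ k"]) auto
  then show ?case using elim by simp
qed

lemma point_value_AE: "AE \<omega> in M. point_value p a b (X \<omega>) = x \<omega> p"
  using local_average_AE_tendsto by eventually_elim (simp add: point_value_def limI)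

text \<open>An increment of local averages has variance \<open>R l l - 2 * R l k + R k k\<close>.
  All these covariances are within the same error of \<open>c (p, p)\<close>, the common value
  cancels, and four errors remain, counted by the leading 4. The bound then passes to the limit by
  \<open>limit_square_integrable\<close>.\<close>

lemma point_value_approximation:
  shows "square_integrable_var (\<lambda>\<omega>. point_value p a b (X \<omega>))"
    and "expectation (\<lambda>\<omega>. (centred (\<lambda>\<omega>. point_value p a b (X \<omega>)) \<omega>
        - centred (\<lambda>\<omega>. local_average (shrunk p a b k) (X \<omega>)) \<omega>)\<^sup>2) \<le> 4 * sqrt 2 * L * dist a b / 4 ^ k"
proof -
  let ?V = "\<lambda>k \<omega>. local_average (shrunk p a b k) (X \<omega>)" and ?\<epsilon> = "\<lambda>k. 4 * sqrt 2 * L * dist a b / 4 ^ k"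
  have V: "square_integrable_var (?V k)" for k
    by (rule local_average_square_integrable)
  have \<xi>: "(\<lambda>\<omega>. point_value p a b (X \<omega>)) \<in> borel_measurable M"
    using X by measurable
  have lim: "AE \<omega> in M. (\<lambda>k. ?V k \<omega>) \<longlonglongrightarrow> point_value p a b (X \<omega>)"
    using local_average_AE_tendsto point_value_AE by eventually_elim simp
  have le: "expectation (\<lambda>\<omega>. ((?V l \<omega> - expectation (?V l)) - (?V k \<omega> - expectation (?V k)))\<^sup>2) \<le> ?\<epsilon> k"
    if kl: "k \<le> l" for k l
  proof -
    have mono: "dist a b / 4 ^ i \<le> dist a b / 4 ^ k" if "k \<le> i" for i
      using that by (intro divide_left_mono power_increasing) auto
    let ?R = "\<lambda>i j. expectation (\<lambda>\<omega>. centred (?V i) \<omega> * centred (?V j) \<omega>)"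
    have R: "\<bar>?R i j - c (p, p)\<bar> \<le> sqrt 2 * L * (dist a b / 4 ^ k)" if "k \<le> i" "k \<le> j" for i j
    proof (rule covariance_local_averages[OF shrunk_facts shrunk_facts])
      fix u v assume uv: "u \<in> shrunk p a b i" "v \<in> shrunk p a b j"
      have "dist u p \<le> dist a b / 4 ^ k" "dist v p \<le> dist a b / 4 ^ k"
        using shrunk_dist[OF p ab uv(1)] shrunk_dist[OF p ab uv(2)] mono[OF that(1)] mono[OF that(2)]
        by linarith+
      then show "\<bar>c (u, v) - c (p, p)\<bar> \<le> sqrt 2 * L * (dist a b / 4 ^ k)"
        using uv p sub shrunk_facts(2) by (intro kernel_dist) auto
    qed
    have ints: "integrable M (\<lambda>\<omega>. centred (?V i) \<omega> * centred (?V j) \<omega>)" for i j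
      by (intro square_integrable_var_mult centred_square_integrable V)
    have "expectation (\<lambda>\<omega>. ((?V l \<omega> - expectation (?V l)) - (?V k \<omega> - expectation (?V k)))\<^sup>2)
        = expectation (\<lambda>\<omega>. centred (?V l) \<omega> * centred (?V l) \<omega> - 2 * (centred (?V l) \<omega> * centred (?V k) \<omega>)
            + centred (?V k) \<omega> * centred (?V k) \<omega>)"
      by (intro Bochner_Integration.integral_cong refl) (simp add: centred_def power2_eq_square algebra_simps)
    also have "\<dots> = ?R l l - 2 * ?R l k + ?R k k"
      using ints by simp
    also have "\<dots> \<le> 4 * (sqrt 2 * L * (dist a b / 4 ^ k))"
    proof -
      have "u - 2 * v + w \<le> 4 * r" if "\<bar>u - s\<bar> \<le> r" "\<bar>v - s\<bar> \<le> r" "\<bar>w - s\<bar> \<le> r" for u v w s r :: real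
        using that unfolding abs_le_iff by linarith
      from this[OF R[OF kl kl] R[OF kl order.refl] R[OF order.refl order.refl]] show ?thesis .
    qed
    finally show ?thesis by simp
  qed
  \<comment> \<open>The ratio \<open>1 / 4\<close> of successive boxes makes the root of the error
    geometric with ratio \<open>1 / 2\<close>, hence summable.\<close>
  have "summable (\<lambda>k. sqrt (4 * sqrt 2 * L * dist a b) * (1 / 2) ^ k)"
    by (intro summable_mult summable_geometric) simp
  moreover have "sqrt (?\<epsilon> k) = sqrt (4 * sqrt 2 * L * dist a b) * (1 / 2) ^ k" for k
  proof -
    have "sqrt (4 ^ k :: real) = 2 ^ k"
      using real_sqrt_power[of 4 k] by simp
    then show ?thesis by (simp add: real_sqrt_divide power_one_over)
  qed
  ultimately have "summable (\<lambda>k. sqrt (?\<epsilon> k))" by simp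
  from limit_square_integrable[OF V \<xi> lim le this]
  show "square_integrable_var (\<lambda>\<omega>. point_value p a b (X \<omega>))"
    and "expectation (\<lambda>\<omega>. (centred (\<lambda>\<omega>. point_value p a b (X \<omega>)) \<omega>
        - centred (\<lambda>\<omega>. local_average (shrunk p a b k) (X \<omega>)) \<omega>)\<^sup>2) \<le> ?\<epsilon> k"
    by (simp_all add: centred_def)
qed

lemma point_value_error_tendsto:
  "(\<lambda>k. expectation (\<lambda>\<omega>. (centred (\<lambda>\<omega>. point_value p a b (X \<omega>)) \<omega>
        - centred (\<lambda>\<omega>. local_average (shrunk p a b k) (X \<omega>)) \<omega>)\<^sup>2)) \<longlonglongrightarrow> 0"
proof (rule Lim_null_comparison)
  show "\<forall>\<^sub>F k in sequentially. norm (expectation (\<lambda>\<omega>. (centred (\<lambda>\<omega>. point_value p a b (X \<omega>)) \<omega>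
        - centred (\<lambda>\<omega>. local_average (shrunk p a b k) (X \<omega>)) \<omega>)\<^sup>2)) \<le> 4 * sqrt 2 * L * dist a b * (1 / 4) ^ k"
    using point_value_approximation(2) by (intro always_eventually allI) (simp add: power_one_over)
  have "(\<lambda>k. 4 * sqrt 2 * L * dist a b * (1 / 4) ^ k) \<longlonglongrightarrow> 4 * sqrt 2 * L * dist a b * 0"
    by (intro tendsto_mult tendsto_const LIMSEQ_realpow_zero) auto
  then show "(\<lambda>k. 4 * sqrt 2 * L * dist a b * (1 / 4) ^ k) \<longlonglongrightarrow> 0" by simp
qed

end

text \<open>Both factors are mean-square limits of local averages, whose covariances tend to
  \<open>c (p, q)\<close> by continuity of the kernel. The kernel thus gives the covariance at every
  pair of points and not merely almost everywhere.\<close>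

lemma covariance_point_values:
  assumes pab: "p \<in> cbox a b" "\<And>i. i \<in> Basis \<Longrightarrow> a \<bullet> i < b \<bullet> i" "cbox a b \<subseteq> cbox 0 One"
    and qab: "q \<in> cbox a' b'" "\<And>i. i \<in> Basis \<Longrightarrow> a' \<bullet> i < b' \<bullet> i" "cbox a' b' \<subseteq> cbox 0 One"
  shows "expectation (\<lambda>\<omega>. centred (\<lambda>\<omega>. point_value p a b (X \<omega>)) \<omega> * centred (\<lambda>\<omega>. point_value q a' b' (X \<omega>)) \<omega>) = c (p, q)"
proof (rule LIMSEQ_unique)
  let ?R = "\<lambda>k. expectation (\<lambda>\<omega>. centred (\<lambda>\<omega>. local_average (shrunk p a b k) (X \<omega>)) \<omega> * centred (\<lambda>\<omega>. local_average (shrunk q a' b' k) (X \<omega>)) \<omega>)"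
  show "?R \<longlonglongrightarrow> expectation (\<lambda>\<omega>. centred (\<lambda>\<omega>. point_value p a b (X \<omega>)) \<omega> * centred (\<lambda>\<omega>. point_value q a' b' (X \<omega>)) \<omega>)"
    using point_value_error_tendsto[OF pab] point_value_error_tendsto[OF qab]
      point_value_approximation(1)[OF pab] point_value_approximation(1)[OF qab]
    by (intro expectation_mult_tendsto centred_square_integrable local_average_square_integrable)
  let ?d = "max (dist a b) (dist a' b')"
  have "(\<lambda>k. ?R k - c (p, q)) \<longlonglongrightarrow> 0"
  proof (rule Lim_null_comparison)
    show "\<forall>\<^sub>F k in sequentially. norm (?R k - c (p, q)) \<le> sqrt 2 * L * ?d * (1 / 4) ^ k"
    proof (rule always_eventually, rule allI)
      fix k
      have "\<bar>?R k - c (p, q)\<bar> \<le> sqrt 2 * L * (?d / 4 ^ k)"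
      proof (rule covariance_local_averages[OF shrunk_facts[OF pab] shrunk_facts[OF qab]])
        fix u v assume uv: "u \<in> shrunk p a b k" "v \<in> shrunk q a' b' k"
        have "dist u p \<le> ?d / 4 ^ k" "dist v q \<le> ?d / 4 ^ k"
          using shrunk_dist[OF pab(1,2) uv(1)] shrunk_dist[OF qab(1,2) uv(2)]
            divide_right_mono[of "dist a b" ?d "4 ^ k"] divide_right_mono[of "dist a' b'" ?d "4 ^ k"]
          by auto
        then show "\<bar>c (u, v) - c (p, q)\<bar> \<le> sqrt 2 * L * (?d / 4 ^ k)"
          using pab(1,3) qab(1,3) subsetD[OF shrunk_facts(2)[OF pab] uv(1)] subsetD[OF shrunk_facts(2)[OF qab] uv(2)]
          by (intro kernel_dist) blast+
      qed
      then show "norm (?R k - c (p, q)) \<le> sqrt 2 * L * ?d * (1 / 4) ^ k"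
        by (simp add: power_one_over)
    qed
    have "(\<lambda>k. sqrt 2 * L * ?d * (1 / 4) ^ k) \<longlonglongrightarrow> sqrt 2 * L * ?d * 0"
      by (intro tendsto_mult tendsto_const LIMSEQ_realpow_zero) auto
    then show "(\<lambda>k. sqrt 2 * L * ?d * (1 / 4) ^ k) \<longlonglongrightarrow> 0" by simp
  qed
  then show "?R \<longlonglongrightarrow> c (p, q)" by (simp add: LIM_zero_iff)
qed

end

section \<open>Pixels\<close>

locale pixel_grid =
  fixes K1 K2 :: nat and T S :: "nat \<Rightarrow> real set"
  assumes K: "1 \<le> K1" "1 \<le> K2" and T: "regular_partition K1 T" and S: "regular_partition K2 S"
begin

definition pixels :: "(nat \<times> nat) set"
  where "pixels = {1..K1} \<times> {1..K2}"

definition cell :: "nat \<times> nat \<Rightarrow> (real \<times> real) set"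
  where "cell r = T (fst r) \<times> S (snd r)"

definition lower :: "nat \<times> nat \<Rightarrow> real \<times> real"
  where "lower r = ((real (fst r) - 1) / real K1, (real (snd r) - 1) / real K2)"

definition upper :: "nat \<times> nat \<Rightarrow> real \<times> real"
  where "upper r = (real (fst r) / real K1, real (snd r) / real K2)"

text \<open>The length of the diagonal of a pixel.\<close>

definition mesh :: real
  where "mesh = sqrt (1 / (real K1)\<^sup>2 + 1 / (real K2)\<^sup>2)"

text \<open>Left unnormalized: its squared norm is the pixel area.\<close>

definition indicator_vector :: "nat \<times> nat \<Rightarrow> (real \<times> real) L2"
  where "indicator_vector r = abs_L2 (indicator (cell r))"

lemma finite_pixels: "finite pixels" and pixels_nonempty: "pixels \<noteq> {}"
  and card_pixels: "card pixels = K1 * K2"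
  using K by (auto simp: pixels_def card_cartesian_product)

lemma mesh_nonneg: "0 \<le> mesh"
  by (simp add: mesh_def)

lemma mesh_le: "mesh \<le> sqrt 2"
  unfolding mesh_def
proof (rule real_sqrt_le_mono)
  have "1 / (real K)\<^sup>2 \<le> 1" if "1 \<le> K" for K :: nat
    using that by simp
  from this[OF K(1)] this[OF K(2)] show "1 / (real K1)\<^sup>2 + 1 / (real K2)\<^sup>2 \<le> 2" by linarith
qed

lemma partition_interval:
  assumes "regular_partition K U" "i \<in> {1..K}"
  shows "{(real i - 1) / real K <..< real i / real K} \<subseteq> U i" "U i \<subseteq> {(real i - 1) / real K .. real i / real K}"
    "U i \<in> sets borel"
proof -
  show 1: "{(real i - 1) / real K <..< real i / real K} \<subseteq> U i" and 2: "U i \<subseteq> {(real i - 1) / real K .. real i / real K}"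
    using assms unfolding regular_partition_def by blast+
  \<comment> \<open>\<open>U i\<close> differs from the open interval by at most its two endpoints,
    hence is Borel.\<close>
  have "x = (real i - 1) / real K \<or> x = real i / real K"
    if "x \<in> U i" "x \<notin> {(real i - 1) / real K <..< real i / real K}" for x
    using subsetD[OF 2 that(1)] that(2) by simp linarith
  then have "U i = {(real i - 1) / real K <..< real i / real K} \<union> (U i \<inter> {(real i - 1) / real K, real i / real K})"
    using 1 by blast
  moreover have "finite (U i \<inter> {(real i - 1) / real K, real i / real K})" by simp
  then have "U i \<inter> {(real i - 1) / real K, real i / real K} \<in> sets borel"
    by (intro borel_closed finite_imp_closed)
  ultimately show "U i \<in> sets borel"
    by (metis sets.Un borel_open open_greaterThanLessThan)
qed

lemma lower_upper:
  assumes r: "r \<in> pixels"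
  shows "i \<in> Basis \<Longrightarrow> lower r \<bullet> i < upper r \<bullet> i"
    and "cbox (lower r) (upper r) \<subseteq> cbox 0 One"
    and "box (lower r) (upper r) \<subseteq> cell r" and "cell r \<subseteq> cbox (lower r) (upper r)"
    and "cell r \<in> sets borel"
    and "dist (lower r) (upper r) = mesh"
    and "measure lborel (box (lower r) (upper r)) = 1 / (real K1 * real K2)"
    and "measure lborel (cbox (lower r) (upper r)) = 1 / (real K1 * real K2)"
proof -
  obtain m n where r_eq: "r = (m, n)" "m \<in> {1..K1}" "n \<in> {1..K2}"
    using r by (auto simp: pixels_def)
  have pos: "0 < real K1" "0 < real K2" using K by auto
  have lt: "(real m - 1) / real K1 < real m / real K1" "(real n - 1) / real K2 < real n / real K2"
    using pos by (auto simp: divide_strict_right_mono)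
  show lu: "lower r \<bullet> i < upper r \<bullet> i" if "i \<in> Basis" for i
    using that lt by (auto simp: r_eq lower_def upper_def Basis_prod_def)
  have c: "cbox (lower r) (upper r) = {(real m - 1) / real K1..real m / real K1} \<times> {(real n - 1) / real K2..real n / real K2}"
    by (simp add: r_eq lower_def upper_def cbox_Pair_eq)
  show "cbox (lower r) (upper r) \<subseteq> cbox 0 One"
  proof -
    have "0 \<le> (real m - 1) / real K1" "real m / real K1 \<le> 1" "0 \<le> (real n - 1) / real K2" "real n / real K2 \<le> 1"
      using r_eq pos by auto
    then show ?thesis
      unfolding c cbox_unit_prod by (intro Sigma_mono) auto
  qed
  have b: "box (lower r) (upper r) = {(real m - 1) / real K1<..<real m / real K1} \<times> {(real n - 1) / real K2<..<real n / real K2}"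
    by (auto simp: r_eq lower_def upper_def box_def Basis_prod_def)
  show "box (lower r) (upper r) \<subseteq> cell r" "cell r \<subseteq> cbox (lower r) (upper r)"
    unfolding b c cell_def using partition_interval(1,2)[OF T r_eq(2)] partition_interval(1,2)[OF S r_eq(3)]
    by (simp_all add: r_eq Sigma_mono Times_subset_cancel2 subset_iff)
  show "cell r \<in> sets borel"
    unfolding cell_def using partition_interval(3)[OF T r_eq(2)] partition_interval(3)[OF S r_eq(3)]
    by (simp add: r_eq borel_Times)
  show "dist (lower r) (upper r) = mesh"
    using pos by (simp add: lower_def upper_def mesh_def dist_Pair_Pair dist_real_def diff_divide_distrib power_divide)
  have "(\<Prod>i\<in>Basis. (upper r - lower r) \<bullet> i) = 1 / (real K1 * real K2)"
    by (simp add: lower_def upper_def Basis_prod_def diff_divide_distrib)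
  then show "measure lborel (box (lower r) (upper r)) = 1 / (real K1 * real K2)"
    "measure lborel (cbox (lower r) (upper r)) = 1 / (real K1 * real K2)"
    using lu by (simp_all add: less_imp_le)
qed

lemma cell_unit: "r \<in> pixels \<Longrightarrow> cell r \<subseteq> cbox 0 One"
  using lower_upper(2,4) by blast

text \<open>The cell lies between an open and a closed box of equal volume, whichever endpoints it
  contains.\<close>

lemma measure_cell:
  assumes r: "r \<in> pixels"
  shows "measure lborel (cell r) = 1 / (real K1 * real K2)"
proof (rule antisym)
  show "measure lborel (cell r) \<le> 1 / (real K1 * real K2)"
    unfolding lower_upper(8)[OF r, symmetric] using lower_upper(4,5)[OF r]
    by (intro measure_mono_fmeasurable) auto
  have "cell r \<in> fmeasurable lborel"
    by (rule fmeasurableI2[OF fmeasurable_cbox lower_upper(4)[OF r]]) (use lower_upper(5)[OF r] in simp)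
  then show "1 / (real K1 * real K2) \<le> measure lborel (cell r)"
    unfolding lower_upper(7)[OF r, symmetric] using lower_upper(3)[OF r]
    by (intro measure_mono_fmeasurable) auto
qed

lemma cell_disjoint:
  assumes "r \<in> pixels" "s \<in> pixels" "r \<noteq> s"
  shows "cell r \<inter> cell s = {}"
proof -
  have "disjoint_family_on T {1..K1}" "disjoint_family_on S {1..K2}"
    using T S by (simp_all add: regular_partition_def)
  moreover have "fst r \<in> {1..K1}" "fst s \<in> {1..K1}" "snd r \<in> {1..K2}" "snd s \<in> {1..K2}"
    using assms(1,2) by (auto simp: pixels_def)
  moreover have "fst r \<noteq> fst s \<or> snd r \<noteq> snd s"
    using assms(3) by (simp add: prod_eq_iff)
  ultimately have "T (fst r) \<inter> T (fst s) = {} \<or> S (snd r) \<inter> S (snd s) = {}"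
    by (metis disjoint_family_onD)
  then show ?thesis
    unfolding cell_def Times_Int_Times by auto
qed

lemma cells_cover:
  assumes "p \<in> cbox 0 One"
  obtains r where "r \<in> pixels" "p \<in> cell r"
proof -
  have "fst p \<in> (\<Union>i\<in>{1..K1}. T i)" "snd p \<in> (\<Union>j\<in>{1..K2}. S j)"
    using assms T S unfolding regular_partition_def cbox_unit_prod by auto
  then obtain i j where "i \<in> {1..K1}" "fst p \<in> T i" "j \<in> {1..K2}" "snd p \<in> S j" by blast
  then show ?thesis
    by (intro that[of "(i, j)"]) (auto simp: pixels_def cell_def mem_Times_iff)
qed

lemma cell_dist:
  assumes r: "r \<in> pixels" and pq: "p \<in> cell r" "q \<in> cell r"
  shows "dist p q \<le> mesh"
proof -
  have "norm (p - q) \<le> norm (upper r - lower r)"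
  proof (rule norm_le_componentwise)
    fix i :: "real \<times> real" assume i: "i \<in> Basis"
    have "p \<in> cbox (lower r) (upper r)" "q \<in> cbox (lower r) (upper r)"
      using pq lower_upper(4)[OF r] by auto
    then have "lower r \<bullet> i \<le> p \<bullet> i" "p \<bullet> i \<le> upper r \<bullet> i" "lower r \<bullet> i \<le> q \<bullet> i" "q \<bullet> i \<le> upper r \<bullet> i"
      using i by (auto simp: mem_box)
    then show "\<bar>(p - q) \<bullet> i\<bar> \<le> \<bar>(upper r - lower r) \<bullet> i\<bar>"
      by (simp add: inner_diff_left)
  qed
  then show ?thesis
    using lower_upper(6)[OF r] by (simp add: dist_norm norm_minus_commute)
qed

lemma inner_disjoint_indicators:
  assumes Q: "\<And>r. r \<in> pixels \<Longrightarrow> Q r \<in> sets borel" "\<And>r. r \<in> pixels \<Longrightarrow> Q r \<subseteq> cell r"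
    and rs: "r \<in> pixels" "s \<in> pixels"
  shows "inner (abs_L2 (indicator (Q r))) (abs_L2 (indicator (Q s))) = (if r = s then measure lborel (Q r) else 0)"
proof -
  have "inner (abs_L2 (indicator (Q r))) (abs_L2 (indicator (Q s)))
      = integral\<^sup>L cube_measure (indicator (Q r \<inter> Q s) :: real \<times> real \<Rightarrow> real)"
    unfolding inner_abs_L2[OF square_integrable_indicator[OF Q(1)[OF rs(1)]] square_integrable_indicator[OF Q(1)[OF rs(2)]]]
      indicator_inter_arith ..
  also have "\<dots> = measure lborel (Q r \<inter> Q s)"
    using Q(1)[OF rs(1)] Q(1)[OF rs(2)] Q(2)[OF rs(1)] cell_unit[OF rs(1)]
    by (intro integral_cube_indicator) auto
  also have "\<dots> = (if r = s then measure lborel (Q r) else 0)"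
  proof (cases "r = s")
    case False
    then have "Q r \<inter> Q s = {}" using Q(2) rs cell_disjoint[of r s] by blast
    then show ?thesis using False by simp
  qed simp
  finally show ?thesis .
qed

lemma inner_indicator_vector:
  "r \<in> pixels \<Longrightarrow> s \<in> pixels \<Longrightarrow>
    inner (indicator_vector r) (indicator_vector s) = (if r = s then 1 / (real K1 * real K2) else 0)"
  unfolding indicator_vector_def
  using inner_disjoint_indicators[of cell r s] lower_upper(5) by (simp add: measure_cell)

lemma pixel_surface_eq:
  "pixel_surface K1 K2 T S y = (\<Sum>r\<in>pixels. y (fst r) (snd r) *\<^sub>R indicator_vector r)"
proof -
  have sq: "(\<lambda>p. y (fst r) (snd r) * indicator (cell r) p) \<in> square_integrable" if "r \<in> pixels" for r
    using lower_upper(5)[OF that] by (intro square_integrable_scale square_integrable_indicator)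
  have "pixel_surface K1 K2 T S y = abs_L2 (\<lambda>p. \<Sum>r\<in>pixels. y (fst r) (snd r) * indicator (cell r) p)"
    unfolding pixel_surface_def pixels_def cell_def by (simp only: sum.cartesian_product case_prod_unfold)
  also have "\<dots> = (\<Sum>r\<in>pixels. abs_L2 (\<lambda>p. y (fst r) (snd r) * indicator (cell r) p))"
    using abs_L2_sum[of pixels "\<lambda>r p. y (fst r) (snd r) * indicator (cell r) p"] sq by blast
  also have "\<dots> = (\<Sum>r\<in>pixels. y (fst r) (snd r) *\<^sub>R indicator_vector r)"
    unfolding indicator_vector_def using lower_upper(5)
    by (intro sum.cong refl abs_L2_scale square_integrable_indicator)
  finally show ?thesis .
qed

end

section \<open>The two measurement schemes as functionals of the surface\<close>

locale gridded_covariance = lipschitz_covariance M X C c L + pixel_grid K1 K2 T S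
  for M :: "'w measure" and X :: "'w \<Rightarrow> (real \<times> real) L2" and C c L K1 K2 T S
begin

definition pixel_norm :: "(nat \<times> nat \<Rightarrow> (real \<times> real) L2 \<Rightarrow> real) \<Rightarrow> 'w \<Rightarrow> real"
  where "pixel_norm \<phi> \<omega> = (\<Sum>r\<in>pixels. (centred (\<lambda>\<omega>. \<phi> r (X \<omega>)) \<omega>)\<^sup>2) / card pixels"

text \<open>The interface shared by both schemes. The second clause ties covariances of pixel values
  to the kernel. The third says that pixel values are dominated by the norm of the centred surface
  up to a part of small mean. In \<open>4 * 16 ^ k\<close> the power is the ratio of the areas of a
  pixel and its shrunk box; the 4 leaves room to absorb the averages over the shrunk boxes.\<close>

definition regular_pixel_functional :: "(nat \<times> nat \<Rightarrow> (real \<times> real) L2 \<Rightarrow> real) \<Rightarrow> bool"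
  where "regular_pixel_functional \<phi> \<longleftrightarrow>
    (\<forall>r\<in>pixels. square_integrable_var (\<lambda>\<omega>. \<phi> r (X \<omega>))) \<and>
    (\<forall>r\<in>pixels. \<forall>s\<in>pixels. \<forall>p\<in>cell r. \<forall>q\<in>cell s.
      \<bar>expectation (\<lambda>\<omega>. centred (\<lambda>\<omega>. \<phi> r (X \<omega>)) \<omega> * centred (\<lambda>\<omega>. \<phi> s (X \<omega>)) \<omega>) - c (p, q)\<bar> \<le> sqrt 2 * L * mesh) \<and>
    (\<forall>k. expectation (\<lambda>\<omega>. if pixel_norm \<phi> \<omega> \<le> 4 * 16 ^ k * (norm (X \<omega> - expectation X))\<^sup>2 then 0 else pixel_norm \<phi> \<omega>)
      \<le> 16 * sqrt 2 * L * mesh / 4 ^ k)"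

lemma L_nonneg: "0 \<le> L"
  by (rule lipschitz_on_nonneg[OF c])

lemma kernel_cell_dist:
  assumes rs: "r \<in> pixels" "s \<in> pixels" and "p \<in> cell r" "u \<in> cell r" "q \<in> cell s" "v \<in> cell s"
  shows "\<bar>c (u, v) - c (p, q)\<bar> \<le> sqrt 2 * L * mesh"
  using assms cell_unit cell_dist[OF rs(1)] cell_dist[OF rs(2)] by (intro kernel_dist) blast+

text \<open>Divided by the root of their measure, indicators of disjoint sets are orthonormal, so
  Bessel applies. A smaller measure \<open>m\<close> weakens the bound in proportion.\<close>

lemma local_averages_norm:
  assumes Q: "\<And>r. r \<in> pixels \<Longrightarrow> Q r \<in> sets borel" "\<And>r. r \<in> pixels \<Longrightarrow> Q r \<subseteq> cell r"
    and m: "\<And>r. r \<in> pixels \<Longrightarrow> measure lborel (Q r) = m" "0 < m"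
  shows "(\<Sum>r\<in>pixels. (centred (\<lambda>\<omega>. local_average (Q r) (X \<omega>)) \<omega>)\<^sup>2) * m \<le> (norm (X \<omega> - expectation X))\<^sup>2"
proof -
  define v where "v r = (1 / sqrt m) *\<^sub>R abs_L2 (indicator (Q r))" for r
  have "(\<Sum>r\<in>pixels. (inner (X \<omega> - expectation X) (v r))\<^sup>2) \<le> (norm (X \<omega> - expectation X))\<^sup>2"
  proof (rule bessel_finite[OF finite_pixels])
    fix r s assume rs: "r \<in> pixels" "s \<in> pixels"
    show "inner (v r) (v s) = (if r = s then 1 else 0)"
      using m(2) by (simp add: v_def inner_disjoint_indicators[OF Q rs] m(1)[OF rs(1)] m(1)[OF rs(2)])
  qed
  moreover have "(inner (X \<omega> - expectation X) (v r))\<^sup>2 = (centred (\<lambda>\<omega>. local_average (Q r) (X \<omega>)) \<omega>)\<^sup>2 * m"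
    if "r \<in> pixels" for r
    using m(2) m(1)[OF that]
    by (simp add: centred_local_average v_def power_divide power2_eq_square[of m])
  ultimately show ?thesis by (simp add: sum_distrib_right)
qed

text \<open>For averages over whole pixels Bessel holds with constant 1, so the truncation discards
  nothing.\<close>

lemma averaged_regular: "regular_pixel_functional (\<lambda>r. local_average (cell r))"
  unfolding regular_pixel_functional_def
proof (intro conjI ballI allI)
  fix r assume "r \<in> pixels"
  show "square_integrable_var (\<lambda>\<omega>. local_average (cell r) (X \<omega>))"
    by (rule local_average_square_integrable)
next
  fix r s p q assume "r \<in> pixels" "s \<in> pixels" "p \<in> cell r" "q \<in> cell s"
  then show "\<bar>expectation (\<lambda>\<omega>. centred (\<lambda>\<omega>. local_average (cell r) (X \<omega>)) \<omega> *
      centred (\<lambda>\<omega>. local_average (cell s) (X \<omega>)) \<omega>) - c (p, q)\<bar> \<le> sqrt 2 * L * mesh"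
    using K by (intro covariance_local_averages kernel_cell_dist cell_unit lower_upper(5)) (auto simp: measure_cell)
next
  fix k
  have "pixel_norm (\<lambda>r. local_average (cell r)) \<omega> \<le> 4 * 16 ^ k * (norm (X \<omega> - expectation X))\<^sup>2" for \<omega>
  proof -
    have "pixel_norm (\<lambda>r. local_average (cell r)) \<omega> \<le> (norm (X \<omega> - expectation X))\<^sup>2"
      using local_averages_norm[of cell "1 / (real K1 * real K2)" \<omega>] K
      by (simp add: pixel_norm_def measure_cell lower_upper(5) card_pixels)
    also have "\<dots> \<le> 4 * 16 ^ k * (norm (X \<omega> - expectation X))\<^sup>2"
    proof -
      have "1 \<le> (16 :: real) ^ k" by (rule one_le_power) simp
      then have "1 \<le> 4 * (16 :: real) ^ k" by linarith
      from mult_right_mono[OF this, of "(norm (X \<omega> - expectation X))\<^sup>2"] show ?thesis by simp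
    qed
    finally show ?thesis .
  qed
  then show "expectation (\<lambda>\<omega>. if pixel_norm (\<lambda>r. local_average (cell r)) \<omega> \<le> 4 * 16 ^ k * (norm (X \<omega> - expectation X))\<^sup>2
      then 0 else pixel_norm (\<lambda>r. local_average (cell r)) \<omega>) \<le> 16 * sqrt 2 * L * mesh / 4 ^ k"
    using L_nonneg mesh_nonneg by simp
qed

text \<open>A centred point value is split into the centred average \<open>U\<close> over the shrunk
  box and an error \<open>D\<close>. The averages satisfy Bessel with constant
  \<open>16 ^ k\<close>, and the errors are small in mean square.\<close>

lemma pointwise_regular:
  assumes x: "AE \<omega> in M. continuous_on (cbox 0 One) (x \<omega>) \<and> X \<omega> = abs_L2 (x \<omega>)"
    and t: "\<And>r. r \<in> pixels \<Longrightarrow> t r \<in> cell r"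
  shows "regular_pixel_functional (\<lambda>r. point_value (t r) (lower r) (upper r))" (is "regular_pixel_functional ?\<phi>")
    and "r \<in> pixels \<Longrightarrow> AE \<omega> in M. point_value (t r) (lower r) (upper r) (X \<omega>) = x \<omega> (t r)"
proof -
  interpret continuous_surface M X C c L x
    by unfold_locales (rule x)
  have tc: "t r \<in> cbox (lower r) (upper r)" if "r \<in> pixels" for r
    using t[OF that] lower_upper(4)[OF that] by auto
  note box = tc lower_upper(1,2)
  show "AE \<omega> in M. point_value (t r) (lower r) (upper r) (X \<omega>) = x \<omega> (t r)" if r: "r \<in> pixels" for r
    by (rule point_value_AE[OF tc[OF r] lower_upper(1)[OF r] lower_upper(2)[OF r]])
  show "regular_pixel_functional ?\<phi>"
    unfolding regular_pixel_functional_def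
  proof (intro conjI ballI allI)
    fix r assume r: "r \<in> pixels"
    show "square_integrable_var (\<lambda>\<omega>. ?\<phi> r (X \<omega>))"
      by (rule point_value_approximation(1)[OF tc[OF r] lower_upper(1)[OF r] lower_upper(2)[OF r]])
  next
    fix r s p q assume rs: "r \<in> pixels" "s \<in> pixels" and pq: "p \<in> cell r" "q \<in> cell s"
    have "expectation (\<lambda>\<omega>. centred (\<lambda>\<omega>. ?\<phi> r (X \<omega>)) \<omega> * centred (\<lambda>\<omega>. ?\<phi> s (X \<omega>)) \<omega>) = c (t r, t s)"
      by (rule covariance_point_values[OF tc[OF rs(1)] lower_upper(1)[OF rs(1)] lower_upper(2)[OF rs(1)]
            tc[OF rs(2)] lower_upper(1)[OF rs(2)] lower_upper(2)[OF rs(2)]])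
    then show "\<bar>expectation (\<lambda>\<omega>. centred (\<lambda>\<omega>. ?\<phi> r (X \<omega>)) \<omega> * centred (\<lambda>\<omega>. ?\<phi> s (X \<omega>)) \<omega>) - c (p, q)\<bar>
        \<le> sqrt 2 * L * mesh"
      using kernel_cell_dist[OF rs pq(1) t[OF rs(1)] pq(2) t[OF rs(2)]] by simp
  next
    fix k
    define Q where "Q r = shrunk (t r) (lower r) (upper r) k" for r
    define U where "U r \<omega> = centred (\<lambda>\<omega>. local_average (Q r) (X \<omega>)) \<omega>" for r \<omega>
    define D where "D r \<omega> = centred (\<lambda>\<omega>. ?\<phi> r (X \<omega>)) \<omega> - U r \<omega>" for r \<omega>
    let ?m = "1 / (real K1 * real K2) / 16 ^ k"
    have Q: "Q r \<in> sets borel" "Q r \<subseteq> cell r" "measure lborel (Q r) = ?m" if r: "r \<in> pixels" for r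
    proof -
      show "Q r \<in> sets borel" unfolding Q_def by (rule shrunk_borel)
      show "Q r \<subseteq> cell r"
        using shrunk_subset[OF tc[OF r] lower_upper(1)[OF r], of k] lower_upper(3)[OF r] by (auto simp: Q_def)
      have "(4 :: real) ^ k * 4 ^ k = 16 ^ k" by (simp flip: power_mult_distrib)
      then show "measure lborel (Q r) = ?m"
        unfolding Q_def using measure_shrunk[OF tc[OF r] lower_upper(1)[OF r], of k] lower_upper(7)[OF r]
        by simp
    qed
    have U: "(\<Sum>r\<in>pixels. (U r \<omega>)\<^sup>2) / card pixels \<le> 16 ^ k * (norm (X \<omega> - expectation X))\<^sup>2" for \<omega>
      using local_averages_norm[of Q ?m \<omega>, OF Q] K by (simp add: U_def card_pixels field_simps)
    have Dsq: "square_integrable_var (D r)" if r: "r \<in> pixels" for r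
      unfolding D_def U_def
      by (intro square_integrable_var_diff centred_square_integrable local_average_square_integrable
          point_value_approximation(1)[OF tc[OF r] lower_upper(1)[OF r] lower_upper(2)[OF r]])
    have D: "expectation (\<lambda>\<omega>. (D r \<omega>)\<^sup>2) \<le> 4 * sqrt 2 * L * mesh / 4 ^ k" if r: "r \<in> pixels" for r
      using point_value_approximation(2)[OF tc[OF r] lower_upper(1)[OF r] lower_upper(2)[OF r], of k]
      by (simp add: D_def U_def Q_def lower_upper(6)[OF r])
    let ?D = "\<lambda>\<omega>. 4 * ((\<Sum>r\<in>pixels. (D r \<omega>)\<^sup>2) / card pixels)"
    have Dint: "integrable M ?D"
      by (intro integrable_mult_right integrable_divide_zero Bochner_Integration.integrable_sum
          square_integrable_var_square Dsq impI)
    \<comment> \<open>Beyond the threshold the mean of \<open>U\<^sup>2\<close> over the pixels is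
      at most a quarter of \<open>pixel_norm\<close>. In the bound by
      \<open>2 * U\<^sup>2 + 2 * D\<^sup>2\<close> it therefore takes at most half, and the errors
      account for the other half; this is the factor 4 in \<open>?D\<close>.\<close>
    have le: "(if pixel_norm ?\<phi> \<omega> \<le> 4 * 16 ^ k * (norm (X \<omega> - expectation X))\<^sup>2 then 0 else pixel_norm ?\<phi> \<omega>) \<le> ?D \<omega>" for \<omega>
    proof (cases "pixel_norm ?\<phi> \<omega> \<le> 4 * 16 ^ k * (norm (X \<omega> - expectation X))\<^sup>2")
      case True
      then show ?thesis by (simp add: sum_nonneg)
    next
      case False
      have "pixel_norm ?\<phi> \<omega> \<le> (\<Sum>r\<in>pixels. 2 * (U r \<omega>)\<^sup>2 + 2 * (D r \<omega>)\<^sup>2) / card pixels"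
        unfolding pixel_norm_def
      proof (intro divide_right_mono sum_mono)
        fix r
        have "(a + b)\<^sup>2 \<le> 2 * a\<^sup>2 + 2 * b\<^sup>2" for a b :: real
          using sum_squares_bound[of a b] by (simp add: power2_sum)
        from this[of "U r \<omega>" "D r \<omega>"] show "(centred (\<lambda>\<omega>. ?\<phi> r (X \<omega>)) \<omega>)\<^sup>2 \<le> 2 * (U r \<omega>)\<^sup>2 + 2 * (D r \<omega>)\<^sup>2"
          by (simp add: D_def)
      qed simp
      also have "\<dots> = 2 * ((\<Sum>r\<in>pixels. (U r \<omega>)\<^sup>2) / card pixels) + ?D \<omega> / 2"
        by (simp add: sum.distrib sum_distrib_left[symmetric] add_divide_distrib)
      finally show ?thesis using False U[of \<omega>] by simp
    qed
    have "expectation (\<lambda>\<omega>. if pixel_norm ?\<phi> \<omega> \<le> 4 * 16 ^ k * (norm (X \<omega> - expectation X))\<^sup>2 then 0 else pixel_norm ?\<phi> \<omega>)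
        \<le> expectation ?D"
    proof (rule integral_mono_AE'[OF Dint])
      show "AE \<omega> in M. (if pixel_norm ?\<phi> \<omega> \<le> 4 * 16 ^ k * (norm (X \<omega> - expectation X))\<^sup>2 then 0 else pixel_norm ?\<phi> \<omega>) \<le> ?D \<omega>"
        using le by (intro AE_I2)
      show "AE \<omega> in M. 0 \<le> ?D \<omega>"
        by (intro AE_I2) (simp add: sum_nonneg)
    qed
    also have "\<dots> = 4 * ((\<Sum>r\<in>pixels. expectation (\<lambda>\<omega>. (D r \<omega>)\<^sup>2)) / card pixels)"
      using square_integrable_var_square[OF Dsq] by (simp add: Bochner_Integration.integral_sum)
    also have "\<dots> \<le> 4 * ((\<Sum>r\<in>pixels. 4 * sqrt 2 * L * mesh / 4 ^ k) / card pixels)"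
      using D by (intro mult_left_mono divide_right_mono sum_mono) auto
    also have "\<dots> = 16 * sqrt 2 * L * mesh / 4 ^ k"
      using finite_pixels pixels_nonempty by simp
    finally show "expectation (\<lambda>\<omega>. if pixel_norm ?\<phi> \<omega> \<le> 4 * 16 ^ k * (norm (X \<omega> - expectation X))\<^sup>2 then 0 else pixel_norm ?\<phi> \<omega>)
      \<le> 16 * sqrt 2 * L * mesh / 4 ^ k" .
  qed
qed

end

section \<open>Operators given by a matrix over the pixels\<close>

lemma rank_one_sum:
  "rank_one (\<Sum>r\<in>P. a r *\<^sub>R u r) (\<Sum>s\<in>Q. b s *\<^sub>R v s) = (\<Sum>(r, s)\<in>P \<times> Q. (a r * b s) *\<^sub>R rank_one (u r) (v s))"
proof (rule blinfun_eqI)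
  fix f
  have "blinfun_apply (rank_one (\<Sum>r\<in>P. a r *\<^sub>R u r) (\<Sum>s\<in>Q. b s *\<^sub>R v s)) f
      = (\<Sum>r\<in>P. \<Sum>s\<in>Q. (b s * inner (v s) f) *\<^sub>R a r *\<^sub>R u r)"
    by (simp add: rank_one_apply inner_sum_left scaleR_sum_left scaleR_sum_right sum_distrib_right)
  also have "\<dots> = (\<Sum>(r, s)\<in>P \<times> Q. (b s * inner (v s) f) *\<^sub>R a r *\<^sub>R u r)"
    by (rule sum.cartesian_product)
  also have "\<dots> = blinfun_apply (\<Sum>(r, s)\<in>P \<times> Q. (a r * b s) *\<^sub>R rank_one (u r) (v s)) f"
    by (simp add: blinfun.sum_left case_prod_unfold blinfun.scaleR_left rank_one_apply ac_simps)
  finally show "blinfun_apply (rank_one (\<Sum>r\<in>P. a r *\<^sub>R u r) (\<Sum>s\<in>Q. b s *\<^sub>R v s)) f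
      = blinfun_apply (\<Sum>(r, s)\<in>P \<times> Q. (a r * b s) *\<^sub>R rank_one (u r) (v s)) f" .
qed

lemma rep_L2_abs_diff:
  assumes "g \<in> square_integrable"
  shows "AE p in cube_measure. rep_L2 (f - abs_L2 g) p = rep_L2 f p - g p"
  using rep_abs_L2[OF square_integrable_diff[OF rep_L2_square_integrable assms], of f]
    abs_L2_diff[OF rep_L2_square_integrable assms, of f] by (simp add: abs_rep_L2)

context pixel_grid
begin

definition pixel_operator :: "(nat \<times> nat \<Rightarrow> nat \<times> nat \<Rightarrow> real) \<Rightarrow> ((real \<times> real) L2 \<Rightarrow>\<^sub>L (real \<times> real) L2)"
  where "pixel_operator a = (\<Sum>(r, s)\<in>pixels \<times> pixels. a r s *\<^sub>R rank_one (indicator_vector r) (indicator_vector s))"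

text \<open>The Hilbert-Schmidt distance of the two pixel operators, written in terms of their
  matrices alone.\<close>

definition pixel_distance :: "(nat \<times> nat \<Rightarrow> nat \<times> nat \<Rightarrow> real) \<Rightarrow> (nat \<times> nat \<Rightarrow> nat \<times> nat \<Rightarrow> real) \<Rightarrow> real"
  where "pixel_distance a b = (1 / real (card pixels)) * L2_set (\<lambda>(r, s). a r s - b r s) (pixels \<times> pixels)"

text \<open>The noise contributes a multiple of the identity matrix, whose Frobenius norm is the
  root of the number of pixels, while the weight is the reciprocal of that number. Hence the rate
  \<open>1 / sqrt (K1 * K2)\<close>.\<close>

lemma pixel_distance_noise:
  assumes "0 \<le> \<tau>2"
  shows "pixel_distance (\<lambda>r s. \<gamma> r s + (if r = s then \<tau>2 else 0)) \<gamma> = \<tau>2 / sqrt (real K1 * real K2)"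
proof -
  have "(\<Sum>q\<in>pixels \<times> pixels. (if fst q = snd q then \<tau>2 else 0)\<^sup>2)
      = (\<Sum>r\<in>pixels. \<Sum>s\<in>pixels. if r = s then \<tau>2\<^sup>2 else 0)"
    unfolding sum.cartesian_product by (intro sum.cong) auto
  also have "\<dots> = real (card pixels) * \<tau>2\<^sup>2"
    using finite_pixels by simp
  finally have "L2_set (\<lambda>(r, s). (\<gamma> r s + (if r = s then \<tau>2 else 0)) - \<gamma> r s) (pixels \<times> pixels) = sqrt (real (card pixels)) * \<tau>2"
    using assms by (simp add: L2_set_def case_prod_unfold real_sqrt_mult)
  moreover have "0 < real (card pixels)"
    using K by (simp add: card_pixels)
  ultimately have "pixel_distance (\<lambda>r s. \<gamma> r s + (if r = s then \<tau>2 else 0)) \<gamma>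
      = \<tau>2 * (sqrt (real (card pixels)) / real (card pixels))"
    by (simp only: pixel_distance_def) simp
  also have "sqrt (real (card pixels)) / real (card pixels) = inverse (sqrt (real (card pixels)))"
    by (rule sqrt_divide_self_eq) simp
  finally show ?thesis
    by (simp add: card_pixels divide_inverse)
qed

context
  fixes B :: "(real \<times> real) L2 set"
  assumes B: "orthonormal_basis B"
begin

lemma hilbert_schmidt_pixel_operator: "hilbert_schmidt (pixel_operator a)"
  unfolding pixel_operator_def case_prod_unfold
  by (intro hilbert_schmidt_sum[OF B] hs_scaleR rank_one_hilbert_schmidt[OF B])

text \<open>Rank-one operators between pixel indicators are pairwise orthogonal, each with norm
  equal to the pixel area.\<close>

lemma hs_norm_pixel_operator:
  "hs_norm (pixel_operator a) = (1 / real (card pixels)) * L2_set (\<lambda>(r, s). a r s) (pixels \<times> pixels)"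
proof -
  let ?\<nu> = "1 / real (card pixels)"
  have "hs_norm (\<Sum>q\<in>pixels \<times> pixels. (case q of (r, s) \<Rightarrow> a r s) *\<^sub>R rank_one (indicator_vector (fst q)) (indicator_vector (snd q)))
      = sqrt (?\<nu> * ?\<nu>) * L2_set (\<lambda>(r, s). a r s) (pixels \<times> pixels)"
    using finite_pixels
    by (intro hs_norm_sum_orthogonal[OF _ _ _ B] rank_one_hilbert_schmidt[OF B])
      (auto simp: hs_inner_rank_one[OF B] inner_indicator_vector card_pixels mem_Times_iff prod_eq_iff)
  then show ?thesis
    by (simp add: pixel_operator_def case_prod_unfold real_sqrt_divide)
qed

lemma hs_norm_pixel_operator_diff:
  "hs_norm (pixel_operator a - pixel_operator b) = pixel_distance a b"
proof -
  have "pixel_operator a - pixel_operator b = pixel_operator (\<lambda>r s. a r s - b r s)"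
    by (simp add: pixel_operator_def case_prod_unfold scaleR_left_diff_distrib sum_subtractf)
  then show ?thesis
    by (simp only: hs_norm_pixel_operator pixel_distance_def)
qed

text \<open>\<open>C\<close> minus the pixel operator has as kernel \<open>c\<close> minus a step
  function. It is bounded by \<open>d\<close> at every point because the cells cover the square, so
  \<open>hs_norm_kernel_le\<close> applies.\<close>

lemma kernel_pixel_approximation:
  assumes C: "has_kernel C c" and c: "\<And>p. p \<in> cbox 0 One \<Longrightarrow> (\<lambda>q. c (p, q)) \<in> square_integrable"
    and d: "0 \<le> d" "\<And>r s p q. r \<in> pixels \<Longrightarrow> s \<in> pixels \<Longrightarrow> p \<in> cell r \<Longrightarrow> q \<in> cell s \<Longrightarrow> \<bar>\<gamma> r s - c (p, q)\<bar> \<le> d"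
  shows "hs_norm (pixel_operator \<gamma> - C) \<le> d"
proof -
  define k where "k = (\<lambda>(p, q). c (p, q) - (\<Sum>(r, s)\<in>pixels \<times> pixels. (\<gamma> r s * indicator (cell r) p) * indicator (cell s) q))"
  have sq: "indicator (cell r) \<in> square_integrable" if "r \<in> pixels" for r
    using lower_upper(5)[OF that] by (rule square_integrable_indicator)
  have sum_sq: "(\<lambda>q. \<Sum>(r, s)\<in>pixels \<times> pixels. b r s * indicator (cell s) q) \<in> square_integrable" for b
    unfolding case_prod_unfold
    by (rule conjunct1[OF abs_L2_sum]) (auto intro!: square_integrable_scale sq)
  have "hs_norm (C - pixel_operator \<gamma>) \<le> d"
  proof (rule hs_norm_kernel_le(2)[where k = k, OF _ _ _ d(1) B])
    show ksq: "(\<lambda>q. k (p, q)) \<in> square_integrable" if "p \<in> cbox 0 One" for p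
      unfolding k_def prod.case by (intro square_integrable_diff c that sum_sq)
    show "\<bar>k (p, q)\<bar> \<le> d" if pq: "p \<in> cbox 0 One" "q \<in> cbox 0 One" for p q
    proof -
      obtain r s where rs: "r \<in> pixels" "p \<in> cell r" "s \<in> pixels" "q \<in> cell s"
        using cells_cover[OF pq(1)] cells_cover[OF pq(2)] by metis
      \<comment> \<open>The cells are disjoint, so the double sum reduces to the one pair of cells
        that contains the two points.\<close>
      have "indicator (cell r') p = (if r' = r then 1 else 0 :: real)" if "r' \<in> pixels" for r'
        using cell_disjoint[OF that rs(1)] rs(2) by (auto simp: indicator_def)
      moreover have "indicator (cell s') q = (if s' = s then 1 else 0 :: real)" if "s' \<in> pixels" for s'
        using cell_disjoint[OF that rs(3)] rs(4) by (auto simp: indicator_def)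
      ultimately have "(\<Sum>(r, s)\<in>pixels \<times> pixels. (\<gamma> r s * indicator (cell r) p) * indicator (cell s) q)
          = (\<Sum>z\<in>pixels \<times> pixels. if z = (r, s) then \<gamma> r s else 0)"
        by (intro sum.cong) (auto split: if_splits)
      also have "\<dots> = \<gamma> r s"
        using rs by (subst sum.delta[OF finite_cartesian_product[OF finite_pixels finite_pixels]]) simp
      finally show ?thesis
        using d(2)[OF rs(1,3,2,4)] by (simp add: k_def abs_minus_commute)
    qed
    show "has_kernel (C - pixel_operator \<gamma>) k"
      unfolding has_kernel_def
    proof
      fix f
      \<comment> \<open>\<open>g\<close> is a representative of the image of \<open>f\<close> under
        the pixel operator.\<close>
      define g where "g p = (\<Sum>(r, s)\<in>pixels \<times> pixels. (\<gamma> r s * inner (indicator_vector s) f) * indicator (cell r) p)" for p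
      have terms: "(\<lambda>p. (\<gamma> (fst q) (snd q) * inner (indicator_vector (snd q)) f) * indicator (cell (fst q)) p) \<in> square_integrable"
        if "q \<in> pixels \<times> pixels" for q
        using that by (intro square_integrable_scale sq) auto
      have g: "g \<in> square_integrable"
        and "abs_L2 g = (\<Sum>q\<in>pixels \<times> pixels. abs_L2 (\<lambda>p. (\<gamma> (fst q) (snd q) * inner (indicator_vector (snd q)) f) * indicator (cell (fst q)) p))"
        unfolding g_def[abs_def] case_prod_unfold
        by (rule conjunct1[OF abs_L2_sum[OF terms]], assumption, rule conjunct2[OF abs_L2_sum[OF terms]])
      note this(2)
      also have "(\<Sum>q\<in>pixels \<times> pixels. abs_L2 (\<lambda>p. (\<gamma> (fst q) (snd q) * inner (indicator_vector (snd q)) f) * indicator (cell (fst q)) p))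
          = (\<Sum>q\<in>pixels \<times> pixels. (\<gamma> (fst q) (snd q) * inner (indicator_vector (snd q)) f) *\<^sub>R indicator_vector (fst q))"
        unfolding indicator_vector_def by (intro sum.cong refl abs_L2_scale sq) auto
      also have "\<dots> = blinfun_apply (pixel_operator \<gamma>) f"
        by (simp add: pixel_operator_def case_prod_unfold blinfun.sum_left blinfun.scaleR_left rank_one_apply)
      finally have gf: "blinfun_apply (C - pixel_operator \<gamma>) f = blinfun_apply C f - abs_L2 g"
        by (simp add: blinfun.diff_left)
      have "AE p in cube_measure. rep_L2 (blinfun_apply C f) p = (LINT q|cube_measure. c (p, q) * rep_L2 f q)"
        using C by (simp add: has_kernel_def)
      with rep_L2_abs_diff[OF g, of "blinfun_apply C f"] AE_space
      show "AE p in cube_measure. rep_L2 (blinfun_apply (C - pixel_operator \<gamma>) f) p = (LINT q|cube_measure. k (p, q) * rep_L2 f q)"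
      proof eventually_elim
        case (elim p)
        then have p: "p \<in> cbox 0 One" by (simp add: space_cube)
        have ints: "integrable cube_measure (\<lambda>q. indicator (cell s) q * rep_L2 f q)"
          and val: "(LINT q|cube_measure. indicator (cell s) q * rep_L2 f q) = inner (indicator_vector s) f" if "s \<in> pixels" for s
          using square_integrable_mult[OF sq[OF that] rep_L2_square_integrable[of f]]
            inner_abs_L2_right[OF sq[OF that], of f]
          by (auto simp: indicator_vector_def inner_commute mult.commute)
        have "(LINT q|cube_measure. k (p, q) * rep_L2 f q)
            = (LINT q|cube_measure. c (p, q) * rep_L2 f q - (\<Sum>z\<in>pixels \<times> pixels. (\<gamma> (fst z) (snd z) * indicator (cell (fst z)) p) * (indicator (cell (snd z)) q * rep_L2 f q)))"
          by (intro Bochner_Integration.integral_cong refl)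
            (simp add: k_def case_prod_unfold left_diff_distrib sum_distrib_right mult.assoc)
        also have "\<dots> = (LINT q|cube_measure. c (p, q) * rep_L2 f q)
            - (\<Sum>z\<in>pixels \<times> pixels. (\<gamma> (fst z) (snd z) * indicator (cell (fst z)) p) * inner (indicator_vector (snd z)) f)"
        proof -
          have "(LINT q|cube_measure. (\<Sum>z\<in>pixels \<times> pixels. (\<gamma> (fst z) (snd z) * indicator (cell (fst z)) p) * (indicator (cell (snd z)) q * rep_L2 f q)))
              = (\<Sum>z\<in>pixels \<times> pixels. (LINT q|cube_measure. (\<gamma> (fst z) (snd z) * indicator (cell (fst z)) p) * (indicator (cell (snd z)) q * rep_L2 f q)))"
            by (intro Bochner_Integration.integral_sum integrable_mult_right ints) auto
          also have "\<dots> = (\<Sum>z\<in>pixels \<times> pixels. (\<gamma> (fst z) (snd z) * indicator (cell (fst z)) p) * inner (indicator_vector (snd z)) f)"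
          proof (rule sum.cong[OF refl])
            fix z assume "z \<in> pixels \<times> pixels"
            then have "snd z \<in> pixels" by auto
            from val[OF this] show "(LINT q|cube_measure. (\<gamma> (fst z) (snd z) * indicator (cell (fst z)) p) * (indicator (cell (snd z)) q * rep_L2 f q))
                = (\<gamma> (fst z) (snd z) * indicator (cell (fst z)) p) * inner (indicator_vector (snd z)) f"
              by (simp only: integral_mult_right_zero)
          qed
          finally have sum_eq: "(LINT q|cube_measure. (\<Sum>z\<in>pixels \<times> pixels. (\<gamma> (fst z) (snd z) * indicator (cell (fst z)) p) * (indicator (cell (snd z)) q * rep_L2 f q)))
              = (\<Sum>z\<in>pixels \<times> pixels. (\<gamma> (fst z) (snd z) * indicator (cell (fst z)) p) * inner (indicator_vector (snd z)) f)" .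
          have "integrable cube_measure (\<lambda>q. \<Sum>z\<in>pixels \<times> pixels. (\<gamma> (fst z) (snd z) * indicator (cell (fst z)) p) * (indicator (cell (snd z)) q * rep_L2 f q))"
            by (intro Bochner_Integration.integrable_sum integrable_mult_right ints) auto
          from Bochner_Integration.integral_diff[OF square_integrable_mult[OF c[OF p] rep_L2_square_integrable] this]
          show ?thesis unfolding sum_eq .
        qed
        also have "(\<Sum>z\<in>pixels \<times> pixels. (\<gamma> (fst z) (snd z) * indicator (cell (fst z)) p) * inner (indicator_vector (snd z)) f) = g p"
          unfolding g_def case_prod_unfold by (intro sum.cong refl) (simp only: ac_simps)
        finally show ?case
          using elim by (simp only: gf)
      qed
    qed
  qed
  then show ?thesis by (simp only: hs_norm_minus_commute)
qed

end

text \<open>By bilinearity of \<open>rank_one\<close>: centring the surfaces centres their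
  coefficients with respect to the pixel indicators.\<close>

lemma empirical_covariance_pixel_surface:
  "empirical_covariance N (\<lambda>n. pixel_surface K1 K2 T S (\<lambda>i j. y n (i, j))) = pixel_operator (sample_covariance N y)"
proof -
  let ?Z = "\<lambda>n. \<Sum>r\<in>pixels. y n r *\<^sub>R indicator_vector r" and ?m = "\<lambda>r. (1 / real N) * (\<Sum>n=1..N. y n r)"
  have Z: "pixel_surface K1 K2 T S (\<lambda>i j. y n (i, j)) = ?Z n" for n
    by (simp add: pixel_surface_eq)
  have mean: "empirical_mean N ?Z = (\<Sum>r\<in>pixels. ?m r *\<^sub>R indicator_vector r)"
  proof -
    have "(\<Sum>n=1..N. ?Z n) = (\<Sum>r\<in>pixels. (\<Sum>n=1..N. y n r) *\<^sub>R indicator_vector r)"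
      by (subst sum.swap) (simp add: scaleR_sum_left)
    then show ?thesis
      by (simp add: empirical_mean_def scaleR_sum_right)
  qed
  have diff: "?Z n - empirical_mean N ?Z = (\<Sum>r\<in>pixels. (y n r - ?m r) *\<^sub>R indicator_vector r)" for n
    unfolding mean by (simp add: scaleR_left_diff_distrib sum_subtractf)
  have "empirical_covariance N ?Z = (1 / real N) *\<^sub>R (\<Sum>n=1..N. \<Sum>q\<in>pixels \<times> pixels.
      ((y n (fst q) - ?m (fst q)) * (y n (snd q) - ?m (snd q))) *\<^sub>R rank_one (indicator_vector (fst q)) (indicator_vector (snd q)))"
    unfolding empirical_covariance_def diff rank_one_sum case_prod_unfold ..
  also have "\<dots> = (1 / real N) *\<^sub>R (\<Sum>q\<in>pixels \<times> pixels. (\<Sum>n=1..N.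
      (y n (fst q) - ?m (fst q)) * (y n (snd q) - ?m (snd q))) *\<^sub>R rank_one (indicator_vector (fst q)) (indicator_vector (snd q)))"
    by (subst sum.swap) (simp only: scaleR_sum_left)
  also have "\<dots> = pixel_operator (sample_covariance N y)"
    by (simp add: pixel_operator_def sample_covariance_def case_prod_unfold scaleR_sum_right)
  finally show ?thesis unfolding Z .
qed

end

section \<open>Noisy pixel samples\<close>

context prob_space
begin

lemma indep_var_expectation_mult:
  fixes f g :: "'b \<Rightarrow> real"
  assumes "indep_var M1 F M2 H" and f: "f \<in> borel_measurable M1" and g: "g \<in> borel_measurable M2"
    and int: "integrable M (\<lambda>\<omega>. f (F \<omega>))" "integrable M (\<lambda>\<omega>. g (H \<omega>))"
  shows "integrable M (\<lambda>\<omega>. f (F \<omega>) * g (H \<omega>))"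
    and "expectation (\<lambda>\<omega>. f (F \<omega>) * g (H \<omega>)) = expectation (\<lambda>\<omega>. f (F \<omega>)) * expectation (\<lambda>\<omega>. g (H \<omega>))"
proof -
  have "indep_var borel (f \<circ> F) borel (g \<circ> H)"
    by (rule indep_var_compose[OF assms(1) f g])
  then have i: "indep_var borel (\<lambda>\<omega>. f (F \<omega>)) borel (\<lambda>\<omega>. g (H \<omega>))"
    by (simp add: o_def)
  show "integrable M (\<lambda>\<omega>. f (F \<omega>) * g (H \<omega>))"
    by (rule indep_var_integrable[OF i int])
  show "expectation (\<lambda>\<omega>. f (F \<omega>) * g (H \<omega>)) = expectation (\<lambda>\<omega>. f (F \<omega>)) * expectation (\<lambda>\<omega>. g (H \<omega>))"
    by (rule indep_var_lebesgue_integral[OF i int])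
qed

lemma indep_vars_expectation_mult:
  fixes f g :: "('i \<Rightarrow> 'b) \<Rightarrow> real"
  assumes X: "indep_vars (\<lambda>_. N) X I" and AB: "A \<inter> B = {}" "A \<subseteq> I" "B \<subseteq> I"
    and f: "f \<in> borel_measurable (PiM A (\<lambda>_. N))" and g: "g \<in> borel_measurable (PiM B (\<lambda>_. N))"
    and int: "integrable M (\<lambda>\<omega>. f (\<lambda>i\<in>A. X i \<omega>))" "integrable M (\<lambda>\<omega>. g (\<lambda>i\<in>B. X i \<omega>))"
  shows "expectation (\<lambda>\<omega>. f (\<lambda>i\<in>A. X i \<omega>) * g (\<lambda>i\<in>B. X i \<omega>))
    = expectation (\<lambda>\<omega>. f (\<lambda>i\<in>A. X i \<omega>)) * expectation (\<lambda>\<omega>. g (\<lambda>i\<in>B. X i \<omega>))"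
  by (rule indep_var_expectation_mult(2)[where f = f and g = g and F = "\<lambda>\<omega>. \<lambda>i\<in>A. X i \<omega>"
        and H = "\<lambda>\<omega>. \<lambda>i\<in>B. X i \<omega>", OF indep_var_restrict[OF X AB] f g int])

end

text \<open>One fixed grid. The bounds \<open>m4\<close>, \<open>cb\<close> and
  \<open>\<kappa>\<close> are parameters, so that the same values can serve all grids. Pixel values
  are expressed by functionals \<open>\<phi>\<close> common to all \<open>n\<close>, so that they
  inherit independence and equal laws from the surfaces.\<close>

locale pixel_sample = prob_space M + pixel_grid K1 K2 T S
  for M :: "'w measure" and K1 K2 T S +
  fixes Xs :: "nat \<Rightarrow> 'w \<Rightarrow> (real \<times> real) L2" and C :: "(real \<times> real) L2 \<Rightarrow>\<^sub>L (real \<times> real) L2"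
    and c :: "(real \<times> real) \<times> (real \<times> real) \<Rightarrow> real" and L :: real
    and \<phi> :: "nat \<times> nat \<Rightarrow> (real \<times> real) L2 \<Rightarrow> real"
    and e XK :: "nat \<Rightarrow> nat \<times> nat \<Rightarrow> 'w \<Rightarrow> real" and \<tau>2 \<kappa> m4 cb :: real
  assumes Xs_indep: "indep_vars (\<lambda>_. borel) Xs {1..}"
    and Xs_law: "\<And>n. 1 \<le> n \<Longrightarrow> distr M borel (Xs n) = distr M borel (Xs 1)"
    and Xs_grid: "\<And>n. 1 \<le> n \<Longrightarrow> gridded_covariance M (Xs n) C c L K1 K2 T S"
    and Xs4: "integrable M (\<lambda>\<omega>. norm (Xs 1 \<omega> - expectation (Xs 1)) ^ 4)"
    and Xs4_le: "expectation (\<lambda>\<omega>. norm (Xs 1 \<omega> - expectation (Xs 1)) ^ 4) \<le> m4"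
    and \<phi>_measurable: "\<And>r. r \<in> pixels \<Longrightarrow> \<phi> r \<in> borel_measurable borel"
    and \<phi>_regular: "\<And>n. 1 \<le> n \<Longrightarrow> gridded_covariance.regular_pixel_functional M (Xs n) c L K1 K2 T S \<phi>"
    and XK_\<phi>: "\<And>n r. 1 \<le> n \<Longrightarrow> r \<in> pixels \<Longrightarrow> AE \<omega> in M. XK n r \<omega> = \<phi> r (Xs n \<omega>)"
    and cb: "\<And>p. p \<in> cbox 0 One \<Longrightarrow> c (p, p) \<le> cb"
    and e_indep: "indep_vars (\<lambda>_. borel) (\<lambda>(n, r). e n r) ({1..} \<times> pixels)"
    and e_mean: "\<And>n r. 1 \<le> n \<Longrightarrow> r \<in> pixels \<Longrightarrow> expectation (e n r) = 0"
    and e_var: "\<And>n r. 1 \<le> n \<Longrightarrow> r \<in> pixels \<Longrightarrow> expectation (\<lambda>\<omega>. (e n r \<omega>)\<^sup>2) = \<tau>2"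
    and e_fourth: "\<And>n r. 1 \<le> n \<Longrightarrow> r \<in> pixels \<Longrightarrow> integrable M (\<lambda>\<omega>. e n r \<omega> ^ 4)"
    and e_fourth_le: "\<And>n r. 1 \<le> n \<Longrightarrow> r \<in> pixels \<Longrightarrow> expectation (\<lambda>\<omega>. e n r \<omega> ^ 4) \<le> \<kappa>"
    and e_XK: "indep_var
      (PiM ({1..} \<times> pixels) (\<lambda>_. borel)) (\<lambda>\<omega>. \<lambda>(n, r)\<in>{1..} \<times> pixels. e n r \<omega>)
      (PiM ({1..} \<times> pixels) (\<lambda>_. borel)) (\<lambda>\<omega>. \<lambda>(n, r)\<in>{1..} \<times> pixels. XK n r \<omega>)"
begin

definition \<mu> where "\<mu> r = expectation (\<lambda>\<omega>. \<phi> r (Xs 1 \<omega>))"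
definition m where "m = expectation (Xs 1)"
definition x where "x n r \<omega> = \<phi> r (Xs n \<omega>) - \<mu> r"
definition B :: "nat \<Rightarrow> real" where "B k = 4 * 16 ^ k"
text \<open>The truncation event. It depends on the \<open>n\<close>-th surface alone, which keeps
  truncated products of different surfaces independent.\<close>

definition G where "G k n \<omega> \<longleftrightarrow> (\<Sum>r\<in>pixels. (x n r \<omega>)\<^sup>2) / real (card pixels) \<le> B k * (norm (Xs n \<omega> - m))\<^sup>2"
definition \<gamma> where "\<gamma> r s = expectation (\<lambda>\<omega>. x 1 r \<omega> * x 1 s \<omega>)"

lemma Xs_measurable [measurable]: "1 \<le> n \<Longrightarrow> Xs n \<in> borel_measurable M"
  using Xs_indep unfolding indep_vars_def by auto

lemma e_measurable [measurable]: "1 \<le> n \<Longrightarrow> r \<in> pixels \<Longrightarrow> e n r \<in> borel_measurable M"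
  using e_indep unfolding indep_vars_def by auto

lemma XK_measurable: "1 \<le> n \<Longrightarrow> r \<in> pixels \<Longrightarrow> XK n r \<in> borel_measurable M"
proof -
  assume nr: "1 \<le> n" "r \<in> pixels"
  have "(\<lambda>\<omega>. \<lambda>(n, r)\<in>{1..} \<times> pixels. XK n r \<omega>) \<in> M \<rightarrow>\<^sub>M PiM ({1..} \<times> pixels) (\<lambda>_. borel)"
    using e_XK by (rule indep_var_rv2)
  from measurable_compose[OF this measurable_component_singleton[of "(n, r)"]] nr
  show "XK n r \<in> borel_measurable M" by simp
qed

lemma x_measurable [measurable]: "1 \<le> n \<Longrightarrow> r \<in> pixels \<Longrightarrow> x n r \<in> borel_measurable M"
  unfolding x_def using \<phi>_measurable by measurable

lemma same_law:
  fixes h :: "(real \<times> real) L2 \<Rightarrow> 'b::{banach, second_countable_topology}"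
  assumes n: "1 \<le> n" and h: "h \<in> borel_measurable borel"
  shows "integrable M (\<lambda>\<omega>. h (Xs n \<omega>)) \<longleftrightarrow> integrable M (\<lambda>\<omega>. h (Xs 1 \<omega>))"
    and "expectation (\<lambda>\<omega>. h (Xs n \<omega>)) = expectation (\<lambda>\<omega>. h (Xs 1 \<omega>))"
  using integrable_distr_eq[OF Xs_measurable[OF n] h] integrable_distr_eq[OF Xs_measurable[of 1] h]
    integral_distr[OF Xs_measurable[OF n] h] integral_distr[OF Xs_measurable[of 1] h]
  by (simp_all add: Xs_law[OF n])

lemma expectation_Xs: "1 \<le> n \<Longrightarrow> expectation (Xs n) = m"
  using same_law(2)[of n "\<lambda>f. f"] by (simp add: m_def)

lemma expectation_\<phi>: "1 \<le> n \<Longrightarrow> r \<in> pixels \<Longrightarrow> expectation (\<lambda>\<omega>. \<phi> r (Xs n \<omega>)) = \<mu> r"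
  using same_law(2)[of n "\<phi> r"] \<phi>_measurable by (simp add: \<mu>_def)

lemma x_regular:
  assumes n: "1 \<le> n"
  shows "r \<in> pixels \<Longrightarrow> square_integrable_var (x n r)"
    and "r \<in> pixels \<Longrightarrow> s \<in> pixels \<Longrightarrow> p \<in> cell r \<Longrightarrow> q \<in> cell s \<Longrightarrow>
      \<bar>expectation (\<lambda>\<omega>. x n r \<omega> * x n s \<omega>) - c (p, q)\<bar> \<le> sqrt 2 * L * mesh"
    and "expectation (\<lambda>\<omega>. if G k n \<omega> then 0 else (\<Sum>r\<in>pixels. (x n r \<omega>)\<^sup>2) / real (card pixels)) \<le> 16 * sqrt 2 * L * mesh / 4 ^ k"
proof -
  interpret g: gridded_covariance M "Xs n" C c L K1 K2 T S
    by (rule Xs_grid[OF n])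
  have c: "g.centred (\<lambda>\<omega>. \<phi> r (Xs n \<omega>)) \<omega> = x n r \<omega>" if "r \<in> pixels" for r \<omega>
    using expectation_\<phi>[OF n that] by (simp add: g.centred_def x_def)
  have pn: "g.pixel_norm \<phi> \<omega> = (\<Sum>r\<in>pixels. (x n r \<omega>)\<^sup>2) / real (card pixels)" for \<omega>
    unfolding g.pixel_norm_def by (simp add: c)
  note reg = \<phi>_regular[OF n, unfolded g.regular_pixel_functional_def pn expectation_Xs[OF n] G_def[symmetric] B_def[symmetric]]
  show sq: "square_integrable_var (x n r)" if "r \<in> pixels" for r
    unfolding x_def[abs_def] using reg that by (intro square_integrable_var_diff square_integrable_var_const) blast
  show "\<bar>expectation (\<lambda>\<omega>. x n r \<omega> * x n s \<omega>) - c (p, q)\<bar> \<le> sqrt 2 * L * mesh"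
    if "r \<in> pixels" "s \<in> pixels" "p \<in> cell r" "q \<in> cell s" for r s p q
    using reg that by (simp add: c)
  show "expectation (\<lambda>\<omega>. if G k n \<omega> then 0 else (\<Sum>r\<in>pixels. (x n r \<omega>)\<^sup>2) / real (card pixels)) \<le> 16 * sqrt 2 * L * mesh / 4 ^ k"
    using reg by blast
qed

lemma L_nonneg: "0 \<le> L"
proof -
  interpret g: gridded_covariance M "Xs 1" C c L K1 K2 T S
    by (rule Xs_grid) simp
  show ?thesis by (rule g.L_nonneg)
qed

lemma covariance_kernel_dist:
  "r \<in> pixels \<Longrightarrow> s \<in> pixels \<Longrightarrow> p \<in> cell r \<Longrightarrow> q \<in> cell s \<Longrightarrow> \<bar>\<gamma> r s - c (p, q)\<bar> \<le> sqrt 2 * L * mesh"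
  unfolding \<gamma>_def by (rule x_regular(2)) simp

text \<open>Compared with \<open>c (p, p)\<close> at a point of the cell;
  \<open>mesh \<le> sqrt 2\<close> turns the error into \<open>2 * L\<close>, which is free of the
  grid.\<close>

lemma \<gamma>_diag_le:
  assumes r: "r \<in> pixels"
  shows "\<gamma> r r \<le> cb + 2 * L"
proof -
  have "cell r \<noteq> {}"
    using measure_cell[OF r] K by auto
  then obtain p where p: "p \<in> cell r" by auto
  have "sqrt 2 * mesh \<le> sqrt 2 * sqrt 2"
    by (intro mult_left_mono mesh_le) simp
  then have "L * (sqrt 2 * mesh) \<le> L * 2"
    using L_nonneg by (intro mult_left_mono) simp_all
  then have "sqrt 2 * L * mesh \<le> 2 * L" by (simp add: ac_simps)
  then show ?thesis
    using covariance_kernel_dist[OF r r p p] cb[of p] cell_unit[OF r] p by fastforce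
qed

lemma x_law:
  assumes n: "1 \<le> n" and rs: "r \<in> pixels" "s \<in> pixels"
  shows "expectation (\<lambda>\<omega>. x n r \<omega> * x n s \<omega>) = \<gamma> r s"
  unfolding \<gamma>_def x_def
  using same_law(2)[OF n, of "\<lambda>f. (\<phi> r f - \<mu> r) * (\<phi> s f - \<mu> s)"] \<phi>_measurable rs by simp

lemma Xs_expectation_mult:
  fixes f g :: "(real \<times> real) L2 \<Rightarrow> real"
  assumes nm: "1 \<le> n" "1 \<le> n'" "n \<noteq> n'" and fg: "f \<in> borel_measurable borel" "g \<in> borel_measurable borel"
    and int: "integrable M (\<lambda>\<omega>. f (Xs n \<omega>))" "integrable M (\<lambda>\<omega>. g (Xs n' \<omega>))"
  shows "expectation (\<lambda>\<omega>. f (Xs n \<omega>) * g (Xs n' \<omega>)) = expectation (\<lambda>\<omega>. f (Xs n \<omega>)) * expectation (\<lambda>\<omega>. g (Xs n' \<omega>))"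
proof -
  have 1: "(\<lambda>v. f (v n)) \<in> borel_measurable (PiM {n} (\<lambda>_. borel))" "(\<lambda>v. g (v n')) \<in> borel_measurable (PiM {n'} (\<lambda>_. borel))"
    by (rule measurable_compose[OF measurable_component_singleton[of n "{n}" "\<lambda>_. borel"] fg(1)], simp,
        rule measurable_compose[OF measurable_component_singleton[of n' "{n'}" "\<lambda>_. borel"] fg(2)], simp)
  show ?thesis
    using indep_vars_expectation_mult[OF Xs_indep _ _ _ 1] nm int by simp
qed

lemma expectation_x: "1 \<le> n \<Longrightarrow> r \<in> pixels \<Longrightarrow> expectation (x n r) = 0"
proof -
  assume nr: "1 \<le> n" "r \<in> pixels"
  have "square_integrable_var (\<lambda>\<omega>. x n r \<omega> + \<mu> r)"
    by (intro square_integrable_var_add square_integrable_var_const x_regular nr)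
  then have "integrable M (\<lambda>\<omega>. \<phi> r (Xs n \<omega>))"
    using square_integrable_var_integrable by (simp add: x_def)
  then show "expectation (x n r) = 0"
    using expectation_\<phi>[OF nr] by (simp add: x_def[abs_def] prob_space)
qed

lemma x_uncorrelated:
  assumes "1 \<le> n" "1 \<le> n'" "n \<noteq> n'" "r \<in> pixels"
  shows "expectation (\<lambda>\<omega>. x n r \<omega> * x n' r \<omega>) = 0"
proof -
  have f: "(\<lambda>f. \<phi> r f - \<mu> r) \<in> borel_measurable borel"
    using \<phi>_measurable[OF assms(4)] by simp
  have "integrable M (\<lambda>\<omega>. \<phi> r (Xs n \<omega>) - \<mu> r)" "expectation (\<lambda>\<omega>. \<phi> r (Xs n \<omega>) - \<mu> r) = 0" if "1 \<le> n" for n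
    using square_integrable_var_integrable[OF x_regular(1)[OF that assms(4)]] expectation_x[OF that assms(4)]
    unfolding x_def[abs_def] by simp_all
  with Xs_expectation_mult[OF assms(1-3) f f] assms show ?thesis
    unfolding x_def by (simp only: mult_zero_left)
qed

lemma e_square_integrable:
  assumes "1 \<le> n" "r \<in> pixels"
  shows "square_integrable_var (\<lambda>\<omega>. (e n r \<omega>)\<^sup>2)" "square_integrable_var (e n r)"
proof -
  show *: "square_integrable_var (\<lambda>\<omega>. (e n r \<omega>)\<^sup>2)"
    using e_fourth[OF assms] e_measurable[OF assms] by (simp add: square_integrable_var_def)
  show "square_integrable_var (e n r)"
    using square_integrable_var_integrable[OF *] e_measurable[OF assms] by (simp add: square_integrable_var_def)
qed

text \<open>The inequality \<open>2 * a * b \<le> a\<^sup>2 + b\<^sup>2\<close>, applied to squares,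
  reduces products to fourth moments. The case \<open>p = q\<close> is included.\<close>

lemma e_mult:
  assumes n: "1 \<le> n" and pq: "p \<in> pixels" "q \<in> pixels"
  shows "square_integrable_var (\<lambda>\<omega>. e n p \<omega> * e n q \<omega>)"
    and "expectation (\<lambda>\<omega>. (e n p \<omega> * e n q \<omega>)\<^sup>2) \<le> \<kappa>"
proof -
  have ab: "(a * b)\<^sup>2 \<le> (a ^ 4 + b ^ 4) / 2" for a b :: real
  proof -
    have "2 * (a\<^sup>2 * b\<^sup>2) \<le> (a\<^sup>2)\<^sup>2 + (b\<^sup>2)\<^sup>2"
      using sum_squares_bound[of "a\<^sup>2" "b\<^sup>2"] by simp
    then show ?thesis by (simp add: power_mult_distrib)
  qed
  have int: "integrable M (\<lambda>\<omega>. (e n p \<omega> ^ 4 + e n q \<omega> ^ 4) / 2)"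
    using e_fourth n pq by simp
  have "integrable M (\<lambda>\<omega>. (e n p \<omega> * e n q \<omega>)\<^sup>2)"
    by (rule Bochner_Integration.integrable_bound[OF int])
      (use n pq ab in \<open>auto intro!: AE_I2 order_trans[OF ab] simp: abs_of_nonneg\<close>)
  then show "square_integrable_var (\<lambda>\<omega>. e n p \<omega> * e n q \<omega>)"
    using n pq by (auto simp: square_integrable_var_def)
  have "expectation (\<lambda>\<omega>. (e n p \<omega> * e n q \<omega>)\<^sup>2) \<le> expectation (\<lambda>\<omega>. (e n p \<omega> ^ 4 + e n q \<omega> ^ 4) / 2)"
    by (intro integral_mono int ab) fact
  also have "\<dots> \<le> \<kappa>"
    using e_fourth e_fourth_le[OF n pq(1)] e_fourth_le[OF n pq(2)] n pq by simp
  finally show "expectation (\<lambda>\<omega>. (e n p \<omega> * e n q \<omega>)\<^sup>2) \<le> \<kappa>" .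
qed

text \<open>Covers two pixels of one surface as well as two different surfaces.\<close>

lemma e_distinct:
  assumes "1 \<le> n" "1 \<le> n'" "r \<in> pixels" "r' \<in> pixels" "(n, r) \<noteq> (n', r')"
  shows "expectation (\<lambda>\<omega>. e n r \<omega> * e n' r' \<omega>) = 0"
proof -
  have 1: "(\<lambda>v. v (n, r)) \<in> borel_measurable (PiM {(n, r)} (\<lambda>_. borel))"
    "(\<lambda>v. v (n', r')) \<in> borel_measurable (PiM {(n', r')} (\<lambda>_. borel))"
    by (rule measurable_component_singleton, simp)+
  have "{(n, r)} \<inter> {(n', r')} = {}" using assms(5) by auto
  from indep_vars_expectation_mult[OF e_indep this _ _ 1] show ?thesis
    using assms square_integrable_var_integrable[OF e_square_integrable(2)] e_mean by simp
qed

text \<open>For different \<open>n\<close> the products are functions of disjoint blocks of errors,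
  hence independent. For \<open>p = q\<close> a block shrinks to one index and the argument is
  unchanged.\<close>

lemma e_products_uncorrelated:
  assumes "1 \<le> n" "1 \<le> n'" "n \<noteq> n'" "p \<in> pixels" "q \<in> pixels"
    and d: "expectation (\<lambda>\<omega>. e n p \<omega> * e n q \<omega>) = d"
  shows "expectation (\<lambda>\<omega>. (e n p \<omega> * e n q \<omega> - d) * (e n' p \<omega> * e n' q \<omega> - d)) = 0"
proof -
  have 1: "(\<lambda>v. v (n, p) * v (n, q) - d) \<in> borel_measurable (PiM {(n, p), (n, q)} (\<lambda>_. borel))" for n
    by (intro borel_measurable_diff borel_measurable_times measurable_component_singleton) auto
  have int: "integrable M (\<lambda>\<omega>. e n p \<omega> * e n q \<omega> - d)" if "1 \<le> n" for n
    using square_integrable_var_integrable[OF e_mult(1)] that assms by simp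
  have "expectation (\<lambda>\<omega>. e n p \<omega> * e n q \<omega> - d) = 0"
    using square_integrable_var_integrable[OF e_mult(1)] assms by (simp add: prob_space)
  then show ?thesis
    using indep_vars_expectation_mult[OF e_indep _ _ _ 1[of n] 1[of n']] assms int by simp
qed

lemma centred_XK:
  assumes n: "1 \<le> n" and r: "r \<in> pixels"
  shows "AE \<omega> in M. XK n r \<omega> - \<mu> r = x n r \<omega>"
  using XK_\<phi>[OF n r] by eventually_elim (simp add: x_def)

text \<open>
  The noise is independent of the measured pixel values \<open>XK\<close>, which agree with the functionals of
  the surfaces only almost surely.
\<close>

lemma noise_surface_mult:
  assumes I: "1 \<le> n" "1 \<le> n'" "p \<in> pixels" "q \<in> pixels" and int: "integrable M (\<lambda>\<omega>. e n q \<omega> * e n' q \<omega>)"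
  shows "integrable M (\<lambda>\<omega>. (e n q \<omega> * e n' q \<omega>) * (x n p \<omega> * x n' p \<omega>))"
    and "expectation (\<lambda>\<omega>. (e n q \<omega> * e n' q \<omega>) * (x n p \<omega> * x n' p \<omega>))
      = expectation (\<lambda>\<omega>. e n q \<omega> * e n' q \<omega>) * expectation (\<lambda>\<omega>. x n p \<omega> * x n' p \<omega>)"
proof -
  let ?I = "{1..} \<times> pixels"
  have f: "(\<lambda>v. v (n, q) * v (n', q) :: real) \<in> borel_measurable (PiM ?I (\<lambda>_. borel))"
    "(\<lambda>v. (v (n, p) - \<mu> p) * (v (n', p) - \<mu> p)) \<in> borel_measurable (PiM ?I (\<lambda>_. borel))"
    using I by (auto intro!: borel_measurable_diff borel_measurable_times measurable_component_singleton)
  note [measurable] = XK_measurable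
  have ae: "AE \<omega> in M. (XK n p \<omega> - \<mu> p) * (XK n' p \<omega> - \<mu> p) = x n p \<omega> * x n' p \<omega>"
    using centred_XK[OF I(1,3)] centred_XK[OF I(2,3)] by eventually_elim simp
  have m: "(\<lambda>\<omega>. (XK n p \<omega> - \<mu> p) * (XK n' p \<omega> - \<mu> p)) \<in> borel_measurable M" "(\<lambda>\<omega>. x n p \<omega> * x n' p \<omega>) \<in> borel_measurable M"
    using I by measurable
  have int2: "integrable M (\<lambda>\<omega>. (XK n p \<omega> - \<mu> p) * (XK n' p \<omega> - \<mu> p))"
    using integrable_cong_AE[OF m ae] square_integrable_var_mult[OF x_regular(1) x_regular(1)] I by blast
  note prod = indep_var_expectation_mult[OF e_XK f]
  have ae2: "AE \<omega> in M. (e n q \<omega> * e n' q \<omega>) * ((XK n p \<omega> - \<mu> p) * (XK n' p \<omega> - \<mu> p)) = (e n q \<omega> * e n' q \<omega>) * (x n p \<omega> * x n' p \<omega>)"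
    using ae by eventually_elim simp
  have m2: "(\<lambda>\<omega>. (e n q \<omega> * e n' q \<omega>) * ((XK n p \<omega> - \<mu> p) * (XK n' p \<omega> - \<mu> p))) \<in> borel_measurable M"
    "(\<lambda>\<omega>. (e n q \<omega> * e n' q \<omega>) * (x n p \<omega> * x n' p \<omega>)) \<in> borel_measurable M"
    using m e_measurable I by (auto intro!: borel_measurable_times)
  show "integrable M (\<lambda>\<omega>. (e n q \<omega> * e n' q \<omega>) * (x n p \<omega> * x n' p \<omega>))"
    using prod(1) int int2 I integrable_cong_AE[OF m2 ae2] by simp
  show "expectation (\<lambda>\<omega>. (e n q \<omega> * e n' q \<omega>) * (x n p \<omega> * x n' p \<omega>))
      = expectation (\<lambda>\<omega>. e n q \<omega> * e n' q \<omega>) * expectation (\<lambda>\<omega>. x n p \<omega> * x n' p \<omega>)"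
    using prod(2) int int2 I integral_cong_AE[OF m2 ae2] integral_cong_AE[OF m ae] by simp
qed

text \<open>Independence factors the second moment into the noise variance and
  \<open>\<gamma> p p\<close>.\<close>

lemma x_e:
  assumes n: "1 \<le> n" and pq: "p \<in> pixels" "q \<in> pixels"
  shows "square_integrable_var (\<lambda>\<omega>. x n p \<omega> * e n q \<omega>)"
    and "expectation (\<lambda>\<omega>. (x n p \<omega> * e n q \<omega>)\<^sup>2) \<le> (cb + 2 * L) * \<tau>2"
proof -
  have i: "integrable M (\<lambda>\<omega>. e n q \<omega> * e n q \<omega>)"
    by (intro square_integrable_var_mult e_square_integrable n pq)
  have eq: "(\<lambda>\<omega>. (x n p \<omega> * e n q \<omega>)\<^sup>2) = (\<lambda>\<omega>. (e n q \<omega> * e n q \<omega>) * (x n p \<omega> * x n p \<omega>))"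
    by (auto simp: power2_eq_square)
  show "square_integrable_var (\<lambda>\<omega>. x n p \<omega> * e n q \<omega>)"
    unfolding square_integrable_var_def eq
    using noise_surface_mult(1)[OF n n pq i] n pq by auto
  have "0 \<le> \<tau>2"
    unfolding e_var[OF n pq(2), symmetric] by simp
  then show "expectation (\<lambda>\<omega>. (x n p \<omega> * e n q \<omega>)\<^sup>2) \<le> (cb + 2 * L) * \<tau>2"
    unfolding eq noise_surface_mult(2)[OF n n pq i] x_law[OF n pq(1) pq(1)]
    using e_var[OF n pq(2)] mult_right_mono[OF \<gamma>_diag_le[OF pq(1)], of \<tau>2]
    by (simp add: power2_eq_square mult.commute)
qed

lemma x_e_uncorrelated:
  assumes "1 \<le> n" "1 \<le> n'" "n \<noteq> n'" "p \<in> pixels" "q \<in> pixels"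
  shows "expectation (\<lambda>\<omega>. (x n p \<omega> * e n q \<omega>) * (x n' p \<omega> * e n' q \<omega>)) = 0"
proof -
  have i: "integrable M (\<lambda>\<omega>. e n q \<omega> * e n' q \<omega>)"
    by (intro square_integrable_var_mult e_square_integrable assms)
  have "(\<lambda>\<omega>. (x n p \<omega> * e n q \<omega>) * (x n' p \<omega> * e n' q \<omega>)) = (\<lambda>\<omega>. (e n q \<omega> * e n' q \<omega>) * (x n p \<omega> * x n' p \<omega>))"
    by auto
  then show ?thesis
    using noise_surface_mult(2)[OF assms(1,2,4,5) i] x_uncorrelated[OF assms(1-4)] by simp
qed

text \<open>The truncated product as a function of the surface, so that independence of the surfaces
  passes to it.\<close>

definition truncated where
  "truncated k p q f = (if (\<Sum>r\<in>pixels. (\<phi> r f - \<mu> r)\<^sup>2) / real (card pixels) \<le> B k * (norm (f - m))\<^sup>2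
    then (\<phi> p f - \<mu> p) * (\<phi> q f - \<mu> q) else 0)"

lemma truncated_measurable:
  assumes "p \<in> pixels" "q \<in> pixels"
  shows "truncated k p q \<in> borel_measurable borel"
proof -
  note [measurable] = \<phi>_measurable[OF assms(1)] \<phi>_measurable[OF assms(2)] \<phi>_measurable
  show ?thesis unfolding truncated_def[abs_def] by measurable
qed

lemma truncated_Xs: "truncated k p q (Xs n \<omega>) = (if G k n \<omega> then x n p \<omega> * x n q \<omega> else 0)"
  by (simp add: truncated_def G_def x_def)

lemma G_measurable: "1 \<le> n \<Longrightarrow> Measurable.pred M (G k n)"
  unfolding G_def[abs_def] by measurable

lemma norm4:
  assumes n: "1 \<le> n"
  shows "integrable M (\<lambda>\<omega>. norm (Xs n \<omega> - m) ^ 4)" "expectation (\<lambda>\<omega>. norm (Xs n \<omega> - m) ^ 4) \<le> m4"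
  using same_law[OF n, of "\<lambda>f. norm (f - m) ^ 4"] Xs4 Xs4_le by (simp_all add: m_def)

text \<open>The sum of squared products over all pairs is the square of a sum of squares, which
  \<open>G\<close> bounds by the norm of the surface. Fourth moments of that norm then suffice, and
  the number of pixels cancels against the weight.\<close>

lemma kept_bound:
  assumes G: "G k n \<omega>"
  shows "(\<Sum>(p, q)\<in>pixels \<times> pixels. (x n p \<omega> * x n q \<omega>)\<^sup>2) \<le> (real (card pixels))\<^sup>2 * ((B k)\<^sup>2 * norm (Xs n \<omega> - m) ^ 4)"
proof -
  have card: "0 < real (card pixels)" using K by (simp add: card_pixels)
  have "(\<Sum>(p, q)\<in>pixels \<times> pixels. (x n p \<omega> * x n q \<omega>)\<^sup>2) = (\<Sum>r\<in>pixels. (x n r \<omega>)\<^sup>2)\<^sup>2"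
    by (simp add: power_mult_distrib power2_eq_square[of "sum _ _"] sum_product sum.cartesian_product)
  also have "\<dots> \<le> (real (card pixels) * (B k * (norm (Xs n \<omega> - m))\<^sup>2))\<^sup>2"
    using G card by (intro power_mono) (auto simp: G_def sum_nonneg pos_divide_le_eq mult.commute)
  finally show ?thesis by (simp add: power_mult_distrib)
qed

lemma kept_square_integrable:
  assumes n: "1 \<le> n" and pq: "p \<in> pixels" "q \<in> pixels"
  shows "square_integrable_var (\<lambda>\<omega>. if G k n \<omega> then x n p \<omega> * x n q \<omega> else 0)"
proof -
  have m: "(\<lambda>\<omega>. if G k n \<omega> then x n p \<omega> * x n q \<omega> else 0) \<in> borel_measurable M"
    using measurable_compose[OF Xs_measurable[OF n] truncated_measurable[OF pq, of k]] by (simp add: truncated_Xs)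
  have "integrable M (\<lambda>\<omega>. (if G k n \<omega> then x n p \<omega> * x n q \<omega> else 0)\<^sup>2)"
  proof (rule Bochner_Integration.integrable_bound)
    show "integrable M (\<lambda>\<omega>. (real (card pixels))\<^sup>2 * ((B k)\<^sup>2 * norm (Xs n \<omega> - m) ^ 4))"
      using norm4(1)[OF n] by simp
    show "AE \<omega> in M. norm ((if G k n \<omega> then x n p \<omega> * x n q \<omega> else 0)\<^sup>2)
        \<le> norm ((real (card pixels))\<^sup>2 * ((B k)\<^sup>2 * norm (Xs n \<omega> - m) ^ 4))"
    proof (rule AE_I2)
      fix \<omega>
      have "(x n p \<omega> * x n q \<omega>)\<^sup>2 \<le> (\<Sum>(p, q)\<in>pixels \<times> pixels. (x n p \<omega> * x n q \<omega>)\<^sup>2)"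
        using member_le_sum[of "(p, q)" "pixels \<times> pixels" "\<lambda>(p, q). (x n p \<omega> * x n q \<omega>)\<^sup>2"] pq finite_pixels
        by (auto simp: case_prod_unfold)
      then have "G k n \<omega> \<Longrightarrow> (x n p \<omega> * x n q \<omega>)\<^sup>2 \<le> (real (card pixels))\<^sup>2 * ((B k)\<^sup>2 * norm (Xs n \<omega> - m) ^ 4)"
        using kept_bound[of k n \<omega>] by (rule order_trans)
      then show "norm ((if G k n \<omega> then x n p \<omega> * x n q \<omega> else 0)\<^sup>2)
        \<le> norm ((real (card pixels))\<^sup>2 * ((B k)\<^sup>2 * norm (Xs n \<omega> - m) ^ 4))"
        by (cases "G k n \<omega>") simp_all
    qed
  qed (use m in simp)
  then show ?thesis using m by (simp add: square_integrable_var_def)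
qed

lemma kept_uncorrelated:
  assumes n: "1 \<le> n" "1 \<le> n'" "n \<noteq> n'" and pq: "p \<in> pixels" "q \<in> pixels"
  shows "expectation (\<lambda>\<omega>.
        ((if G k n \<omega> then x n p \<omega> * x n q \<omega> else 0) - expectation (\<lambda>\<omega>. if G k n \<omega> then x n p \<omega> * x n q \<omega> else 0)) *
        ((if G k n' \<omega> then x n' p \<omega> * x n' q \<omega> else 0) - expectation (\<lambda>\<omega>. if G k n' \<omega> then x n' p \<omega> * x n' q \<omega> else 0))) = 0"
proof -
  have t: "(\<lambda>f. truncated k p q f - d) \<in> borel_measurable borel" for d
    using truncated_measurable[OF pq, of k] by simp
  have int: "integrable M (\<lambda>\<omega>. truncated k p q (Xs n \<omega>))" if "1 \<le> n" for n
    unfolding truncated_Xs using that pq by (intro square_integrable_var_integrable kept_square_integrable)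
  show ?thesis
    unfolding truncated_Xs[symmetric]
    using Xs_expectation_mult[OF n t t] int[OF n(1)] int[OF n(2)] by (simp add: prob_space)
qed

lemma kept_le:
  assumes n: "1 \<le> n"
  shows "(\<Sum>(p, q)\<in>pixels \<times> pixels. expectation (\<lambda>\<omega>. (if G k n \<omega> then x n p \<omega> * x n q \<omega> else 0)\<^sup>2)) / (real (card pixels))\<^sup>2
    \<le> (B k)\<^sup>2 * m4"
proof -
  have card: "0 < (real (card pixels))\<^sup>2" using K by (simp add: card_pixels)
  let ?w = "\<lambda>z \<omega>. (if G k n \<omega> then x n (fst z) \<omega> * x n (snd z) \<omega> else 0)\<^sup>2"
  have int: "integrable M (?w z)" if "z \<in> pixels \<times> pixels" for z
    using that n by (intro square_integrable_var_square kept_square_integrable) auto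
  have "(\<Sum>z\<in>pixels \<times> pixels. expectation (?w z)) = expectation (\<lambda>\<omega>. \<Sum>z\<in>pixels \<times> pixels. ?w z \<omega>)"
    by (intro Bochner_Integration.integral_sum[symmetric] int)
  also have "\<dots> \<le> expectation (\<lambda>\<omega>. (real (card pixels))\<^sup>2 * ((B k)\<^sup>2 * norm (Xs n \<omega> - m) ^ 4))"
  proof (intro integral_mono Bochner_Integration.integrable_sum int)
    show "integrable M (\<lambda>\<omega>. (real (card pixels))\<^sup>2 * ((B k)\<^sup>2 * norm (Xs n \<omega> - m) ^ 4))"
      using norm4(1)[OF n] by simp
    show "(\<Sum>z\<in>pixels \<times> pixels. ?w z \<omega>) \<le> (real (card pixels))\<^sup>2 * ((B k)\<^sup>2 * norm (Xs n \<omega> - m) ^ 4)" for \<omega>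
      using kept_bound[of k n \<omega>] by (cases "G k n \<omega>") (auto simp: case_prod_unfold)
  qed
  also have "\<dots> = (real (card pixels))\<^sup>2 * ((B k)\<^sup>2 * expectation (\<lambda>\<omega>. norm (Xs n \<omega> - m) ^ 4))"
    by simp
  also have "\<dots> \<le> (real (card pixels))\<^sup>2 * ((B k)\<^sup>2 * m4)"
    using norm4(2)[OF n] by (intro mult_left_mono) auto
  finally show ?thesis
    using card by (simp add: pos_divide_le_eq case_prod_unfold mult.commute)
qed

lemma noisy_sample:
  assumes N: "1 \<le> N"
  shows "noisy_sample M N pixels x e (G k) \<gamma> \<tau>2 (cb + 2 * L) \<kappa> ((B k)\<^sup>2 * m4) (16 * sqrt 2 * L * mesh / 4 ^ k)"
proof unfold_locales
  fix n n' p q assume n: "n \<in> {1..N}" and n': "n' \<in> {1..N}" and p: "p \<in> pixels" and q: "q \<in> pixels"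
  show "expectation (\<lambda>\<omega>. e n p \<omega> * e n q \<omega>) = (if p = q then \<tau>2 else 0)"
    using n p q e_var[of n p] e_distinct[of n n p q] by (auto simp: power2_eq_square)
next
  fix n n' p q assume n: "n \<in> {1..N}" "n' \<in> {1..N}" "n \<noteq> n'" and p: "p \<in> pixels" and q: "q \<in> pixels"
  have "expectation (\<lambda>\<omega>. e n p \<omega> * e n q \<omega>) = (if p = q then \<tau>2 else 0)"
    using n p q e_var[of n p] e_distinct[of n n p q] by (auto simp: power2_eq_square)
  then show "expectation (\<lambda>\<omega>. (e n p \<omega> * e n q \<omega> - (if p = q then \<tau>2 else 0)) * (e n' p \<omega> * e n' q \<omega> - (if p = q then \<tau>2 else 0))) = 0"
    using n p q by (intro e_products_uncorrelated) auto
next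
  fix n n' p assume "n \<in> {1..N}" "n' \<in> {1..N}" "n \<noteq> n'" "p \<in> pixels"
  then show "expectation (\<lambda>\<omega>. e n p \<omega> * e n' p \<omega>) = 0"
    by (intro e_distinct) auto
qed (use N finite_pixels pixels_nonempty in \<open>simp_all add: x_regular x_law x_uncorrelated \<gamma>_diag_le e_square_integrable e_mult x_e x_e_uncorrelated
    G_measurable kept_square_integrable kept_uncorrelated kept_le\<close>)

end

section \<open>Tail bound for one grid\<close>

context pixel_sample
begin

text \<open>Built from the recorded values \<open>XK\<close>, with which the functionals
  \<open>\<phi>\<close> agree only almost surely.\<close>

definition measured :: "nat \<Rightarrow> 'w \<Rightarrow> nat \<times> nat \<Rightarrow> nat \<times> nat \<Rightarrow> real"
  where "measured N \<omega> = sample_covariance N (\<lambda>n r. XK n r \<omega> + e n r \<omega>)"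

definition limit_covariance :: "nat \<times> nat \<Rightarrow> nat \<times> nat \<Rightarrow> real"
  where "limit_covariance r s = \<gamma> r s + (if r = s then \<tau>2 else 0)"

lemma noise_variance_nonneg: "0 \<le> \<tau>2"
proof -
  obtain r where "r \<in> pixels" using pixels_nonempty by auto
  then show ?thesis using e_var[of 1 r, symmetric] by simp
qed

lemma pixel_distance_measurable:
  assumes "\<And>n r. n \<in> {1..N} \<Longrightarrow> r \<in> pixels \<Longrightarrow> y n r \<in> borel_measurable M"
  shows "(\<lambda>\<omega>. pixel_distance (sample_covariance N (\<lambda>n r. y n r \<omega>)) g) \<in> borel_measurable M"
proof -
  have mean: "(\<lambda>\<omega>. (1 / real N) * (\<Sum>n=1..N. y n r \<omega>)) \<in> borel_measurable M" if "r \<in> pixels" for r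
    using assms that by (intro borel_measurable_times borel_measurable_const borel_measurable_sum)
  have [measurable]: "(\<lambda>\<omega>. sample_covariance N (\<lambda>n r. y n r \<omega>) r s) \<in> borel_measurable M"
    if "r \<in> pixels" "s \<in> pixels" for r s
    unfolding sample_covariance_def using assms that
    by (intro borel_measurable_times borel_measurable_const borel_measurable_sum borel_measurable_diff mean)
  have "(\<lambda>\<omega>. \<Sum>q\<in>pixels \<times> pixels. (sample_covariance N (\<lambda>n r. y n r \<omega>) (fst q) (snd q) - g (fst q) (snd q))\<^sup>2)
      \<in> borel_measurable M"
    by (intro borel_measurable_sum) auto
  then show ?thesis
    unfolding pixel_distance_def L2_set_def case_prod_unfold by simp
qed

text \<open>An instance of \<open>deviation_tail\<close> with \<open>h = L * mesh\<close> and
  \<open>\<eta> = 16 * sqrt 2 / 4 ^ k\<close>, transferred from the functionals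
  \<open>\<phi>\<close> to the recorded values.\<close>

lemma measured_distance_tail:
  assumes N: "1 \<le> N" and t: "0 < t" and k: "3 \<le> k"
  shows "prob {\<omega> \<in> space M. L * mesh + t < pixel_distance (measured N \<omega>) limit_covariance}
    \<le> (sqrt ((B k)\<^sup>2 * m4) + 2 * sqrt ((cb + 2 * L) * \<tau>2) + sqrt \<kappa> + 2 * (cb + 2 * L + \<tau>2)) / (t * sqrt (real N))
      + 32 * sqrt 2 / 4 ^ k"
proof -
  interpret ns: noisy_sample M N pixels x e "G k" \<gamma> \<tau>2 "cb + 2 * L" \<kappa> "(B k)\<^sup>2 * m4" "16 * sqrt 2 * L * mesh / 4 ^ k"
    by (rule noisy_sample[OF N])
  have dev: "ns.deviation \<mu> \<omega> = pixel_distance (sample_covariance N (\<lambda>n r. x n r \<omega> + e n r \<omega> + \<mu> r)) limit_covariance" for \<omega>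
    unfolding ns.deviation_def ns.weight_def pixel_distance_def ns.target_def limit_covariance_def ..
  \<comment> \<open>Only finitely many surfaces and pixels enter, so the almost sure identities hold
    jointly.\<close>
  have "AE \<omega> in M. \<forall>n\<in>{1..N}. \<forall>r\<in>pixels. XK n r \<omega> = x n r \<omega> + \<mu> r"
  proof (intro AE_finite_allI finite_pixels finite_atLeastAtMost)
    fix n r assume "n \<in> {1..N}" "r \<in> pixels"
    then have "AE \<omega> in M. XK n r \<omega> - \<mu> r = x n r \<omega>" by (intro centred_XK) auto
    then show "AE \<omega> in M. XK n r \<omega> = x n r \<omega> + \<mu> r" by eventually_elim simp
  qed
  then have ae: "AE \<omega> in M. pixel_distance (measured N \<omega>) limit_covariance = ns.deviation \<mu> \<omega>"
  proof eventually_elim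
    case (elim \<omega>)
    have "measured N \<omega> r s = sample_covariance N (\<lambda>n r. x n r \<omega> + e n r \<omega> + \<mu> r) r s" if "r \<in> pixels" "s \<in> pixels" for r s
    proof -
      have "XK n r' \<omega> + e n r' \<omega> = x n r' \<omega> + e n r' \<omega> + \<mu> r'" if "n \<in> {1..N}" "r' \<in> {r, s}" for n r'
        using elim that \<open>r \<in> pixels\<close> \<open>s \<in> pixels\<close> by auto
      then show ?thesis
        unfolding measured_def by (intro sample_covariance_cong) auto
    qed
    then show ?case
      unfolding dev pixel_distance_def by (intro arg_cong2[where f = "(*)"] refl L2_set_cong) auto
  qed
  have m: "ns.deviation \<mu> \<in> borel_measurable M"
    unfolding dev using x_measurable e_measurable
    by (intro pixel_distance_measurable borel_measurable_add borel_measurable_const) auto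
  have "prob {\<omega> \<in> space M. L * mesh + t < pixel_distance (measured N \<omega>) limit_covariance}
      \<le> prob {\<omega> \<in> space M. L * mesh + t < ns.deviation \<mu> \<omega>}"
    using m ae by (intro finite_measure_mono_AE) (auto elim: eventually_mono)
  also have "\<dots> \<le> ns.rate / (t * sqrt (real N)) + 2 * (16 * sqrt 2 / 4 ^ k)"
  proof (rule ns.deviation_tail[OF t])
    show "0 \<le> L * mesh" using L_nonneg mesh_nonneg by simp
    \<comment> \<open>With \<open>k \<ge> 3\<close> the bound \<open>\<eta> \<le> 1 / 2\<close>
      follows, since \<open>16 * 2 / 4 ^ 3 = 1 / 2\<close>.\<close>
    have "sqrt 2 \<le> 2" by (rule real_le_lsqrt) auto
    moreover have "(4 :: real) ^ 3 \<le> 4 ^ k" by (rule power_increasing[OF k]) simp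
    ultimately show "16 * sqrt 2 / 4 ^ k \<le> 1 / 2"
      by (simp add: pos_divide_le_eq)
  qed simp_all
  finally show ?thesis
    unfolding ns.rate_def by simp
qed

lemma empirical_covariance_error:
  assumes hs: "hilbert_schmidt C"
  shows "hilbert_schmidt (pixel_operator (measured N \<omega>))"
    and "hs_norm (pixel_operator (measured N \<omega>) - C)
      \<le> pixel_distance (measured N \<omega>) limit_covariance + \<tau>2 / sqrt (real K1 * real K2) + sqrt 2 * L * mesh"
proof -
  obtain E :: "(real \<times> real) L2 set" where E: "orthonormal_basis E"
    using hs by (rule hilbert_schmidt_basis)
  note pixel_hs = hilbert_schmidt_pixel_operator[OF E]
  show "hilbert_schmidt (pixel_operator (measured N \<omega>))" by (rule pixel_hs)
  interpret g: gridded_covariance M "Xs 1" C c L K1 K2 T S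
    by (rule Xs_grid) simp
  have "hs_norm (pixel_operator (measured N \<omega>) - C)
      \<le> hs_norm (pixel_operator (measured N \<omega>) - pixel_operator limit_covariance) + hs_norm (pixel_operator limit_covariance - C)"
    by (intro hs_norm_triangle pixel_hs hs)
  also have "hs_norm (pixel_operator limit_covariance - C)
      \<le> hs_norm (pixel_operator limit_covariance - pixel_operator \<gamma>) + hs_norm (pixel_operator \<gamma> - C)"
    by (intro hs_norm_triangle pixel_hs hs)
  also have "hs_norm (pixel_operator limit_covariance - pixel_operator \<gamma>) = \<tau>2 / sqrt (real K1 * real K2)"
    unfolding hs_norm_pixel_operator_diff[OF E] limit_covariance_def
    by (rule pixel_distance_noise[OF noise_variance_nonneg])
  also have "hs_norm (pixel_operator \<gamma> - C) \<le> sqrt 2 * L * mesh"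
    using L_nonneg mesh_nonneg
    by (intro kernel_pixel_approximation[OF E g.C] g.kernel_square_integrable covariance_kernel_dist) auto
  finally show "hs_norm (pixel_operator (measured N \<omega>) - C)
      \<le> pixel_distance (measured N \<omega>) limit_covariance + \<tau>2 / sqrt (real K1 * real K2) + sqrt 2 * L * mesh"
    by (simp add: hs_norm_pixel_operator_diff[OF E])
qed

text \<open>The existential \<open>D\<close> hides the functional \<open>\<phi>\<close> and the
  locale, so that one \<open>D\<close> per grid can be chosen later. In the tail bound the grid
  appears in the threshold but not on the right-hand side.\<close>

lemma empirical_covariance_tail:
  assumes hs: "hilbert_schmidt C"
  shows "\<exists>D. (\<forall>N. D N \<in> borel_measurable M) \<and>
    (\<forall>N \<omega>. hilbert_schmidt (pixel_operator (measured N \<omega>)) \<and>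
      hs_norm (pixel_operator (measured N \<omega>) - C) \<le> D N \<omega> + \<tau>2 / sqrt (real K1 * real K2) + sqrt 2 * L * mesh) \<and>
    (\<forall>N t k. 1 \<le> N \<longrightarrow> 0 < t \<longrightarrow> 3 \<le> k \<longrightarrow> prob {\<omega> \<in> space M. L * mesh + t < D N \<omega>}
      \<le> (sqrt ((B k)\<^sup>2 * m4) + 2 * sqrt ((cb + 2 * L) * \<tau>2) + sqrt \<kappa> + 2 * (cb + 2 * L + \<tau>2)) / (t * sqrt (real N))
        + 32 * sqrt 2 / 4 ^ k)"
proof (intro exI[of _ "\<lambda>N \<omega>. pixel_distance (measured N \<omega>) limit_covariance"] conjI allI impI)
  show "(\<lambda>\<omega>. pixel_distance (measured N \<omega>) limit_covariance) \<in> borel_measurable M" for N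
    unfolding measured_def using XK_measurable e_measurable
    by (intro pixel_distance_measurable borel_measurable_add) auto
qed (use empirical_covariance_error[OF hs] measured_distance_tail in auto)

end

section \<open>The scores and the size of \<open>a_R\<close>\<close>

lemma score_gap_bounds:
  assumes \<sigma>: "\<And>j. 1 \<le> j \<Longrightarrow> 0 \<le> \<sigma> j" "\<And>i. i \<in> {1..R} \<Longrightarrow> \<sigma> (Suc i) < \<sigma> i" and i: "i \<in> {1..R}"
  shows "0 < score_gap \<sigma> i" "score_gap \<sigma> i \<le> (\<sigma> i)\<^sup>2"
proof -
  have pos: "0 < (\<sigma> j)\<^sup>2 - (\<sigma> (Suc j))\<^sup>2" if "j \<in> {1..R}" for j
    using power_strict_mono[OF \<sigma>(2)[OF that], of 2] \<sigma>(1)[of "Suc j"] by simp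
  show "0 < score_gap \<sigma> i"
  proof (cases "i = 1")
    case True
    then show ?thesis using pos[OF i] by (simp add: score_gap_def numeral_2_eq_2)
  next
    case False
    with i have "i - 1 \<in> {1..R}" "Suc (i - 1) = i" by auto
    then show ?thesis using pos[OF i] pos[of "i - 1"] False by (simp add: score_gap_def)
  qed
  show "score_gap \<sigma> i \<le> (\<sigma> i)\<^sup>2"
    by (auto simp: score_gap_def min_le_iff_disj)
qed

text \<open>The first summand suffices: \<open>c * \<sigma> 1\<close> is at least
  \<open>(\<sigma> 1)\<^sup>2\<close>, which is at least the first gap. With
  \<open>c = hs_norm C\<close> the sum is \<open>a_R\<close>.\<close>

lemma score_constant_ge_one:
  assumes R: "1 \<le> R" and \<sigma>: "\<And>j. 1 \<le> j \<Longrightarrow> 0 \<le> \<sigma> j" "\<And>i. i \<in> {1..R} \<Longrightarrow> \<sigma> (Suc i) < \<sigma> i"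
    and c: "\<sigma> 1 \<le> c"
  shows "1 \<le> c * (\<Sum>i=1..R. \<sigma> i / score_gap \<sigma> i)"
proof -
  have one: "1 \<in> {1..R}" using R by simp
  have pos: "0 < \<sigma> 1"
    using \<sigma>(2)[OF one] \<sigma>(1)[of "Suc 1"] by linarith
  note gap = score_gap_bounds[where \<sigma> = \<sigma> and R = R, OF \<sigma> one]
  have "1 \<le> \<sigma> 1 * (\<sigma> 1 / score_gap \<sigma> 1)"
    using gap by (simp add: pos_le_divide_eq power2_eq_square)
  also have "\<dots> \<le> c * (\<sigma> 1 / score_gap \<sigma> 1)"
    using c pos gap by (intro mult_right_mono) auto
  also have "\<sigma> 1 / score_gap \<sigma> 1 \<le> (\<Sum>i=1..R. \<sigma> i / score_gap \<sigma> i)"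
    using score_gap_bounds(1)[where \<sigma> = \<sigma> and R = R, OF \<sigma>] \<sigma>(1)
    by (intro member_le_sum[OF one, of "\<lambda>i. \<sigma> i / score_gap \<sigma> i"]) (auto intro!: divide_nonneg_pos)
  finally show ?thesis using c pos by (simp add: mult_left_mono)
qed

context prob_space
begin

text \<open>Lets every observed surface share the operator, the kernel and the centred fourth moment
  of \<open>X\<close>, since all of these are determined by the law.\<close>

lemma lipschitz_covariance_copy:
  fixes X Y :: "'a \<Rightarrow> 'b::euclidean_space L2"
  assumes X: "X \<in> borel_measurable M" and X4: "integrable M (\<lambda>\<omega>. norm (X \<omega>) ^ 4)"
    and Y: "Y \<in> borel_measurable M" "distr M borel Y = distr M borel X"
    and c: "has_kernel (covariance M X) c" "L-lipschitz_on (cbox 0 One) c"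
  shows "lipschitz_covariance M Y (covariance M X) c L"
    and "integrable M (\<lambda>\<omega>. norm (Y \<omega> - expectation Y) ^ 4)"
    and "expectation (\<lambda>\<omega>. norm (Y \<omega> - expectation Y) ^ 4) = expectation (\<lambda>\<omega>. norm (X \<omega> - expectation X) ^ 4)"
proof -
  have law: "integrable M (\<lambda>\<omega>. h (Y \<omega>)) \<longleftrightarrow> integrable M (\<lambda>\<omega>. h (X \<omega>))"
    "expectation (\<lambda>\<omega>. h (Y \<omega>)) = expectation (\<lambda>\<omega>. h (X \<omega>))"
    if h: "h \<in> borel_measurable borel" for h :: "'b L2 \<Rightarrow> 'c::{banach, second_countable_topology}"
    using integrable_distr_eq[OF X h] integrable_distr_eq[OF Y(1) h] integral_distr[OF X h] integral_distr[OF Y(1) h]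
    by (simp_all add: Y(2))
  have mean: "expectation Y = expectation X"
    using law(2)[of "\<lambda>f. f"] by simp
  have X2: "integrable M (\<lambda>\<omega>. (norm (X \<omega>))\<^sup>2)"
  proof (rule Bochner_Integration.integrable_bound)
    show "integrable M (\<lambda>\<omega>. 1 + norm (X \<omega>) ^ 4)" using X4 by simp
    have "t\<^sup>2 \<le> 1 + t ^ 4" for t :: real
    proof -
      have "2 * t\<^sup>2 \<le> (t\<^sup>2)\<^sup>2 + 1" using sum_squares_bound[of "t\<^sup>2" 1] by simp
      then have "2 * t\<^sup>2 \<le> t ^ 4 + 1" by simp
      then show ?thesis using zero_le_power2[of t] by linarith
    qed
    then show "AE \<omega> in M. norm ((norm (X \<omega>))\<^sup>2) \<le> norm (1 + norm (X \<omega>) ^ 4)"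
      by (intro AE_I2) simp
  qed (use X in simp)
  have centred: "norm (x - u) ^ 4 \<le> 8 * norm x ^ 4 + 8 * norm u ^ 4" for x u :: "'b L2"
  proof -
    have sq: "(a + b)\<^sup>2 \<le> 2 * a\<^sup>2 + 2 * b\<^sup>2" for a b :: real
      using sum_squares_bound[of a b] by (simp add: power2_sum)
    have "norm (x - u) ^ 4 \<le> (norm x + norm u) ^ 4"
      by (intro power_mono norm_triangle_ineq4) simp
    also have "\<dots> = ((norm x + norm u)\<^sup>2)\<^sup>2" by simp
    also have "\<dots> \<le> (2 * (norm x)\<^sup>2 + 2 * (norm u)\<^sup>2)\<^sup>2"
      by (intro power_mono sq) simp
    also have "\<dots> \<le> 2 * (2 * (norm x)\<^sup>2)\<^sup>2 + 2 * (2 * (norm u)\<^sup>2)\<^sup>2"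
      by (rule sq)
    finally show ?thesis by (simp add: power_mult_distrib)
  qed
  have "integrable M (\<lambda>\<omega>. norm (X \<omega> - expectation X) ^ 4)"
  proof (rule Bochner_Integration.integrable_bound)
    show "integrable M (\<lambda>\<omega>. 8 * norm (X \<omega>) ^ 4 + 8 * norm (expectation X) ^ 4)" using X4 by simp
    show "AE \<omega> in M. norm (norm (X \<omega> - expectation X) ^ 4) \<le> norm (8 * norm (X \<omega>) ^ 4 + 8 * norm (expectation X) ^ 4)"
      using centred by (intro AE_I2) simp
  qed (use X in simp)
  then show "integrable M (\<lambda>\<omega>. norm (Y \<omega> - expectation Y) ^ 4)"
    "expectation (\<lambda>\<omega>. norm (Y \<omega> - expectation Y) ^ 4) = expectation (\<lambda>\<omega>. norm (X \<omega> - expectation X) ^ 4)"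
    using law[of "\<lambda>f. norm (f - expectation X) ^ 4"] by (simp_all add: mean)
  show "lipschitz_covariance M Y (covariance M X) c L"
  proof unfold_locales
    show "integrable M (\<lambda>\<omega>. (norm (Y \<omega>))\<^sup>2)"
      using X2 law(1)[of "\<lambda>f. (norm f)\<^sup>2"] by simp
    show "inner g (blinfun_apply (covariance M X) f)
      = expectation (\<lambda>\<omega>. inner (Y \<omega> - expectation Y) g * inner (Y \<omega> - expectation Y) f)" for f g
      unfolding inner_covariance[OF X X2] mean
      using law(2)[of "\<lambda>z. inner (z - expectation X) g * inner (z - expectation X) f"] by simp
  qed (use Y c in auto)
qed

end

lemma averaged_value_eq:
  assumes "A \<in> sets borel"
  shows "(LINT p:A|cube_measure. rep_L2 f p) / measure lborel A = local_average A f"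
  unfolding set_lebesgue_integral_def local_average_def
  by (simp add: inner_abs_L2_right square_integrable_indicator assms mult.commute)


section \<open>Error of the separable estimator\<close>

theorem theorem2:
  fixes M :: "'w measure"
    and X :: "'w \<Rightarrow> (real \<times> real) L2" and Xs :: "nat \<Rightarrow> 'w \<Rightarrow> (real \<times> real) L2"
    and R :: nat and L \<tau> \<kappa> :: real
    and \<sigma> :: "nat \<Rightarrow> real" and A B :: "nat \<Rightarrow> (real L2 \<Rightarrow>\<^sub>L real L2)"
    and C :: "(real \<times> real) L2 \<Rightarrow>\<^sub>L (real \<times> real) L2"
    and c :: "(real \<times> real) \<times> (real \<times> real) \<Rightarrow> real"
    and T S :: "nat \<Rightarrow> nat \<Rightarrow> real set"
    and XK E Y :: "nat \<Rightarrow> nat \<Rightarrow> nat \<Rightarrow> nat \<Rightarrow> nat \<Rightarrow> 'w \<Rightarrow> real"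
    and Chat ChatR :: "nat \<Rightarrow> nat \<Rightarrow> nat \<Rightarrow> 'w \<Rightarrow> ((real \<times> real) L2 \<Rightarrow>\<^sub>L (real \<times> real) L2)"
    and \<alpha> :: "nat \<Rightarrow> real" and a_R :: real
  assumes "prob_space M"
    and "1 \<le> R"
    \<comment> \<open>the random surfaces\<close>
    and "X \<in> borel_measurable M"
    and "iid_vars M borel Xs {1..}"
    and "\<And>n. 1 \<le> n \<Longrightarrow> distr M borel (Xs n) = distr M borel X"
    and "integrable M (\<lambda>\<omega>. norm (X \<omega>) ^ 4)"
    and "C = covariance M X"
    and "separable_expansion C \<sigma> A B"
    and "\<And>i. i \<in> {1..R} \<Longrightarrow> \<sigma> (Suc i) < \<sigma> i"
    and "has_kernel C c"
    and "L-lipschitz_on (cbox 0 One) c"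
    \<comment> \<open>pixels, measurement errors and measurements\<close>
    and "\<And>K. 1 \<le> K \<Longrightarrow> regular_partition K (T K)"
    and "\<And>K. 1 \<le> K \<Longrightarrow> regular_partition K (S K)"
    and "\<And>K1 K2. 1 \<le> K1 \<Longrightarrow> 1 \<le> K2 \<Longrightarrow>
      iid_vars M borel (\<lambda>(n, i, j). E K1 K2 n i j) ({1..} \<times> {1..K1} \<times> {1..K2})"
    and "\<And>K1 K2. 1 \<le> K1 \<Longrightarrow> 1 \<le> K2 \<Longrightarrow>
      prob_space.indep_var M
        (\<Pi>\<^sub>M q\<in>{1..} \<times> {1..K1} \<times> {1..K2}. borel)
        (\<lambda>\<omega>. \<lambda>(n, i, j)\<in>{1..} \<times> {1..K1} \<times> {1..K2}. E K1 K2 n i j \<omega>)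
        (\<Pi>\<^sub>M q\<in>{1..} \<times> {1..K1} \<times> {1..K2}. borel)
        (\<lambda>\<omega>. \<lambda>(n, i, j)\<in>{1..} \<times> {1..K1} \<times> {1..K2}. XK K1 K2 n i j \<omega>)"
    and "\<And>K1 K2 n i j. 1 \<le> n \<Longrightarrow> i \<in> {1..K1} \<Longrightarrow> j \<in> {1..K2} \<Longrightarrow>
      integral\<^sup>L M (E K1 K2 n i j) = 0"
    and "\<And>K1 K2 n i j. 1 \<le> n \<Longrightarrow> i \<in> {1..K1} \<Longrightarrow> j \<in> {1..K2} \<Longrightarrow>
      (LINT \<omega>|M. (E K1 K2 n i j \<omega> - integral\<^sup>L M (E K1 K2 n i j))\<^sup>2) = \<tau>\<^sup>2"
    and "\<And>K1 K2 n i j. 1 \<le> n \<Longrightarrow> i \<in> {1..K1} \<Longrightarrow> j \<in> {1..K2} \<Longrightarrow>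
      integrable M (\<lambda>\<omega>. \<bar>E K1 K2 n i j \<omega>\<bar> ^ 4)"
    and "\<And>K1 K2 n i j. 1 \<le> n \<Longrightarrow> i \<in> {1..K1} \<Longrightarrow> j \<in> {1..K2} \<Longrightarrow>
      (LINT \<omega>|M. \<bar>E K1 K2 n i j \<omega>\<bar> ^ 4) \<le> \<kappa>"
    and "pointwise_scheme M Xs T S XK \<or> averaged_scheme M Xs T S XK"
    and "\<And>K1 K2 n i j \<omega>. Y K1 K2 n i j \<omega> = XK K1 K2 n i j \<omega> + E K1 K2 n i j \<omega>"
    \<comment> \<open>the estimators\<close>
    and "\<And>N K1 K2 \<omega>. Chat N K1 K2 \<omega> =
      empirical_covariance N (\<lambda>n. pixel_surface K1 K2 (T K1) (S K2) (\<lambda>i j. Y K1 K2 n i j \<omega>))"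
    and "\<And>N K1 K2 \<omega>. 1 \<le> N \<Longrightarrow> 1 \<le> K1 \<Longrightarrow> 1 \<le> K2 \<Longrightarrow> \<omega> \<in> space M \<Longrightarrow>
      best_separable_approx R (Chat N K1 K2 \<omega>) (ChatR N K1 K2 \<omega>)"
    \<comment> \<open>the constants\<close>
    and "\<And>i. \<alpha> i = score_gap \<sigma> i"
    and "a_R = hs_norm C * (\<Sum>i=1..R. \<sigma> i / \<alpha> i)"
  shows "\<exists>Z :: nat \<Rightarrow> nat \<times> nat \<Rightarrow> 'w \<Rightarrow> real.
    uniform_bigO_prob M ({1..} \<times> {1..}) Z (\<lambda>N. a_R / sqrt (real N)) \<and>
    (\<forall>N\<ge>1. \<forall>K1\<ge>1. \<forall>K2\<ge>1. \<forall>\<omega>\<in>space M.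
      hs_norm (ChatR N K1 K2 \<omega> - C) \<le>
        sqrt (\<Sum>\<^sub>\<infinity>i\<in>{R + 1..}. (\<sigma> i)\<^sup>2)
        + Z N (K1, K2) \<omega>
        + (16 * a_R + sqrt 2) * L * sqrt (1 / (real K1)\<^sup>2 + 1 / (real K2)\<^sup>2)
        + 8 * sqrt 2 * L\<^sup>2 / hs_norm C * (1 / (real K1)\<^sup>2 + 1 / (real K2)\<^sup>2) * a_R
        + (8 * sqrt 2 * a_R + 1) * \<tau>\<^sup>2 / sqrt (real K1 * real K2)
        + 4 * sqrt 2 * \<tau> ^ 4 * a_R / (hs_norm C * real K1 * real K2)
        + 16 * L * \<tau>\<^sup>2 * a_R / (hs_norm C * sqrt (real K1 * real K2))
            * sqrt (1 / (real K1)\<^sup>2 + 1 / (real K2)\<^sup>2))"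
proof -
  interpret prob_space M by (rule assms(1))
  define e where "e K1 K2 n r = E K1 K2 n (fst r) (snd r)" for K1 K2 n r
  define xk where "xk K1 K2 n r = XK K1 K2 n (fst r) (snd r)" for K1 K2 n r
  define m4 where "m4 = expectation (\<lambda>\<omega>. norm (X \<omega> - expectation X) ^ 4)"
  have hsC: "hilbert_schmidt C"
    by (rule expansion_hilbert_schmidt[OF assms(8)])
  \<comment> \<open>\<open>c\<close> is continuous on a compact cube, hence bounded; the bound on
    the diagonal controls pixel variances on every grid.\<close>
  obtain cb where cb: "\<And>p. p \<in> cbox 0 One \<Longrightarrow> c (p, p) \<le> cb"
  proof -
    have "bounded (c ` cbox 0 One)"
      by (intro compact_imp_bounded compact_continuous_image lipschitz_on_continuous_on[OF assms(11)] compact_cbox)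
    then obtain b where b: "\<And>z. z \<in> cbox 0 One \<Longrightarrow> norm (c z) \<le> b"
      by (auto simp: bounded_iff)
    show ?thesis
    proof (rule that)
      fix p :: "real \<times> real" assume "p \<in> cbox 0 One"
      then have "norm (c (p, p)) \<le> b" by (intro b) (auto simp: cbox_unit_prod)
      then show "c (p, p) \<le> b" by simp
    qed
  qed
  have Xs_indep: "indep_vars (\<lambda>_. borel) Xs {1..}"
    using assms(4) by (simp add: iid_vars_def)
  have Xs_measurable: "Xs n \<in> borel_measurable M" if "1 \<le> n" for n
    using Xs_indep that unfolding indep_vars_def by auto
  note copy = lipschitz_covariance_copy[OF assms(3,6) Xs_measurable assms(5) assms(10,11)[unfolded assms(7)], folded assms(7) m4_def]
  \<comment> \<open>\<open>\<phi>\<close> depends on the grid and the scheme, whereas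
    \<open>\<kappa>\<close>, \<open>m4\<close> and \<open>cb\<close> do not.\<close>
  have sample: "\<exists>\<phi>. pixel_sample M K1 K2 (T K1) (S K2) Xs C c L \<phi> (e K1 K2) (xk K1 K2) (\<tau>\<^sup>2) \<kappa> m4 cb"
    if K: "1 \<le> K1" "1 \<le> K2" for K1 K2
  proof -
    interpret grid: pixel_grid K1 K2 "T K1" "S K2"
      by (unfold_locales) (use K assms(12,13) in auto)
    have gridded: "gridded_covariance M (Xs n) C c L K1 K2 (T K1) (S K2)" if "1 \<le> n" for n
      by (intro gridded_covariance.intro copy(1) that grid.pixel_grid_axioms)
    have pixel_index: "fst r \<in> {1..K1}" "snd r \<in> {1..K2}" if "r \<in> grid.pixels" for r
      using that by (auto simp: grid.pixels_def)
    obtain \<phi> where \<phi>_measurable: "\<And>r. r \<in> grid.pixels \<Longrightarrow> \<phi> r \<in> borel_measurable borel"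
      and \<phi>_regular: "\<And>n. 1 \<le> n \<Longrightarrow> gridded_covariance.regular_pixel_functional M (Xs n) c L K1 K2 (T K1) (S K2) \<phi>"
      and xk_\<phi>: "\<And>n r. 1 \<le> n \<Longrightarrow> r \<in> grid.pixels \<Longrightarrow> AE \<omega> in M. xk K1 K2 n r \<omega> = \<phi> r (Xs n \<omega>)"
    proof (cases "averaged_scheme M Xs T S XK")
      case True
      show ?thesis
      proof (rule that[of "\<lambda>r. local_average (grid.cell r)"])
        show "gridded_covariance.regular_pixel_functional M (Xs n) c L K1 K2 (T K1) (S K2) (\<lambda>r. local_average (grid.cell r))"
          if "1 \<le> n" for n
          by (rule gridded_covariance.averaged_regular[OF gridded[OF that]])
        show "AE \<omega> in M. xk K1 K2 n r \<omega> = local_average (grid.cell r) (Xs n \<omega>)" if n: "1 \<le> n" and r: "r \<in> grid.pixels" for n r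
          using True n K pixel_index[OF r] averaged_value_eq[OF grid.lower_upper(5)[OF r]]
          by (intro AE_I2) (simp add: averaged_scheme_def xk_def grid.cell_def)
      qed simp
    next
      case False
      then have "pointwise_scheme M Xs T S XK" using assms(20) by simp
      then obtain x t s where scheme:
        "\<forall>n\<ge>1. AE \<omega> in M. continuous_on (cbox 0 One) (x n \<omega>) \<and> Xs n \<omega> = abs_L2 (x n \<omega>)"
        "\<forall>K\<ge>1. \<forall>i\<in>{1..K}. t K i \<in> T K i \<and> s K i \<in> S K i"
        "\<forall>K1\<ge>1. \<forall>K2\<ge>1. \<forall>n\<ge>1. \<forall>i\<in>{1..K1}. \<forall>j\<in>{1..K2}. \<forall>\<omega>\<in>space M.
          XK K1 K2 n i j \<omega> = x n \<omega> (t K1 i, s K2 j)"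
        unfolding pointwise_scheme_def by (elim exE conjE) (rule that)
      note x = scheme(1)[rule_format] and ts = scheme(2)[rule_format] and XK = scheme(3)[rule_format]
      define p where "p r = (t K1 (fst r), s K2 (snd r))" for r :: "nat \<times> nat"
      have p: "p r \<in> grid.cell r" if "r \<in> grid.pixels" for r
        using pixel_index[OF that] ts K by (auto simp: p_def grid.cell_def)
      show ?thesis
      proof (rule that[of "\<lambda>r. point_value (p r) (grid.lower r) (grid.upper r)"])
        show "gridded_covariance.regular_pixel_functional M (Xs n) c L K1 K2 (T K1) (S K2)
            (\<lambda>r. point_value (p r) (grid.lower r) (grid.upper r))" if "1 \<le> n" for n
          by (rule gridded_covariance.pointwise_regular(1)[OF gridded[OF that] x[OF that]]) (rule p)
        show "AE \<omega> in M. xk K1 K2 n r \<omega> = point_value (p r) (grid.lower r) (grid.upper r) (Xs n \<omega>)"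
          if n: "1 \<le> n" and r: "r \<in> grid.pixels" for n r
        proof -
          have "AE \<omega> in M. point_value (p r) (grid.lower r) (grid.upper r) (Xs n \<omega>) = x n \<omega> (p r)"
            by (rule gridded_covariance.pointwise_regular(2)[OF gridded[OF n] x[OF n] _ r]) (rule p)
          with AE_space show ?thesis
          proof eventually_elim
            case (elim \<omega>)
            then show ?case
              using XK[OF K n pixel_index[OF r]] by (simp add: xk_def p_def)
          qed
        qed
      qed simp
    qed
    have index: "{1..} \<times> grid.pixels = {1..} \<times> {1..K1} \<times> {1..K2}"
      by (simp add: grid.pixels_def)
    have e_iid: "iid_vars M borel (\<lambda>(n, r). e K1 K2 n r) ({1..} \<times> grid.pixels)"
      using assms(14)[OF K] unfolding index e_def by (simp only: case_prod_unfold)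
    have e_fourth: "integrable M (\<lambda>\<omega>. e K1 K2 n r \<omega> ^ 4)" "expectation (\<lambda>\<omega>. e K1 K2 n r \<omega> ^ 4) \<le> \<kappa>"
      if "1 \<le> n" "r \<in> grid.pixels" for n r
      using assms(18,19)[OF that(1) pixel_index[OF that(2)]] by (simp_all add: e_def)
    show ?thesis
    proof (intro exI[of _ \<phi>] pixel_sample.intro pixel_sample_axioms.intro)
      show "distr M borel (Xs n) = distr M borel (Xs 1)" if "1 \<le> n" for n
        using assms(5)[OF that] assms(5)[of 1] by simp
      show "expectation (e K1 K2 n r) = 0" if "1 \<le> n" "r \<in> grid.pixels" for n r
        using assms(16)[OF that(1) pixel_index[OF that(2)]] by (simp add: e_def[abs_def])
      show "expectation (\<lambda>\<omega>. (e K1 K2 n r \<omega>)\<^sup>2) = \<tau>\<^sup>2" if "1 \<le> n" "r \<in> grid.pixels" for n r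
        using assms(16,17)[OF that(1) pixel_index[OF that(2)]] by (simp add: e_def)
      show "indep_vars (\<lambda>_. borel) (\<lambda>(n, r). e K1 K2 n r) ({1..} \<times> grid.pixels)"
        using e_iid by (simp add: iid_vars_def)
      show "indep_var (Pi\<^sub>M ({1..} \<times> grid.pixels) (\<lambda>_. borel)) (\<lambda>\<omega>. \<lambda>(n, r)\<in>{1..} \<times> grid.pixels. e K1 K2 n r \<omega>)
          (Pi\<^sub>M ({1..} \<times> grid.pixels) (\<lambda>_. borel)) (\<lambda>\<omega>. \<lambda>(n, r)\<in>{1..} \<times> grid.pixels. xk K1 K2 n r \<omega>)"
        using assms(15)[OF K] unfolding index e_def xk_def by (simp only: case_prod_unfold)
      show "integrable M (\<lambda>\<omega>. norm (Xs 1 \<omega> - expectation (Xs 1)) ^ 4)"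
        "expectation (\<lambda>\<omega>. norm (Xs 1 \<omega> - expectation (Xs 1)) ^ 4) \<le> m4"
        using copy(2,3)[of 1] by simp_all
      show "prob_space M" "pixel_grid K1 K2 (T K1) (S K2)" "indep_vars (\<lambda>_. borel) Xs {1..}"
        by (rule prob_space_axioms grid.pixel_grid_axioms Xs_indep)+
      show "gridded_covariance M (Xs n) C c L K1 K2 (T K1) (S K2)"
        "gridded_covariance.regular_pixel_functional M (Xs n) c L K1 K2 (T K1) (S K2) \<phi>" if "1 \<le> n" for n
        by (rule gridded[OF that], rule \<phi>_regular[OF that])
      show "\<phi> r \<in> borel_measurable borel" if "r \<in> grid.pixels" for r
        by (rule \<phi>_measurable[OF that])
      show "AE \<omega> in M. xk K1 K2 n r \<omega> = \<phi> r (Xs n \<omega>)" "integrable M (\<lambda>\<omega>. e K1 K2 n r \<omega> ^ 4)"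
        "expectation (\<lambda>\<omega>. e K1 K2 n r \<omega> ^ 4) \<le> \<kappa>" if "1 \<le> n" "r \<in> grid.pixels" for n r
        by (rule xk_\<phi>[OF that], rule e_fourth(1)[OF that], rule e_fourth(2)[OF that])
      show "c (p, p) \<le> cb" if "p \<in> cbox 0 One" for p
        by (rule cb[OF that])
    qed
  qed
  define h where "h K = sqrt (1 / (real (fst K))\<^sup>2 + 1 / (real (snd K))\<^sup>2)" for K :: "nat \<times> nat"
  \<comment> \<open>Free of the grid: the uniformity in \<open>K1\<close> and \<open>K2\<close>
    rests on this.\<close>
  define rate where "rate k = sqrt ((4 * 16 ^ k)\<^sup>2 * m4) + 2 * sqrt ((cb + 2 * L) * \<tau>\<^sup>2) + sqrt \<kappa>
      + 2 * (cb + 2 * L + \<tau>\<^sup>2)" for k :: nat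
  \<comment> \<open>The condition on \<open>K\<close> stands inside the existential, so that
    \<open>choice\<close> yields a single function \<open>D\<close> for all grids.\<close>
  have "\<forall>K. \<exists>D. 1 \<le> fst K \<and> 1 \<le> snd K \<longrightarrow>
      (\<forall>N. D N \<in> borel_measurable M) \<and>
      (\<forall>N \<omega>. hilbert_schmidt (Chat N (fst K) (snd K) \<omega>) \<and>
        hs_norm (Chat N (fst K) (snd K) \<omega> - C) \<le> D N \<omega> + \<tau>\<^sup>2 / sqrt (real (fst K) * real (snd K)) + sqrt 2 * L * h K) \<and>
      (\<forall>N t k. 1 \<le> N \<longrightarrow> 0 < t \<longrightarrow> 3 \<le> k \<longrightarrow>
        prob {\<omega> \<in> space M. L * h K + t < D N \<omega>} \<le> rate k / (t * sqrt (real N)) + 32 * sqrt 2 / 4 ^ k)"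
  proof
    fix K :: "nat \<times> nat"
    obtain K1 K2 where K_eq: "K = (K1, K2)" by (cases K)
    show "\<exists>D. 1 \<le> fst K \<and> 1 \<le> snd K \<longrightarrow>
      (\<forall>N. D N \<in> borel_measurable M) \<and>
      (\<forall>N \<omega>. hilbert_schmidt (Chat N (fst K) (snd K) \<omega>) \<and>
        hs_norm (Chat N (fst K) (snd K) \<omega> - C) \<le> D N \<omega> + \<tau>\<^sup>2 / sqrt (real (fst K) * real (snd K)) + sqrt 2 * L * h K) \<and>
      (\<forall>N t k. 1 \<le> N \<longrightarrow> 0 < t \<longrightarrow> 3 \<le> k \<longrightarrow>
        prob {\<omega> \<in> space M. L * h K + t < D N \<omega>} \<le> rate k / (t * sqrt (real N)) + 32 * sqrt 2 / 4 ^ k)"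
    proof (cases "1 \<le> K1 \<and> 1 \<le> K2")
      case True
      then obtain \<phi> where "pixel_sample M K1 K2 (T K1) (S K2) Xs C c L \<phi> (e K1 K2) (xk K1 K2) (\<tau>\<^sup>2) \<kappa> m4 cb"
        using sample by blast
      then interpret ps: pixel_sample M K1 K2 "T K1" "S K2" Xs C c L \<phi> "e K1 K2" "xk K1 K2" "\<tau>\<^sup>2" \<kappa> m4 cb .
      have Chat: "Chat N K1 K2 \<omega> = ps.pixel_operator (ps.measured N \<omega>)" for N \<omega>
        using ps.empirical_covariance_pixel_surface[of N "\<lambda>n r. xk K1 K2 n r \<omega> + e K1 K2 n r \<omega>"]
        by (simp add: assms(21,22) ps.measured_def xk_def e_def)
      have mesh: "ps.mesh = h K"
        by (simp add: ps.mesh_def h_def K_eq)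
      show ?thesis
        using ps.empirical_covariance_tail[OF hsC] unfolding Chat[symmetric] mesh ps.B_def rate_def[symmetric] K_eq fst_conv snd_conv
        by (elim exE) (intro exI impI, assumption)
    next
      case False
      then have "\<not> (1 \<le> fst K \<and> 1 \<le> snd K)" by (simp add: K_eq)
      then show ?thesis by iprover
    qed
  qed
  from choice[OF this] obtain D where D: "\<forall>K. 1 \<le> fst K \<and> 1 \<le> snd K \<longrightarrow>
      (\<forall>N. D K N \<in> borel_measurable M) \<and>
      (\<forall>N \<omega>. hilbert_schmidt (Chat N (fst K) (snd K) \<omega>) \<and>
        hs_norm (Chat N (fst K) (snd K) \<omega> - C) \<le> D K N \<omega> + \<tau>\<^sup>2 / sqrt (real (fst K) * real (snd K)) + sqrt 2 * L * h K) \<and>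
      (\<forall>N t k. 1 \<le> N \<longrightarrow> 0 < t \<longrightarrow> 3 \<le> k \<longrightarrow>
        prob {\<omega> \<in> space M. L * h K + t < D K N \<omega>} \<le> rate k / (t * sqrt (real N)) + 32 * sqrt 2 / 4 ^ k)" ..
  have D_all: "(\<forall>N. D K N \<in> borel_measurable M) \<and>
      (\<forall>N \<omega>. hilbert_schmidt (Chat N (fst K) (snd K) \<omega>) \<and>
        hs_norm (Chat N (fst K) (snd K) \<omega> - C) \<le> D K N \<omega> + \<tau>\<^sup>2 / sqrt (real (fst K) * real (snd K)) + sqrt 2 * L * h K) \<and>
      (\<forall>N t k. 1 \<le> N \<longrightarrow> 0 < t \<longrightarrow> 3 \<le> k \<longrightarrow>
        prob {\<omega> \<in> space M. L * h K + t < D K N \<omega>} \<le> rate k / (t * sqrt (real N)) + 32 * sqrt 2 / 4 ^ k)"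
    if K: "K \<in> {1..} \<times> {1..}" for K
  proof -
    have "1 \<le> fst K \<and> 1 \<le> snd K" using K by (simp add: mem_Times_iff)
    with spec[OF D] show ?thesis by (rule mp)
  qed
  note D_measurable = spec[OF conjunct1[OF D_all]]
    and D_error = spec[OF spec[OF conjunct1[OF conjunct2[OF D_all]]]]
    and D_tail = conjunct2[OF conjunct2[OF D_all], rule_format]
  \<comment> \<open>The factor 2 comes from \<open>best_separable_approx_error\<close>, and
    \<open>L * h K\<close> is moved to the bias terms. The positive part is taken because the
    \<open>O_P\<close> condition bounds the absolute value, while a negative value of the difference
    would only improve the estimate.\<close>
  define Z where "Z N K \<omega> = max 0 (2 * (D K N \<omega> - L * h K))" for N K \<omega>
  have L: "0 \<le> L" by (rule lipschitz_on_nonneg[OF assms(11)])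
  have a1: "1 \<le> a_R"
    unfolding assms(24,25)
    by (rule score_constant_ge_one[OF assms(2) scores_nonneg[OF assms(8)] assms(9) first_score_le[OF assms(8)]])
  have Z_bigO: "uniform_bigO_prob M ({1..} \<times> {1..}) Z (\<lambda>N. a_R / sqrt (real N))"
    unfolding uniform_bigO_prob_def
  proof (intro conjI allI ballI impI)
    fix N and K :: "nat \<times> nat" assume K: "K \<in> {1..} \<times> {1..}"
    note [measurable] = D_measurable[OF K]
    show "Z N K \<in> borel_measurable M" unfolding Z_def[abs_def] by measurable
  next
    fix \<epsilon> :: real assume \<epsilon>: "0 < \<epsilon>"
    \<comment> \<open>\<open>k\<close> is fixed by \<open>\<epsilon>\<close> before
      \<open>b\<close>, since \<open>b\<close> is built from \<open>rate k\<close>. Half of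
      \<open>\<epsilon>\<close> is reserved for the dropped products.\<close>
    obtain k0 where k0: "(1 / 4) ^ k0 < \<epsilon> / (64 * sqrt 2)"
      using real_arch_pow_inv[of "\<epsilon> / (64 * sqrt 2)" "1 / 4"] \<epsilon> by auto
    define k where "k = max 3 k0"
    have "(1 / 4 :: real) ^ k \<le> (1 / 4) ^ k0"
      unfolding k_def by (intro power_decreasing) auto
    with k0 have "(1 / 4) ^ k < \<epsilon> / (64 * sqrt 2)" by linarith
    then have "(1 / 4) ^ k * (64 * sqrt 2) < \<epsilon>"
      by (subst (asm) pos_less_divide_eq) simp_all
    then have "32 * sqrt 2 * (1 / 4) ^ k \<le> \<epsilon> / 2" by (simp add: ac_simps)
    then have k: "3 \<le> k" "32 * sqrt 2 / 4 ^ k \<le> \<epsilon> / 2"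
      by (simp_all add: k_def power_one_over)
    \<comment> \<open>The requirement is \<open>rate k / (b * a_R / 2) \<le> \<epsilon> / 2\<close>;
      as \<open>a_R \<ge> 1\<close>, \<open>b \<ge> 4 * \<bar>rate k\<bar> / \<epsilon>\<close> is
      enough, and the added 1 keeps \<open>b\<close> positive.\<close>
    define b where "b = 4 * \<bar>rate k\<bar> / \<epsilon> + 1"
    have b: "0 < b" using \<epsilon> by (simp add: b_def add_nonneg_pos)
    show "\<exists>b. \<forall>\<^sub>F N in sequentially. \<forall>K\<in>{1..} \<times> {1..}.
      measure M {\<omega> \<in> space M. \<bar>Z N K \<omega>\<bar> > b * (a_R / sqrt (real N))} \<le> \<epsilon>"
    proof (intro exI[of _ b] eventually_mono[OF eventually_ge_at_top[of 1]] ballI)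
      fix N :: nat and K :: "nat \<times> nat" assume N: "1 \<le> N" and K: "K \<in> {1..} \<times> {1..}"
      \<comment> \<open>Half of the threshold for \<open>Z\<close>, because \<open>Z\<close> doubles
        the excess of \<open>D\<close>.\<close>
      define t where "t = b * (a_R / sqrt (real N)) / 2"
      have t: "0 < t" using b a1 N by (simp add: t_def)
      note [measurable] = D_measurable[OF K]
      have "{\<omega> \<in> space M. \<bar>Z N K \<omega>\<bar> > b * (a_R / sqrt (real N))} \<subseteq> {\<omega> \<in> space M. L * h K + t < D K N \<omega>}"
      proof -
        have "b * (a_R / sqrt (real N)) = 2 * t" by (simp add: t_def)
        then show ?thesis using t by (auto simp: Z_def max_def split: if_splits)
      qed
      then have "prob {\<omega> \<in> space M. \<bar>Z N K \<omega>\<bar> > b * (a_R / sqrt (real N))} \<le> prob {\<omega> \<in> space M. L * h K + t < D K N \<omega>}"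
        by (intro finite_measure_mono) auto
      also have "\<dots> \<le> rate k / (t * sqrt (real N)) + 32 * sqrt 2 / 4 ^ k"
        by (rule D_tail[OF K N t k(1)])
      also have "t * sqrt (real N) = b * a_R / 2"
        using N by (simp add: t_def)
      also have "rate k / (b * a_R / 2) \<le> \<epsilon> / 2"
      proof -
        have "4 * \<bar>rate k\<bar> \<le> \<epsilon> * b" using \<epsilon> by (simp add: b_def distrib_left)
        also have "\<dots> \<le> \<epsilon> * (b * a_R)" using \<epsilon> b a1 by simp
        finally have "rate k \<le> \<epsilon> / 2 * (b * a_R / 2)" by simp
        then show ?thesis using b a1 by (subst pos_divide_le_eq) auto
      qed
      finally show "prob {\<omega> \<in> space M. \<bar>Z N K \<omega>\<bar> > b * (a_R / sqrt (real N))} \<le> \<epsilon>"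
        using k(2) by simp
    qed
  qed
  show ?thesis
  proof (intro exI[of _ Z] conjI Z_bigO allI impI ballI)
    fix N K1 K2 :: nat and \<omega> assume N: "1 \<le> N" and K: "1 \<le> K1" "1 \<le> K2" and \<omega>: "\<omega> \<in> space M"
    let ?h = "sqrt (1 / (real K1)\<^sup>2 + 1 / (real K2)\<^sup>2)" and ?s = "sqrt (real K1 * real K2)"
    have h: "h (K1, K2) = ?h" by (simp add: h_def)
    have hs: "hilbert_schmidt (Chat N K1 K2 \<omega>)"
      and err: "hs_norm (Chat N K1 K2 \<omega> - C) \<le> D (K1, K2) N \<omega> + \<tau>\<^sup>2 / ?s + sqrt 2 * L * ?h"
      using D_error[of "(K1, K2)" N \<omega>] K by (simp_all add: h)
    \<comment> \<open>The final bookkeeping with abstract reals: \<open>y\<close> is the distance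
      from the empirical covariance to \<open>C\<close>, \<open>d\<close> the fluctuation,
      \<open>n\<close> the noise norm, and \<open>l\<close> and \<open>m\<close> are
      \<open>L * h\<close> and \<open>sqrt 2 * L * h\<close>.\<close>
    have sum_le: "r \<le> s + z + u + p + v + q + w"
      if "r \<le> s + 2 * y" "2 * d - 2 * l \<le> z" "2 * l + 2 * m \<le> u" "2 * n \<le> v" "0 \<le> p" "0 \<le> q" "0 \<le> w" "y \<le> d + n + m"
      for r s z u p v q w y d l m n :: real
      using that by linarith
    have "hs_norm (ChatR N K1 K2 \<omega> - C) \<le> sqrt (\<Sum>\<^sub>\<infinity>i\<in>{R + 1..}. (\<sigma> i)\<^sup>2) + 2 * hs_norm (Chat N K1 K2 \<omega> - C)"
      by (rule best_separable_approx_error[OF assms(8) hs assms(23)[OF N K \<omega>]])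
    moreover have "2 * D (K1, K2) N \<omega> - 2 * (L * ?h) \<le> Z N (K1, K2) \<omega>"
      by (simp add: Z_def h)
    \<comment> \<open>Twice \<open>L * h\<close> compensates what was subtracted in
      \<open>Z\<close>, and twice \<open>sqrt 2 * L * h\<close> is the discretization error;
      \<open>a_R \<ge> 1\<close> makes the stated coefficient large enough.\<close>
    moreover have "2 * (L * ?h) + 2 * (sqrt 2 * L * ?h) \<le> (16 * a_R + sqrt 2) * L * ?h"
    proof -
      have "sqrt 2 \<le> 2" by (rule real_le_lsqrt) auto
      then have "2 + 2 * sqrt 2 \<le> 16 * a_R + sqrt 2" using a1 by linarith
      moreover have "0 \<le> L * ?h" using L by simp
      ultimately have "(2 + 2 * sqrt 2) * (L * ?h) \<le> (16 * a_R + sqrt 2) * (L * ?h)"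
        by (rule mult_right_mono)
      then show ?thesis by (simp add: algebra_simps)
    qed
    moreover have "2 * (\<tau>\<^sup>2 / ?s) \<le> (8 * sqrt 2 * a_R + 1) * \<tau>\<^sup>2 / ?s"
    proof -
      have "1 \<le> sqrt 2" by (rule real_le_rsqrt) simp
      then have "1 * 1 \<le> sqrt 2 * a_R" using a1 by (intro mult_mono) auto
      then have "2 \<le> 8 * sqrt 2 * a_R + 1" by simp
      then have "2 * (\<tau>\<^sup>2 / ?s) \<le> (8 * sqrt 2 * a_R + 1) * (\<tau>\<^sup>2 / ?s)"
        by (intro mult_right_mono) auto
      then show ?thesis by simp
    qed
    moreover have "0 \<le> 8 * sqrt 2 * L\<^sup>2 / hs_norm C * (1 / (real K1)\<^sup>2 + 1 / (real K2)\<^sup>2) * a_R"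
      "0 \<le> 4 * sqrt 2 * \<tau> ^ 4 * a_R / (hs_norm C * real K1 * real K2)"
      "0 \<le> 16 * L * \<tau>\<^sup>2 * a_R / (hs_norm C * ?s) * ?h"
      using a1 L hs_norm_nonneg[of C] by simp_all
    ultimately show "hs_norm (ChatR N K1 K2 \<omega> - C) \<le>
        sqrt (\<Sum>\<^sub>\<infinity>i\<in>{R + 1..}. (\<sigma> i)\<^sup>2)
        + Z N (K1, K2) \<omega>
        + (16 * a_R + sqrt 2) * L * ?h
        + 8 * sqrt 2 * L\<^sup>2 / hs_norm C * (1 / (real K1)\<^sup>2 + 1 / (real K2)\<^sup>2) * a_R
        + (8 * sqrt 2 * a_R + 1) * \<tau>\<^sup>2 / ?s
        + 4 * sqrt 2 * \<tau> ^ 4 * a_R / (hs_norm C * real K1 * real K2)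
        + 16 * L * \<tau>\<^sup>2 * a_R / (hs_norm C * ?s) * ?h"
      using err by (rule sum_le)
  qed
qed

end
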